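(* All half-angles $\theta$ with $\frac{\pi}{4}\le\theta<\frac{\pi}{2}$ are non-resonant.
   Context: $E_n(A)$ is the $n$th discrete eigenvalue of a lower semibounded self-adjoint operator $A$, in non-decreasing order with multiplicities. For $\theta\in(0,\pi/2)$ let $\mathcal{S}_\theta=\{(x_1,x_2)\in\mathbb{R}^2:|\arg(x_1+\mathrm{i}x_2)|<\theta\}$ and for $\alpha>0$ let $T_{\theta,\alpha}$ be the operator in $L^2(\mathcal{S}_\theta)$ generated by the form $u\mapsto\int_{\mathcal{S}_\theta}|\nabla u|^2dx-\alpha\int_{\partial\mathcal{S}_\theta}u^2ds$ on $H^1(\mathcal{S}_\theta)$. Its essential spectrum is $[-\alpha^2,+\infty)$, and $\kappa(\theta)<\infty$ denotes the number of its discrete eigenvalues (with multiplicities), which does not depend on $\alpha$. It is known that $\kappa(\theta)=1$ for $\frac{\pi}{6}\le\theta<\frac{\pi}{2}$. For $r>0$ put $O=(0,0)$, $A^\pm_r=r(\cos\theta,\pm\sin\theta)$, $B_r=(r/\cos\theta,0)$, and let $\mathcal{S}^r_\theta$ be the interior of the quadrangle $OA^+_rB_rA^-_r$. Let $N^r_{\theta,\alpha}$ be the Laplacian in $\mathcal{S}^r_\theta$ with the condition $\partial u/\partial\nu=\alpha u$ ($\nu$ outer unit normal) on $OA^\pm_r$ and Neumann condition on $A^\pm_rB_r$, i.e. generated by the form $u\mapsto\int_{\mathcal{S}^r_\theta}|\nabla u|^2dx-\alpha\int_{OA^+_r\cup OA^-_r}u^2ds$ on $H^1(\mathcal{S}^r_\theta)$.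 A half-angle $\theta\in(0,\pi/2)$ is called non-resonant if there is $C>0$ such that $E_{\kappa(\theta)+1}(N^r_{\theta,\alpha})\ge-\alpha^2+C/r^2$ as $\alpha>0$ is fixed and $r$ is large; by scaling the property depends on $\theta$ only (so one may take $\alpha=1$). *)

theory Defs
  imports "HOL-Analysis.Analysis"
begin

text \<open>
  All Hilbert spaces are real. The forms considered are real (they commute with complex
  conjugation), so that spectra, multiplicities and hence eigenvalue enumerations agree with those
  of the complexified operators.
\<close>

type_synonym plane = "real \<times> real"


section \<open>The Hilbert space of square integrable functions on the plane\<close>

definition square_integrable :: "'a measure \<Rightarrow> ('a \<Rightarrow> real) \<Rightarrow> bool" where
  "square_integrable M f \<longleftrightarrow> f \<in> borel_measurable M \<and> integrable M (\<lambda>x. (f x)\<^sup>2)"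

lemma square_integrable_add:
  assumes "square_integrable M f" "square_integrable M g"
  shows "square_integrable M (\<lambda>x. f x + g x)"
  unfolding square_integrable_def
proof
  have f: "f \<in> borel_measurable M" "integrable M (\<lambda>x. (f x)\<^sup>2)"
    and g: "g \<in> borel_measurable M" "integrable M (\<lambda>x. (g x)\<^sup>2)"
    using assms by (auto simp: square_integrable_def)
  show m: "(\<lambda>x. f x + g x) \<in> borel_measurable M"
    using f(1) g(1) by measurable
  show "integrable M (\<lambda>x. (f x + g x)\<^sup>2)"
  proof (rule Bochner_Integration.integrable_bound)
    show "integrable M (\<lambda>x. 2 * (f x)\<^sup>2 + 2 * (g x)\<^sup>2)"
      using f g by simp
    show "(\<lambda>x. (f x + g x)\<^sup>2) \<in> borel_measurable M"
      using m by measurable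
    show "AE x in M. norm ((f x + g x)\<^sup>2) \<le> norm (2 * (f x)\<^sup>2 + 2 * (g x)\<^sup>2)"
    proof (rule AE_I2)
      fix x
      have "0 \<le> (f x - g x)\<^sup>2" by simp
      then have "(f x + g x)\<^sup>2 \<le> 2 * (f x)\<^sup>2 + 2 * (g x)\<^sup>2"
        by (simp add: power2_sum power2_diff)
      then show "norm ((f x + g x)\<^sup>2) \<le> norm (2 * (f x)\<^sup>2 + 2 * (g x)\<^sup>2)"
        by simp
    qed
  qed
qed

lemma square_integrable_cmult:
  assumes "square_integrable M f"
  shows "square_integrable M (\<lambda>x. c * f x)"
  using assms by (auto simp: square_integrable_def power_mult_distrib)

lemma square_integrable_mult_integrable:
  assumes "square_integrable M f" "square_integrable M g"
  shows "integrable M (\<lambda>x. f x * g x)"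
proof (rule Bochner_Integration.integrable_bound)
  have f: "f \<in> borel_measurable M" "integrable M (\<lambda>x. (f x)\<^sup>2)"
    and g: "g \<in> borel_measurable M" "integrable M (\<lambda>x. (g x)\<^sup>2)"
    using assms by (auto simp: square_integrable_def)
  show "integrable M (\<lambda>x. (f x)\<^sup>2 + (g x)\<^sup>2)"
    using f g by simp
  show "(\<lambda>x. f x * g x) \<in> borel_measurable M"
    using f(1) g(1) by measurable
  show "AE x in M. norm (f x * g x) \<le> norm ((f x)\<^sup>2 + (g x)\<^sup>2)"
  proof (rule AE_I2)
    fix x
    have "2 * \<bar>f x * g x\<bar> \<le> (f x)\<^sup>2 + (g x)\<^sup>2"
      using sum_squares_bound[of "\<bar>f x\<bar>" "\<bar>g x\<bar>"] by (simp add: abs_mult)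
    moreover have "0 \<le> \<bar>f x * g x\<bar>" by simp
    ultimately show "norm (f x * g x) \<le> norm ((f x)\<^sup>2 + (g x)\<^sup>2)"
      unfolding real_norm_def by linarith
  qed
qed

definition l2_rel :: "(plane \<Rightarrow> real) \<Rightarrow> (plane \<Rightarrow> real) \<Rightarrow> bool" where
  "l2_rel f g \<longleftrightarrow>
     square_integrable lborel f \<and> square_integrable lborel g \<and> (AE x in lborel. f x = g x)"

lemma part_equivp_l2_rel: "part_equivp l2_rel"
proof (rule part_equivpI)
  show "\<exists>f. l2_rel f f"
    by (rule exI[of _ "\<lambda>_. 0"]) (simp add: l2_rel_def square_integrable_def)
  show "symp l2_rel"
    by (rule sympI) (auto simp: l2_rel_def eq_commute)
  show "transp l2_rel"
    by (rule transpI) (auto simp: l2_rel_def)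
qed

quotient_type l2 = "plane \<Rightarrow> real" / partial: l2_rel
  by (rule part_equivp_l2_rel)

instantiation l2 :: real_inner
begin

lift_definition zero_l2 :: l2 is "\<lambda>_. 0"
  by (simp add: l2_rel_def square_integrable_def)

lift_definition plus_l2 :: "l2 \<Rightarrow> l2 \<Rightarrow> l2" is "\<lambda>f g x. f x + g x"
  by (auto simp: l2_rel_def intro: square_integrable_add)

lift_definition scaleR_l2 :: "real \<Rightarrow> l2 \<Rightarrow> l2" is "\<lambda>c f x. c * f x"
  by (auto simp: l2_rel_def intro: square_integrable_cmult)

lift_definition uminus_l2 :: "l2 \<Rightarrow> l2" is "\<lambda>f x. - f x"
  by (auto simp: l2_rel_def square_integrable_def)

lift_definition minus_l2 :: "l2 \<Rightarrow> l2 \<Rightarrow> l2" is "\<lambda>f g x. f x - g x"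
proof -
  fix f f' g g' :: "plane \<Rightarrow> real"
  assume "l2_rel f f'" "l2_rel g g'"
  then show "l2_rel (\<lambda>x. f x - g x) (\<lambda>x. f' x - g' x)"
    using square_integrable_add[of lborel f "\<lambda>x. (-1) * g x"]
      square_integrable_add[of lborel f' "\<lambda>x. (-1) * g' x"]
      square_integrable_cmult[of lborel g "-1"] square_integrable_cmult[of lborel g' "-1"]
    by (auto simp: l2_rel_def)
qed

lift_definition inner_l2 :: "l2 \<Rightarrow> l2 \<Rightarrow> real" is "\<lambda>f g. \<integral>x. f x * g x \<partial>lborel"
proof -
  fix f f' g g' :: "plane \<Rightarrow> real"
  assume *: "l2_rel f f'" "l2_rel g g'"
  show "(\<integral>x. f x * g x \<partial>lborel) = (\<integral>x. f' x * g' x \<partial>lborel)"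
  proof (rule integral_cong_AE)
    show "AE x in lborel. f x * g x = f' x * g' x"
      using * by (auto simp: l2_rel_def)
  qed (use * in \<open>auto simp: l2_rel_def square_integrable_def\<close>)
qed

definition norm_l2 :: "l2 \<Rightarrow> real" where
  "norm_l2 u = sqrt (inner u u)"

definition dist_l2 :: "l2 \<Rightarrow> l2 \<Rightarrow> real" where
  "dist_l2 u v = norm (u - v)"

definition sgn_l2 :: "l2 \<Rightarrow> l2" where
  "sgn_l2 u = inverse (norm u) *\<^sub>R u"

definition uniformity_l2 :: "(l2 \<times> l2) filter" where
  "uniformity_l2 = (INF e\<in>{0<..}. principal {(u, v). dist u v < e})"

definition open_l2 :: "l2 set \<Rightarrow> bool" where
  "open_l2 U \<longleftrightarrow> (\<forall>u\<in>U. eventually (\<lambda>(u', v). u' = u \<longrightarrow> v \<in> U) uniformity)"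

instance
proof
  fix a b c :: l2 and s t :: real
  show "a + b + c = a + (b + c)"
    by transfer (auto simp: l2_rel_def add.assoc intro!: square_integrable_add)
  show "a + b = b + a"
    by transfer (auto simp: l2_rel_def add.commute intro!: square_integrable_add)
  show "0 + a = a"
    by transfer (auto simp: l2_rel_def)
  show "- a + a = 0"
    by transfer (auto simp: l2_rel_def square_integrable_def)
  show "a - b = a + - b"
  proof transfer
    fix f g :: "plane \<Rightarrow> real"
    assume "l2_rel f f" "l2_rel g g"
    then show "l2_rel (\<lambda>x. f x - g x) (\<lambda>x. f x + - g x)"
      using square_integrable_add[of lborel f "\<lambda>x. (-1) * g x"]
        square_integrable_cmult[of lborel g "-1"]
      by (simp add: l2_rel_def)
  qed
  show "s *\<^sub>R (a + b) = s *\<^sub>R a + s *\<^sub>R b"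
  proof transfer
    fix s :: real and f g :: "plane \<Rightarrow> real"
    assume "l2_rel f f" "l2_rel g g"
    then show "l2_rel (\<lambda>x. s * (f x + g x)) (\<lambda>x. s * f x + s * g x)"
      using square_integrable_cmult[OF square_integrable_add[of lborel f g], of s]
      by (simp add: l2_rel_def distrib_left)
  qed
  show "(s + t) *\<^sub>R a = s *\<^sub>R a + t *\<^sub>R a"
  proof transfer
    fix s t :: real and f :: "plane \<Rightarrow> real"
    assume "l2_rel f f"
    then show "l2_rel (\<lambda>x. (s + t) * f x) (\<lambda>x. s * f x + t * f x)"
      using square_integrable_cmult[of lborel f "s + t"]
      by (simp add: l2_rel_def distrib_right)
  qed
  show "s *\<^sub>R t *\<^sub>R a = (s * t) *\<^sub>R a"
  proof transfer
    fix s t :: real and f :: "plane \<Rightarrow> real"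
    assume "l2_rel f f"
    then show "l2_rel (\<lambda>x. s * (t * f x)) (\<lambda>x. s * t * f x)"
      using square_integrable_cmult[of lborel f "s * t"] by (simp add: l2_rel_def mult.assoc)
  qed
  show "1 *\<^sub>R a = a"
    by transfer (auto simp: l2_rel_def)
  show "dist a b = norm (a - b)"
    by (rule dist_l2_def)
  show "sgn a = inverse (norm a) *\<^sub>R a"
    by (rule sgn_l2_def)
  show "(uniformity :: (l2 \<times> l2) filter) = (INF e\<in>{0<..}. principal {(x, y). dist x y < e})"
    by (rule uniformity_l2_def)
  show "inner a b = inner b a"
    by transfer (simp add: mult.commute)
  show "inner (a + b) c = inner a c + inner b c"
  proof transfer
    fix f g h :: "plane \<Rightarrow> real"
    assume "l2_rel f f" "l2_rel g g" "l2_rel h h"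
    then have "integrable lborel (\<lambda>x. f x * h x)" "integrable lborel (\<lambda>x. g x * h x)"
      by (auto simp: l2_rel_def intro: square_integrable_mult_integrable)
    then show "(\<integral>x. (f x + g x) * h x \<partial>lborel)
        = (\<integral>x. f x * h x \<partial>lborel) + (\<integral>x. g x * h x \<partial>lborel)"
      by (simp add: distrib_right)
  qed
  show "inner (s *\<^sub>R a) b = s * inner a b"
    by transfer (simp add: mult.assoc)
  show "0 \<le> inner a a"
    by transfer simp
  show "inner a a = 0 \<longleftrightarrow> a = 0"
  proof transfer
    fix f :: "plane \<Rightarrow> real"
    assume f: "l2_rel f f"
    then have "integrable lborel (\<lambda>x. f x * f x)"
      by (simp add: l2_rel_def square_integrable_def power2_eq_square)
    then have "(\<integral>x. f x * f x \<partial>lborel) = 0 \<longleftrightarrow> (AE x in lborel. f x * f x = 0)"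
      by (rule integral_nonneg_eq_0_iff_AE) simp
    also have "\<dots> \<longleftrightarrow> l2_rel f (\<lambda>_. 0)"
      using f by (simp add: l2_rel_def square_integrable_def)
    finally show "(\<integral>x. f x * f x \<partial>lborel) = 0 \<longleftrightarrow> l2_rel f (\<lambda>_. 0)" .
  qed
  show "norm a = sqrt (inner a a)"
    by (rule norm_l2_def)
next
  fix U :: "l2 set"
  show "open U \<longleftrightarrow> (\<forall>x\<in>U. \<forall>\<^sub>F (x', y) in uniformity. x' = x \<longrightarrow> y \<in> U)"
    by (rule open_l2_def)
qed

end

text \<open>\<open>L\<^sup>2(S)\<close> is identified with the closed subspace of functions vanishing outside \<open>S\<close>.\<close>

definition L2_on :: "plane set \<Rightarrow> l2 set" where
  "L2_on S = {u. AE x in lborel. x \<notin> S \<longrightarrow> rep_l2 u x = 0}"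

definition restr_l2 :: "plane set \<Rightarrow> (plane \<Rightarrow> real) \<Rightarrow> l2" where
  "restr_l2 S f = abs_l2 (\<lambda>x. indicator S x * f x)"


section \<open>Discrete spectrum of operators\<close>

text \<open>An operator in the Hilbert space \<open>H\<close> is given by its graph \<open>A \<subseteq> H \<times> H\<close>.\<close>

definition resolvent_set :: "'a::real_inner set \<Rightarrow> ('a \<times> 'a) set \<Rightarrow> real set" where
  "resolvent_set H A = {z.
     (\<forall>f\<in>H. \<exists>!u. (u, f + z *\<^sub>R u) \<in> A) \<and>
     (\<exists>K. \<forall>(u, g)\<in>A. norm u \<le> K * norm (g - z *\<^sub>R u))}"

definition spectrum :: "'a::real_inner set \<Rightarrow> ('a \<times> 'a) set \<Rightarrow> real set" where
  "spectrum H A = - resolvent_set H A"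

definition eigenspace :: "('a::real_inner \<times> 'a) set \<Rightarrow> real \<Rightarrow> 'a set" where
  "eigenspace A z = {u. (u, z *\<^sub>R u) \<in> A}"

text \<open>The finiteness condition is needed since \<^const>\<open>dim\<close> is \<open>0\<close> for infinite-dimensional spaces.\<close>

definition discrete_spectrum :: "'a::real_inner set \<Rightarrow> ('a \<times> 'a) set \<Rightarrow> real set" where
  "discrete_spectrum H A = {z. z isolated_in spectrum H A \<and> eigenspace A z \<noteq> {0} \<and>
     (\<exists>B. finite B \<and> eigenspace A z \<subseteq> span B)}"

definition multiplicity_sum :: "('a::real_inner \<times> 'a) set \<Rightarrow> real set \<Rightarrow> nat" where
  "multiplicity_sum A Z = (\<Sum>z\<in>Z. dim (eigenspace A z))"

text \<open>
  \<open>E\<^sub>n(A) = z\<close>, counting from \<open>n = 1\<close>: in the non-decreasing enumeration with multiplicities the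
  value \<open>z\<close> occupies the positions \<open>k + 1, \<dots>, k + m\<close>, where \<open>k\<close> is the number of discrete
  eigenvalues below \<open>z\<close> and \<open>m\<close> the multiplicity of \<open>z\<close>.
\<close>

definition nth_discrete_eigenvalue ::
    "'a::real_inner set \<Rightarrow> ('a \<times> 'a) set \<Rightarrow> nat \<Rightarrow> real \<Rightarrow> bool" where
  "nth_discrete_eigenvalue H A n z \<longleftrightarrow>
     z \<in> discrete_spectrum H A \<and>
     finite (discrete_spectrum H A \<inter> {..z}) \<and>
     multiplicity_sum A (discrete_spectrum H A \<inter> {..<z}) < n \<and>
     n \<le> multiplicity_sum A (discrete_spectrum H A \<inter> {..z})"


section \<open>Sobolev space, traces and Robin Laplacians\<close>

definition C1c :: "plane set \<Rightarrow> (plane \<Rightarrow> real) set" where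
  "C1c S = {\<phi>. (\<forall>x. \<phi> differentiable (at x)) \<and>
     (\<forall>e. continuous_on UNIV (\<lambda>x. frechet_derivative \<phi> (at x) e)) \<and>
     (\<exists>K. compact K \<and> K \<subseteq> S \<and> (\<forall>x. x \<notin> K \<longrightarrow> \<phi> x = 0))}"

text \<open>
  First-order weak derivatives, tested against \<open>C\<^sup>1\<close> functions of compact support as in Gilbarg and
  Trudinger.
\<close>

definition is_weak_deriv :: "plane set \<Rightarrow> plane \<Rightarrow> l2 \<Rightarrow> l2 \<Rightarrow> bool" where
  "is_weak_deriv S e u g \<longleftrightarrow> g \<in> L2_on S \<and>
     (\<forall>\<phi>\<in>C1c S. (\<integral>x. rep_l2 u x * frechet_derivative \<phi> (at x) e \<partial>lborel)
                 = - (\<integral>x. rep_l2 g x * \<phi> x \<partial>lborel))"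

definition weak_deriv :: "plane set \<Rightarrow> plane \<Rightarrow> l2 \<Rightarrow> l2" where
  "weak_deriv S e u = (THE g. is_weak_deriv S e u g)"

definition H1 :: "plane set \<Rightarrow> l2 set" where
  "H1 S = {u \<in> L2_on S. \<forall>e\<in>Basis. \<exists>g. is_weak_deriv S e u g}"

text \<open>
  Traces on a part of the boundary of \<open>S\<close> carrying the arc length measure \<open>\<sigma>\<close>: limits of boundary
  values of functions that are \<open>C\<^sup>1\<close> up to the boundary and converge in \<open>H\<^sup>1(S)\<close>.
\<close>

definition is_trace :: "plane set \<Rightarrow> plane measure \<Rightarrow> l2 \<Rightarrow> (plane \<Rightarrow> real) \<Rightarrow> bool" where
  "is_trace S \<sigma> u g \<longleftrightarrow> square_integrable \<sigma> g \<and>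
     (\<exists>\<phi> :: nat \<Rightarrow> plane \<Rightarrow> real.
        (\<forall>n. \<phi> n \<in> C1c UNIV) \<and>
        (\<lambda>n. restr_l2 S (\<phi> n)) \<longlonglongrightarrow> u \<and>
        (\<forall>e\<in>Basis. (\<lambda>n. restr_l2 S (\<lambda>x. frechet_derivative (\<phi> n) (at x) e))
                      \<longlonglongrightarrow> weak_deriv S e u) \<and>
        (\<lambda>n. \<integral>x. (\<phi> n x - g x)\<^sup>2 \<partial>\<sigma>) \<longlonglongrightarrow> 0)"

definition boundary_trace :: "plane set \<Rightarrow> plane measure \<Rightarrow> l2 \<Rightarrow> plane \<Rightarrow> real" where
  "boundary_trace S \<sigma> u = (SOME g. is_trace S \<sigma> u g)"

definition robin_form :: "plane set \<Rightarrow> plane measure \<Rightarrow> real \<Rightarrow> l2 \<Rightarrow> l2 \<Rightarrow> real" where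
  "robin_form S \<sigma> \<alpha> u v =
     (\<Sum>e\<in>Basis. inner (weak_deriv S e u) (weak_deriv S e v))
     - \<alpha> * (\<integral>x. boundary_trace S \<sigma> u x * boundary_trace S \<sigma> v x \<partial>\<sigma>)"

text \<open>The operator generated by the form with domain \<open>H\<^sup>1(S)\<close>, as in Kato's representation theorem.\<close>

definition robin_operator :: "plane set \<Rightarrow> plane measure \<Rightarrow> real \<Rightarrow> (l2 \<times> l2) set" where
  "robin_operator S \<sigma> \<alpha> = {(u, f). u \<in> H1 S \<and> f \<in> L2_on S \<and>
     (\<forall>v\<in>H1 S. robin_form S \<sigma> \<alpha> u v = inner f v)}"


section \<open>Sectors, quadrangles and non-resonant half-angles\<close>

text \<open>The apex is excluded explicitly because \<^prop>\<open>Arg 0 = 0\<close>.\<close>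

definition sector :: "real \<Rightarrow> plane set" where
  "sector \<theta> = {x. x \<noteq> 0 \<and> \<bar>Arg (Complex (fst x) (snd x))\<bar> < \<theta>}"

definition quadrangle :: "real \<Rightarrow> real \<Rightarrow> plane set" where
  "quadrangle \<theta> r = interior (convex hull
     {(0, 0), (r * cos \<theta>, r * sin \<theta>), (r / cos \<theta>, 0), (r * cos \<theta>, - r * sin \<theta>)})"

text \<open>
  Arc length measure on the two pieces \<open>{t (cos \<theta>, \<plusminus> sin \<theta>) | t \<in> J}\<close> of the boundary rays.
\<close>

definition side_measure :: "real \<Rightarrow> real set \<Rightarrow> plane measure" where
  "side_measure \<theta> J =
     distr (count_space {1, -1} \<Otimes>\<^sub>M restrict_space lborel J) borel
       (\<lambda>(s, t). (t * cos \<theta>, s * t * sin \<theta>))"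

lemma measurable_side_param:
  "(\<lambda>(s, t). (t * cos \<theta>, s * t * sin \<theta>))
     \<in> count_space {1, -1 :: real} \<Otimes>\<^sub>M restrict_space lborel J \<rightarrow>\<^sub>M (borel :: plane measure)"
proof -
  have 1: "(\<lambda>s. s) \<in> count_space {1, -1 :: real} \<rightarrow>\<^sub>M borel"
    by simp
  have 2: "(\<lambda>t. t) \<in> restrict_space lborel J \<rightarrow>\<^sub>M borel"
    by (rule measurable_restrict_space1) simp
  note [measurable] = measurable_compose[OF measurable_fst 1] measurable_compose[OF measurable_snd 2]
  show ?thesis
    unfolding split_beta' borel_prod[symmetric] by measurable
qed

lemma nn_integral_side_measure:
  assumes [measurable]: "g \<in> borel_measurable borel" "J \<in> sets borel"
  shows "(\<integral>\<^sup>+x. g x \<partial>side_measure \<theta> J) =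
    (\<integral>\<^sup>+t\<in>J. g (t * cos \<theta>, t * sin \<theta>) \<partial>lborel) + (\<integral>\<^sup>+t\<in>J. g (t * cos \<theta>, - t * sin \<theta>) \<partial>lborel)"
proof -
  let ?M = "count_space {1, -1 :: real}" and ?N = "restrict_space lborel J"
  let ?f = "\<lambda>(s, t). (t * cos \<theta>, s * t * sin \<theta>) :: plane"
  interpret N: sigma_finite_measure ?N
    by (rule sigma_finite_measure_restrict_space) (auto intro: lborel.sigma_finite_measure_axioms)
  have "(\<integral>\<^sup>+x. g x \<partial>side_measure \<theta> J) = (\<integral>\<^sup>+y. g (?f y) \<partial>(?M \<Otimes>\<^sub>M ?N))"
    unfolding side_measure_def by (rule nn_integral_distr[OF measurable_side_param]) simp
  also have "\<dots> = (\<integral>\<^sup>+s. \<integral>\<^sup>+t. g (?f (s, t)) \<partial>?N \<partial>?M)"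
    by (rule N.nn_integral_fst[symmetric]) (rule measurable_compose[OF measurable_side_param], simp)
  finally show ?thesis
    by (simp add: nn_integral_count_space_finite nn_integral_restrict_space)
qed

definition T_op :: "real \<Rightarrow> real \<Rightarrow> (l2 \<times> l2) set" where
  "T_op \<theta> \<alpha> = robin_operator (sector \<theta>) (side_measure \<theta> {0<..}) \<alpha>"

definition N_op :: "real \<Rightarrow> real \<Rightarrow> real \<Rightarrow> (l2 \<times> l2) set" where
  "N_op \<theta> r \<alpha> = robin_operator (quadrangle \<theta> r) (side_measure \<theta> {0<..<r}) \<alpha>"

text \<open>
  The number of discrete eigenvalues of \<^term>\<open>T_op \<theta> \<alpha>\<close>; it is finite and, by scaling, independent
  of \<open>\<alpha> > 0\<close>.
\<close>

definition kappa :: "real \<Rightarrow> real \<Rightarrow> nat" where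
  "kappa \<theta> \<alpha> = multiplicity_sum (T_op \<theta> \<alpha>) (discrete_spectrum (L2_on (sector \<theta>)) (T_op \<theta> \<alpha>))"

text \<open>That \<open>E\<^bsub>\<kappa>(\<theta>)+1\<^esub>\<close> exists for large \<open>r\<close> is part of the requirement.\<close>

definition non_resonant :: "real \<Rightarrow> bool" where
  "non_resonant \<theta> \<longleftrightarrow> (\<forall>\<alpha>>0. \<exists>C>0. \<forall>\<^sub>F r in at_top.
     \<exists>E. nth_discrete_eigenvalue (L2_on (quadrangle \<theta> r)) (N_op \<theta> r \<alpha>) (kappa \<theta> \<alpha> + 1) E \<and>
         E \<ge> - \<alpha>\<^sup>2 + C / r\<^sup>2)"

end

(* Cutting the sector along its axis and stretching each half along its Robin side turns it, up to a
 factor tan theta >= 1 in the gradient, into a quadrant, and the quadrangle into a square. There the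
 form is bounded below by a sum of two one-dimensional Robin forms. Off the product of the two
 one-dimensional ground states, this gives -alpha^2 for the sector and -alpha^2 + C/r^2 for the
 quadrangle. So both operators have at most one eigenvalue below these bounds; the sector has one,
 by the trial function exp(-alpha x1 / sin theta), and plane waves along a side show that its
 spectrum contains [-alpha^2, oo). *)
theory Submission
 imports Defs "HOL-Real_Asymp.Real_Asymp"
begin

text \<open>Half the quadrangle is a right triangle with legs \<open>r\<close> (the Robin side) and
  \<open>r * tan th\<close>; the stretch makes it isosceles, so two halves glue to a square. Area
  and arc length acquire the same factor, hence \<open>al\<close> is the Robin parameter in both
  variables. Only the tangential derivative changes, and its change lowers the energy because
  \<open>tan th >= 1\<close>.

  Let P, Q be the projections onto the one-dimensional profile in each variable. If the two
  one-dimensional forms are at least \<open>m - (k^2 + m) P\<close> and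
  \<open>m - (k^2 + m) Q\<close>, their sum is at least \<open>m - k^2\<close> off the product,
  since P + Q <= 1 + PQ. In the quadrangle \<open>m\<close> has order \<open>1 / r^2\<close> by a
  Poincare inequality, and \<open>k^2 - al^2\<close> is at most half of \<open>m\<close>; in the
  sector \<open>m = 0\<close> and \<open>k = al\<close>.

  No compact embedding is invoked: eigenvalues arise by minimisation from lower bounds that hold off
  finitely many functionals. All estimates are made for smooth functions and reach \<open>H1\<close>
  by density, where convexity of the domains is used. In the sector, no point of [-al^2, oo) is
  isolated in the spectrum, so none of them can be a discrete eigenvalue.\<close>

abbreviation sqint :: "'a measure => ('a => real) => bool" where "sqint \<equiv> square_integrable"
abbreviation bmeas :: "('a::topological_space => 'b::topological_space) set" where "bmeas \<equiv> borel_measurable borel"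
abbreviation ind :: "'a set => 'a => 'b::zero_neq_one" where "ind \<equiv> indicator"
abbreviation restr :: "plane set => (plane => real) => l2" where "restr \<equiv> restr_l2"
abbreviation limseq :: "(nat => 'a::topological_space) => 'a => bool" ("((_)/ ----> (_))" [60, 60] 60) where
 "X ----> l \<equiv> X \<longlonglongrightarrow> l"

section \<open>Semibounded closed forms\<close>

text \<open>The constant term is left free to cover two uses: Cauchy-Schwarz for a nonnegative form,
  and the Euler equation of an almost minimiser, where it is the defect
  \<open>1 / (n + 1)\<close>.\<close>

lemma quadratic_nonneg_discriminant:
 fixes a b e :: real
 assumes "!!t. 0 <= e + 2 * t * b + t^2 * a"
 shows "b^2 <= e * a"
proof (cases "a = 0")
 case True
 have "b = 0"
 proof (rule ccontr)
 assume "b ~= 0"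
 have "0 <= e + 2 * (- (e + 1) / (2 * b)) * b + (- (e + 1) / (2 * b))^2 * a"
  by (rule assms)
 with True \<open>b ~= 0\<close> show False by (simp add: field_simps)
 qed
 with True show ?thesis by simp
next
 case False
 have "0 <= a"
 proof (rule ccontr)
 assume "\<not> 0 <= a"
 then have a: "a < 0" by simp
 \<comment> \<open>Large enough for the negative term \<open>t^2 * a\<close> to outweigh both
   \<open>e\<close> and \<open>2 * t * b\<close>.\<close>
 define t where "t = (\<bar>e\<bar> + 1 + 2 * \<bar>b\<bar>) / (- a) + 1"
 have "0 <= (\<bar>e\<bar> + 1 + 2 * \<bar>b\<bar>) / (- a)" using a by (intro divide_nonneg_pos) auto
 moreover have "t * (- a) = \<bar>e\<bar> + 1 + 2 * \<bar>b\<bar> - a" using a by (simp add: t_def field_simps)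
 ultimately have t: "t >= 1" "t * (- a) >= \<bar>e\<bar> + 1 + 2 * \<bar>b\<bar>"
  using a by (auto simp: t_def)
 have "t * (t * (- a)) >= t * (\<bar>e\<bar> + 1 + 2 * \<bar>b\<bar>)"
  using t by (intro mult_left_mono) auto
 moreover have "t * (\<bar>e\<bar> + 1) >= 1 * (\<bar>e\<bar> + 1)"
  using t by (intro mult_right_mono) auto
 moreover have "t * b <= t * \<bar>b\<bar>" using t by (intro mult_left_mono) auto
 ultimately have "e + 2 * t * b + t^2 * a < 0"
  by (simp add: power2_eq_square algebra_simps)
 with assms[of t] show False by simp
 qed
 with False have a: "a > 0" by simp
 have "0 <= e + 2 * (- b / a) * b + (- b / a)^2 * a"
 by (rule assms)
 also have "... = e - b^2 / a"
 using a by (simp add: field_simps power2_eq_square)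
 finally show ?thesis using a by (simp add: field_simps)
qed

lemma tendsto_zero_square:
 fixes f :: "'i => real"
 assumes "((%n. (f n)^2) \<longlongrightarrow> 0) F"
 shows "(f \<longlongrightarrow> 0) F"
proof -
 have "((%n. sqrt ((f n)^2)) \<longlongrightarrow> sqrt 0) F"
 by (intro tendsto_intros assms)
 then show ?thesis by (simp add: tendsto_rabs_zero_iff)
qed

lemma bounded_sequences_common_subseq:
 fixes x :: "'i => nat => real"
 assumes "finite F" and "!!i. i \<in> F ==> bounded (range (x i))"
 shows "\<exists>r. strict_mono (r :: nat => nat) & (\<forall>i\<in>F. convergent (%n. x i (r n)))"
 using assms
proof (induction F rule: finite_induct)
 case empty
 show ?case by (rule exI[of _ id]) (auto simp: strict_mono_def)
next
 case (insert j F)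
 then obtain r where r: "strict_mono r" "\<forall>i\<in>F. convergent (%n. x i (r n))" by auto
 have "bounded (range (x j \<circ> r))"
 by (rule bounded_subset[OF insert.prems[OF insertI1]]) auto
 then obtain l s where s: "strict_mono s" "((x j \<circ> r) \<circ> s) ----> l"
 using bounded_imp_convergent_subsequence by metis
 have "convergent (%n. x i (r (s n)))" if "i \<in> F" for i
 using r(2) that s(1) convergent_subseq_convergent[of "%n. x i (r n)" s]
 by (auto simp: o_def)
 moreover have "convergent (%n. x j (r (s n)))"
 using s(2) by (auto simp: convergent_def o_def)
 ultimately show ?case
 using r(1) s(1) by (intro exI[of _ "r \<circ> s"]) (auto simp: strict_mono_def)
qed

text \<open>Gaussian elimination: the equation \<open>g\<close> is solved for a pivot
  \<open>b0\<close>, and the remaining equations are reduced by it. This is the dimension count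
  behind both min-max arguments below.\<close>

lemma exists_kernel_vector:
 fixes a :: "'f => 'b => real"
 assumes "finite F" "finite B" "card F < card B"
 shows "\<exists>x. (\<exists>b\<in>B. x b ~= 0) & (\<forall>f\<in>F. (\<Sum>b\<in>B. x b * a f b) = 0)"
 using assms
proof (induction F arbitrary: B a rule: finite_induct)
 case empty
 then obtain b where "b \<in> B" by fastforce
 then show ?case by (intro exI[of _ "%_. 1"]) auto
next
 case (insert g F)
 show ?case
 proof (cases "\<forall>b\<in>B. a g b = 0")
 case True
 have "card F < card B" using insert by simp
 from insert.IH[OF insert.prems(1) this, of a] show ?thesis
  using True by auto
 next
 case False
 then obtain b0 where b0: "b0 \<in> B" "a g b0 ~= 0" by auto
 define B' where "B' = B - {b0}"
 have B': "finite B'" "B = insert b0 B'" "b0 \<notin> B'"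
  using b0 insert.prems by (auto simp: B'_def)
 have "card F < card B'"
  using insert.prems insert.hyps b0 by (simp add: B'_def)
 from insert.IH[OF B'(1) this, of "%f b. a f b - a f b0 * a g b / a g b0"]
 obtain x where x: "\<exists>b\<in>B'. x b ~= 0"
  "!!f. f \<in> F ==> (\<Sum>b\<in>B'. x b * (a f b - a f b0 * a g b / a g b0)) = 0" by auto
 define s where "s = - (\<Sum>b\<in>B'. x b * a g b) / a g b0"
 define y where "y b = (if b = b0 then s else x b)" for b
 have sum_y: "(\<Sum>b\<in>B. y b * a f b) = s * a f b0 + (\<Sum>b\<in>B'. x b * a f b)" for f
  unfolding B'(2) using B'(1,3) by (simp add: y_def) (auto intro!: sum.cong)
 have "(\<Sum>b\<in>B. y b * a g b) = 0"
  unfolding sum_y using b0 by (simp add: s_def)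
 moreover have "(\<Sum>b\<in>B. y b * a f b) = 0" if "f \<in> F" for f
 proof -
  have "(\<Sum>b\<in>B'. x b * (a f b - a f b0 * a g b / a g b0))
   = (\<Sum>b\<in>B'. x b * a f b) - a f b0 / a g b0 * (\<Sum>b\<in>B'. x b * a g b)"
  by (simp add: right_diff_distrib sum_subtractf sum_distrib_left mult_ac)
  then show ?thesis using x(2)[OF that] by (simp add: sum_y s_def)
 qed
 moreover have "\<exists>b\<in>B. y b ~= 0" using x(1) B' by (auto simp: y_def)
 ultimately show ?thesis by (intro exI[of _ y]) auto
 qed
qed

section \<open>Closed forms and the form norm\<close>

locale semibounded_form =
 fixes H V :: "'a::real_inner set" and q :: "'a => 'a => real" and c :: real
 assumes subspace_H: "subspace H" and subspace_V: "subspace V" and V_subset: "V \<subseteq> H"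
 and q_add: "!!u v w. u \<in> V ==> v \<in> V ==> w \<in> V ==> q (u + v) w = q u w + q v w"
 and q_scale: "!!s u w. u \<in> V ==> w \<in> V ==> q (s *\<^sub>R u) w = s * q u w"
 and q_sym: "!!u v. u \<in> V ==> v \<in> V ==> q u v = q v u"
 and q_bound: "!!u. u \<in> V ==> inner u u <= q u u + c * inner u u"
 and complete_V: "!!X. (!!n. X n \<in> V) ==>
  (!!e. e > 0 ==> \<exists>N. \<forall>m\<ge>N. \<forall>n\<ge>N.
   q (X m - X n) (X m - X n) + c * inner (X m - X n) (X m - X n) < e) ==>
  \<exists>u\<in>V. (%n. q (X n - u) (X n - u) + c * inner (X n - u) (X n - u)) ----> 0"
begin

lemma q_add_right: "u \<in> V ==> v \<in> V ==> w \<in> V ==> q w (u + v) = q w u + q w v"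
 using q_add[of u v w] q_sym subspace_V by (simp add: subspace_add)

lemma q_scale_right: "u \<in> V ==> w \<in> V ==> q w (s *\<^sub>R u) = s * q w u"
 using q_scale[of u w s] q_sym subspace_V by (simp add: subspace_scale)

lemma V_add: "u \<in> V ==> v \<in> V ==> u + v \<in> V"
 and V_scale: "u \<in> V ==> s *\<^sub>R u \<in> V"
 and V_diff: "u \<in> V ==> v \<in> V ==> u - v \<in> V"
 and V_zero: "0 \<in> V"
 and V_sum: "(!!i. i \<in> I ==> g i \<in> V) ==> (\<Sum>i\<in>I. g i) \<in> V"
 using subspace_V by (auto simp: subspace_add subspace_scale subspace_diff subspace_0 subspace_sum)

lemma q_diff: "u \<in> V ==> v \<in> V ==> w \<in> V ==> q (u - v) w = q u w - q v w"
 using q_add[of u "(-1) *\<^sub>R v" w] q_scale[of v w "-1"] V_scale[of v "-1"] by simp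

lemma q_diff_right: "u \<in> V ==> v \<in> V ==> w \<in> V ==> q w (u - v) = q w u - q w v"
 using q_diff[of u v w] q_sym V_diff by simp

lemma q_zero: "w \<in> V ==> q 0 w = 0"
 using q_scale[of 0 w 0] V_zero by simp

lemma q_sum: "w \<in> V ==> (!!i. i \<in> I ==> g i \<in> V) ==> q (\<Sum>i\<in>I. g i) w = (\<Sum>i\<in>I. q (g i) w)"
proof (induction I rule: infinite_finite_induct)
 case (insert x F)
 then show ?case using q_add[of "g x" "\<Sum>i\<in>F. g i" w] V_sum[of F g] by simp
qed (auto simp: q_zero)

lemma q_sum_right: "w \<in> V ==> (!!i. i \<in> I ==> g i \<in> V) ==> q w (\<Sum>i\<in>I. g i) = (\<Sum>i\<in>I. q w (g i))"
 using q_sum[of w I g] q_sym V_sum[of I g] by (simp cong: sum.cong)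

definition graph :: "('a \<times> 'a) set" where
 "graph = {(u, f). u \<in> V & f \<in> H & (\<forall>v\<in>V. q u v = inner f v)}"

text \<open>The form of the shifted operator; at \<open>z = - c\<close> it is the squared form
  norm.\<close>

definition qs :: "real => 'a => 'a => real" where
 "qs z u v = q u v - z * inner u v"

lemma qs_add: "u \<in> V ==> v \<in> V ==> w \<in> V ==> qs z (u + v) w = qs z u w + qs z v w"
 and qs_add_right: "u \<in> V ==> v \<in> V ==> w \<in> V ==> qs z w (u + v) = qs z w u + qs z w v"
 and qs_diff: "u \<in> V ==> v \<in> V ==> w \<in> V ==> qs z (u - v) w = qs z u w - qs z v w"
 and qs_diff_right: "u \<in> V ==> v \<in> V ==> w \<in> V ==> qs z w (u - v) = qs z w u - qs z w v"
 and qs_scale: "u \<in> V ==> w \<in> V ==> qs z (s *\<^sub>R u) w = s * qs z u w"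
 and qs_scale_right: "u \<in> V ==> w \<in> V ==> qs z w (s *\<^sub>R u) = s * qs z w u"
 and qs_sym: "u \<in> V ==> v \<in> V ==> qs z u v = qs z v u"
 by (simp_all add: qs_def q_add q_add_right q_diff q_diff_right q_scale q_scale_right
  inner_add_left inner_add_right inner_diff_left inner_diff_right algebra_simps)
 (simp_all add: q_sym inner_commute)

lemma qs_square: "u \<in> V ==> v \<in> V ==>
 qs z (u + t *\<^sub>R v) (u + t *\<^sub>R v) = qs z u u + 2 * t * qs z u v + t^2 * qs z v v"
 by (simp add: qs_add qs_add_right qs_scale qs_scale_right V_add V_scale qs_sym[of v u]
  algebra_simps power2_eq_square)

lemma norm_le_form: "u \<in> V ==> inner u u <= qs (- c) u u"
 using q_bound[of u] by (simp add: qs_def)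

text \<open>Stated on a subspace because for the infimum \<open>l\<close> of the Rayleigh quotient
  on an orthogonal complement, \<open>qs l\<close> is known to be nonnegative on that complement
  only.\<close>

lemma qs_Cauchy_Schwarz:
 assumes "u \<in> W" "v \<in> W" "subspace W" "W \<subseteq> V" and "!!w. w \<in> W ==> 0 <= qs z w w"
 shows "(qs z u v)^2 <= qs z u u * qs z v v"
proof (rule quadratic_nonneg_discriminant)
 fix t :: real
 have "u + t *\<^sub>R v \<in> W" using assms by (simp add: subspace_add subspace_scale)
 from assms(5)[OF this] show "0 <= qs z u u + 2 * t * qs z u v + t^2 * qs z v v"
 using assms by (subst (asm) qs_square) auto
qed

text \<open>Convergence in the form norm, for which \<open>V\<close> is complete and which dominates
  the norm of \<open>H\<close>.\<close>

definition converges :: "(nat => 'a) => 'a => bool" where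
 "converges X u \<longleftrightarrow> (\<forall>n. X n \<in> V) & u \<in> V & (%n. qs (- c) (X n - u) (X n - u)) ----> 0"

lemma Cauchy_converges:
 assumes "!!n. X n \<in> V"
 and "!!e. e > 0 ==> \<exists>N. \<forall>m\<ge>N. \<forall>n\<ge>N. qs (- c) (X m - X n) (X m - X n) < e"
 shows "\<exists>u. converges X u"
 using complete_V[of X] assms by (auto simp: converges_def qs_def)

lemma converges_tendsto:
 assumes "converges X u"
 shows "X ----> u"
proof -
 have *: "(norm (X n - u))^2 <= qs (- c) (X n - u) (X n - u)" for n
 using assms norm_le_form[of "X n - u"]
 by (simp add: converges_def V_diff power2_norm_eq_inner)
 have "(%n. (norm (X n - u))^2) ----> 0"
 by (rule tendsto_sandwich[of "%_. 0", OF _ _ tendsto_const])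
  (use assms * in \<open>auto simp: converges_def\<close>)
 then have "(%n. sqrt ((norm (X n - u))^2)) ----> sqrt 0"
 by (rule tendsto_real_sqrt)
 then have "(%n. X n - u) ----> 0"
 by (simp add: tendsto_norm_zero_iff)
 then show ?thesis by (rule LIM_zero_cancel)
qed

lemma converges_form:
 assumes "converges X u" "v \<in> V"
 shows "(%n. qs z (X n) v) ----> qs z u v"
proof -
 have V: "X n \<in> V" "u \<in> V" for n using assms by (auto simp: converges_def)
 have *: "(qs (- c) (X n - u) v)^2 <= qs (- c) (X n - u) (X n - u) * qs (- c) v v" for n
 by (rule qs_Cauchy_Schwarz[where W = V])
  (use V assms subspace_V order_trans[OF inner_ge_zero norm_le_form] in \<open>auto simp: V_diff\<close>)
 have "(%n. (qs (- c) (X n - u) v)^2) ----> 0"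
 proof (rule tendsto_sandwich[of "%_. 0", OF _ _ tendsto_const])
 show "(%n. qs (- c) (X n - u) (X n - u) * qs (- c) v v) ----> 0"
  using tendsto_mult_right[of _ 0 sequentially "qs (- c) v v"] assms
  by (auto simp: converges_def)
 qed (use * in auto)
 then have "(%n. qs (- c) (X n - u) v) ----> 0"
 by (rule tendsto_zero_square)
 moreover have "(%n. (- c - z) * inner (X n - u) v) ----> (- c - z) * inner (u - u) v"
 by (intro tendsto_intros converges_tendsto[OF assms(1)])
 ultimately have "(%n. qs (- c) (X n - u) v + (- c - z) * inner (X n - u) v) ----> 0 + 0"
 by (intro tendsto_add) auto
 then have "(%n. qs z (X n) v - qs z u v) ----> 0"
 using V assms by (simp add: qs_def q_diff algebra_simps inner_diff_left)
 then show ?thesis by (rule LIM_zero_cancel)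
qed

text \<open>Dirichlet's principle: the solution minimises the energy \<open>J\<close>. By the
  parallelogram identity a minimising sequence is Cauchy for \<open>qs z\<close>, hence in the form
  norm, and the discriminant lemma turns almost minimality into the Euler equation in the
  limit.\<close>

lemma solve_coercive:
 assumes W: "subspace W" "W \<subseteq> V"
 and closed: "!!X u. (!!n. X n \<in> W) ==> converges X u ==> u \<in> W"
 and d: "d > 0" "!!u. u \<in> W ==> d * inner u u <= qs z u u"
 shows "\<exists>u\<in>W. \<forall>v\<in>W. qs z u v = inner f v"
proof -
 define J where "J u = qs z u u - 2 * inner f u" for u
 have Jlow: "- (norm f)\<^sup>2 / d <= J u" if "u \<in> W" for u
 proof -
 have "2 * inner f u <= 2 * (norm f * norm u)" using norm_cauchy_schwarz[of f u] by simp
 moreover have "0 <= (norm f / sqrt d - sqrt d * norm u)^2" by simp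
 then have "0 <= (norm f)^2 / d - 2 * (norm f * norm u) + d * (norm u)^2"
  using d(1) by (simp add: power2_diff power_divide power_mult_distrib)
 ultimately show ?thesis
  using d(2)[OF that] by (simp add: J_def power2_norm_eq_inner)
 qed
 define m where "m = Inf (J ` W)"
 have bdd: "bdd_below (J ` W)" by (rule bdd_belowI2[of _ "- (norm f)\<^sup>2 / d"]) (rule Jlow)
 have W0: "0 \<in> W" using W by (simp add: subspace_0)
 have mle: "m <= J u" if "u \<in> W" for u
 unfolding m_def using bdd that by (intro cInf_lower) auto
 have "\<exists>u\<in>W. J u < m + 1 / real (Suc n)" for n
 proof -
 have "\<exists>x\<in>J ` W. x < m + 1 / real (Suc n)"
  using W0 bdd by (subst cInf_less_iff[symmetric]) (auto simp: m_def)
 then show ?thesis by auto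
 qed
 then obtain X where X: "!!n. X n \<in> W" "!!n. J (X n) < m + 1 / real (Suc n)" by metis
 have XV: "X n \<in> V" for n using X W by auto
 have par: "qs z (u - v) (u - v) <= 2 * (J u - m) + 2 * (J v - m)" if "u \<in> W" "v \<in> W" for u v
 proof -
 let ?w = "(1/2) *\<^sub>R (u + v)"
 have uv: "u \<in> V" "v \<in> V" using that W by auto
 have "qs z (u - v) (u - v) = 2 * J u + 2 * J v - 4 * J ?w"
  unfolding J_def using uv
  by (simp add: qs_add qs_add_right qs_scale qs_scale_right V_add V_scale qs_sym[of v u] V_diff
   qs_diff qs_diff_right inner_add_right algebra_simps)
 moreover have "?w \<in> W" using that W by (simp add: subspace_add subspace_scale)
 ultimately show ?thesis using mle[of ?w] by simp
 qed
 \<comment> \<open>\<open>qs (- c)\<close> differs from \<open>qs z\<close> by \<open>c + z\<close>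
   times the squared norm, which coercivity bounds by \<open>qs z / d\<close>.\<close>
 define K where "K = 1 + \<bar>c + z\<bar> / d"
 have K: "K > 0" using d by (simp add: K_def add_pos_nonneg)
 have pK: "qs (- c) u u <= K * qs z u u" if "u \<in> W" for u
 proof -
 have "(c + z) * inner u u <= \<bar>c + z\<bar> * inner u u" by (intro mult_right_mono) auto
 also have "... = \<bar>c + z\<bar> / d * (d * inner u u)" using d by simp
 also have "... <= \<bar>c + z\<bar> / d * qs z u u" using d that by (intro mult_left_mono) auto
 finally show ?thesis by (simp add: qs_def K_def algebra_simps)
 qed
 have "\<exists>u. converges X u"
 proof (rule Cauchy_converges)
 fix e :: real assume "e > 0"
 obtain N where "4 * K / e < real N" using reals_Archimedean2 by blast
 then have N: "4 * K < e * real (Suc N)"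
  using \<open>e > 0\<close> by (simp add: field_simps)
 have "qs (- c) (X m - X n) (X m - X n) < e" if "m >= N" "n >= N" for m n
 proof -
  have a: "J (X k) - m' <= 1 / real (Suc N)" if "k >= N" "m' = Inf (J ` W)" for k m'
  proof -
  have "1 / real (Suc k) <= 1 / real (Suc N)"
   using that by (intro divide_left_mono) auto
  then show ?thesis using X(2)[of k] that by (simp add: m_def)
  qed
  have "qs (- c) (X m - X n) (X m - X n) <= K * qs z (X m - X n) (X m - X n)"
  by (rule pK) (use X W in \<open>simp add: subspace_diff\<close>)
  also have "... <= K * (4 / real (Suc N))"
  using par[OF X(1) X(1), of m n] a[OF that(1)] a[OF that(2)] K
  by (intro mult_left_mono) (auto simp: m_def)
  also have "... < e" using N by (simp add: field_simps)
  finally show ?thesis .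
 qed
 then show "\<exists>N. \<forall>m\<ge>N. \<forall>n\<ge>N. qs (- c) (X m - X n) (X m - X n) < e" by blast
 qed (rule XV)
 then obtain u where u: "converges X u" by blast
 have uW: "u \<in> W" using closed[OF X(1) u] .
 have "qs z u v = inner f v" if v: "v \<in> W" for v
 proof -
 have *: "(qs z (X n) v - inner f v)^2 <= (1 / real (Suc n)) * qs z v v" for n
 proof (rule quadratic_nonneg_discriminant)
  fix t :: real
  have "m <= J (X n + t *\<^sub>R v)"
  by (rule mle) (use X W v in \<open>simp add: subspace_add subspace_scale\<close>)
  also have "... = J (X n) + 2 * t * (qs z (X n) v - inner f v) + t^2 * qs z v v"
  unfolding J_def using XV W v by (subst qs_square) (auto simp: inner_add_right algebra_simps)
  finally show "0 <= 1 / real (Suc n) + 2 * t * (qs z (X n) v - inner f v) + t^2 * qs z v v"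
  using X(2)[of n] by linarith
 qed
 have "(%n. (qs z (X n) v - inner f v)^2) ----> 0"
 proof (rule tendsto_sandwich[of "%_. 0", OF _ _ tendsto_const])
  show "(%n. (1 / real (Suc n)) * qs z v v) ----> 0"
  using tendsto_mult_right[OF LIMSEQ_inverse_real_of_nat, of "qs z v v"]
  by (simp add: inverse_eq_divide)
 qed (use * in auto)
 then have "(%n. qs z (X n) v - inner f v) ----> 0"
  by (rule tendsto_zero_square)
 then have "(%n. qs z (X n) v) ----> inner f v" by (rule LIM_zero_cancel)
 with converges_form[OF u, of v z] show ?thesis
  using LIMSEQ_unique v W by blast
 qed
 with uW show ?thesis by blast
qed

section \<open>Finite eigensystems and the resolvent off them\<close>

definition eigensystem :: "'a set => ('a => real) => bool" where
 "eigensystem B ev \<longleftrightarrow> finite B & B \<subseteq> V &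
  (\<forall>b\<in>B. \<forall>b'\<in>B. inner b b' = (if b = b' then 1 else 0)) &
  (\<forall>b\<in>B. \<forall>v\<in>V. q b v = ev b * inner b v)"

definition orth :: "'a set => 'a set" where
 "orth B = {u\<in>V. \<forall>b\<in>B. inner u b = 0}"

lemma subspace_orth: "subspace (orth B)"
 using subspace_V by (auto simp: orth_def subspace_def inner_add_left)

lemma orth_closed:
 assumes "!!n. X n \<in> orth B" "converges X u"
 shows "u \<in> orth B"
proof -
 have "inner u b = 0" if "b \<in> B" for b
 proof -
 have "(%n. inner (X n) b) ----> inner u b"
  by (intro tendsto_intros converges_tendsto assms)
 moreover have "inner (X n) b = 0" for n using assms(1)[of n] that by (auto simp: orth_def)
 ultimately show ?thesis by (simp add: LIMSEQ_const_iff)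
 qed
 then show ?thesis using assms(2) by (auto simp: orth_def converges_def)
qed

lemma eigensystem_qs: "eigensystem B ev ==> b \<in> B ==> v \<in> V ==> qs z b v = (ev b - z) * inner b v"
 by (simp add: eigensystem_def qs_def algebra_simps)

lemma eigensystem_in_V: "eigensystem B ev ==> b \<in> B ==> b \<in> V"
 by (auto simp: eigensystem_def)

lemma inner_eigensystem_sum:
 assumes "eigensystem B ev" "b \<in> B"
 shows "inner (\<Sum>a\<in>B. x a *\<^sub>R a) b = x b"
proof -
 have "inner (\<Sum>a\<in>B. x a *\<^sub>R a) b = (\<Sum>a\<in>B. if a = b then x b else 0)"
 unfolding inner_sum_left using assms
 by (intro sum.cong) (auto simp: eigensystem_def)
 also have "... = x b" using assms by (simp add: eigensystem_def)
 finally show ?thesis .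
qed

definition proj :: "'a set => 'a => 'a" where
 "proj B v = (\<Sum>b\<in>B. inner v b *\<^sub>R b)"

lemma proj_in_V: "eigensystem B ev ==> proj B v \<in> V"
 unfolding proj_def by (intro V_sum V_scale) (rule eigensystem_in_V)

lemma diff_proj_orth:
 assumes "eigensystem B ev" "v \<in> V"
 shows "v - proj B v \<in> orth B"
 using assms proj_in_V[OF assms(1)]
 by (auto simp: orth_def V_diff inner_diff_left proj_def inner_eigensystem_sum)

text \<open>Eigenvectors orthogonal in \<open>H\<close> are orthogonal for the form too, so every
  quadratic quantity splits along \<open>span B\<close> and \<open>orth B\<close>.\<close>

lemma qs_sum_orth:
 assumes "eigensystem B ev" "u \<in> orth B"
 shows "qs z (\<Sum>b\<in>B. x b *\<^sub>R b) u = 0" "qs z u (\<Sum>b\<in>B. x b *\<^sub>R b) = 0"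
proof -
 have u: "u \<in> V" "!!b. b \<in> B ==> inner b u = 0"
 using assms by (auto simp: orth_def inner_commute)
 have b: "!!b. b \<in> B ==> b \<in> V" using assms(1) by (rule eigensystem_in_V)
 have "q (\<Sum>b\<in>B. x b *\<^sub>R b) u = (\<Sum>b\<in>B. q (x b *\<^sub>R b) u)"
 using u b by (intro q_sum V_scale) auto
 also have "... = 0"
 using u b assms by (intro sum.neutral) (auto simp: q_scale eigensystem_def)
 finally show 1: "qs z (\<Sum>b\<in>B. x b *\<^sub>R b) u = 0"
 using u by (simp add: qs_def inner_sum_left)
 show "qs z u (\<Sum>b\<in>B. x b *\<^sub>R b) = 0"
 using 1 qs_sym[of u "\<Sum>b\<in>B. x b *\<^sub>R b" z] u(1) V_sum[of B "%b. x b *\<^sub>R b"] b V_scale by simp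
qed

lemma graph_iff: "(u, f + z *\<^sub>R u) \<in> graph \<longleftrightarrow> u \<in> V & f \<in> H & (\<forall>v\<in>V. qs z u v = inner f v)"
proof -
 have "f + z *\<^sub>R u \<in> H \<longleftrightarrow> f \<in> H" if "u \<in> V"
 proof -
 have "z *\<^sub>R u \<in> H" using that V_subset subspace_H by (auto simp: subspace_scale)
 then show ?thesis using subspace_H subspace_add[of H f "z *\<^sub>R u"] subspace_diff[of H "f + z *\<^sub>R u" "z *\<^sub>R u"]
  by auto
 qed
 then show ?thesis
 by (auto simp: graph_def qs_def inner_add_left algebra_simps)
qed

text \<open>The equation decouples: testing with the component of \<open>u\<close> in
  \<open>orth B\<close> gives the first estimate, testing with \<open>b\<close> itself the
  second.\<close>

lemma solution_bounds:
 assumes B: "eigensystem B ev" and M: "!!u. u \<in> orth B ==> M * inner u u <= q u u"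
 and z: "z < M" and u: "u \<in> V" "!!v. v \<in> V ==> qs z u v = inner f v"
 shows "norm (u - proj B u) <= norm f / (M - z)"
 and "b \<in> B ==> (ev b - z) * inner u b = inner f b"
proof -
 define w where "w = u - proj B u"
 have w: "w \<in> orth B" "w \<in> V" using diff_proj_orth[OF B u(1)] by (auto simp: w_def orth_def)
 have "qs z w w = qs z u w"
 using qs_diff[OF u(1) proj_in_V[OF B, of u] w(2), of z] qs_sum_orth(1)[OF B w(1), of z "%b. inner u b"]
 by (simp add: w_def[symmetric] proj_def[symmetric])
 also have "... = inner f w" using u w by simp
 also have "... <= norm f * norm w" by (rule norm_cauchy_schwarz)
 finally have "(M - z) * (norm w)^2 <= norm f * norm w"
 using M[OF w(1)] by (simp add: qs_def power2_norm_eq_inner algebra_simps)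
 then have "(M - z) * norm w <= norm f \<or> norm w = 0"
 by (auto simp: power2_eq_square mult.assoc[symmetric] dest!: mult_right_le_imp_le)
 then show "norm (u - proj B u) <= norm f / (M - z)"
 using z by (auto simp: w_def field_simps)
next
 assume b: "b \<in> B"
 then show "(ev b - z) * inner u b = inner f b"
 using u eigensystem_qs[OF B b u(1), of z] eigensystem_in_V[OF B b] qs_sym[of u b z]
 by (simp add: inner_commute)
qed

text \<open>The solution is assembled from a coercive problem on \<open>orth B\<close>, where the
  form of the shifted operator is at least \<open>M - z\<close>, and a diagonal one on
  \<open>span B\<close>, where \<open>ev b - z\<close> is inverted.\<close>

lemma resolvent_setI:
 assumes B: "eigensystem B ev" and M: "!!u. u \<in> orth B ==> M * inner u u <= q u u"
 and z: "z < M" "!!b. b \<in> B ==> ev b ~= z"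
 shows "z \<in> resolvent_set H graph"
proof -
 have fin: "finite B" using B by (simp add: eigensystem_def)
 have BV: "!!b. b \<in> B ==> b \<in> V" using eigensystem_in_V[OF B] .
 have ex: "\<exists>u\<in>V. \<forall>v\<in>V. qs z u v = inner f v" for f
 proof -
 have "\<exists>u\<in>orth B. \<forall>v\<in>orth B. qs z u v = inner f v"
 proof (rule solve_coercive[where d = "M - z"])
  show "(M - z) * inner u u <= qs z u u" if "u \<in> orth B" for u
  using M[OF that] by (simp add: qs_def algebra_simps)
  show "u \<in> orth B" if "!!n. X n \<in> orth B" "converges X u" for X u
  by (rule orth_closed[OF that])
 qed (use z in \<open>auto simp: orth_def intro: subspace_orth[unfolded orth_def]\<close>)
 then obtain u0 where u0: "u0 \<in> orth B" "!!v. v \<in> orth B ==> qs z u0 v = inner f v" by blast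
 define s where "s = (\<Sum>b\<in>B. (inner f b / (ev b - z)) *\<^sub>R b)"
 have sV: "s \<in> V" unfolding s_def using BV by (intro V_sum V_scale)
 have u0V: "u0 \<in> V" using u0 by (simp add: orth_def)
 have "qs z (u0 + s) v = inner f v" if v: "v \<in> V" for v
 proof -
  define w where "w = v - proj B v"
  have w: "w \<in> orth B" "w \<in> V" using diff_proj_orth[OF B v] by (auto simp: w_def orth_def)
  have pV: "proj B v \<in> V" by (rule proj_in_V[OF B])
  have v_eq: "v = w + proj B v" by (simp add: w_def)
  have 1: "qs z u0 v = inner f w"
  using qs_sum_orth(2)[OF B u0(1), of z "%b. inner v b"] u0(2)[OF w(1)] w u0V pV
  by (subst v_eq) (simp add: qs_add_right proj_def)
  have "qs z s v = (\<Sum>b\<in>B. qs z ((inner f b / (ev b - z)) *\<^sub>R b) v)"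
  unfolding qs_def s_def using v BV
  by (simp add: q_sum V_scale inner_sum_left sum_subtractf sum_distrib_left)
  also have "... = (\<Sum>b\<in>B. inner f b * inner v b)"
  proof (rule sum.cong)
  fix b assume b: "b \<in> B"
  have "ev b - z ~= 0" using z(2)[OF b] by simp
  then show "qs z ((inner f b / (ev b - z)) *\<^sub>R b) v = inner f b * inner v b"
   using eigensystem_qs[OF B b v, of z] b BV v by (simp add: qs_scale inner_commute)
  qed simp
  also have "... = inner f (proj B v)"
  by (simp add: proj_def inner_sum_right mult.commute)
  finally show ?thesis
  using 1 u0V sV v by (simp add: qs_add w_def inner_diff_right)
 qed
 then show ?thesis using u0V sV V_add by blast
 qed
 have bound: "norm u <= (1 / (M - z) + (\<Sum>b\<in>B. 1 / \<bar>ev b - z\<bar>)) * norm f"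
 if u: "u \<in> V" "!!v. v \<in> V ==> qs z u v = inner f v" for u f
 proof -
 have 1: "norm (inner u b *\<^sub>R b) <= 1 / \<bar>ev b - z\<bar> * norm f" if b: "b \<in> B" for b
 proof -
  have nb: "norm b = 1" using B b by (simp add: eigensystem_def norm_eq_1)
  have "(ev b - z) * inner u b = inner f b"
  by (rule solution_bounds(2)[OF B M z(1) u b])
  then have "\<bar>ev b - z\<bar> * \<bar>inner u b\<bar> = \<bar>inner f b\<bar>" by (simp add: abs_mult[symmetric])
  also have "... <= norm f" using Cauchy_Schwarz_ineq2[of f b] nb by simp
  finally show ?thesis using z(2)[OF b] nb by (simp add: field_simps)
 qed
 have "norm u <= norm (u - proj B u) + norm (proj B u)"
  using norm_triangle_ineq[of "u - proj B u" "proj B u"] by simp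
 also have "norm (proj B u) <= (\<Sum>b\<in>B. 1 / \<bar>ev b - z\<bar> * norm f)"
  unfolding proj_def using 1 by (rule sum_norm_le)
 also have "norm (u - proj B u) <= norm f / (M - z)"
  by (rule solution_bounds(1)[OF B M z(1) u])
 finally show ?thesis by (simp add: distrib_right sum_distrib_right)
 qed
 show ?thesis
 unfolding resolvent_set_def
 proof (intro CollectI conjI ballI exI[of _ "1 / (M - z) + (\<Sum>b\<in>B. 1 / \<bar>ev b - z\<bar>)"])
 fix f assume f: "f \<in> H"
 show "\<exists>!u. (u, f + z *\<^sub>R u) \<in> graph"
  unfolding graph_iff
 proof (rule ex_ex1I)
  show "\<exists>u. u \<in> V & f \<in> H & (\<forall>v\<in>V. qs z u v = inner f v)" using ex[of f] f by auto
 next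
  fix u v
  assume u: "u \<in> V & f \<in> H & (\<forall>v\<in>V. qs z u v = inner f v)"
  and v: "v \<in> V & f \<in> H & (\<forall>w\<in>V. qs z v w = inner f w)"
  have "norm (u - v) <= (1 / (M - z) + (\<Sum>b\<in>B. 1 / \<bar>ev b - z\<bar>)) * norm (0::'a)"
  by (rule bound) (use u v in \<open>auto simp: V_diff qs_diff\<close>)
  then show "u = v" by simp
 qed
 next
 fix p assume p: "p \<in> graph"
 obtain u g where ug: "p = (u, g)" by force
 have "(u, (g - z *\<^sub>R u) + z *\<^sub>R u) \<in> graph" using p ug by simp
 then have "norm u <= (1 / (M - z) + (\<Sum>b\<in>B. 1 / \<bar>ev b - z\<bar>)) * norm (g - z *\<^sub>R u)"
  unfolding graph_iff by (intro bound) auto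
 then show "case p of (u, g) => norm u <= (1 / (M - z) + (\<Sum>b\<in>B. 1 / \<bar>ev b - z\<bar>)) * norm (g - z *\<^sub>R u)"
  using ug by simp
 qed
qed

section \<open>Existence and counting of eigenvalues below a bound\<close>

text \<open>
 Bounded below by \<open>M\<close> up to finitely many linear functionals; this replaces compactness in
 the variational construction of the eigenvalues below \<open>M\<close>.
\<close>

definition essentially_ge :: "real => 'a set => bool" where
 "essentially_ge M F \<longleftrightarrow> finite F &
  (\<exists>C. \<forall>u\<in>V. q u u >= M * inner u u - C * (\<Sum>f\<in>F. (inner u f)^2))"

text \<open>The Rayleigh quotient is minimised on \<open>orth B\<close>. Its infimum
  \<open>l\<close> lies below \<open>M\<close>, and this gap together with the convergence of
  finitely many functionals makes a minimising sequence Cauchy in the form norm.\<close>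

lemma exists_eigenvector:
 assumes ess: "essentially_ge M F" and B: "eigensystem B ev"
 and w: "w \<in> orth B" "q w w < M * inner w w"
 shows "\<exists>b l. l < M & b \<in> orth B & inner b b = 1 & (\<forall>v\<in>V. q b v = l * inner b v)"
proof -
 let ?W = "orth B"
 have WV: "?W \<subseteq> V" by (auto simp: orth_def)
 have fin: "finite F" using ess by (simp add: essentially_ge_def)
 obtain C where C: "!!u. u \<in> V ==> q u u >= M * inner u u - C * (\<Sum>f\<in>F. (inner u f)^2)"
 using ess by (auto simp: essentially_ge_def)
 define S where "S = {u\<in>?W. inner u u = 1}"
 define l where "l = Inf ((%u. q u u) ` S)"
 have bdd: "bdd_below ((%u. q u u) ` S)"
 by (rule bdd_belowI2[of _ "1 - c"]) (use q_bound WV in \<open>fastforce simp: S_def\<close>)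
 have normalize: "(1 / norm u) *\<^sub>R u \<in> S" if "u \<in> ?W" "u ~= 0" for u
 using that subspace_orth[of B] by (auto simp: S_def subspace_scale dot_square_norm power2_eq_square)
 have q_normalize: "q ((1 / norm u) *\<^sub>R u) ((1 / norm u) *\<^sub>R u) = q u u / inner u u" if "u \<in> ?W" for u
 using that WV by (auto simp: q_scale q_scale_right V_scale dot_square_norm power2_eq_square)
 have w0: "w ~= 0" using w q_zero[OF V_zero] by auto
 have ne: "S ~= {}" using normalize[OF w(1) w0] by auto
 have lq: "l <= q u u" if "u \<in> S" for u
 unfolding l_def using that bdd by (intro cInf_lower) auto
 have lM: "l < M"
 proof -
 have "inner w w > 0" using w0 by simp
 then have "q w w / inner w w < M" using w(2) by (simp add: field_simps)
 then show ?thesis using lq[OF normalize[OF w(1) w0]] q_normalize[OF w(1)] by simp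
 qed
 have pos: "0 <= qs l u u" if "u \<in> ?W" for u
 proof (cases "u = 0")
 case True
 then show ?thesis using q_zero[OF V_zero] by (simp add: qs_def)
 next
 case False
 then have "inner u u > 0" by simp
 with lq[OF normalize[OF that False]] q_normalize[OF that] show ?thesis
  by (simp add: qs_def field_simps)
 qed
 have "\<exists>u\<in>S. q u u < l + 1 / real (Suc n)" for n
 proof -
 have "\<exists>x\<in>(%u. q u u) ` S. x < l + 1 / real (Suc n)"
  using ne bdd by (subst cInf_less_iff[symmetric]) (auto simp: l_def)
 then show ?thesis by auto
 qed
 then obtain X where X: "!!n. X n \<in> S" "!!n. q (X n) (X n) < l + 1 / real (Suc n)" by metis
 \<comment> \<open>Along this subsequence the correction term of \<open>essentially_ge\<close> tends
   to zero on differences; this is the place usually taken by a compact embedding.\<close>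
 have "\<exists>r. strict_mono (r :: nat => nat) & (\<forall>f\<in>F. convergent (%n. inner (X (r n)) f))"
 proof (rule bounded_sequences_common_subseq[OF fin, of "%f n. inner (X n) f"])
 fix f
 have "\<bar>inner (X n) f\<bar> <= norm f" for n
  using Cauchy_Schwarz_ineq2[of "X n" f] X(1)[of n] by (simp add: S_def norm_eq_1[symmetric])
 then show "bounded (range (%n. inner (X n) f))"
  by (auto simp: bounded_iff)
 qed
 then obtain r :: "nat => nat" where r: "strict_mono r" "!!f. f \<in> F ==> convergent (%n. inner (X (r n)) f)"
 by blast
 define Y where "Y n = X (r n)" for n
 have YS: "Y n \<in> S" and YW: "Y n \<in> ?W" and YV: "Y n \<in> V" for n
 using X(1) WV by (auto simp: Y_def S_def)
 have Yl: "qs l (Y n) (Y n) < 1 / real (Suc n)" for n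
 proof -
 have "1 / real (Suc (r n)) <= 1 / real (Suc n)"
  using seq_suble[OF r(1), of n] by (intro divide_left_mono) auto
 then show ?thesis using X(2)[of "r n"] YS[of n] by (simp add: qs_def Y_def S_def)
 qed
 \<comment> \<open>Since \<open>l < M\<close>, the essential bound controls the norm, and then the
   form norm, by \<open>qs l\<close> and the correction term.\<close>
 define K where "K = 1 + \<bar>c + l\<bar> / (M - l)"
 have K: "K > 0" using lM by (simp add: K_def add_pos_nonneg)
 have pK: "qs (- c) u u <= K * (qs l u u + \<bar>C\<bar> * (\<Sum>f\<in>F. (inner u f)^2))" if "u \<in> ?W" for u
 proof -
 let ?s = "\<Sum>f\<in>F. (inner u f)^2"
 have s: "0 <= ?s" by (intro sum_nonneg) auto
 have "C * ?s <= \<bar>C\<bar> * ?s" using s by (intro mult_right_mono) auto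
 then have 1: "(M - l) * inner u u <= qs l u u + \<bar>C\<bar> * ?s"
  using C[of u] that WV by (auto simp: qs_def algebra_simps)
 have "(c + l) * inner u u <= \<bar>c + l\<bar> / (M - l) * ((M - l) * inner u u)"
  using lM by (auto intro: mult_right_mono)
 also have "... <= \<bar>c + l\<bar> / (M - l) * (qs l u u + \<bar>C\<bar> * ?s)"
  using lM 1 by (intro mult_left_mono) auto
 finally have "(c + l) * inner u u <= \<bar>c + l\<bar> / (M - l) * (qs l u u + \<bar>C\<bar> * ?s)" .
 moreover have "qs (- c) u u = qs l u u + (c + l) * inner u u" by (simp add: qs_def algebra_simps)
 moreover have "0 <= \<bar>C\<bar> * ?s" using s by simp
 moreover have "K * (qs l u u + \<bar>C\<bar> * ?s)
  = (qs l u u + \<bar>C\<bar> * ?s) + \<bar>c + l\<bar> / (M - l) * (qs l u u + \<bar>C\<bar> * ?s)"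
  unfolding K_def by (simp only: distrib_right mult_1)
 ultimately show ?thesis by linarith
 qed
 have par: "qs l (u - v) (u - v) <= 2 * qs l u u + 2 * qs l v v" if "u \<in> ?W" "v \<in> ?W" for u v
 proof -
 have "u \<in> V" "v \<in> V" using that WV by auto
 moreover have "0 <= qs l (u + v) (u + v)"
  by (rule pos) (use that subspace_orth[of B] in \<open>simp add: subspace_add\<close>)
 ultimately show ?thesis
  by (simp add: qs_add qs_add_right qs_diff qs_diff_right V_add V_diff qs_sym[of v u])
 qed
 have "\<exists>u. converges Y u"
 proof (rule Cauchy_converges)
 fix e :: real assume e: "e > 0"
 \<comment> \<open>The total \<open>K * (2 * e')\<close> equals \<open>e\<close>: one
   \<open>e'\<close> is for \<open>qs l\<close> of a difference, by the parallelogram law, the other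
   for the correction term, for which \<open>d\<close> is chosen.\<close>
 define e' where "e' = e / (2 * K)"
 have e': "e' > 0" using e K by (simp add: e'_def)
 define d where "d = sqrt (e' / ((\<bar>C\<bar> + 1) * (card F + 1)))"
 have D: "(\<bar>C\<bar> + 1) * (real (card F + 1)) ~= 0" by (simp add: add_nonneg_eq_0_iff)
 have d: "d > 0" "d^2 = e' / ((\<bar>C\<bar> + 1) * (card F + 1))" using e' by (auto simp: d_def)
 have "\<forall>f\<in>F. \<exists>N. \<forall>m\<ge>N. \<forall>n\<ge>N. \<bar>inner (Y m) f - inner (Y n) f\<bar> < d"
 proof
  fix f assume "f \<in> F"
  then have "Cauchy (%n. inner (Y n) f)" using r(2)[of f] by (simp add: Y_def Cauchy_convergent_iff)
  then show "\<exists>N. \<forall>m\<ge>N. \<forall>n\<ge>N. \<bar>inner (Y m) f - inner (Y n) f\<bar> < d"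
  using d(1) by (auto simp: Cauchy_def dist_real_def)
 qed
 then obtain N where N: "!!f m n. f \<in> F ==> m >= N f ==> n >= N f ==> \<bar>inner (Y m) f - inner (Y n) f\<bar> < d"
  by metis
 obtain N0 where N0: "4 / e' < real N0" using reals_Archimedean2 by blast
 define N1 where "N1 = Max (insert N0 (N ` F))"
 have N1: "N0 <= N1" "!!f. f \<in> F ==> N f <= N1" using fin by (auto simp: N1_def)
 have "qs (- c) (Y m - Y n) (Y m - Y n) < e" if mn: "m >= N1" "n >= N1" for m n
 proof -
  have W: "Y m - Y n \<in> ?W" using YW subspace_orth[of B] by (simp add: subspace_diff)
  have k: "qs l (Y k) (Y k) < e' / 4" if "k >= N1" for k
  proof -
  have "4 / e' < real (Suc k)" using N0 N1(1) that by linarith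
  then have "1 / real (Suc k) < e' / 4" using e' by (simp add: field_simps)
  with Yl[of k] show ?thesis by simp
  qed
  have 1: "qs l (Y m - Y n) (Y m - Y n) < e'" using par[OF YW YW, of m n] k[OF mn(1)] k[OF mn(2)] by simp
  have "(\<Sum>f\<in>F. (inner (Y m - Y n) f)^2) <= (\<Sum>f\<in>F. d^2)"
  proof (rule sum_mono)
  fix f assume f: "f \<in> F"
  have "\<bar>inner (Y m - Y n) f\<bar> <= \<bar>d\<bar>"
   using N[OF f, of m n] mn N1(2)[OF f] d(1) by (simp add: inner_diff_left)
  then show "(inner (Y m - Y n) f)^2 <= d^2" by (rule abs_le_square_iff[THEN iffD1])
  qed
  also have "... = card F * d^2" by simp
  finally have "\<bar>C\<bar> * (\<Sum>f\<in>F. (inner (Y m - Y n) f)^2) <= \<bar>C\<bar> * (card F * d^2)"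
  by (intro mult_left_mono) auto
  also have "... <= ((\<bar>C\<bar> + 1) * (card F + 1)) * d^2"
  unfolding mult.assoc[symmetric, of "\<bar>C\<bar>"] by (intro mult_right_mono mult_mono) auto
  also have "... = e'" unfolding d(2) by (simp only: times_divide_eq_right nonzero_mult_div_cancel_left[OF D])
  finally have "qs l (Y m - Y n) (Y m - Y n) + \<bar>C\<bar> * (\<Sum>f\<in>F. (inner (Y m - Y n) f)^2) < 2 * e'"
  using 1 by simp
  then have "K * (qs l (Y m - Y n) (Y m - Y n) + \<bar>C\<bar> * (\<Sum>f\<in>F. (inner (Y m - Y n) f)^2)) < K * (2 * e')"
  using K by (rule mult_strict_left_mono)
  also have "... = e" using K by (simp add: e'_def)
  finally show ?thesis using pK[OF W] by linarith
 qed
 then show "\<exists>N. \<forall>m\<ge>N. \<forall>n\<ge>N. qs (- c) (Y m - Y n) (Y m - Y n) < e" by blast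
 qed (rule YV)
 then obtain b where b: "converges Y b" by blast
 have bW: "b \<in> ?W" by (rule orth_closed[OF YW b])
 then have bV: "b \<in> V" using WV by auto
 have "(%n. inner (Y n) (Y n)) ----> inner b b"
 by (intro tendsto_intros converges_tendsto b)
 then have b1: "inner b b = 1" using YS by (simp add: S_def LIMSEQ_const_iff)
 have W: "qs l b v = 0" if v: "v \<in> ?W" for v
 proof -
 have *: "(qs l (Y n) v)^2 <= 1 / real (Suc n) * qs l v v" for n
 proof -
  have "(qs l (Y n) v)^2 <= qs l (Y n) (Y n) * qs l v v"
  by (rule qs_Cauchy_Schwarz[where W = ?W]) (use YW v subspace_orth WV pos in auto)
  also have "... <= 1 / real (Suc n) * qs l v v"
  using Yl[of n] pos[OF v] by (intro mult_right_mono) auto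
  finally show ?thesis .
 qed
 have "(%n. (qs l (Y n) v)^2) ----> 0"
 proof (rule tendsto_sandwich[of "%_. 0", OF _ _ tendsto_const])
  show "(%n. (1 / real (Suc n)) * qs l v v) ----> 0"
  using tendsto_mult_right[OF LIMSEQ_inverse_real_of_nat, of "qs l v v"]
  by (simp add: inverse_eq_divide)
 qed (use * in auto)
 then have "(%n. qs l (Y n) v) ----> 0" by (rule tendsto_zero_square)
 moreover have "(%n. qs l (Y n) v) ----> qs l b v"
  using converges_form[OF b] v WV by auto
 ultimately show ?thesis using LIMSEQ_unique by blast
 qed
 have "q b v = l * inner b v" if v: "v \<in> V" for v
 proof -
 \<comment> \<open>The Euler equation is known for test vectors in \<open>orth B\<close> only; the
   component in \<open>span B\<close> contributes nothing because \<open>b\<close> is orthogonal to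
   it also for the form.\<close>
 have "qs l b v = qs l b (v - proj B v) + qs l b (proj B v)"
  using bV v proj_in_V[OF B, of v] by (simp add: qs_add_right[symmetric] V_diff)
 also have "... = 0"
  using W[OF diff_proj_orth[OF B v]] qs_sum_orth(2)[OF B bW] by (simp add: proj_def)
 finally show ?thesis by (simp add: qs_def)
 qed
 with lM bW b1 show ?thesis by blast
qed

lemma eigensystem_combination:
 assumes "eigensystem B ev"
 shows "inner (\<Sum>b\<in>B. x b *\<^sub>R b) (\<Sum>b\<in>B. x b *\<^sub>R b) = (\<Sum>b\<in>B. (x b)^2)"
 and "q (\<Sum>b\<in>B. x b *\<^sub>R b) (\<Sum>b\<in>B. x b *\<^sub>R b) = (\<Sum>b\<in>B. ev b * (x b)^2)"
proof -
 let ?u = "\<Sum>b\<in>B. x b *\<^sub>R b"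
 have BV: "!!b. b \<in> B ==> b \<in> V" using eigensystem_in_V[OF assms] .
 have uV: "?u \<in> V" using BV by (intro V_sum V_scale)
 have "inner ?u ?u = (\<Sum>b\<in>B. x b * inner ?u b)" by (simp add: inner_sum_right)
 also have "... = (\<Sum>b\<in>B. (x b)^2)"
 by (intro sum.cong) (auto simp: inner_eigensystem_sum[OF assms] power2_eq_square)
 finally show "inner ?u ?u = (\<Sum>b\<in>B. (x b)^2)" .
 have "q ?u ?u = (\<Sum>b\<in>B. x b * q b ?u)" using BV uV by (simp add: q_sum V_scale q_scale)
 also have "... = (\<Sum>b\<in>B. ev b * (x b)^2)"
 proof (rule sum.cong)
 fix b assume b: "b \<in> B"
 then have "q b ?u = ev b * inner ?u b"
  using assms uV by (auto simp: eigensystem_def inner_commute)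
 then show "x b * q b ?u = ev b * (x b)^2"
  by (simp add: inner_eigensystem_sum[OF assms b] power2_eq_square)
 qed simp
 finally show "q ?u ?u = (\<Sum>b\<in>B. ev b * (x b)^2)" .
qed

text \<open>With more eigenvectors than functionals, some nonzero combination is annihilated by all
  functionals; its Rayleigh quotient would be at least \<open>M\<close> and below \<open>M\<close>
  at once.\<close>

lemma card_eigensystem_le:
 assumes ess: "essentially_ge M F" and B: "eigensystem B ev" "!!b. b \<in> B ==> ev b < M"
 shows "card B <= card F"
proof (rule ccontr)
 assume "\<not> card B <= card F"
 moreover have "finite B" "finite F" using B ess by (auto simp: eigensystem_def essentially_ge_def)
 ultimately obtain x where x: "\<exists>b\<in>B. x b ~= 0" "!!f. f \<in> F ==> (\<Sum>b\<in>B. x b * inner b f) = 0"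
 using exists_kernel_vector[of F B "%f b. inner b f"] by auto
 obtain C where C: "!!u. u \<in> V ==> q u u >= M * inner u u - C * (\<Sum>f\<in>F. (inner u f)^2)"
 using ess by (auto simp: essentially_ge_def)
 let ?u = "\<Sum>b\<in>B. x b *\<^sub>R b"
 have "?u \<in> V" using eigensystem_in_V[OF B(1)] by (intro V_sum V_scale)
 moreover have "inner ?u f = 0" if "f \<in> F" for f using x(2)[OF that] by (simp add: inner_sum_left)
 ultimately have "M * inner ?u ?u <= q ?u ?u" using C[of ?u] by simp
 then have "(\<Sum>b\<in>B. M * (x b)^2) <= (\<Sum>b\<in>B. ev b * (x b)^2)"
 by (simp add: eigensystem_combination[OF B(1)] sum_distrib_left)
 moreover have "(\<Sum>b\<in>B. ev b * (x b)^2) < (\<Sum>b\<in>B. M * (x b)^2)"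
 proof (rule sum_strict_mono_ex1)
 show "\<forall>b\<in>B. ev b * (x b)^2 <= M * (x b)^2"
  using B(2) by (auto intro: mult_right_mono simp: less_imp_le)
 obtain b where "b \<in> B" "x b ~= 0" using x(1) by blast
 then have "ev b * (x b)^2 < M * (x b)^2" using B(2)[of b] by (intro mult_strict_right_mono) auto
 with \<open>b \<in> B\<close> show "\<exists>b\<in>B. ev b * (x b)^2 < M * (x b)^2" by blast
 qed (rule \<open>finite B\<close>)
 ultimately show False by simp
qed

text \<open>A system of maximal cardinality does it: if the bound failed on its orthogonal
  complement, one more eigenvector could be added.\<close>

lemma exists_eigensystem:
 assumes ess: "essentially_ge M F"
 shows "\<exists>B ev. eigensystem B ev & (\<forall>b\<in>B. ev b < M) & (\<forall>u\<in>orth B. M * inner u u <= q u u)"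
proof -
 define N where "N = {card B |B ev. eigensystem B ev & (\<forall>b\<in>B. ev b < M)}"
 have "N \<subseteq> {..card F}" using card_eigensystem_le[OF ess] by (auto simp: N_def)
 then have finN: "finite N" using finite_subset by blast
 have "eigensystem {} (%_. 0)" by (simp add: eigensystem_def)
 then have "N ~= {}" by (auto simp: N_def)
 then have "Max N \<in> N" using finN by simp
 then obtain B ev where B: "eigensystem B ev" "\<forall>b\<in>B. ev b < M" "card B = Max N" by (auto simp: N_def)
 have "M * inner u u <= q u u" if u: "u \<in> orth B" for u
 proof (rule ccontr)
 assume "\<not> M * inner u u <= q u u"
 then have "q u u < M * inner u u" by simp
 from exists_eigenvector[OF ess B(1) u this]
 obtain b l where b: "l < M" "b \<in> orth B" "inner b b = 1" "\<forall>v\<in>V. q b v = l * inner b v" by blast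
 have nb: "b \<notin> B" using b(2,3) by (auto simp: orth_def)
 have "eigensystem (insert b B) (ev(b := l))"
  using B(1) b nb by (auto simp: eigensystem_def orth_def inner_commute)
 moreover have "\<forall>a\<in>insert b B. (ev(b := l)) a < M" using B(2) b(1) by auto
 ultimately have "card (insert b B) \<in> N" unfolding N_def by blast
 then have "card (insert b B) <= Max N" using finN by simp
 then show False using B nb by (simp add: eigensystem_def)
 qed
 with B show ?thesis by blast
qed

lemma eigenspace_eq:
 assumes B: "eigensystem B ev" and M: "!!u. u \<in> orth B ==> M * inner u u <= q u u" and z: "z < M"
 shows "eigenspace graph z = span {b\<in>B. ev b = z}"
proof
 show "eigenspace graph z \<subseteq> span {b\<in>B. ev b = z}"
 proof
 fix u assume "u \<in> eigenspace graph z"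
 then have "(u, 0 + z *\<^sub>R u) \<in> graph" by (simp add: eigenspace_def)
 then have u: "u \<in> V" "!!v. v \<in> V ==> qs z u v = inner 0 v" unfolding graph_iff by auto
 have "norm (u - proj B u) <= norm (0::'a) / (M - z)"
  by (rule solution_bounds(1)[OF B M z u])
 then have "u = proj B u" by simp
 moreover have "inner u b *\<^sub>R b \<in> span {b\<in>B. ev b = z}" if b: "b \<in> B" for b
 proof (cases "ev b = z")
  case True
  then show ?thesis using b by (intro span_scale span_base) auto
 next
  case False
  then have "inner u b = 0" using solution_bounds(2)[OF B M z u b] by simp
  then show ?thesis by (simp add: span_zero)
 qed
 ultimately show "u \<in> span {b\<in>B. ev b = z}" unfolding proj_def by (metis (no_types, lifting) span_sum)
 qed
next
 have H: "z *\<^sub>R x + z *\<^sub>R y \<in> H" "(s * z) *\<^sub>R x \<in> H" "0 \<in> H"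
 if "z *\<^sub>R x \<in> H" "z *\<^sub>R y \<in> H" for x y s
 using subspace_add[OF subspace_H that] subspace_scale[OF subspace_H that(1), of s]
  subspace_0[OF subspace_H] by simp_all
 have "subspace (eigenspace graph z)"
 unfolding eigenspace_def subspace_def
 by (auto simp: graph_def q_add q_scale inner_add_left scaleR_add_right q_zero V_zero V_add V_scale
  subspace_0[OF subspace_H] distrib_left H(1))
  (metis H(2) mult.commute)
 moreover have "{b\<in>B. ev b = z} \<subseteq> eigenspace graph z"
 using B V_subset subspace_H by (auto simp: eigenspace_def graph_def eigensystem_def subspace_scale)
 ultimately show "span {b\<in>B. ev b = z} \<subseteq> eigenspace graph z" by (rule span_minimal[rotated])
qed

lemma eigensystem_independent: "eigensystem B ev ==> independent B"
 by (rule pairwise_orthogonal_independent)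
 (force simp: eigensystem_def pairwise_def orthogonal_def)+

text \<open>Below \<open>M\<close> the spectrum consists of the finitely many values of
  \<open>ev\<close>, so all its points are isolated, and a multiplicity is the number of vectors in
  \<open>B\<close> that carry the value.\<close>

lemma spectrum_below:
 assumes B: "eigensystem B ev" and M: "!!u. u \<in> orth B ==> M * inner u u <= q u u"
 and ev: "!!b. b \<in> B ==> ev b < M"
 shows "discrete_spectrum H graph \<inter> {..<M} = ev ` B"
 and "Y \<subseteq> {..<M} ==> multiplicity_sum graph (discrete_spectrum H graph \<inter> Y) = card {b\<in>B. ev b \<in> Y}"
proof -
 have fin: "finite B" using B by (simp add: eigensystem_def)
 have not_res: "z \<notin> resolvent_set H graph" if z: "z \<in> ev ` B" for z
 proof
 obtain b where b: "b \<in> B" "ev b = z" using z by auto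
 assume "z \<in> resolvent_set H graph"
 then have "\<exists>!u. (u, 0 + z *\<^sub>R u) \<in> graph"
  using subspace_0[OF subspace_H] unfolding resolvent_set_def by blast
 moreover have "(0, 0 + z *\<^sub>R 0) \<in> graph" unfolding graph_iff
  using V_zero subspace_H by (auto simp: qs_def q_zero subspace_0)
 moreover have "(b, 0 + z *\<^sub>R b) \<in> graph" unfolding graph_iff
  using b eigensystem_in_V[OF B] subspace_H eigensystem_qs[OF B] by (auto simp: subspace_0)
 ultimately have "b = 0" by blast
 moreover have "inner b b = 1" using B b unfolding eigensystem_def by simp
 ultimately show False by simp
 qed
 have spec: "spectrum H graph \<inter> {..<M} = ev ` B"
 using not_res ev resolvent_setI[OF B M] by (fastforce simp: spectrum_def)
 have "z \<in> discrete_spectrum H graph" if z: "z \<in> ev ` B" for z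
 proof -
 have zM: "z < M" using z ev by auto
 obtain b where b: "b \<in> B" "ev b = z" using z by auto
 have "open ({..<M} - (ev ` B - {z}))"
  using fin by (intro open_Diff finite_imp_closed) auto
 moreover have "({..<M} - (ev ` B - {z})) \<inter> spectrum H graph = {z}" using spec z zM by auto
 ultimately have "z isolated_in spectrum H graph" using spec z by (auto simp: isolated_in_def)
 moreover have es: "eigenspace graph z = span {b\<in>B. ev b = z}"
  by (rule eigenspace_eq[OF B M zM])
 moreover have "b \<in> eigenspace graph z" unfolding es using b by (intro span_base) auto
 moreover have "inner b b = 1" using B b unfolding eigensystem_def by simp
 then have "b ~= 0" by auto
 ultimately show ?thesis
  unfolding discrete_spectrum_def using fin
  by (auto intro!: exI[of _ "{b \<in> B. ev b = z}"])
 qed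
 then show 1: "discrete_spectrum H graph \<inter> {..<M} = ev ` B"
 using spec ev by (auto simp: discrete_spectrum_def isolated_in_def)
 assume Y: "Y \<subseteq> {..<M}"
 have "discrete_spectrum H graph \<inter> Y = ev ` {b\<in>B. ev b \<in> Y}" using 1 Y by auto
 then have "multiplicity_sum graph (discrete_spectrum H graph \<inter> Y)
  = (\<Sum>z\<in>ev ` {b\<in>B. ev b \<in> Y}. dim (eigenspace graph z))"
 by (simp add: multiplicity_sum_def)
 also have "... = (\<Sum>z\<in>ev ` {b\<in>B. ev b \<in> Y}. card {b\<in>{b\<in>B. ev b \<in> Y}. ev b = z})"
 proof (rule sum.cong)
 fix z assume z: "z \<in> ev ` {b\<in>B. ev b \<in> Y}"
 then have zM: "z < M" using Y by auto
 have "independent {b\<in>B. ev b = z}"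
  by (rule independent_mono[OF eigensystem_independent[OF B]]) auto
 then have "dim (eigenspace graph z) = card {b\<in>B. ev b = z}"
  using eigenspace_eq[OF B M zM] dim_span_eq_card_independent by simp
 also have "{b\<in>B. ev b = z} = {b\<in>{b\<in>B. ev b \<in> Y}. ev b = z}" using z by auto
 finally show "dim (eigenspace graph z) = card {b\<in>{b\<in>B. ev b \<in> Y}. ev b = z}" .
 qed simp
 also have "... = card {b\<in>B. ev b \<in> Y}"
 using fin sum.image_gen[of "{b\<in>B. ev b \<in> Y}" "%_. 1 :: nat" ev] by simp
 finally show "multiplicity_sum graph (discrete_spectrum H graph \<inter> Y) = card {b\<in>B. ev b \<in> Y}" .
qed

text \<open>The three groups of hypotheses have separate tasks: \<open>all\<close> makes the
  spectrum below any level finite, the orthonormal set \<open>U\<close> guarantees \<open>n\<close>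
  eigenvalues below some level, and \<open>low\<close> with fewer than \<open>n\<close> functionals
  keeps the \<open>n\<close>-th one above \<open>L\<close>.\<close>

theorem exists_nth_eigenvalue_ge:
 assumes low: "essentially_ge L F0" "card F0 < n"
 and all: "!!M. \<exists>F. essentially_ge M F"
 and U: "finite U" "card U = n" "U \<subseteq> V" "\<forall>u\<in>U. \<forall>v\<in>U. inner u v = (if u = v then 1 else 0)"
 shows "\<exists>E\<ge>L. nth_discrete_eigenvalue H graph n E"
proof -
 \<comment> \<open>The double sum bounds the form on unit vectors of \<open>span U\<close>; adding 1
   makes the comparison strict.\<close>
 define M where "M = (\<Sum>u\<in>U. \<Sum>v\<in>U. \<bar>q u v\<bar>) + 1"
 obtain F where "essentially_ge M F" using all by blast
 from exists_eigensystem[OF this] obtain B ev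
 where B: "eigensystem B ev" "!!b. b \<in> B ==> ev b < M" "!!u. u \<in> orth B ==> M * inner u u <= q u u"
 by blast
 have fin: "finite B" using B by (simp add: eigensystem_def)
 have nB: "n <= card B"
 proof (rule ccontr)
 assume "\<not> n <= card B"
 then obtain x where x: "\<exists>u\<in>U. x u ~= 0" "!!b. b \<in> B ==> (\<Sum>u\<in>U. x u * inner u b) = 0"
  using exists_kernel_vector[of B U "%b u. inner u b"] U(1,2) fin unfolding not_le by blast
 let ?u = "\<Sum>u\<in>U. x u *\<^sub>R u"
 let ?s = "\<Sum>u\<in>U. (x u)^2"
 have uV: "?u \<in> V" using U by (intro V_sum V_scale) auto
 then have "?u \<in> orth B" using x(2) by (auto simp: orth_def inner_sum_left)
 then have 1: "M * inner ?u ?u <= q ?u ?u" by (rule B(3))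
 have "inner ?u ?u = (\<Sum>u\<in>U. \<Sum>v\<in>U. x u * (x v * inner u v))"
  by (simp add: inner_sum_left inner_sum_right sum_distrib_left inner_commute mult.left_commute)
 also have "... = (\<Sum>u\<in>U. \<Sum>v\<in>U. if u = v then (x u)\<^sup>2 else 0)"
  using U(4) by (intro sum.cong) (auto simp: power2_eq_square)
 also have "... = ?s" using U(1) by simp
 finally have 2: "inner ?u ?u = ?s" .
 obtain u0 where "u0 \<in> U" "x u0 ~= 0" using x(1) by blast
 then have s: "?s > 0" using U(1) by (intro sum_pos2[of U u0]) auto
 have xs: "\<bar>x u * x v\<bar> <= ?s" if "u \<in> U" "v \<in> U" for u v
 proof -
  have "(x u)^2 <= ?s" "(x v)^2 <= ?s"
  using that U(1) by (auto intro: member_le_sum)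
  moreover have "2 * \<bar>x u * x v\<bar> <= (x u)^2 + (x v)^2"
  using sum_squares_bound[of "\<bar>x u\<bar>" "\<bar>x v\<bar>"] by (simp add: abs_mult)
  ultimately show ?thesis by linarith
 qed
 have "q ?u ?u = (\<Sum>u\<in>U. \<Sum>v\<in>U. x u * x v * q u v)"
 proof -
  have "q ?u ?u = (\<Sum>u\<in>U. x u * q u ?u)"
  using uV U(3) by (simp add: q_sum V_scale q_scale subset_iff)
  also have "... = (\<Sum>u\<in>U. x u * (\<Sum>v\<in>U. x v * q u v))"
  using U(3) by (intro sum.cong) (auto simp: q_sum_right V_scale q_scale_right subset_iff)
  finally show ?thesis by (simp add: sum_distrib_left mult.assoc)
 qed
 also have "... <= (\<Sum>u\<in>U. \<Sum>v\<in>U. ?s * \<bar>q u v\<bar>)"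
 proof (intro sum_mono)
  fix u v assume uv: "u \<in> U" "v \<in> U"
  have "x u * x v * q u v <= \<bar>x u * x v\<bar> * \<bar>q u v\<bar>" by (metis abs_ge_self abs_mult)
  also have "... <= ?s * \<bar>q u v\<bar>" using xs[OF uv] by (intro mult_right_mono) auto
  finally show "x u * x v * q u v <= ?s * \<bar>q u v\<bar>" .
 qed
 also have "... = ?s * (M - 1)" by (simp add: M_def sum_distrib_left)
 also have "... < M * ?s" using s by (simp add: algebra_simps)
 finally show False using 1 2 by simp
 qed
 \<comment> \<open>The eigenvalues up to which at least \<open>n\<close> vectors are counted; the
   least of them is the \<open>n\<close>-th eigenvalue with multiplicities.\<close>
 define Z where "Z = {z\<in>ev ` B. n <= card {b\<in>B. ev b <= z}}"
 have finZ: "finite Z" using fin by (simp add: Z_def)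
 have Bne: "B ~= {}" using nB low(2) by auto
 have "Max (ev ` B) \<in> Z"
 proof -
 have "{b\<in>B. ev b <= Max (ev ` B)} = B" using fin by auto
 then show ?thesis using nB fin Bne by (auto simp: Z_def)
 qed
 then have Zne: "Z ~= {}" by auto
 define E where "E = Min Z"
 have EZ: "E \<in> Z" unfolding E_def using finZ Zne by (rule Min_in)
 then have E: "E \<in> ev ` B" "n <= card {b\<in>B. ev b <= E}" by (auto simp: Z_def)
 then have EM: "E < M" using B(2) by auto
 have less: "card {b\<in>B. ev b < E} < n"
 proof (rule ccontr)
 assume n: "\<not> card {b\<in>B. ev b < E} < n"
 then have ne: "{b\<in>B. ev b < E} ~= {}" using low(2) by (metis card.empty not_less_zero gr_implies_not0 gr0I)
 define z where "z = Max (ev ` {b\<in>B. ev b < E})"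
 have zin: "z \<in> ev ` {b\<in>B. ev b < E}" unfolding z_def using fin ne by (intro Max_in) auto
 have zub: "ev b <= z" if "b \<in> B" "ev b < E" for b
  unfolding z_def using fin that by (intro Max_ge) auto
 have "{b\<in>B. ev b < E} = {b\<in>B. ev b <= z}" using zin zub by fastforce
 then have "z \<in> Z" using n zin by (auto simp: Z_def)
 then have "E <= z" unfolding E_def using finZ by (intro Min_le)
 then show False using zin by auto
 qed
 have "nth_discrete_eigenvalue H graph n E"
 unfolding nth_discrete_eigenvalue_def
 proof (intro conjI)
 note sp = spectrum_below[OF B(1) B(3) B(2)]
 show "E \<in> discrete_spectrum H graph" using sp(1) E(1) by auto
 have "discrete_spectrum H graph \<inter> {..E} \<subseteq> ev ` B" using sp(1) EM by auto
 then show "finite (discrete_spectrum H graph \<inter> {..E})" using fin finite_subset by blast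
 show "multiplicity_sum graph (discrete_spectrum H graph \<inter> {..<E}) < n"
  using sp(2)[of "{..<E}"] EM less by auto
 have "{..E} \<subseteq> {..<M}" using EM by auto
 then show "n <= multiplicity_sum graph (discrete_spectrum H graph \<inter> {..E})"
  using sp(2)[of "{..E}"] E(2) by simp
 qed
 \<comment> \<open>Otherwise at least \<open>n\<close> eigenvectors would belong to values below
   \<open>L\<close>, more than there are functionals in \<open>F0\<close>.\<close>
 moreover have "L <= E"
 proof (rule ccontr)
 assume "\<not> L <= E"
 then have EL: "E < L" by simp
 have "eigensystem {b\<in>B. ev b <= E} ev" using B(1) by (auto simp: eigensystem_def)
 from card_eigensystem_le[OF low(1) this] EL E(2) low(2) show False by auto
 qed
 ultimately show ?thesis by blast
qed

text \<open>One functional permits at most one eigenvalue below \<open>M\<close>, the trial vector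
  \<open>w\<close> forces one, and at or above \<open>M\<close> every point is an accumulation point
  of the spectrum, hence not discrete.\<close>

theorem multiplicity_sum_eq_1:
 assumes ess: "essentially_ge M {f}" and w: "w \<in> V" "q w w < M * inner w w"
 and spec: "{M..} \<subseteq> spectrum H graph"
 shows "multiplicity_sum graph (discrete_spectrum H graph) = 1"
proof -
 from exists_eigensystem[OF ess] obtain B ev
 where B: "eigensystem B ev" "!!b. b \<in> B ==> ev b < M" "!!u. u \<in> orth B ==> M * inner u u <= q u u"
 by blast
 have "B ~= {}" using B(3)[of w] w by (auto simp: orth_def)
 moreover have "finite B" using B by (simp add: eigensystem_def)
 moreover have "card B <= 1" using card_eigensystem_le[OF ess B(1,2)] by simp
 ultimately have "card B = 1" by (metis card_0_eq le_antisym less_one not_le)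
 have "\<not> z isolated_in spectrum H graph" if "z >= M" for z
 proof -
 have "z islimpt {z..z+1}" by (rule islimpt_Icc[THEN iffD2]) auto
 then have "z islimpt spectrum H graph"
  by (rule islimpt_subset) (use spec that in auto)
 then show ?thesis by (simp add: isolated_in_islimpt_iff)
 qed
 then have "discrete_spectrum H graph = discrete_spectrum H graph \<inter> {..<M}"
 by (auto simp: discrete_spectrum_def not_le[symmetric])
 then have "multiplicity_sum graph (discrete_spectrum H graph) = card {b\<in>B. ev b \<in> {..<M}}"
 using spectrum_below(2)[OF B(1) B(3) B(2), of "{..<M}"] by simp
 also have "{b\<in>B. ev b \<in> {..<M}} = B" using B(2) by auto
 finally show ?thesis using \<open>card B = 1\<close> by simp
qed

text \<open>Weyl's criterion in weak form: the defect is measured against the form norm of the test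
  vector, so approximate eigenvectors need only lie in the form domain. If \<open>w\<close> is the
  resolvent applied to \<open>u\<close>, symmetry gives \<open>(norm u)^2 = qs z u w\<close>, and
  the form norm of \<open>w\<close> is at most \<open>sqrt K1 * norm u\<close>.\<close>

lemma resolvent_set_lower_bound:
 assumes "z \<in> resolvent_set H graph"
 shows "\<exists>K. \<forall>u\<in>V. \<forall>e\<ge>0. (\<forall>v\<in>V. \<bar>qs z u v\<bar> <= e * sqrt (qs (- c) v v)) \<longrightarrow> norm u <= K * e"
proof -
 obtain K0 where K0: "\<forall>(u, g)\<in>graph. norm u <= K0 * norm (g - z *\<^sub>R u)"
 and ex: "!!f. f \<in> H ==> \<exists>!u. (u, f + z *\<^sub>R u) \<in> graph"
 using assms unfolding resolvent_set_def by blast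
 define K1 where "K1 = \<bar>K0\<bar> + \<bar>c + z\<bar> * K0^2"
 show ?thesis
 proof (intro exI[of _ "sqrt K1"] ballI allI impI)
 fix u and e :: real assume u: "u \<in> V" and e0: "0 <= e" and e: "\<forall>v\<in>V. \<bar>qs z u v\<bar> <= e * sqrt (qs (- c) v v)"
 obtain w where w: "(w, u + z *\<^sub>R w) \<in> graph" using ex[of u] u V_subset by auto
 have wu: "norm w <= \<bar>K0\<bar> * norm u"
 proof -
  have "norm w <= K0 * norm u" using K0 w by force
  also have "... <= \<bar>K0\<bar> * norm u" by (intro mult_right_mono) auto
  finally show ?thesis .
 qed
 have w': "w \<in> V" "!!v. v \<in> V ==> qs z w v = inner u v" using w unfolding graph_iff by auto
 have "qs (- c) w w = inner u w + (c + z) * inner w w"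
  using w'(2)[OF w'(1)] by (simp add: qs_def algebra_simps)
 also have "... <= norm u * norm w + \<bar>c + z\<bar> * (norm w)^2"
  using norm_cauchy_schwarz[of u w]
  by (intro add_mono) (auto simp: power2_norm_eq_inner intro: mult_right_mono)
 also have "... <= norm u * (\<bar>K0\<bar> * norm u) + \<bar>c + z\<bar> * (\<bar>K0\<bar> * norm u)^2"
  using wu by (intro add_mono mult_left_mono power_mono) auto
 also have "... = K1 * (norm u)^2"
  by (simp add: K1_def power_mult_distrib algebra_simps power2_eq_square)
 finally have p: "sqrt (qs (- c) w w) <= sqrt K1 * norm u"
  using real_sqrt_le_mono[of "qs (- c) w w" "K1 * (norm u)^2"] by (simp add: real_sqrt_mult)
 have K1: "K1 >= 0" by (simp add: K1_def)
 have "(norm u)^2 = qs z u w"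
  using w' u qs_sym[of w u z] by (simp add: power2_norm_eq_inner)
 also have "... <= e * sqrt (qs (- c) w w)" using e w'(1) by (metis abs_le_D1)
 finally have *: "(norm u)^2 <= e * sqrt (qs (- c) w w)" .
 show "norm u <= sqrt K1 * e"
 proof (cases "norm u = 0")
  case False
  have "e * sqrt (qs (- c) w w) <= e * (sqrt K1 * norm u)"
  using p e0 by (intro mult_left_mono)
  with * have "norm u * norm u <= sqrt K1 * e * norm u" by (simp add: power2_eq_square mult_ac)
  then show ?thesis using False by (auto dest!: mult_right_le_imp_le)
 next
  case True
  with e0 K1 show ?thesis by simp
 qed
 qed
qed

end

section \<open>Square integrable functions\<close>

lemma square_integrableD:
 assumes "sqint M f"
 shows "f \<in> borel_measurable M" "integrable M (%x. (f x)^2)"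
 using assms by (auto simp: square_integrable_def)

lemma square_integrable_diff:
 assumes "sqint M f" "sqint M g"
 shows "sqint M (%x. f x - g x)"
 using square_integrable_add[OF assms(1) square_integrable_cmult[OF assms(2), of "-1"]] by simp

lemma square_integrable_bounded_mult:
 assumes f: "sqint M f" and g: "g \<in> borel_measurable M" "!!x. \<bar>g x\<bar> <= B"
 shows "sqint M (%x. g x * f x)"
 unfolding square_integrable_def
proof
 note [measurable] = g(1) square_integrableD(1)[OF f]
 show "(%x. g x * f x) \<in> borel_measurable M" by measurable
 show "integrable M (%x. (g x * f x)^2)"
 proof (rule Bochner_Integration.integrable_bound)
 show "integrable M (%x. B^2 * (f x)^2)" using square_integrableD(2)[OF f] by simp
 show "AE x in M. norm ((g x * f x)^2) <= norm (B^2 * (f x)^2)"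
 proof (rule AE_I2)
  fix x
  have "\<bar>g x\<bar>\<^sup>2 <= B^2" using g(2)[of x] by (intro power_mono) auto
  then show "norm ((g x * f x)^2) <= norm (B^2 * (f x)^2)"
  by (auto simp: power_mult_distrib intro: mult_right_mono)
 qed
 qed measurable
qed

lemma square_integrable_indicator:
 "sqint M f ==> S \<in> sets M ==> sqint M (%x. ind S x * f x)"
 by (rule square_integrable_bounded_mult[where B = 1]) (auto simp: indicator_def)

lemma square_integral_triangle:
 assumes "sqint M f" "sqint M g" "sqint M h"
 shows "(\<integral>x. (f x - h x)^2 \<partial>M) <= 2 * (\<integral>x. (f x - g x)^2 \<partial>M) + 2 * (\<integral>x. (g x - h x)^2 \<partial>M)"
proof -
 note I = square_integrableD(2)[OF square_integrable_diff]
 have "(\<integral>x. (f x - h x)^2 \<partial>M) <= (\<integral>x. 2 * (f x - g x)^2 + 2 * (g x - h x)^2 \<partial>M)"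
 proof (intro integral_mono Bochner_Integration.integrable_add integrable_mult_right I assms)
 fix x
 have "0 <= ((f x - g x) - (g x - h x))^2" by simp
 then show "(f x - h x)^2 <= 2 * (f x - g x)^2 + 2 * (g x - h x)^2"
  by (simp add: power2_eq_square algebra_simps)
 qed
 also have "... = 2 * (\<integral>x. (f x - g x)^2 \<partial>M) + 2 * (\<integral>x. (g x - h x)^2 \<partial>M)"
 using I[OF assms(1,2)] I[OF assms(2,3)] by simp
 finally show ?thesis .
qed

lemma square_integrable_Cauchy_Schwarz:
 assumes "sqint M f" "sqint M g"
 shows "(\<integral>x. f x * g x \<partial>M)^2 <= (\<integral>x. (f x)^2 \<partial>M) * (\<integral>x. (g x)^2 \<partial>M)"
proof -
 note I = square_integrableD(2)[OF assms(1)] square_integrableD(2)[OF assms(2)]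
 square_integrable_mult_integrable[OF assms]
 let ?a = "\<integral>x. (f x)^2 \<partial>M" and ?b = "\<integral>x. f x * g x \<partial>M" and ?c = "\<integral>x. (g x)^2 \<partial>M"
 have *: "0 <= s^2 * ?a + 2 * s * t * ?b + t^2 * ?c" for s t
 proof -
 have "0 <= (\<integral>x. (s * f x + t * g x)^2 \<partial>M)" by simp
 also have "(%x. (s * f x + t * g x)^2) = (%x. s^2 * (f x)^2 + (2 * s * t) * (f x * g x) + t^2 * (g x)^2)"
  by (auto simp: power2_eq_square algebra_simps)
 also have "(\<integral>x. s^2 * (f x)^2 + (2 * s * t) * (f x * g x) + t^2 * (g x)^2 \<partial>M)
  = s^2 * ?a + 2 * s * t * ?b + t^2 * ?c"
  using I by simp
 finally show ?thesis .
 qed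
 have "?a >= 0" "?c >= 0" by simp_all
 show ?thesis
 proof (cases "?c = 0")
 case False
 then have c: "?c > 0" using \<open>?c >= 0\<close> by linarith
 have "0 <= ?c^2 * ?a + 2 * ?c * (- ?b) * ?b + (- ?b)^2 * ?c" by (rule *)
 also have "... = ?c * (?a * ?c - ?b^2)" by (simp add: power2_eq_square algebra_simps)
 finally show ?thesis using c by (simp add: zero_le_mult_iff)
 next
 case True
 have "?b = 0"
 proof (rule ccontr)
  assume b: "?b ~= 0"
  have "0 <= 1^2 * ?a + 2 * 1 * (- (?a + 1) / (2 * ?b)) * ?b + (- (?a + 1) / (2 * ?b))^2 * ?c" by (rule *)
  also have "... = -1" using b True by (simp add: field_simps)
  finally show False by simp
 qed
 then show ?thesis using True by simp
 qed
qed

lemma nn_integral_square: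
 "integrable M (%x. (f x :: real)^2) ==> (\<integral>\<^sup>+x. ennreal ((f x)^2) \<partial>M) = ennreal (\<integral>x. (f x)^2 \<partial>M)"
 by (rule nn_integral_eq_integral) auto

text \<open>Kept general in the measure since it serves twice: for completeness of \<open>l2\<close>
  and for the construction of traces on the boundary.\<close>

theorem Riesz_Fischer:
 assumes f: "!!n. sqint M (f n)"
 and Cauchy: "!!e. e > 0 ==> \<exists>N. \<forall>m\<ge>N. \<forall>n\<ge>N. (\<integral>x. (f m x - f n x)^2 \<partial>M) < e"
 shows "\<exists>g. sqint M g & (%n. \<integral>x. (f n x - g x)^2 \<partial>M) ----> 0"
proof -
 note [measurable] = square_integrableD(1)[OF f]
 have I: "integrable M (%x. (f m x - f n x)^2)" for m n
 by (rule square_integrableD(2)[OF square_integrable_diff[OF f f]])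
 \<comment> \<open>The rate \<open>(1/8)^k\<close> leaves room for the weight \<open>4^k\<close>:
   the weighted squares of the increments have a summable integral, so almost everywhere the
   increments are eventually below \<open>(1/2)^k\<close>.\<close>
 have "\<exists>r. \<forall>k. (\<forall>m\<ge>r k. \<forall>n\<ge>r k. (\<integral>x. (f m x - f n x)^2 \<partial>M) < (1/8)^k) & r k < r (Suc k)"
 proof (intro dependent_nat_choice, goal_cases)
 case 1
 show ?case using Cauchy[of "(1/8)^0"] by simp
 next
 case (2 x k)
 obtain N where N: "\<forall>m\<ge>N. \<forall>n\<ge>N. (\<integral>x. (f m x - f n x)^2 \<partial>M) < (1/8)^Suc k"
  using Cauchy[of "(1/8)^Suc k"] by auto
 then show ?case by (intro exI[of _ "max N (Suc x)"]) auto
 qed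
 then obtain r where r: "!!k m n. m >= r k ==> n >= r k ==> (\<integral>x. (f m x - f n x)^2 \<partial>M) < (1/8)^k"
 and r_less: "!!k. r k < r (Suc k)" by metis
 have mono: "strict_mono r" using r_less by (simp add: strict_mono_Suc_iff)
 define d where "d k x = f (r (Suc k)) x - f (r k) x" for k x
 have [measurable]: "d k \<in> borel_measurable M" for k unfolding d_def by measurable
 have "(\<integral>\<^sup>+x. (\<Sum>k. ennreal (4^k * (d k x)^2)) \<partial>M) = (\<Sum>k. \<integral>\<^sup>+x. ennreal (4^k * (d k x)^2) \<partial>M)"
 by (rule nn_integral_suminf) measurable
 also have "... <= (\<Sum>k. ennreal ((1/2)^k))"
 proof (rule suminf_le)
 fix k
 have "(\<integral>\<^sup>+x. ennreal (4^k * (d k x)^2) \<partial>M) = ennreal (4^k * (\<integral>x. (d k x)^2 \<partial>M))"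
  using I[of "r (Suc k)" "r k"]
  by (subst nn_integral_eq_integral) (auto simp: d_def)
 also have "... <= ennreal (4^k * (1/8)^k)"
  using r[of k "r (Suc k)" "r k"] r_less[of k] unfolding d_def
  by (intro ennreal_leI mult_left_mono) auto
 also have "4^k * (1/8)^k = ((1/2)^k :: real)" by (simp flip: power_mult_distrib)
 finally show "(\<integral>\<^sup>+x. ennreal (4^k * (d k x)^2) \<partial>M) <= ennreal ((1/2)^k)" .
 qed auto
 also have "... < \<infinity>" by (subst suminf_ennreal2) (auto intro: summable_geometric)
 finally have "AE x in M. (\<Sum>k. ennreal (4^k * (d k x)^2)) ~= \<infinity>"
 by (intro nn_integral_PInf_AE) auto
 then have conv: "AE x in M. convergent (%k. f (r k) x)"
 proof eventually_elim
 fix x assume fin: "(\<Sum>k. ennreal (4^k * (d k x)^2)) ~= \<infinity>"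
 have s: "summable (%k. 4^k * (d k x)^2)"
  by (rule summable_suminf_not_top) (use fin in auto)
 then have "(%k. 4^k * (d k x)^2) ----> 0" by (rule summable_LIMSEQ_zero)
 then have "\<forall>\<^sub>F k in sequentially. 4^k * (d k x)^2 < 1"
  by (rule order_tendstoD) simp
 then have "\<forall>\<^sub>F k in sequentially. norm (d k x) <= (1/2)^k"
 proof eventually_elim
  fix k assume "4^k * (d k x)^2 < 1"
  moreover have "(4::real)^k = (2^k)^2" by (simp add: power_even_eq[symmetric] power2_eq_square flip: power_mult_distrib)
  ultimately have "(2^k * \<bar>d k x\<bar>)^2 < 1^2" by (simp add: power_mult_distrib)
  then have "2^k * \<bar>d k x\<bar> < 1" by (rule power_less_imp_less_base) simp
  then show "norm (d k x) <= (1/2)^k" by (simp add: field_simps)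
 qed
 then have "summable (%k. d k x)"
  by (rule summable_comparison_test_ev) (auto intro: summable_geometric)
 then have "convergent (%n. \<Sum>k<n. d k x)" by (simp add: summable_iff_convergent)
 moreover have "(\<Sum>k<n. d k x) = f (r n) x - f (r 0) x" for n
  unfolding d_def by (rule sum_lessThan_telescope)
 ultimately have "convergent (%n. f (r n) x - f (r 0) x)" by simp
 then show "convergent (%k. f (r k) x)"
  using convergent_add[OF _ convergent_const, of "%n. f (r n) x - f (r 0) x" "f (r 0) x"] by simp
 qed
 define g where "g x = lim (%k. f (r k) x)" for x
 have [measurable]: "g \<in> borel_measurable M" unfolding g_def by measurable
 have lim: "AE x in M. (%k. f (r k) x) ----> g x"
 using conv by eventually_elim (simp add: g_def convergent_LIMSEQ_iff)
 \<comment> \<open>Fatou's lemma carries the Cauchy bound over to the pointwise limit of the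
   subsequence.\<close>
 have nn: "(\<integral>\<^sup>+x. ennreal ((f n x - g x)^2) \<partial>M) <= ennreal e"
 if N: "\<forall>m\<ge>N. \<forall>n\<ge>N. (\<integral>x. (f m x - f n x)^2 \<partial>M) < e" "n >= N" for n N e
 proof -
 have "(\<integral>\<^sup>+x. ennreal ((f n x - g x)^2) \<partial>M)
  = (\<integral>\<^sup>+x. liminf (%k. ennreal ((f n x - f (r k) x)^2)) \<partial>M)"
 proof (rule nn_integral_cong_AE)
  show "AE x in M. ennreal ((f n x - g x)^2) = liminf (%k. ennreal ((f n x - f (r k) x)^2))"
  using lim
  proof eventually_elim
  fix x assume "(%k. f (r k) x) ----> g x"
  then have "(%k. ennreal ((f n x - f (r k) x)^2)) ----> ennreal ((f n x - g x)^2)"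
   by (intro tendsto_ennrealI tendsto_intros)
  then show "ennreal ((f n x - g x)^2) = liminf (%k. ennreal ((f n x - f (r k) x)^2))"
   by (intro lim_imp_Liminf[symmetric]) auto
  qed
 qed
 also have "... <= liminf (%k. \<integral>\<^sup>+x. ennreal ((f n x - f (r k) x)^2) \<partial>M)"
  by (rule nn_integral_liminf) measurable
 also have "... <= ennreal e"
 proof (rule Liminf_le)
  show "\<forall>\<^sub>F k in sequentially. (\<integral>\<^sup>+x. ennreal ((f n x - f (r k) x)^2) \<partial>M) <= ennreal e"
  proof (rule eventually_sequentiallyI[of N])
  fix k assume "k >= N"
  then have "r k >= N" using seq_suble[OF mono, of k] by linarith
  then show "(\<integral>\<^sup>+x. ennreal ((f n x - f (r k) x)^2) \<partial>M) <= ennreal e"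
   using N I[of n "r k"] by (subst nn_integral_square) (auto intro!: ennreal_leI simp: less_imp_le)
  qed
 qed auto
 finally show ?thesis .
 qed
 have int: "integrable M (%x. (f n x - g x)^2)" "(\<integral>x. (f n x - g x)^2 \<partial>M) <= e"
 if N: "\<forall>m\<ge>N. \<forall>n\<ge>N. (\<integral>x. (f m x - f n x)^2 \<partial>M) < e" "n >= N" "e > 0" for n N e
 proof -
 have "(\<integral>\<^sup>+x. ennreal (norm ((f n x - g x)^2)) \<partial>M) < \<infinity>"
  using nn[OF N(1,2)] by (auto simp: top.not_eq_extremum[symmetric] dest: neq_top_trans[OF ennreal_neq_top])
 then show i: "integrable M (%x. (f n x - g x)^2)"
  by (intro integrableI_bounded) auto
 show "(\<integral>x. (f n x - g x)^2 \<partial>M) <= e"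
  using nn[OF N(1,2)] N(3) by (subst (asm) nn_integral_square[OF i]) auto
 qed
 obtain N0 where N0: "\<forall>m\<ge>N0. \<forall>n\<ge>N0. (\<integral>x. (f m x - f n x)^2 \<partial>M) < 1" using Cauchy[of 1] by auto
 have "sqint M (%x. f N0 x - g x)"
 using int(1)[OF N0, of N0] by (simp add: square_integrable_def)
 from square_integrable_diff[OF f[of N0] this] have g: "sqint M g" by simp
 have "(%n. \<integral>x. (f n x - g x)^2 \<partial>M) ----> 0"
 proof (rule LIMSEQ_I)
 fix e :: real assume "e > 0"
 then obtain N where N: "\<forall>m\<ge>N. \<forall>n\<ge>N. (\<integral>x. (f m x - f n x)^2 \<partial>M) < e / 2"
  using Cauchy[of "e / 2"] by auto
 have "norm ((\<integral>x. (f n x - g x)^2 \<partial>M) - 0) < e" if "n >= N" for n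
  using int(2)[OF N that] \<open>e > 0\<close> by simp
 then show "\<exists>no. \<forall>n\<ge>no. norm ((\<integral>x. (f n x - g x)^2 \<partial>M) - 0) < e" by blast
 qed
 with g show ?thesis by blast
qed

section \<open>Representatives of elements of \<open>l2\<close>, completeness\<close>

lemma square_integrable_rep_l2: "sqint lborel (rep_l2 u)"
 using Quotient_rep_reflp[OF Quotient_l2, of u] by (simp add: l2_rel_def)

lemma rep_l2_measurable [measurable]: "rep_l2 u \<in> bmeas"
 using square_integrableD(1)[OF square_integrable_rep_l2, of u] by simp

lemma l2_rel_refl: "sqint lborel f ==> l2_rel f f"
 by (simp add: l2_rel_def)

lemma rep_abs_l2: "sqint lborel f ==> AE x in lborel. rep_l2 (abs_l2 f) x = f x"
 using Quotient_rep_abs[OF Quotient_l2 l2_rel_refl, of f] by (simp add: l2_rel_def)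

lemma abs_rep_l2: "abs_l2 (rep_l2 u) = u"
 by (rule Quotient_abs_rep[OF Quotient_l2])

lemma abs_l2_eqI:
 "sqint lborel f ==> sqint lborel g ==> AE x in lborel. f x = g x ==> abs_l2 f = abs_l2 g"
 using Quotient_rel[OF Quotient_l2, of f g] by (auto simp: l2_rel_def)

lemma inner_l2_eq: "inner u v = (\<integral>x. rep_l2 u x * rep_l2 v x \<partial>lborel)"
 using inner_l2.abs_eq[OF l2_rel_refl l2_rel_refl, OF square_integrable_rep_l2 square_integrable_rep_l2, of u v]
 by (simp add: abs_rep_l2)

lemma inner_abs_l2:
 "sqint lborel f ==> sqint lborel g ==>
 inner (abs_l2 f) (abs_l2 g) = (\<integral>x. f x * g x \<partial>lborel)"
 by (rule inner_l2.abs_eq[OF l2_rel_refl l2_rel_refl])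

lemma inner_abs_l2_right:
 "sqint lborel g ==> inner u (abs_l2 g) = (\<integral>x. rep_l2 u x * g x \<partial>lborel)"
 using inner_abs_l2[OF square_integrable_rep_l2, of g u] by (simp add: abs_rep_l2)

lemma norm_abs_l2:
 "sqint lborel f ==> (norm (abs_l2 f))^2 = (\<integral>x. (f x)^2 \<partial>lborel)"
 unfolding power2_norm_eq_inner by (simp add: inner_abs_l2 power2_eq_square)

lemma abs_l2_add:
 "sqint lborel f ==> sqint lborel g ==> abs_l2 f + abs_l2 g = abs_l2 (%x. f x + g x)"
 by (rule plus_l2.abs_eq[OF l2_rel_refl l2_rel_refl])

lemma abs_l2_diff:
 "sqint lborel f ==> sqint lborel g ==> abs_l2 f - abs_l2 g = abs_l2 (%x. f x - g x)"
 by (rule minus_l2.abs_eq[OF l2_rel_refl l2_rel_refl])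

lemma abs_l2_scale:
 "sqint lborel f ==> c *\<^sub>R abs_l2 f = abs_l2 (%x. c * f x)"
 by (rule scaleR_l2.abs_eq[OF l2_rel_refl])

lemma rep_l2_add: "AE x in lborel. rep_l2 (u + v) x = rep_l2 u x + rep_l2 v x"
 using rep_abs_l2[OF square_integrable_add[OF square_integrable_rep_l2 square_integrable_rep_l2], of u v]
 abs_l2_add[OF square_integrable_rep_l2 square_integrable_rep_l2, of u v]
 by (simp add: abs_rep_l2)

lemma rep_l2_scale: "AE x in lborel. rep_l2 (c *\<^sub>R u) x = c * rep_l2 u x"
 using rep_abs_l2[OF square_integrable_cmult[OF square_integrable_rep_l2], of c u]
 abs_l2_scale[OF square_integrable_rep_l2, of c u]
 by (simp add: abs_rep_l2)

lemma rep_l2_zero: "AE x in lborel. rep_l2 0 x = 0"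
 using rep_l2_scale[of 0 0] by simp

lemma complete_l2:
 fixes X :: "nat => l2"
 assumes "Cauchy X"
 shows "convergent X"
proof -
 have d: "(\<integral>x. (rep_l2 u x - rep_l2 v x)^2 \<partial>lborel) = (norm (u - v))^2" for u v
 proof -
 have "u - v = abs_l2 (%x. rep_l2 u x - rep_l2 v x)"
  using abs_l2_diff[OF square_integrable_rep_l2 square_integrable_rep_l2, of u v] by (simp add: abs_rep_l2)
 then show ?thesis
  by (simp add: norm_abs_l2 square_integrable_diff square_integrable_rep_l2)
 qed
 have "\<exists>g. sqint lborel g & (%n. \<integral>x. (rep_l2 (X n) x - g x)^2 \<partial>lborel) ----> 0"
 proof (rule Riesz_Fischer[OF square_integrable_rep_l2])
 fix e :: real assume "e > 0"
 then obtain N where N: "\<forall>m\<ge>N. \<forall>n\<ge>N. norm (X m - X n) < sqrt e"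
  using assms by (metis Cauchy_iff real_sqrt_gt_zero)
 have "(norm (X m - X n))^2 < e" if "m >= N" "n >= N" for m n
 proof -
  have "(norm (X m - X n))^2 < (sqrt e)^2" using N that by (intro power_strict_mono) auto
  then show ?thesis using \<open>e > 0\<close> by simp
 qed
 then show "\<exists>N. \<forall>m\<ge>N. \<forall>n\<ge>N. (\<integral>x. (rep_l2 (X m) x - rep_l2 (X n) x)^2 \<partial>lborel) < e"
  unfolding d by blast
 qed
 then obtain g where g: "sqint lborel g"
 "(%n. \<integral>x. (rep_l2 (X n) x - g x)^2 \<partial>lborel) ----> 0" by blast
 have "(\<integral>x. (rep_l2 (X n) x - g x)^2 \<partial>lborel) = (norm (X n - abs_l2 g))^2" for n
 using abs_l2_diff[OF square_integrable_rep_l2 g(1), of "X n"]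
 by (simp add: abs_rep_l2 norm_abs_l2 square_integrable_diff square_integrable_rep_l2 g(1))
 then have "(%n. (norm (X n - abs_l2 g))^2) ----> 0" using g(2) by simp
 then have "(%n. sqrt ((norm (X n - abs_l2 g))^2)) ----> sqrt 0" by (rule tendsto_real_sqrt)
 then have "(%n. X n - abs_l2 g) ----> 0" by (simp add: tendsto_norm_zero_iff)
 then have "X ----> abs_l2 g" by (rule LIM_zero_cancel)
 then show ?thesis by (rule convergentI)
qed

lemma abs_l2_in_L2_on:
 assumes "sqint lborel f" "AE x in lborel. x \<notin> S \<longrightarrow> f x = 0"
 shows "abs_l2 f \<in> L2_on S"
 using rep_abs_l2[OF assms(1)] assms(2) unfolding L2_on_def mem_Collect_eq by eventually_elim auto

lemma subspace_L2_on: "subspace (L2_on S)"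
 unfolding subspace_def
proof (intro conjI ballI allI)
 show "0 \<in> L2_on S" using rep_l2_zero unfolding L2_on_def by (auto elim: eventually_mono)
next
 fix u v assume "u \<in> L2_on S" "v \<in> L2_on S"
 then have "AE x in lborel. x \<notin> S \<longrightarrow> rep_l2 u x = 0" "AE x in lborel. x \<notin> S \<longrightarrow> rep_l2 v x = 0"
 by (auto simp: L2_on_def)
 with rep_l2_add[of u v] have "AE x in lborel. x \<notin> S \<longrightarrow> rep_l2 (u + v) x = 0"
 by eventually_elim auto
 then show "u + v \<in> L2_on S" by (simp add: L2_on_def)
next
 fix u c assume "u \<in> L2_on S"
 then have "AE x in lborel. x \<notin> S \<longrightarrow> rep_l2 u x = 0" by (auto simp: L2_on_def)
 with rep_l2_scale[of c u] have "AE x in lborel. x \<notin> S \<longrightarrow> rep_l2 (c *\<^sub>R u) x = 0"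
 by eventually_elim auto
 then show "c *\<^sub>R u \<in> L2_on S" by (simp add: L2_on_def)
qed

text \<open>The space is an orthogonal complement: \<open>w\<close> is the part of the limit outside
  \<open>S\<close>, and orthogonality to it survives the limit.\<close>

lemma L2_on_closed:
 assumes S: "S \<in> sets borel" and X: "!!n. X n \<in> L2_on S" "X ----> u"
 shows "u \<in> L2_on S"
proof -
 define w where "w = abs_l2 (%x. ind (- S) x * rep_l2 u x)"
 have sq: "sqint lborel (%x. ind (- S) x * rep_l2 v x)" for v
 using S by (intro square_integrable_indicator square_integrable_rep_l2) auto
 have "inner (X n) w = 0" for n
 proof -
 have "inner (X n) w = (\<integral>x. rep_l2 (X n) x * (ind (- S) x * rep_l2 u x) \<partial>lborel)"
  unfolding w_def by (rule inner_abs_l2_right[OF sq])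
 also have "... = (\<integral>x. 0 \<partial>(lborel :: plane measure))"
 proof (rule integral_cong_AE)
  show "AE x in lborel. rep_l2 (X n) x * (ind (- S) x * rep_l2 u x) = 0"
  using X(1)[of n] unfolding L2_on_def by (auto elim!: eventually_mono simp: indicator_def)
 qed (use S in auto)
 finally show ?thesis by simp
 qed
 moreover have "(%n. inner (X n) w) ----> inner u w" by (intro tendsto_intros X)
 ultimately have "inner u w = 0" by (simp add: LIMSEQ_const_iff)
 then have "(\<integral>x. rep_l2 u x * (ind (- S) x * rep_l2 u x) \<partial>lborel) = 0"
 unfolding w_def by (simp add: inner_abs_l2_right[OF sq])
 moreover have "integrable lborel (%x. rep_l2 u x * (ind (- S) x * rep_l2 u x))"
 by (rule square_integrable_mult_integrable[OF square_integrable_rep_l2 sq])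
 ultimately have "AE x in lborel. rep_l2 u x * (ind (- S) x * rep_l2 u x) = 0"
 by (subst (asm) integral_nonneg_eq_0_iff_AE) (auto simp: indicator_def)
 then show ?thesis unfolding L2_on_def by (auto elim!: eventually_mono simp: indicator_def)
qed

section \<open>Continuous functions of compact support\<close>

lemma square_integrable_compact_support:
 fixes f :: "'a::euclidean_space => real"
 assumes "continuous_on UNIV f" "compact K" "!!x. x \<notin> K ==> f x = 0"
 shows "sqint lborel f" "integrable lborel f" "\<exists>B. \<forall>x. \<bar>f x\<bar> <= B"
proof -
 have *: "integrable lborel g" if g: "continuous_on UNIV g" "!!x. x \<notin> K ==> g x = 0" for g :: "'a => real"
 proof -
 have "integrable lborel (%x. ind K x *\<^sub>R g x)"
  by (rule borel_integrable_compact[OF assms(2)]) (use g(1) continuous_on_subset in blast)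
 also have "(%x. ind K x *\<^sub>R g x) = g" using g(2) by (intro ext) (case_tac "x \<in> K", auto)
 finally show ?thesis .
 qed
 show "integrable lborel f" by (rule * [OF assms(1,3)])
 have "integrable lborel (%x. (f x)^2)"
 by (rule *) (use assms in \<open>auto intro!: continuous_intros\<close>)
 then show "sqint lborel f"
 using borel_measurable_continuous_onI[OF assms(1)] by (simp add: square_integrable_def)
 have "compact (f ` K)" using assms continuous_on_subset by (intro compact_continuous_image) blast+
 then have "bounded (f ` K)" by (rule compact_imp_bounded)
 then obtain B where "\<forall>x\<in>K. \<bar>f x\<bar> <= B" by (auto simp: bounded_iff)
 then show "\<exists>B. \<forall>x. \<bar>f x\<bar> <= B"
 using assms(3) by (intro exI[of _ "max B 0"]) (metis abs_zero le_max_iff_disj order_refl)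
qed

text \<open>Truncation reduces to bounded functions of bounded support, for which pointwise
 approximation by continuous functions suffices.\<close>

lemma dense_continuous_compact_support:
 fixes f :: "'a::euclidean_space => real"
 assumes f: "sqint lborel f" and e: "e > 0"
 shows "\<exists>g K. continuous_on UNIV g & compact K & (\<forall>x. x \<notin> K \<longrightarrow> g x = 0) & (\<integral>x. (f x - g x)^2 \<partial>lborel) < e"
proof -
 have f_m[measurable]: "f \<in> bmeas" using square_integrableD(1)[OF f] by simp
 define clamp :: "real => real => real" where "clamp b y = max (- b) (min b y)" for b y
 define cut :: "real => 'a => real" where "cut b x = max 0 (min 1 (b - norm x))" for b x
 have clamp_abs: "\<bar>clamp b y\<bar> <= b" if "b >= 0" for b y using that by (auto simp: clamp_def)
 have clamp_le: "\<bar>clamp b y\<bar> <= \<bar>y\<bar>" if "b >= 0" for b y using that by (auto simp: clamp_def)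
 have cut: "0 <= cut b x" "cut b x <= 1" "x \<notin> cball 0 b ==> cut b x = 0" for b x
 by (auto simp: cut_def)
 have [measurable]: "clamp b \<in> bmeas" "cut b \<in> bmeas" for b
 unfolding clamp_def[abs_def] cut_def[abs_def] by measurable
 have dom: "sqint lborel (%x. clamp (real n) (h x) * cut (real n) x)"
 if [measurable]: "h \<in> bmeas" for h and n :: nat
 proof -
 have "integrable lborel (%x. ind (cball 0 (real n)) x *\<^sub>R (real n)\<^sup>2)"
  by (rule borel_integrable_compact) auto
 then have "integrable lborel (%x. (clamp (real n) (h x) * cut (real n) x)^2)"
 proof (rule Bochner_Integration.integrable_bound)
  show "AE x in lborel. norm ((clamp (real n) (h x) * cut (real n) x)^2) <= norm (ind (cball 0 (real n)) x *\<^sub>R (real n)\<^sup>2)"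
  proof (rule AE_I2)
  fix x
  have "\<bar>clamp (real n) (h x) * cut (real n) x\<bar> <= real n * 1"
   unfolding abs_mult using clamp_abs[of "real n" "h x"] cut(1,2)[of "real n" x] by (intro mult_mono) auto
  then have "\<bar>clamp (real n) (h x) * cut (real n) x\<bar>\<^sup>2 <= (real n)^2" by (intro power_mono) auto
  then show "norm ((clamp (real n) (h x) * cut (real n) x)^2) <= norm (ind (cball 0 (real n)) x *\<^sub>R (real n)\<^sup>2)"
   using cut(3)[of x "real n"] by (auto simp: indicator_def)
  qed
 qed measurable
 then show ?thesis by (simp add: square_integrable_def)
 qed
 define F where "F n x = clamp (real n) (f x) * cut (real n) x" for n :: nat and x
 have F: "sqint lborel (F n)" for n unfolding F_def by (rule dom) measurable
 have "(%n. \<integral>x. (f x - F n x)^2 \<partial>lborel) ----> (\<integral>x. 0 \<partial>(lborel :: 'a measure))"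
 proof (rule integral_dominated_convergence[where w = "%x. 4 * (f x)^2"])
 show "AE x in lborel. (%n. (f x - F n x)^2) ----> 0"
 proof (rule AE_I2)
  fix x
  have "\<forall>\<^sub>F n in sequentially. F n x = f x"
  proof (rule eventually_sequentiallyI[of "nat \<lceil>\<bar>f x\<bar> + norm x + 1\<rceil>"])
  fix n :: nat assume "n >= nat \<lceil>\<bar>f x\<bar> + norm x + 1\<rceil>"
  then have n: "real n >= \<bar>f x\<bar> + norm x + 1" by linarith
  then have "clamp (real n) (f x) = f x"
   unfolding clamp_def using norm_ge_zero[of x] by linarith
  moreover have "cut (real n) x = 1" using n by (simp add: cut_def)
  ultimately show "F n x = f x" by (simp add: F_def)
  qed
  then have "\<forall>\<^sub>F n in sequentially. (f x - F n x)^2 = 0" by eventually_elim simp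
  then show "(%n. (f x - F n x)^2) ----> 0" by (rule tendsto_eventually)
 qed
 show "AE x in lborel. norm ((f x - F n x)^2) <= 4 * (f x)^2" for n
 proof (rule AE_I2)
  fix x
  have "\<bar>F n x\<bar> <= \<bar>f x\<bar> * 1" unfolding F_def abs_mult
  using clamp_le[of "real n" "f x"] cut(1,2)[of "real n" x] by (intro mult_mono) auto
  then have "\<bar>f x - F n x\<bar> <= 2 * \<bar>f x\<bar>" by linarith
  then have "\<bar>f x - F n x\<bar>\<^sup>2 <= (2 * \<bar>f x\<bar>)^2" by (intro power_mono) auto
  then show "norm ((f x - F n x)^2) <= 4 * (f x)^2" by (simp add: power_mult_distrib)
 qed
 qed (use square_integrableD[OF f] square_integrableD(1)[OF F] in auto)
 then have "\<forall>\<^sub>F n in sequentially. (\<integral>x. (f x - F n x)^2 \<partial>lborel) < e / 4"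
 using e by (intro order_tendstoD(2)[where y = 0]) auto
 then obtain n :: nat where n: "(\<integral>x. (f x - F n x)^2 \<partial>lborel) < e / 4"
 by (auto simp: eventually_sequentially)
 \<comment> \<open>\<open>measurable_on\<close> means being an almost everywhere limit of continuous
   functions; it supplies the approximants, which are then clamped and cut off like
   \<open>f\<close>.\<close>
 have "f measurable_on UNIV"
 by (rule lebesgue_measurable_imp_measurable_on) (auto simp: measurable_completion)
 then obtain N g where N: "negligible N" and g: "!!n. continuous_on UNIV (g n)"
 "!!x. x \<notin> N ==> (%n. g n x) ----> f x"
 unfolding measurable_on_def by auto
 define G where "G k x = clamp (real n) (g k x) * cut (real n) x" for k x
 have [measurable]: "g k \<in> bmeas" for k
 using borel_measurable_continuous_onI[OF g(1)[of k]] by simp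
 have G: "sqint lborel (G k)" for k unfolding G_def by (rule dom) measurable
 have Nae: "AE x in lborel. x \<notin> N"
 using N by (metis AE_not_in negligible_iff_null_sets AE_completion_iff)
 have "(%k. \<integral>x. (F n x - G k x)^2 \<partial>lborel) ----> (\<integral>x. 0 \<partial>(lborel :: 'a measure))"
 proof (rule integral_dominated_convergence[where w = "%x. ind (cball 0 (real n)) x *\<^sub>R (2 * real n)\<^sup>2"])
 show "AE x in lborel. (%k. (F n x - G k x)^2) ----> 0"
  using Nae
 proof eventually_elim
  fix x assume "x \<notin> N"
  then have "(%k. (F n x - G k x)^2) ----> (F n x - clamp (real n) (f x) * cut (real n) x)^2"
  unfolding G_def clamp_def by (intro tendsto_intros g(2))
  then show "(%k. (F n x - G k x)^2) ----> 0" by (simp add: F_def)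
 qed
 show "AE x in lborel. norm ((F n x - G k x)^2) <= ind (cball 0 (real n)) x *\<^sub>R (2 * real n)\<^sup>2" for k
 proof (rule AE_I2)
  fix x
  have *: "\<bar>clamp (real n) y * cut (real n) x\<bar> <= real n * 1" for y
  unfolding abs_mult using clamp_abs[of "real n" y] cut(1,2)[of "real n" x] by (intro mult_mono) auto
  have "\<bar>F n x - G k x\<bar> <= 2 * real n" using *[of "f x"] *[of "g k x"] by (simp add: F_def G_def)
  then have "\<bar>F n x - G k x\<bar>\<^sup>2 <= (2 * real n)^2" by (intro power_mono) auto
  then show "norm ((F n x - G k x)^2) <= ind (cball 0 (real n)) x *\<^sub>R (2 * real n)\<^sup>2"
  using cut(3)[of x "real n"] by (auto simp: indicator_def F_def G_def)
 qed
 show "integrable lborel (%x. ind (cball 0 (real n)) x *\<^sub>R (2 * real n)\<^sup>2)"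
  by (rule borel_integrable_compact) auto
 qed (use square_integrableD(1)[OF F] square_integrableD(1)[OF G] in auto)
 then have "\<forall>\<^sub>F k in sequentially. (\<integral>x. (F n x - G k x)^2 \<partial>lborel) < e / 4"
 using e by (intro order_tendstoD(2)[where y = 0]) auto
 then obtain k where k: "(\<integral>x. (F n x - G k x)^2 \<partial>lborel) < e / 4"
 by (auto simp: eventually_sequentially)
 show ?thesis
 proof (intro exI[of _ "G k"] exI[of _ "cball 0 (real n)"] conjI allI impI)
 show "continuous_on UNIV (G k)"
  unfolding G_def clamp_def cut_def by (intro continuous_intros g(1))
 show "(\<integral>x. (f x - G k x)^2 \<partial>lborel) < e"
  using square_integral_triangle[OF f F[of n] G[of k]] n k by simp
 qed (use cut(3) in \<open>auto simp: G_def\<close>)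
qed

section \<open>Mollification and density of smooth functions\<close>

abbreviation pd :: "(plane => real) => plane => plane => real" where
 "pd ph e x \<equiv> frechet_derivative ph (at x) e"

abbreviation "dirichlet S f \<equiv> \<Sum>e\<in>Basis. (norm (restr S (pd f e)))^2"

lemma pd_eq: "(ph has_derivative D) (at x) ==> pd ph e x = D e"
 by (simp add: frechet_derivative_at[symmetric])

section \<open>Calculus of test functions\<close>

lemma C1c_has_derivative: "ph \<in> C1c S ==> (ph has_derivative (%e. pd ph e x)) (at x)"
 unfolding C1c_def mem_Collect_eq using frechet_derivative_works by blast

lemma C1c_continuous: "ph \<in> C1c S ==> continuous_on UNIV ph"
 by (meson C1c_has_derivative continuous_at_imp_continuous_on has_derivative_continuous)

lemma C1c_pd_continuous: "ph \<in> C1c S ==> continuous_on UNIV (pd ph e)"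
 unfolding C1c_def mem_Collect_eq by blast

lemma C1c_support:
 assumes "ph \<in> C1c S"
 shows "\<exists>K. compact K & K \<subseteq> S & (\<forall>x. x \<notin> K \<longrightarrow> ph x = 0) & (\<forall>x e. x \<notin> K \<longrightarrow> pd ph e x = 0)"
proof -
 obtain K where K: "compact K" "K \<subseteq> S" "!!x. x \<notin> K ==> ph x = 0"
 using assms unfolding C1c_def mem_Collect_eq by blast
 have "pd ph e x = 0" if "x \<notin> K" for x e
 proof -
 have "open (- K)" using K(1) by (simp add: compact_imp_closed open_Compl)
 have "(ph has_derivative (%_. 0)) (at x)"
  by (rule has_derivative_transform_within_open[of "%_. 0" _ _ _ "- K"])
  (use K(3) that \<open>open (- K)\<close> in auto)
 then show ?thesis by (rule pd_eq)
 qed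
 with K show ?thesis by blast
qed

lemma C1cI:
 assumes "!!x. (ph has_derivative D x) (at x)" "!!e. continuous_on UNIV (%x. D x e)"
 and "compact K" "K \<subseteq> S" "!!x. x \<notin> K ==> ph x = 0"
 shows "ph \<in> C1c S"
 using assms pd_eq[OF assms(1)] unfolding C1c_def differentiable_def by auto

lemma C1c_square_integrable:
 assumes "ph \<in> C1c S"
 shows "sqint lborel ph" "sqint lborel (pd ph e)"
proof -
 obtain K where K: "compact K" "K \<subseteq> S" "!!x. x \<notin> K ==> ph x = 0" "!!x e. x \<notin> K ==> pd ph e x = 0"
 using C1c_support[OF assms] by blast
 show "sqint lborel ph"
 by (rule square_integrable_compact_support(1)[OF C1c_continuous[OF assms] K(1,3)])
 show "sqint lborel (pd ph e)"
 by (rule square_integrable_compact_support(1)[OF C1c_pd_continuous[OF assms] K(1,4)])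
qed

lemma C1c_measurable [measurable_dest]:
 assumes "ph \<in> C1c S"
 shows "ph \<in> bmeas" "pd ph e \<in> bmeas"
 using C1c_square_integrable[OF assms] by (auto simp: square_integrable_def)

lemma pd_plane:
 assumes "ph \<in> C1c S"
 shows "pd ph (a, b) x = a * pd ph (1, 0) x + b * pd ph (0, 1) x"
proof -
 have l: "linear (%e. pd ph e x)"
 using C1c_has_derivative[OF assms] has_derivative_linear by blast
 have eq: "(a, b) = a *\<^sub>R (1, 0) + b *\<^sub>R (0, 1 :: real)" by simp
 show ?thesis
 by (subst eq) (simp only: linear_add[OF l] linear_scale[OF l] real_scaleR_def)
qed

lemma C1c_Lipschitz:
 assumes "ph \<in> C1c S"
 shows "\<exists>B\<ge>0. (\<forall>x h. \<bar>pd ph h x\<bar> <= B * norm h) & (\<forall>x y. \<bar>ph x - ph y\<bar> <= B * norm (x - y))"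
proof -
 obtain K where K: "compact K" "K \<subseteq> S" "!!x. x \<notin> K ==> ph x = 0" "!!x e. x \<notin> K ==> pd ph e x = 0"
 using C1c_support[OF assms] by blast
 have "\<exists>B. \<forall>x. \<bar>pd ph e x\<bar> <= B" for e
 by (rule square_integrable_compact_support(3)[OF C1c_pd_continuous[OF assms] K(1,4)])
 then obtain B where B: "!!e x. \<bar>pd ph e x\<bar> <= B e" by metis
 have B0: "B e >= 0" for e using B[where e = e and x = 0] by linarith
 let ?B = "B (1, 0) + B (0, 1)"
 have pdB: "\<bar>pd ph h x\<bar> <= ?B * norm h" for h x
 proof -
 obtain a b where h: "h = (a, b)" by force
 have ab: "\<bar>a\<bar> <= norm h" "\<bar>b\<bar> <= norm h"
  using norm_fst_le[of a b] norm_snd_le[of b a] by (auto simp: h)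
 have "\<bar>pd ph h x\<bar> <= \<bar>a\<bar> * \<bar>pd ph (1, 0) x\<bar> + \<bar>b\<bar> * \<bar>pd ph (0, 1) x\<bar>"
  using pd_plane[OF assms, where a = a and b = b and x = x] by (metis abs_mult abs_triangle_ineq h)
 also have "... <= norm h * B (1, 0) + norm h * B (0, 1)"
  using ab B by (intro add_mono mult_mono) auto
 finally show ?thesis by (simp add: algebra_simps)
 qed
 have "norm (ph x - ph y) <= ?B * norm (x - y)" for x y
 proof (rule differentiable_bound[of UNIV _ "%x e. pd ph e x"])
 show "onorm (%e. pd ph e z) <= ?B" for z
  by (rule onorm_le) (use pdB in auto)
 qed (use C1c_has_derivative[OF assms] in auto)
 then show ?thesis using pdB B0[of "(1, 0)"] B0[of "(0, 1)"] by (intro exI[of _ ?B]) auto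
qed

lemma C1c_mult:
 assumes f: "!!x. (f has_derivative D x) (at x)" "!!e. continuous_on UNIV (%x. D x e)" and g: "ps \<in> C1c S"
 shows "(%x. f x * ps x) \<in> C1c S" "pd (%x. f x * ps x) e x = D x e * ps x + f x * pd ps e x"
proof -
 obtain K where K: "compact K" "K \<subseteq> S" "!!x. x \<notin> K ==> ps x = 0" "!!x e. x \<notin> K ==> pd ps e x = 0"
 using C1c_support[OF g] by blast
 have d: "((%x. f x * ps x) has_derivative (%e. f x * pd ps e x + D x e * ps x)) (at x)" for x
 by (rule has_derivative_mult[OF f(1) C1c_has_derivative[OF g]])
 have cf: "continuous_on UNIV f"
 using f(1) by (meson continuous_at_imp_continuous_on has_derivative_continuous)
 show "(%x. f x * ps x) \<in> C1c S"
 by (rule C1cI[OF d _ K(1,2)])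
  (use K C1c_pd_continuous[OF g] C1c_continuous[OF g] cf f(2) in \<open>auto intro!: continuous_intros\<close>)
 show "pd (%x. f x * ps x) e x = D x e * ps x + f x * pd ps e x"
 using pd_eq[OF d] by simp
qed

lemma C1c_mult':
 assumes "ph \<in> C1c T" "ps \<in> C1c S"
 shows "(%x. ph x * ps x) \<in> C1c S" "pd (%x. ph x * ps x) e x = pd ph e x * ps x + ph x * pd ps e x"
 using C1c_mult[OF C1c_has_derivative[OF assms(1)] C1c_pd_continuous[OF assms(1)] assms(2)] by auto

lemma C1c_lincomb:
 assumes f: "ph \<in> C1c S" and g: "ps \<in> C1c S"
 shows "(%x. a * ph x + b * ps x) \<in> C1c S" "pd (%x. a * ph x + b * ps x) e x = a * pd ph e x + b * pd ps e x"
proof -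
 obtain K where K: "compact K" "K \<subseteq> S" "!!x. x \<notin> K ==> ph x = 0" using C1c_support[OF f] by blast
 obtain L where L: "compact L" "L \<subseteq> S" "!!x. x \<notin> L ==> ps x = 0" using C1c_support[OF g] by blast
 have d: "((%x. a * ph x + b * ps x) has_derivative (%e. a * pd ph e x + b * pd ps e x)) (at x)" for x
 by (intro has_derivative_add has_derivative_mult_right C1c_has_derivative[OF f] C1c_has_derivative[OF g])
 show "(%x. a * ph x + b * ps x) \<in> C1c S"
 by (rule C1cI[OF d, of "K \<union> L"])
  (use K L C1c_pd_continuous[OF f] C1c_pd_continuous[OF g] in \<open>auto intro!: continuous_intros\<close>)
 show "pd (%x. a * ph x + b * ps x) e x = a * pd ph e x + b * pd ps e x"
 using pd_eq[OF d] by simp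
qed

text \<open>The derivative of a test function integrates to zero because its difference quotients do.\<close>

lemma integral_pd_eq_0:
 assumes ph: "ph \<in> C1c S"
 shows "(\<integral>x. pd ph e x \<partial>lborel) = 0"
proof -
 obtain K where K: "compact K" "K \<subseteq> S" "!!x. x \<notin> K ==> ph x = 0" using C1c_support[OF ph] by blast
 obtain B where B: "B >= 0" "!!x y. \<bar>ph x - ph y\<bar> <= B * norm (x - y)" using C1c_Lipschitz[OF ph] by blast
 obtain R where R: "K \<subseteq> cball 0 R" using compact_imp_bounded[OF K(1)] unfolding bounded_iff by (metis mem_cball_0 subsetI)
 have [measurable]: "ph \<in> bmeas" by (rule C1c_measurable[OF ph])
 have I: "integrable lborel ph"
 by (rule square_integrable_compact_support(2)[OF C1c_continuous[OF ph] K(1,3)])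
 let ?h = "%n. 1 / real (Suc n)"
 let ?s = "%n x. (ph (x + ?h n *\<^sub>R e) - ph x) / ?h n"
 have shift: "integrable lborel (%x. ph (x + v))" "(\<integral>x. ph (x + v) \<partial>lborel) = (\<integral>x. ph x \<partial>lborel)" for v
 proof -
 have "integrable (distr lborel borel ((+) v)) ph" using I by (simp add: lborel_distr_plus)
 then show "integrable lborel (%x. ph (x + v))"
  by (subst (asm) integrable_distr_eq) (auto simp: add.commute)
 have "(\<integral>x. ph x \<partial>lborel) = (\<integral>x. ph x \<partial>distr lborel borel ((+) v))" by (simp add: lborel_distr_plus)
 also have "... = (\<integral>x. ph (x + v) \<partial>lborel)" by (subst integral_distr) (auto simp: add.commute)
 finally show "(\<integral>x. ph (x + v) \<partial>lborel) = (\<integral>x. ph x \<partial>lborel)" by simp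
 qed
 have "(%n. \<integral>x. ?s n x \<partial>lborel) ----> (\<integral>x. pd ph e x \<partial>lborel)"
 proof (rule integral_dominated_convergence[where w = "%x. ind (cball 0 (R + norm e)) x *\<^sub>R (B * norm e)"])
 show "AE x in lborel. (%n. ?s n x) ----> pd ph e x"
 proof (rule AE_I2)
  fix x
  have "((%t. ph (x + t *\<^sub>R e)) has_derivative (%t. pd ph (t *\<^sub>R e) x)) (at 0)"
  by (rule has_derivative_compose[of "%t. x + t *\<^sub>R e" "%t. t *\<^sub>R e" 0 UNIV ph])
   (auto intro!: derivative_eq_intros C1c_has_derivative[OF ph, of x])
  moreover have "pd ph (t *\<^sub>R e) x = pd ph e x * t" for t
  using linear_scale[OF has_derivative_linear[OF C1c_has_derivative[OF ph]], of x t e] by simp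
  ultimately have "((%t. ph (x + t *\<^sub>R e)) has_field_derivative pd ph e x) (at 0)"
  by (simp add: has_field_derivative_def mult_commute_abs)
  then have "((%h. (ph (x + h *\<^sub>R e) - ph x) / h) \<longlongrightarrow> pd ph e x) (at 0)"
  by (simp add: DERIV_def)
  moreover have "filterlim ?h (at 0) sequentially"
  unfolding filterlim_at using LIMSEQ_inverse_real_of_nat by (auto simp: inverse_eq_divide)
  ultimately show "(%n. ?s n x) ----> pd ph e x" by (rule filterlim_compose)
 qed
 show "AE x in lborel. norm (?s n x) <= ind (cball 0 (R + norm e)) x *\<^sub>R (B * norm e)" for n
 proof (rule AE_I2)
  fix x
  have h: "0 < ?h n" "?h n <= 1" by auto
  have "\<bar>ph (x + ?h n *\<^sub>R e) - ph x\<bar> <= B * (?h n * norm e)"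
  using B(2)[of "x + ?h n *\<^sub>R e" x] by simp
  then have *: "norm (?s n x) <= B * norm e"
  unfolding real_norm_def abs_divide using h(1) by (subst pos_divide_le_eq) (auto simp: mult_ac)
  have "?s n x = 0" if "x \<notin> cball 0 (R + norm e)"
  proof -
  have x: "norm x > R + norm e" using that by simp
  have "norm (?h n *\<^sub>R e) <= 1 * norm e" using h by (simp only: norm_scaleR) (intro mult_right_mono, auto)
  then have "norm (x + ?h n *\<^sub>R e) > R" using x norm_triangle_ineq2[of x "- (?h n *\<^sub>R e)"] by simp
  then have "x + ?h n *\<^sub>R e \<notin> cball 0 R" "x \<notin> cball 0 R"
   using x norm_ge_zero[of e] unfolding mem_cball_0 by linarith+
  then have "x + ?h n *\<^sub>R e \<notin> K" "x \<notin> K" using R by blast+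
  then show ?thesis using K(3) by simp
  qed
  then show "norm (?s n x) <= ind (cball 0 (R + norm e)) x *\<^sub>R (B * norm e)"
  using * by (cases "x \<in> cball 0 (R + norm e)") auto
 qed
 show "integrable lborel (%x. ind (cball 0 (R + norm e)) x *\<^sub>R (B * norm e))"
  by (rule borel_integrable_compact) auto
 qed (use C1c_measurable[OF ph] in measurable)
 moreover have "(\<integral>x. ?s n x \<partial>lborel) = 0" for n
 using shift I by simp
 ultimately show ?thesis by (simp add: LIMSEQ_const_iff)
qed

lemma integral_by_parts:
 assumes "ph \<in> C1c T" "ps \<in> C1c S"
 shows "(\<integral>x. ph x * pd ps e x \<partial>lborel) = - (\<integral>x. pd ph e x * ps x \<partial>lborel)"
proof -
 note I = square_integrable_mult_integrable[OF C1c_square_integrable(1)[OF assms(1)] C1c_square_integrable(2)[OF assms(2)]]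
 square_integrable_mult_integrable[OF C1c_square_integrable(2)[OF assms(1)] C1c_square_integrable(1)[OF assms(2)]]
 have "(\<integral>x. pd ph e x * ps x + ph x * pd ps e x \<partial>lborel) = 0"
 using integral_pd_eq_0[OF C1c_mult'(1)[OF assms], of e] by (simp add: C1c_mult'(2)[OF assms])
 then show ?thesis using I by simp
qed

section \<open>The bump function and its rescalings\<close>

lemma has_derivative_max0_square: "((%y :: real. (max 0 y)^2) has_field_derivative 2 * max 0 y) (at y)"
proof -
 consider "y > 0" | "y < 0" | "y = 0" by linarith
 then show ?thesis
 proof cases
 case 1
 have "((%y. y^2) has_field_derivative 2 * max 0 y) (at y)"
  using 1 by (auto intro!: derivative_eq_intros)
 then show ?thesis
  by (rule has_field_derivative_transform_within_open[of _ _ _ "{0<..}"]) (use 1 in auto)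
 next
 case 2
 have "((%y. 0) has_field_derivative 2 * max 0 y) (at y)" using 2 by auto
 then show ?thesis
  by (rule has_field_derivative_transform_within_open[of _ _ _ "{..<0}"]) (use 2 in auto)
 next
 case 3
 have "((%h::real. (max 0 h)^2 / h) \<longlongrightarrow> 0) (at 0)"
 proof (rule tendsto_rabs_zero_cancel, rule tendsto_sandwich[of "%_. 0", OF _ _ tendsto_const])
  show "\<forall>\<^sub>F h in at 0. \<bar>(max 0 h)^2 / h\<bar> <= \<bar>h :: real\<bar>"
  by (intro always_eventually allI) (auto simp: max_def power2_eq_square)
  show "(abs \<longlongrightarrow> (0 :: real)) (at 0)" by (intro tendsto_rabs_zero tendsto_ident_at)
 qed auto
 then show ?thesis using 3 by (simp add: DERIV_def)
 qed
qed

text \<open>A profile that is merely \<open>C^1\<close>, as the test class allows; it has explicit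
  derivatives and an explicit continuous square root, which \<open>bump_Jensen\<close>
  exploits.\<close>

definition bump :: "plane => real" where
 "bump x = (max 0 (1 - inner x x))^2"

lemma bump_has_derivative: "(bump has_derivative (%h. - 4 * max 0 (1 - inner x x) * inner x h)) (at x)"
proof -
 have "((%x. (max 0 (1 - inner x x))^2) has_derivative (%h. 2 * max 0 (1 - inner x x) * (- (inner x h + inner h x)))) (at x)"
 by (rule has_derivative_compose[OF _ has_derivative_max0_square[THEN has_field_derivative_imp_has_derivative],
   of "%x. 1 - inner x x" "%h. - (inner x h + inner h x)" x UNIV])
  (auto intro!: derivative_eq_intros)
 then show ?thesis unfolding bump_def[abs_def]
 by (rule has_derivative_eq_rhs) (auto simp: inner_commute)
qed

lemma bump_bounds: "0 <= bump x" "bump x <= 1" "bump x = 0 \<longleftrightarrow> 1 <= norm x"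
proof -
 have i: "inner x x = (norm x)^2" by (simp add: power2_norm_eq_inner)
 show "0 <= bump x" by (simp add: bump_def)
 have "(max 0 (1 - inner x x))^2 <= 1^2" by (intro power_mono) auto
 then show "bump x <= 1" by (simp add: bump_def)
 have "1 <= norm x \<longleftrightarrow> 1 <= (norm x)^2" using abs_le_square_iff[of 1 "norm x"] by simp
 then show "bump x = 0 \<longleftrightarrow> 1 <= norm x" by (auto simp: bump_def i max_def)
qed

lemma bump_affine_C1c:
 assumes "c ~= 0"
 shows "(%x. bump (c *\<^sub>R (x - p))) \<in> C1c UNIV"
 "pd (%x. bump (c *\<^sub>R (x - p))) e x = - 4 * c * max 0 (1 - inner (c *\<^sub>R (x - p)) (c *\<^sub>R (x - p))) * inner (c *\<^sub>R (x - p)) e"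
proof -
 have d: "((%x. bump (c *\<^sub>R (x - p))) has_derivative
  (%h. - 4 * max 0 (1 - inner (c *\<^sub>R (x - p)) (c *\<^sub>R (x - p))) * inner (c *\<^sub>R (x - p)) (c *\<^sub>R h))) (at x)" for x
 by (rule has_derivative_compose[OF _ bump_has_derivative, of "%x. c *\<^sub>R (x - p)" "%h. c *\<^sub>R h" x UNIV])
  (auto intro!: derivative_eq_intros)
 show "(%x. bump (c *\<^sub>R (x - p))) \<in> C1c UNIV"
 proof (rule C1cI[OF d, of "cball p (1 / \<bar>c\<bar>)"])
 fix x assume "x \<notin> cball p (1 / \<bar>c\<bar>)"
 then show "bump (c *\<^sub>R (x - p)) = 0"
  using assms unfolding bump_bounds(3) norm_scaleR by (simp add: dist_norm norm_minus_commute field_simps)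
 qed (auto intro!: continuous_intros)
 show "pd (%x. bump (c *\<^sub>R (x - p))) e x = - 4 * c * max 0 (1 - inner (c *\<^sub>R (x - p)) (c *\<^sub>R (x - p))) * inner (c *\<^sub>R (x - p)) e"
 using pd_eq[OF d] by simp
qed

lemma bump_C1c: "bump \<in> C1c UNIV" using bump_affine_C1c(1)[of 1 0] by simp

text \<open>With \<open>c = 1 / R\<close> this is the gradient bound \<open>4 / R\<close> of a
  cutoff at scale \<open>R\<close>, the source of the error terms in later truncations.\<close>

lemma bump_pd_bound: "c ~= 0 ==> \<bar>pd (%x. bump (c *\<^sub>R (x - p))) e x\<bar> <= 4 * \<bar>c\<bar> * norm e"
proof -
 assume c: "c ~= 0"
 let ?y = "c *\<^sub>R (x - p)"
 have "\<bar>max 0 (1 - inner ?y ?y)\<bar> * \<bar>inner ?y e\<bar> <= 1 * norm e"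
 proof (cases "norm ?y <= 1")
 case True
 have "\<bar>inner ?y e\<bar> <= norm ?y * norm e" by (rule Cauchy_Schwarz_ineq2)
 also have "... <= 1 * norm e" using True by (intro mult_right_mono) auto
 finally have "\<bar>inner ?y e\<bar> <= norm e" by simp
 moreover have "\<bar>max 0 (1 - inner ?y ?y)\<bar> <= 1" using inner_ge_zero[of ?y] by (auto simp del: inner_scaleR_left inner_scaleR_right)
 ultimately show ?thesis by (intro mult_mono) auto
 next
 case False
 then have "1 < (norm ?y)^2" by (simp add: one_less_power not_le)
 then have "max 0 (1 - inner ?y ?y) = 0" by (simp only: power2_norm_eq_inner)
 then show ?thesis by simp
 qed
 then have "4 * \<bar>c\<bar> * (\<bar>max 0 (1 - inner ?y ?y)\<bar> * \<bar>inner ?y e\<bar>) <= 4 * \<bar>c\<bar> * (1 * norm e)"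
 by (intro mult_left_mono) auto
 then show ?thesis unfolding bump_affine_C1c(2)[OF c] by (simp add: mult_ac abs_mult del: inner_scaleR_left inner_scaleR_right)
qed

lemma integral_C1c_pos:
 assumes "ph \<in> C1c UNIV" "!!x. 0 <= ph x" "ph a > 0"
 shows "0 < (\<integral>x. ph x \<partial>lborel)"
proof -
 obtain K where K': "compact K" "K \<subseteq> UNIV" "!!x. x \<notin> K ==> ph x = 0" "!!x e. x \<notin> K ==> pd ph e x = 0"
 using C1c_support[OF assms(1)] by blast
 note K = K'(1,3)
 have I: "integrable lborel ph"
 by (rule square_integrable_compact_support(2)[OF C1c_continuous[OF assms(1)] K])
 have "(\<integral>x. ph x \<partial>lborel) ~= 0"
 proof
 assume "(\<integral>x. ph x \<partial>lborel) = 0"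
 then have "AE x in lborel. ph x = 0"
  using I assms(2) by (subst (asm) integral_nonneg_eq_0_iff_AE) auto
 then have ae: "AE x in lborel. x \<notin> {x. 0 < ph x}" by eventually_elim auto
 have op: "open {x. 0 < ph x}"
  using C1c_continuous[OF assms(1)] by (intro open_Collect_less) auto
 have "{x. 0 < ph x} \<in> null_sets lborel"
  by (subst AE_iff_null_sets) (use ae op in auto)
 then have "{x. 0 < ph x} = {}" using op
  by (metis negligible_iff_null_sets null_sets_completionI open_not_negligible)
 then show False using assms(3) by blast
 qed
 moreover have "0 <= (\<integral>x. ph x \<partial>lborel)" using assms(2) by simp
 ultimately show ?thesis by linarith
qed

text \<open>Differentiation under the integral by dominated convergence; near a given point the
  kernels live in one ball, and \<open>f\<close> is integrable there. The factor \<open>a\<close>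
  occurs because the mollifier below contracts its argument by \<open>1 - l\<close> before
  averaging.\<close>

lemma convolution_has_derivative:
 fixes a :: real
 assumes f: "sqint lborel f" and \<kappa>: "\<kappa> \<in> C1c UNIV"
 defines "W \<equiv> %x. \<integral>y. f y * \<kappa> (y - a *\<^sub>R x) \<partial>lborel"
 defines "D \<equiv> %x h. - a * (\<integral>y. f y * pd \<kappa> h (y - a *\<^sub>R x) \<partial>lborel)"
 shows "(W has_derivative D x) (at x)" "continuous_on UNIV (%x. D x e)"
proof -
 obtain K where K': "compact K" "K \<subseteq> UNIV" "!!x. x \<notin> K ==> \<kappa> x = 0" "!!x e. x \<notin> K ==> pd \<kappa> e x = 0"
 using C1c_support[OF \<kappa>] by blast
 note K = K'(1,3,4)
 obtain B where B: "B >= 0" "!!x h. \<bar>pd \<kappa> h x\<bar> <= B * norm h" "!!x y. \<bar>\<kappa> x - \<kappa> y\<bar> <= B * norm (x - y)"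
 using C1c_Lipschitz[OF \<kappa>] by blast
 obtain R where R: "K \<subseteq> cball 0 R" using compact_imp_bounded[OF K(1)] unfolding bounded_iff by (metis mem_cball_0 subsetI)
 have R': "\<kappa> v = 0" "pd \<kappa> h v = 0" if "norm v > R" for v h
 proof -
 have "v \<notin> K" using R that by (metis mem_cball_0 not_le subsetD)
 then show "\<kappa> v = 0" "pd \<kappa> h v = 0" using K(2,3) by blast+
 qed
 have fm[measurable]: "f \<in> bmeas" using square_integrableD(1)[OF f] by simp
 note [measurable] = C1c_measurable[OF \<kappa>]
 have loc: "integrable lborel (%y. \<bar>f y\<bar> * (ind (cball z r) y * c))" for z r c
 proof -
 have "integrable lborel (%x. ind (cball z r) x *\<^sub>R c\<^sup>2)" by (rule borel_integrable_compact) auto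
 also have "(%x. ind (cball z r) x *\<^sub>R c\<^sup>2) = (%x. (ind (cball z r) x * c)^2)"
  by (auto simp: indicator_def)
 finally have "sqint lborel (%y. ind (cball z r) y * c)"
  unfolding square_integrable_def by (intro conjI borel_measurable_times borel_measurable_indicator) auto
 moreover have "sqint lborel (%y. \<bar>f y\<bar>)" using f by (simp add: square_integrable_def)
 ultimately show ?thesis by (intro square_integrable_mult_integrable)
 qed
 have I: "integrable lborel (%y. f y * g (y - z))"
 if g: "continuous_on UNIV g" "!!x. x \<notin> K ==> g x = 0" for g z
 proof (rule square_integrable_mult_integrable[OF f])
 show "sqint lborel (%y. g (y - z))"
 proof (rule square_integrable_compact_support(1))
  show "continuous_on UNIV (%y. g (y - z))"
  by (rule continuous_on_compose2[OF g(1)]) (auto intro!: continuous_intros)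
  show "compact ((+) z ` K)" by (rule compact_translation[OF K(1)])
  fix y assume y: "y \<notin> (+) z ` K"
  have "y - z \<notin> K"
  proof
  assume "y - z \<in> K"
  then have "z + (y - z) \<in> (+) z ` K" by blast
  with y show False by simp
  qed
  then show "g (y - z) = 0" by (rule g(2))
 qed
 qed
 have IK: "integrable lborel (%y. f y * \<kappa> (y - z))" "integrable lborel (%y. f y * pd \<kappa> h (y - z))" for z h
 using I[OF C1c_continuous[OF \<kappa>] K(2)] I[OF C1c_pd_continuous[OF \<kappa>] K(3)] by auto
 have lin: "linear (%h. pd \<kappa> h v)" for v by (rule has_derivative_linear[OF C1c_has_derivative[OF \<kappa>]])
 have D: "linear (D x)" for x
 unfolding D_def
 by (rule linearI)
  (auto simp: linear_add[OF lin] linear_scale[OF lin] distrib_left mult.left_commute[of "f _"] IK)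
 show "(W has_derivative D x) (at x)"
 unfolding has_derivative_at
 proof (intro conjI)
 show "bounded_linear (D x)" using D linear_conv_bounded_linear by blast
 show "(%h. norm (W (x + h) - W x - D x h) / norm h) \<midarrow>0\<rightarrow> 0"
  unfolding tendsto_at_iff_sequentially
 proof (intro allI impI)
  fix X :: "nat => plane"
  assume X: "\<forall>i. X i \<in> UNIV - {0}" "X ----> 0"
  obtain c where c: "!!n. norm (X n) <= c"
  using convergent_imp_bounded[OF X(2)] by (auto simp: bounded_iff)
  define r where "r n y = (\<kappa> (y - a *\<^sub>R (x + X n)) - \<kappa> (y - a *\<^sub>R x) + a * pd \<kappa> (X n) (y - a *\<^sub>R x)) / norm (X n)" for n y
  have [measurable]: "r n \<in> bmeas" for n unfolding r_def by measurable
  have c0: "c >= 0" using c[of 0] norm_ge_zero order_trans by blast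
  have "(%n. \<integral>y. f y * r n y \<partial>lborel) ----> (\<integral>y. 0 \<partial>(lborel :: plane measure))"
  proof (rule integral_dominated_convergence[where w = "%y. \<bar>f y\<bar> * (ind (cball (a *\<^sub>R x) (\<bar>R\<bar> + \<bar>a\<bar> * c)) y * (2 * B * \<bar>a\<bar>))"])
  show "AE y in lborel. (%n. f y * r n y) ----> 0"
  proof (rule AE_I2)
   fix y
   have "((%h. \<kappa> (y - a *\<^sub>R (x + h))) has_derivative (%h. pd \<kappa> (- (a *\<^sub>R h)) (y - a *\<^sub>R x))) (at 0)"
   by (rule has_derivative_compose[of "%h. y - a *\<^sub>R (x + h)" "%h. - (a *\<^sub>R h)" 0 UNIV \<kappa>])
    (auto intro!: derivative_eq_intros C1c_has_derivative[OF \<kappa>, of "y - a *\<^sub>R x"])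
   moreover have "pd \<kappa> (- (a *\<^sub>R h)) v = - a * pd \<kappa> h v" for h v
   using linear_scale[OF lin[of v], of "- a" h] by simp
   ultimately have "(%h. norm (\<kappa> (y - a *\<^sub>R (x + (0 + h))) - \<kappa> (y - a *\<^sub>R (x + 0)) - (- a * pd \<kappa> h (y - a *\<^sub>R x))) / norm h) \<midarrow>0\<rightarrow> 0"
   unfolding has_derivative_at by simp
   from this[unfolded tendsto_at_iff_sequentially, rule_format, OF X(1)[rule_format] X(2)]
   have "(%n. norm (r n y)) ----> 0"
   by (simp add: o_def r_def)
   then have "(%n. r n y) ----> 0" by (rule tendsto_norm_zero_cancel)
   then show "(%n. f y * r n y) ----> 0" by (rule tendsto_mult_right_zero)
  qed
  show "AE y in lborel. norm (f y * r n y) <= \<bar>f y\<bar> * (ind (cball (a *\<^sub>R x) (\<bar>R\<bar> + \<bar>a\<bar> * c)) y * (2 * B * \<bar>a\<bar>))" for n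
  proof (rule AE_I2)
   fix y
   have Xn: "norm (X n) > 0" using X(1) by simp
   have "\<bar>\<kappa> (y - a *\<^sub>R (x + X n)) - \<kappa> (y - a *\<^sub>R x)\<bar> <= B * (\<bar>a\<bar> * norm (X n))"
   using B(3)[of "y - a *\<^sub>R (x + X n)" "y - a *\<^sub>R x"] by (simp add: algebra_simps)
   moreover have "\<bar>a * pd \<kappa> (X n) (y - a *\<^sub>R x)\<bar> <= \<bar>a\<bar> * (B * norm (X n))"
   unfolding abs_mult using B(2) by (intro mult_left_mono) auto
   ultimately have "\<bar>\<kappa> (y - a *\<^sub>R (x + X n)) - \<kappa> (y - a *\<^sub>R x) + a * pd \<kappa> (X n) (y - a *\<^sub>R x)\<bar> <= 2 * B * \<bar>a\<bar> * norm (X n)"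
   by (simp add: mult_ac)
   then have 1: "\<bar>r n y\<bar> <= 2 * B * \<bar>a\<bar>" using Xn by (simp add: r_def field_simps)
   have 2: "r n y = 0" if "y \<notin> cball (a *\<^sub>R x) (\<bar>R\<bar> + \<bar>a\<bar> * c)"
   proof -
   have y: "norm (y - a *\<^sub>R x) > \<bar>R\<bar> + \<bar>a\<bar> * c" using that by (simp add: dist_norm norm_minus_commute)
   have "\<bar>a\<bar> * norm (X n) <= \<bar>a\<bar> * c" using c by (intro mult_left_mono) auto
   moreover have "norm (y - a *\<^sub>R x) <= norm (y - a *\<^sub>R (x + X n)) + \<bar>a\<bar> * norm (X n)"
    using norm_triangle_ineq[of "y - a *\<^sub>R (x + X n)" "a *\<^sub>R X n"] by (simp add: algebra_simps)
   ultimately have "norm (y - a *\<^sub>R (x + X n)) > R" using y by linarith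
   moreover have "0 <= \<bar>a\<bar> * c" using c0 by simp
   then have "norm (y - a *\<^sub>R x) > R" using y by linarith
   ultimately show ?thesis by (simp add: r_def R')
   qed
   show "norm (f y * r n y) <= \<bar>f y\<bar> * (ind (cball (a *\<^sub>R x) (\<bar>R\<bar> + \<bar>a\<bar> * c)) y * (2 * B * \<bar>a\<bar>))"
   unfolding real_norm_def abs_mult using 1 2
   by (intro mult_left_mono) (auto simp: indicator_def)
  qed
  qed (use loc in measurable)
  moreover have "(\<integral>y. f y * r n y \<partial>lborel) = (W (x + X n) - W x - D x (X n)) / norm (X n)" for n
  proof -
  have "(%y. f y * r n y) = (%y. (f y * \<kappa> (y - a *\<^sub>R (x + X n)) - f y * \<kappa> (y - a *\<^sub>R x) + a * (f y * pd \<kappa> (X n) (y - a *\<^sub>R x))) / norm (X n))"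
   by (auto simp: r_def field_simps)
  then show ?thesis using IK by (simp add: W_def D_def)
  qed
  ultimately have "(%n. (W (x + X n) - W x - D x (X n)) / norm (X n)) ----> 0" by simp
  then have "(%n. \<bar>(W (x + X n) - W x - D x (X n)) / norm (X n)\<bar>) ----> 0" by (rule tendsto_rabs_zero)
  then show "((%h. norm (W (x + h) - W x - D x h) / norm h) \<circ> X) ----> 0"
  by (simp add: o_def abs_divide)
 qed
 qed
 show "continuous_on UNIV (%x. D x e)"
 proof (intro continuous_at_imp_continuous_on ballI)
 fix x :: plane
 show "isCont (%x. D x e) x"
  unfolding continuous_at_sequentially
 proof (intro allI impI)
  fix X :: "nat => plane" assume X: "X ----> x"
  obtain c where c: "!!n. norm (X n) <= c"
  using convergent_imp_bounded[OF X] by (auto simp: bounded_iff)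
  have "(%n. \<integral>y. f y * pd \<kappa> e (y - a *\<^sub>R X n) \<partial>lborel) ----> (\<integral>y. f y * pd \<kappa> e (y - a *\<^sub>R x) \<partial>lborel)"
  proof (rule integral_dominated_convergence[where w = "%y. \<bar>f y\<bar> * (ind (cball 0 (\<bar>R\<bar> + \<bar>a\<bar> * c)) y * (B * norm e))"])
  show "AE y in lborel. (%n. f y * pd \<kappa> e (y - a *\<^sub>R X n)) ----> f y * pd \<kappa> e (y - a *\<^sub>R x)"
  proof (intro AE_I2 tendsto_intros)
   fix y
   have "isCont (pd \<kappa> e) (y - a *\<^sub>R x)"
   using C1c_pd_continuous[OF \<kappa>] continuous_on_eq_continuous_at open_UNIV by blast
   then show "(%n. pd \<kappa> e (y - a *\<^sub>R X n)) ----> pd \<kappa> e (y - a *\<^sub>R x)"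
   by (rule isCont_tendsto_compose) (intro tendsto_intros X)
  qed
  show "AE y in lborel. norm (f y * pd \<kappa> e (y - a *\<^sub>R X n)) <= \<bar>f y\<bar> * (ind (cball 0 (\<bar>R\<bar> + \<bar>a\<bar> * c)) y * (B * norm e))" for n
  proof (rule AE_I2)
   fix y
   have 2: "pd \<kappa> e (y - a *\<^sub>R X n) = 0" if "y \<notin> cball 0 (\<bar>R\<bar> + \<bar>a\<bar> * c)"
   proof (rule R'(2))
   have "\<bar>a\<bar> * norm (X n) <= \<bar>a\<bar> * c" using c by (intro mult_left_mono) auto
   moreover have "norm y <= norm (y - a *\<^sub>R X n) + \<bar>a\<bar> * norm (X n)"
    using norm_triangle_ineq[of "y - a *\<^sub>R X n" "a *\<^sub>R X n"] by simp
   ultimately show "R < norm (y - a *\<^sub>R X n)" using that by simp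
   qed
   show "norm (f y * pd \<kappa> e (y - a *\<^sub>R X n)) <= \<bar>f y\<bar> * (ind (cball 0 (\<bar>R\<bar> + \<bar>a\<bar> * c)) y * (B * norm e))"
   unfolding real_norm_def abs_mult using B(2)[of "y - a *\<^sub>R X n" e] 2
   by (intro mult_left_mono) (auto simp: indicator_def)
  qed
  qed (use loc in measurable)
  then show "((%x. D x e) \<circ> X) ----> D x e"
  unfolding D_def o_def by (intro tendsto_intros)
 qed
 qed
qed

section \<open>Affine substitutions in the plane\<close>

lemma nn_integral_plane_affine:
 fixes F :: "plane => ennreal"
 assumes [measurable]: "F \<in> bmeas" and c: "c ~= 0"
 shows "(\<integral>\<^sup>+y. F y \<partial>lborel) = ennreal (c^2) * (\<integral>\<^sup>+z. F (t + c *\<^sub>R z) \<partial>lborel)"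
 by (subst lborel_affine[OF c, of t])
 (simp add: nn_integral_density nn_integral_distr nn_integral_cmult power2_eq_square)

lemma integral_plane_affine:
 fixes F :: "plane => real"
 assumes [measurable]: "F \<in> bmeas" and c: "c ~= 0"
 shows "(\<integral>y. F y \<partial>lborel) = c^2 * (\<integral>z. F (t + c *\<^sub>R z) \<partial>lborel)"
proof -
 have "(\<integral>y. F y \<partial>lborel) = (\<integral>y. F y \<partial>density (distr lborel borel (%x. t + c *\<^sub>R x)) (%_. ennreal (c^2)))"
 by (subst lborel_affine[OF c, of t]) (simp add: power2_eq_square)
 also have "... = c^2 * (\<integral>z. F (t + c *\<^sub>R z) \<partial>lborel)"
 by (subst integral_density) (auto simp: integral_distr)
 finally show ?thesis .
qed

lemma square_integrable_plane_affine:
 fixes f :: "plane => real"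
 assumes f: "sqint lborel f" and c: "c ~= 0"
 shows "sqint lborel (%z. f (t + c *\<^sub>R z))"
proof -
 have [measurable]: "f \<in> bmeas" using square_integrableD(1)[OF f] by simp
 have "ennreal (c^2) * (\<integral>\<^sup>+z. ennreal ((f (t + c *\<^sub>R z))^2) \<partial>lborel) = (\<integral>\<^sup>+y. ennreal ((f y)^2) \<partial>lborel)"
 by (rule nn_integral_plane_affine[OF _ c, symmetric]) measurable
 also have "... < \<infinity>" using nn_integral_square[OF square_integrableD(2)[OF f]] by simp
 finally have "(\<integral>\<^sup>+z. ennreal ((f (t + c *\<^sub>R z))^2) \<partial>lborel) < \<infinity>"
 using c by (auto simp: ennreal_mult_less_top ennreal_mult_eq_top_iff)
 then have "integrable lborel (%z. (f (t + c *\<^sub>R z))^2)" by (intro integrableI_bounded) auto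
 then show ?thesis by (simp add: square_integrable_def)
qed

section \<open>Mollification by contraction towards an interior point\<close>

definition bump_mass :: real where "bump_mass = (\<integral>z. bump z \<partial>lborel)"

lemma bump_mass_pos: "bump_mass > 0"
 unfolding bump_mass_def
 by (rule integral_C1c_pos[OF bump_C1c, of 0]) (auto simp: bump_bounds bump_def)

text \<open>The average of \<open>f\<close> over the ball of radius \<open>l * rh\<close> around \<open>(1 - l) x + l p\<close>: if \<open>S\<close> is convex
 and contains the \<open>rh\<close>-ball around \<open>p\<close>, then for \<open>x \<in> S\<close> this ball lies in \<open>S\<close>.\<close>

definition mollify :: "plane => real => real => (plane => real) => plane => real" where
 "mollify p rh l f x = (\<integral>z. f (((1 - l) *\<^sub>R x + l *\<^sub>R p) + (l * rh) *\<^sub>R z) * bump z \<partial>lborel) / bump_mass"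

text \<open>The kernel obtained when the averaging variable is replaced by the point
  \<open>y\<close> at which \<open>f\<close> is evaluated; in this form the derivatives of a
  mollification fall on a smooth factor.\<close>

definition mollify_kernel :: "plane => real => real => plane => real" where
 "mollify_kernel p rh l v = bump ((1 / (l * rh)) *\<^sub>R (v - l *\<^sub>R p)) / (bump_mass * (l * rh)^2)"

lemma bump_measurable [measurable]: "bump \<in> bmeas"
 using C1c_measurable(1)[OF bump_C1c] .

lemma sqrt_bump: "sqint lborel (%z :: plane. max 0 (1 - inner z z))"
proof (rule square_integrable_compact_support(1)[of _ "cball 0 1"])
 fix z :: plane assume "z \<notin> cball 0 1"
 then have "bump z = 0" using bump_bounds(3)[of z] by auto
 then show "max 0 (1 - inner z z) = 0" by (simp add: bump_def)
qed (auto intro!: continuous_intros)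

lemma integrable_mult_bump:
 assumes "sqint lborel g"
 shows "integrable lborel (%z. g z * bump z)" "integrable lborel (%z. (g z)^2 * bump z)"
proof -
 show "integrable lborel (%z. g z * bump z)"
 by (rule square_integrable_mult_integrable[OF assms C1c_square_integrable(1)[OF bump_C1c]])
 have [measurable]: "g \<in> bmeas" using square_integrableD(1)[OF assms] by simp
 show "integrable lborel (%z. (g z)^2 * bump z)"
 proof (rule Bochner_Integration.integrable_bound[OF square_integrableD(2)[OF assms]])
 show "AE z in lborel. norm ((g z)^2 * bump z) <= norm ((g z)^2)"
 proof (rule AE_I2)
  fix z
  have "(g z)^2 * bump z <= (g z)^2 * 1" using bump_bounds(2) by (intro mult_left_mono) auto
  then show "norm ((g z)^2 * bump z) <= norm ((g z)^2)" using bump_bounds(1)[of z] by simp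
 qed
 qed measurable
qed

text \<open>Jensen's inequality for the probability density \<open>bump / bump_mass\<close>,
  obtained from Cauchy-Schwarz by splitting \<open>bump\<close> into its two square roots.\<close>

lemma bump_Jensen:
 assumes "sqint lborel g"
 shows "((\<integral>z. g z * bump z \<partial>lborel) / bump_mass)^2 <= (\<integral>z. (g z)^2 * bump z \<partial>lborel) / bump_mass"
proof -
 let ?s = "%z :: plane. max 0 (1 - inner z z)"
 have [measurable]: "?s \<in> bmeas" using square_integrableD(1)[OF sqrt_bump] by simp
 have gs: "sqint lborel (%z. ?s z * g z)"
 by (rule square_integrable_bounded_mult[OF assms, where B = 1]) auto
 have "(\<integral>z. (?s z * g z) * ?s z \<partial>lborel)^2 <= (\<integral>z. (?s z * g z)^2 \<partial>lborel) * (\<integral>z. (?s z)^2 \<partial>lborel)"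
 by (rule square_integrable_Cauchy_Schwarz[OF gs sqrt_bump])
 also have "(%z. (?s z * g z) * ?s z) = (%z. g z * bump z)" by (auto simp: bump_def power2_eq_square)
 also have "(%z. (?s z * g z)^2) = (%z. (g z)^2 * bump z)" by (auto simp: bump_def power_mult_distrib)
 also have "(\<integral>z. (?s z)^2 \<partial>lborel) = bump_mass" by (simp add: bump_def bump_mass_def)
 finally show ?thesis using bump_mass_pos by (simp add: power_divide field_simps power2_eq_square)
qed

lemma mollify_measurable:
 assumes [measurable]: "f \<in> bmeas"
 shows "mollify p rh l f \<in> bmeas"
proof -
 have "(%x. \<integral>z. f (((1 - l) *\<^sub>R x + l *\<^sub>R p) + (l * rh) *\<^sub>R z) * bump z \<partial>lborel) \<in> bmeas"
 by (rule lborel.borel_measurable_lebesgue_integral) measurable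
 then show ?thesis unfolding mollify_def[abs_def] by measurable
qed

text \<open>By Jensen and Fubini it suffices to fix the averaging variable; what remains is an
  affine substitution with factor \<open>1 - l >= 1/2\<close>, whose Jacobian costs at most
  4.\<close>

lemma mollify_bound:
 assumes f: "sqint lborel f" and l: "0 < l" "l <= 1/2" and rh: "rh > 0"
 shows "sqint lborel (mollify p rh l f)"
 and "(\<integral>x. (mollify p rh l f x)^2 \<partial>lborel) <= 4 * (\<integral>x. (f x)^2 \<partial>lborel)"
proof -
 have [measurable]: "f \<in> bmeas" using square_integrableD(1)[OF f] by simp
 note [measurable] = mollify_measurable
 let ?A = "%x z. ((1 - l) *\<^sub>R x + l *\<^sub>R p) + (l * rh) *\<^sub>R z"
 have c: "l * rh ~= 0" "1 - l ~= 0" using l rh by auto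
 have "(\<integral>\<^sup>+x. ennreal ((mollify p rh l f x)^2) \<partial>lborel)
  <= (\<integral>\<^sup>+x. \<integral>\<^sup>+z. ennreal ((f (?A x z))^2 * bump z / bump_mass) \<partial>lborel \<partial>lborel)"
 proof (rule nn_integral_mono)
 fix x
 have g: "sqint lborel (%z. f (?A x z))" by (rule square_integrable_plane_affine[OF f c(1)])
 have "(mollify p rh l f x)^2 <= (\<integral>z. (f (?A x z))^2 * bump z \<partial>lborel) / bump_mass"
  unfolding mollify_def by (rule bump_Jensen[OF g])
 also have "... = (\<integral>z. (f (?A x z))^2 * bump z / bump_mass \<partial>lborel)" by simp
 finally have "ennreal ((mollify p rh l f x)^2) <= ennreal (\<integral>z. (f (?A x z))^2 * bump z / bump_mass \<partial>lborel)"
  by (rule ennreal_leI)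
 also have "... = (\<integral>\<^sup>+z. ennreal ((f (?A x z))^2 * bump z / bump_mass) \<partial>lborel)"
  using integrable_mult_bump(2)[OF g] bump_mass_pos bump_bounds(1)
  by (intro nn_integral_eq_integral[symmetric]) auto
 finally show "ennreal ((mollify p rh l f x)^2) <= (\<integral>\<^sup>+z. ennreal ((f (?A x z))^2 * bump z / bump_mass) \<partial>lborel)" .
 qed
 also have "... = (\<integral>\<^sup>+z. \<integral>\<^sup>+x. ennreal ((f (?A x z))^2 * bump z / bump_mass) \<partial>lborel \<partial>lborel)"
 by (rule lborel_pair.Fubini'[symmetric]) measurable
 also have "... = (\<integral>\<^sup>+z. ennreal (bump z / bump_mass) * ((\<integral>\<^sup>+x. ennreal ((f x)^2) \<partial>lborel) / ennreal ((1 - l)^2)) \<partial>lborel)"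
 proof (rule nn_integral_cong)
 fix z
 have "(\<integral>\<^sup>+x. ennreal ((f (?A x z))^2 * bump z / bump_mass) \<partial>lborel)
  = (\<integral>\<^sup>+x. ennreal (bump z / bump_mass) * ennreal ((f ((l *\<^sub>R p + (l * rh) *\<^sub>R z) + (1 - l) *\<^sub>R x))^2) \<partial>lborel)"
  using bump_mass_pos bump_bounds(1)
  by (intro nn_integral_cong) (simp add: ennreal_mult[symmetric] algebra_simps)
 also have "... = ennreal (bump z / bump_mass) * (\<integral>\<^sup>+x. ennreal ((f ((l *\<^sub>R p + (l * rh) *\<^sub>R z) + (1 - l) *\<^sub>R x))^2) \<partial>lborel)"
  by (rule nn_integral_cmult) measurable
 also have "(\<integral>\<^sup>+x. ennreal ((f ((l *\<^sub>R p + (l * rh) *\<^sub>R z) + (1 - l) *\<^sub>R x))^2) \<partial>lborel)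
  = (\<integral>\<^sup>+x. ennreal ((f x)^2) \<partial>lborel) / ennreal ((1 - l)^2)"
  using c(2)
  by (subst nn_integral_plane_affine[OF _ c(2), of "%y. ennreal ((f y)^2)" "l *\<^sub>R p + (l * rh) *\<^sub>R z"],
   simp, subst mult.commute, subst ennreal_mult_divide_eq) auto
 finally show "(\<integral>\<^sup>+x. ennreal ((f (?A x z))^2 * bump z / bump_mass) \<partial>lborel)
  = ennreal (bump z / bump_mass) * ((\<integral>\<^sup>+x. ennreal ((f x)^2) \<partial>lborel) / ennreal ((1 - l)^2))" .
 qed
 also have "... = (\<integral>\<^sup>+z. ennreal (bump z / bump_mass) \<partial>lborel) * ((\<integral>\<^sup>+x. ennreal ((f x)^2) \<partial>lborel) / ennreal ((1 - l)^2))"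
 by (rule nn_integral_multc) measurable
 also have "(\<integral>\<^sup>+z. ennreal (bump z / bump_mass) \<partial>lborel) = 1"
 proof -
 have i: "integrable lborel bump"
  by (rule square_integrable_compact_support(2)[of _ "cball 0 1"])
  (use C1c_continuous[OF bump_C1c] bump_bounds(3) in auto)
 then have "(\<integral>\<^sup>+z. ennreal (bump z / bump_mass) \<partial>lborel) = ennreal (\<integral>z. bump z / bump_mass \<partial>lborel)"
  using bump_mass_pos bump_bounds(1) by (intro nn_integral_eq_integral) auto
 also have "(\<integral>z. bump z / bump_mass \<partial>lborel) = 1" using bump_mass_pos by (simp add: bump_mass_def)
 finally show ?thesis by simp
 qed
 also have "1 * ((\<integral>\<^sup>+x. ennreal ((f x)^2) \<partial>lborel) / ennreal ((1 - l)^2)) = ennreal ((\<integral>x. (f x)^2 \<partial>lborel) / (1 - l)^2)"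
 using c(2) by (simp add: nn_integral_square[OF square_integrableD(2)[OF f]] divide_ennreal)
 also have "... <= ennreal (4 * (\<integral>x. (f x)^2 \<partial>lborel))"
 proof (rule ennreal_leI)
 have "(1/2)^2 <= (1 - l)^2" using l by (intro power_mono) auto
 then have "(\<integral>x. (f x)^2 \<partial>lborel) / (1 - l)^2 <= (\<integral>x. (f x)^2 \<partial>lborel) / (1/2)^2"
  using c(2) by (intro divide_left_mono) auto
 then show "(\<integral>x. (f x)^2 \<partial>lborel) / (1 - l)^2 <= 4 * (\<integral>x. (f x)^2 \<partial>lborel)" by (simp add: power2_eq_square)
 qed
 finally have *: "(\<integral>\<^sup>+x. ennreal ((mollify p rh l f x)^2) \<partial>lborel) <= ennreal (4 * (\<integral>x. (f x)^2 \<partial>lborel))" .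
 have i: "integrable lborel (%x. (mollify p rh l f x)^2)"
 by (rule integrableI_bounded) (use * in \<open>auto intro: le_less_trans\<close>)
 then show "sqint lborel (mollify p rh l f)" by (simp add: square_integrable_def mollify_measurable)
 show "(\<integral>x. (mollify p rh l f x)^2 \<partial>lborel) <= 4 * (\<integral>x. (f x)^2 \<partial>lborel)"
 using * by (subst (asm) nn_integral_square[OF i]) simp
qed

lemma mollify_diff:
 assumes "sqint lborel f" "sqint lborel g" "l > 0" "rh > 0"
 shows "mollify p rh l (%x. f x - g x) x = mollify p rh l f x - mollify p rh l g x"
proof -
 have c: "l * rh ~= 0" using assms by simp
 note I = integrable_mult_bump(1)[OF square_integrable_plane_affine[OF _ c]]
 show ?thesis
 unfolding mollify_def left_diff_distrib diff_divide_distrib[symmetric]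
 by (subst Bochner_Integration.integral_diff[OF I[OF assms(1)] I[OF assms(2)]]) simp
qed

lemma mollify_converges_continuous:
 assumes g: "continuous_on UNIV g" "compact K" "!!x. x \<notin> K ==> g x = 0" and rh: "rh > 0"
 shows "(%n. \<integral>x. (mollify p rh (1 / (real n + 2)) g x - g x)^2 \<partial>lborel) ----> 0"
proof -
 define l where "l n = 1 / (real n + 2)" for n
 have l: "0 < l n" "l n <= 1/2" for n by (auto simp: l_def field_simps)
 have l0: "l ----> 0" unfolding l_def by real_asymp
 obtain B where B: "!!x. \<bar>g x\<bar> <= B" using square_integrable_compact_support(3)[OF g] by blast
 have B0: "B >= 0" using B[of 0] by linarith
 obtain R where R: "K \<subseteq> cball 0 R" and R0: "R > 0"
 using compact_imp_bounded[OF g(2)] unfolding bounded_pos by (metis mem_cball_0 subsetI)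
 have gm[measurable]: "g \<in> bmeas" by (rule borel_measurable_continuous_onI[OF g(1)])
 note [measurable] = mollify_measurable
 let ?A = "%n x z. ((1 - l n) *\<^sub>R x + l n *\<^sub>R p) + (l n * rh) *\<^sub>R z"
 have ib: "integrable lborel bump"
 by (rule square_integrable_compact_support(2)[of _ "cball 0 1"])
  (use C1c_continuous[OF bump_C1c] bump_bounds(3) in auto)
 have pw: "(%n. mollify p rh (l n) g x) ----> g x" for x
 proof -
 have "(%n. \<integral>z. g (?A n x z) * bump z \<partial>lborel) ----> (\<integral>z. g x * bump z \<partial>lborel)"
 proof (rule integral_dominated_convergence[where w = "%z. B * bump z"])
  show "AE z in lborel. (%n. g (?A n x z) * bump z) ----> g x * bump z"
  proof (intro AE_I2 tendsto_intros)
  fix z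
  have "(%n. ?A n x z) ----> ((1 - 0) *\<^sub>R x + 0 *\<^sub>R p) + (0 * rh) *\<^sub>R z"
   by (intro tendsto_intros l0)
  then have "(%n. ?A n x z) ----> x" by simp
  moreover have "isCont g x" using g(1) continuous_on_eq_continuous_at open_UNIV by blast
  ultimately show "(%n. g (?A n x z)) ----> g x" by (rule isCont_tendsto_compose[rotated])
  qed
  show "AE z in lborel. norm (g (?A n x z) * bump z) <= B * bump z" for n
  using B bump_bounds(1) by (intro AE_I2) (simp add: abs_mult mult_right_mono)
 qed (use ib in \<open>auto intro!: integrable_mult_right\<close>)
 then have "(%n. (\<integral>z. g (?A n x z) * bump z \<partial>lborel) / bump_mass) ----> (\<integral>z. g x * bump z \<partial>lborel) / bump_mass"
  using bump_mass_pos by (intro tendsto_intros) auto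
 then show ?thesis using bump_mass_pos by (simp add: mollify_def bump_mass_def)
 qed
 have bd: "\<bar>mollify p rh (l n) g x\<bar> <= B" for n x
 proof -
 have "\<bar>\<integral>z. g (?A n x z) * bump z \<partial>lborel\<bar> <= (\<integral>z. B * bump z \<partial>lborel)"
 proof (rule order_trans[OF integral_abs_bound], rule integral_mono)
  have "\<bar>g (?A n x z) * bump z\<bar> <= B * bump z" for z
  using B bump_bounds(1) by (simp add: abs_mult mult_right_mono)
  then show "!!z. \<bar>g (?A n x z) * bump z\<bar> <= B * bump z" .
  show "integrable lborel (%z. \<bar>g (?A n x z) * bump z\<bar>)"
  using square_integrable_compact_support(1)[OF g] l(1)[of n] rh
  by (intro integrable_abs integrable_mult_bump(1) square_integrable_plane_affine) auto
 qed (use ib in auto)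
 then show ?thesis using bump_mass_pos by (simp add: mollify_def bump_mass_def abs_divide field_simps)
 qed
 \<comment> \<open>For \<open>l <= 1/2\<close> the averaging points have norm at least
   \<open>norm x / 2 - norm p - rh\<close>, so one ball contains the supports of all
   mollifications.\<close>
 define R' where "R' = 2 * (R + norm p + rh)"
 have sup: "mollify p rh (l n) g x = 0" "g x = 0" if x: "x \<notin> cball 0 R'" for n x
 proof -
 have xR: "norm x > 2 * (R + norm p + rh)" using x by (simp add: R'_def)
 have "norm x > R" using xR R0 rh norm_ge_zero[of p] by argo
 then have "x \<notin> cball 0 R" by simp
 then show "g x = 0" using g(3) R by blast
 have "g (?A n x z) * bump z = 0" for z
 proof (cases "norm z < 1")
  case True
  have "(1/2) * norm x <= (1 - l n) * norm x" using l[of n] by (intro mult_right_mono) auto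
  moreover have "norm ((1 - l n) *\<^sub>R x) = (1 - l n) * norm x" using l[of n] by simp
  moreover have "norm (l n *\<^sub>R p) <= 1 * norm p"
  unfolding norm_scaleR using l[of n] by (intro mult_right_mono) auto
  moreover have "norm ((l n * rh) *\<^sub>R z) <= (1 * rh) * 1"
  unfolding norm_scaleR using l[of n] rh True by (intro mult_mono) (auto simp: abs_mult intro!: mult_right_mono)
  moreover have "norm ((1 - l n) *\<^sub>R x) <= norm (?A n x z) + norm (l n *\<^sub>R p) + norm ((l n * rh) *\<^sub>R z)"
  using norm_triangle_ineq4[of "?A n x z" "l n *\<^sub>R p + (l n * rh) *\<^sub>R z"]
   norm_triangle_ineq[of "l n *\<^sub>R p" "(l n * rh) *\<^sub>R z"] by (simp add: algebra_simps)
  ultimately have "norm (?A n x z) > R" using xR R0 by argo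
  then have "?A n x z \<notin> cball 0 R" by simp
  then have "?A n x z \<notin> K" using R by blast
  then show ?thesis using g(3) by simp
 next
  case False
  then show ?thesis using bump_bounds(3)[of z] by simp
 qed
 then show "mollify p rh (l n) g x = 0"
  unfolding mollify_def by (simp only: Bochner_Integration.integral_zero div_0)
 qed
 have "(%n. \<integral>x. (mollify p rh (l n) g x - g x)^2 \<partial>lborel) ----> (\<integral>x. 0 \<partial>(lborel :: plane measure))"
 proof (rule integral_dominated_convergence[where w = "%x. ind (cball 0 R') x *\<^sub>R (2 * B)\<^sup>2"])
 show "AE x in lborel. (%n. (mollify p rh (l n) g x - g x)^2) ----> 0"
 proof (rule AE_I2)
  fix x
  have "(%n. (mollify p rh (l n) g x - g x)^2) ----> (g x - g x)^2" by (intro tendsto_intros pw)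
  then show "(%n. (mollify p rh (l n) g x - g x)^2) ----> 0" by simp
 qed
 show "AE x in lborel. norm ((mollify p rh (l n) g x - g x)^2) <= ind (cball 0 R') x *\<^sub>R (2 * B)\<^sup>2" for n
 proof (rule AE_I2)
  fix x
  have "\<bar>mollify p rh (l n) g x - g x\<bar> <= 2 * B" using bd[of n x] B[of x] by linarith
  then have "\<bar>mollify p rh (l n) g x - g x\<bar>\<^sup>2 <= (2 * B)^2" by (intro power_mono) auto
  then show "norm ((mollify p rh (l n) g x - g x)^2) <= ind (cball 0 R') x *\<^sub>R (2 * B)\<^sup>2"
  using sup(1)[of x n] sup(2)[of x] by (cases "x \<in> cball 0 R'") auto
 qed
 show "integrable lborel (%x. ind (cball 0 R') x *\<^sub>R (2 * B)\<^sup>2)"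
  by (rule borel_integrable_compact) auto
 qed measurable
 then show ?thesis by (simp add: l_def)
qed

lemma mollify_converges:
 assumes f: "sqint lborel f" and rh: "rh > 0"
 shows "(%n. \<integral>x. (mollify p rh (1 / (real n + 2)) f x - f x)^2 \<partial>lborel) ----> 0"
proof (rule LIMSEQ_I)
 fix e :: real assume e: "e > 0"
 \<comment> \<open>The two triangle inequalities and the bound 4 for mollification add up to at most
   \<open>2 * 4 + 2 * 2 + 2 * 2 = 16\<close> errors of size \<open>e / 40\<close>.\<close>
 obtain g K where g: "continuous_on UNIV g" "compact K" "!!x. x \<notin> K ==> g x = 0"
 and fg: "(\<integral>x. (f x - g x)^2 \<partial>lborel) < e / 40"
 using dense_continuous_compact_support[OF f, of "e / 40"] e by auto
 have gs: "sqint lborel g" by (rule square_integrable_compact_support(1)[OF g])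
 have "\<forall>\<^sub>F n in sequentially. (\<integral>x. (mollify p rh (1 / (real n + 2)) g x - g x)^2 \<partial>lborel) < e / 40"
 using mollify_converges_continuous[OF g rh] e by (intro order_tendstoD(2)[where y = 0]) auto
 then obtain N where N: "!!n. n >= N ==> (\<integral>x. (mollify p rh (1 / (real n + 2)) g x - g x)^2 \<partial>lborel) < e / 40"
 by (auto simp: eventually_sequentially)
 have "norm ((\<integral>x. (mollify p rh (1 / (real n + 2)) f x - f x)^2 \<partial>lborel) - 0) < e" if "n >= N" for n
 proof -
 define l where "l = 1 / (real n + 2)"
 have l: "0 < l" "l <= 1/2" by (auto simp: l_def field_simps)
 note mf = mollify_bound(1)[OF f l rh, of p] and mg = mollify_bound(1)[OF gs l rh, of p]
 have "(\<integral>x. (mollify p rh l f x - f x)^2 \<partial>lborel)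
  <= 2 * (\<integral>x. (mollify p rh l f x - mollify p rh l g x)^2 \<partial>lborel) + 2 * (\<integral>x. (mollify p rh l g x - f x)^2 \<partial>lborel)"
  by (rule square_integral_triangle[OF mf mg f])
 also have "(\<integral>x. (mollify p rh l f x - mollify p rh l g x)^2 \<partial>lborel) <= 4 * (\<integral>x. (f x - g x)^2 \<partial>lborel)"
  using mollify_bound(2)[OF square_integrable_diff[OF f gs] l rh, of p] mollify_diff[OF f gs l(1) rh, of p] by simp
 also have "(\<integral>x. (mollify p rh l g x - f x)^2 \<partial>lborel)
  <= 2 * (\<integral>x. (mollify p rh l g x - g x)^2 \<partial>lborel) + 2 * (\<integral>x. (g x - f x)^2 \<partial>lborel)"
  by (rule square_integral_triangle[OF mg gs f])
 also have "(\<integral>x. (g x - f x)^2 \<partial>lborel) = (\<integral>x. (f x - g x)^2 \<partial>lborel)" by (simp add: power2_commute)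
 finally have "(\<integral>x. (mollify p rh l f x - f x)^2 \<partial>lborel) < e" using fg N[OF that] e by (simp add: l_def)
 then show ?thesis by (simp add: l_def)
 qed
 then show "\<exists>no. \<forall>n\<ge>no. norm ((\<integral>x. (mollify p rh (1 / (real n + 2)) f x - f x)^2 \<partial>lborel) - 0) < e" by blast
qed

lemma mollify_kernel:
 assumes "l > 0" "rh > 0"
 shows "mollify_kernel p rh l \<in> C1c UNIV"
 and "f \<in> bmeas ==> mollify p rh l f x = (\<integral>y. f y * mollify_kernel p rh l (y - (1 - l) *\<^sub>R x) \<partial>lborel)"
proof -
 have c: "l * rh ~= 0" using assms by simp
 have b: "(%v. bump ((1 / (l * rh)) *\<^sub>R (v - l *\<^sub>R p))) \<in> C1c UNIV"
 by (rule bump_affine_C1c) (use c in simp)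
 show "mollify_kernel p rh l \<in> C1c UNIV"
 using C1c_lincomb(1)[OF b b, of "1 / (bump_mass * (l * rh)^2)" 0] by (simp add: mollify_kernel_def[abs_def])
 assume [measurable]: "f \<in> bmeas"
 let ?t = "(1 - l) *\<^sub>R x + l *\<^sub>R p"
 have "(\<integral>y. f y * bump ((1 / (l * rh)) *\<^sub>R (y - ?t)) \<partial>lborel)
  = (l * rh)^2 * (\<integral>z. f (?t + (l * rh) *\<^sub>R z) * bump ((1 / (l * rh)) *\<^sub>R ((?t + (l * rh) *\<^sub>R z) - ?t)) \<partial>lborel)"
 by (rule integral_plane_affine[OF _ c]) measurable
 also have "(%z. f (?t + (l * rh) *\<^sub>R z) * bump ((1 / (l * rh)) *\<^sub>R ((?t + (l * rh) *\<^sub>R z) - ?t)))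
  = (%z. f (?t + (l * rh) *\<^sub>R z) * bump z)"
 using c by simp
 finally have "(\<integral>y. f y * bump ((1 / (l * rh)) *\<^sub>R (y - ?t)) \<partial>lborel) = (l * rh)^2 * bump_mass * mollify p rh l f x"
 using bump_mass_pos by (simp add: mollify_def)
 moreover have "y - (1 - l) *\<^sub>R x - l *\<^sub>R p = y - ?t" for y by simp
 ultimately show "mollify p rh l f x = (\<integral>y. f y * mollify_kernel p rh l (y - (1 - l) *\<^sub>R x) \<partial>lborel)"
 using bump_mass_pos c unfolding mollify_kernel_def by (simp only: times_divide_eq_right integral_divide_zero) simp
qed

text \<open>The support is a ball of convex combinations of \<open>x\<close> with points of
  \<open>cball p rh\<close>, so convexity keeps it in \<open>S\<close>. Hence weak derivatives may
  be tested with the mollification kernel at every point of \<open>S\<close>, however close to the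
  boundary.\<close>

lemma mollify_kernel_test:
 assumes S: "convex S" "x \<in> S" "cball p rh \<subseteq> S" and l: "0 < l" "l < 1" and rh: "rh > 0"
 shows "(%y. mollify_kernel p rh l (y - (1 - l) *\<^sub>R x)) \<in> C1c S"
 and "pd (%y. mollify_kernel p rh l (y - (1 - l) *\<^sub>R x)) e y = pd (mollify_kernel p rh l) e (y - (1 - l) *\<^sub>R x)"
proof -
 have c: "1 / (l * rh) ~= 0" using l rh by simp
 note k = mollify_kernel(1)[OF l(1) rh, of p]
 have d: "((%y. mollify_kernel p rh l (y - (1 - l) *\<^sub>R x)) has_derivative (%e. pd (mollify_kernel p rh l) e (y - (1 - l) *\<^sub>R x))) (at y)" for y
 by (rule has_derivative_compose[of "%y. y - (1 - l) *\<^sub>R x" "%e. e" y UNIV "mollify_kernel p rh l"])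
  (auto intro!: derivative_eq_intros C1c_has_derivative[OF k])
 then show "pd (%y. mollify_kernel p rh l (y - (1 - l) *\<^sub>R x)) e y = pd (mollify_kernel p rh l) e (y - (1 - l) *\<^sub>R x)"
 by (rule pd_eq)
 let ?K = "cball ((1 - l) *\<^sub>R x + l *\<^sub>R p) (l * rh)"
 show "(%y. mollify_kernel p rh l (y - (1 - l) *\<^sub>R x)) \<in> C1c S"
 proof (rule C1cI[OF d])
 show "continuous_on UNIV (%y. pd (mollify_kernel p rh l) e (y - (1 - l) *\<^sub>R x))" for e
  by (rule continuous_on_compose2[OF C1c_pd_continuous[OF k]]) (auto intro!: continuous_intros)
 show "?K \<subseteq> S"
 proof
  fix y assume y: "y \<in> ?K"
  define z where "z = (1 / l) *\<^sub>R (y - (1 - l) *\<^sub>R x)"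
  have "z - p = (1 / l) *\<^sub>R (y - ((1 - l) *\<^sub>R x + l *\<^sub>R p))"
  using l by (simp add: z_def algebra_simps)
  then have "norm (z - p) = norm (y - ((1 - l) *\<^sub>R x + l *\<^sub>R p)) / l"
  using l by (simp only: norm_scaleR) simp
  then have "norm (z - p) <= rh"
  using y l unfolding mem_cball dist_norm norm_minus_commute[of _ y] by (simp add: divide_le_eq mult.commute)
  then have "z \<in> S" using S(3) by (auto simp: dist_norm norm_minus_commute)
  then have "(1 - l) *\<^sub>R x + l *\<^sub>R z \<in> S" using S(1,2) l by (intro convexD) auto
  then show "y \<in> S" using l by (simp add: z_def)
 qed
 fix y assume "y \<notin> ?K"
 then have y: "l * rh < norm (y - ((1 - l) *\<^sub>R x + l *\<^sub>R p))" by (simp add: dist_norm norm_minus_commute)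
 have "1 <= norm ((1 / (l * rh)) *\<^sub>R (y - (1 - l) *\<^sub>R x - l *\<^sub>R p))"
  using y l rh unfolding norm_scaleR diff_diff_eq by (simp add: field_simps)
 then show "mollify_kernel p rh l (y - (1 - l) *\<^sub>R x) = 0"
  by (simp only: mollify_kernel_def bump_bounds(3)[THEN iffD2] div_0)
 qed simp
qed

text \<open>On \<open>S\<close> all mollifications of \<open>d\<close> vanish, because their kernels
  are test functions, and \<open>d\<close> itself vanishes off \<open>S\<close>; but the
  mollifications converge to \<open>d\<close>.\<close>

lemma L2_test_zero:
 assumes S: "convex S" "open S" "S ~= {}" and d: "d \<in> L2_on S"
 and test: "!!ps. ps \<in> C1c S ==> (\<integral>x. rep_l2 d x * ps x \<partial>lborel) = 0"
 shows "d = 0"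
proof -
 obtain p where "p \<in> S" using S(3) by blast
 then obtain rh where rh: "rh > 0" "cball p rh \<subseteq> S" using S(2) open_contains_cball by blast
 let ?f = "rep_l2 d"
 have z: "mollify p rh (1 / (real n + 2)) ?f x = 0" if "x \<in> S" for n x
 proof -
 have l: "0 < 1 / (real n + 2)" "1 / (real n + 2) < 1" by auto
 show ?thesis
  using mollify_kernel(2)[OF l(1) rh(1), of ?f p x] test[OF mollify_kernel_test(1)[OF S(1) that rh(2) l rh(1)]] by simp
 qed
 have "(\<integral>x. (?f x)^2 \<partial>lborel) <= (\<integral>x. (mollify p rh (1 / (real n + 2)) ?f x - ?f x)^2 \<partial>lborel)" for n
 proof (rule integral_mono_AE)
 have l: "0 < 1 / (real n + 2)" "1 / (real n + 2) <= 1/2" by (auto simp: field_simps)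
 show "integrable lborel (%x. (mollify p rh (1 / (real n + 2)) ?f x - ?f x)^2)"
  by (intro square_integrableD square_integrable_diff mollify_bound(1)[OF _ l] rh square_integrable_rep_l2)
 show "AE x in lborel. (?f x)^2 <= (mollify p rh (1 / (real n + 2)) ?f x - ?f x)^2"
  using d unfolding L2_on_def mem_Collect_eq
 proof eventually_elim
  fix x assume x: "x \<notin> S \<longrightarrow> rep_l2 d x = 0"
  show "(?f x)^2 <= (mollify p rh (1 / (real n + 2)) ?f x - ?f x)^2"
  using x z[of x n] by (cases "x \<in> S") auto
 qed
 qed (intro square_integrableD square_integrable_rep_l2)
 then have "(\<integral>x. (?f x)^2 \<partial>lborel) <= 0"
 using mollify_converges[OF square_integrable_rep_l2[of d] rh(1), of p] by (intro LIMSEQ_le_const) auto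
 moreover have "inner d d = (\<integral>x. (?f x)^2 \<partial>lborel)" by (simp add: inner_l2_eq power2_eq_square)
 ultimately show "d = 0" by (metis inner_gt_zero_iff not_le)
qed

lemma abs_l2_tendstoI:
 assumes "!!n. sqint lborel (F n)" "(%n. \<integral>x. (F n x - rep_l2 u x)^2 \<partial>lborel) ----> 0"
 shows "(%n. abs_l2 (F n)) ----> u"
proof -
 have "(\<integral>x. (F n x - rep_l2 u x)^2 \<partial>lborel) = (norm (abs_l2 (F n) - u))^2" for n
 using abs_l2_diff[OF assms(1) square_integrable_rep_l2, of n u]
 by (simp add: abs_rep_l2 norm_abs_l2 square_integrable_diff square_integrable_rep_l2 assms(1))
 with assms(2) have "(%n. (norm (abs_l2 (F n) - u))^2) ----> 0" by simp
 then have "(%n. sqrt ((norm (abs_l2 (F n) - u))^2)) ----> sqrt 0" by (rule tendsto_real_sqrt)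
 then have "(%n. abs_l2 (F n) - u) ----> 0" by (simp add: tendsto_norm_zero_iff)
 then show ?thesis by (rule LIM_zero_cancel)
qed

section \<open>The Sobolev space\<close>

lemma C1c_vanish: "ps \<in> C1c S ==> x \<notin> S ==> ps x = 0 & pd ps e x = 0"
 using C1c_support[of ps S] by blast

lemma is_weak_deriv_iff:
 "is_weak_deriv S e u g \<longleftrightarrow> g \<in> L2_on S &
 (\<forall>ps\<in>C1c S. inner u (abs_l2 (pd ps e)) = - inner g (abs_l2 ps))"
 unfolding is_weak_deriv_def by (auto simp: inner_abs_l2_right C1c_square_integrable)

lemma square_integrable_restr:
 "sqint lborel f ==> open S ==> sqint lborel (%x. ind S x * f x)"
 by (rule square_integrable_indicator) auto

lemma restr_l2_in_L2_on: "sqint lborel f ==> open S ==> restr S f \<in> L2_on S"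
 unfolding restr_l2_def by (rule abs_l2_in_L2_on[OF square_integrable_restr]) auto

lemma inner_restr_l2:
 assumes "sqint lborel f" "sqint lborel g" "open S"
 shows "inner (restr S f) (restr S g) = (\<integral>x. ind S x * (f x * g x) \<partial>lborel)"
proof -
 have "(%x. ind S x * f x * (ind S x * g x)) = (%x. ind S x * (f x * g x))"
 by (intro ext) (auto simp: indicator_def)
 then show ?thesis
 unfolding restr_l2_def by (simp add: inner_abs_l2 square_integrable_restr assms)
qed

lemma inner_restr_l2_test:
 assumes f: "sqint lborel f" and g: "sqint lborel g" "!!x. x \<notin> S ==> g x = 0" and S: "open S"
 shows "inner (restr S f) (abs_l2 g) = (\<integral>x. f x * g x \<partial>lborel)"
proof -
 have "(%x. ind S x * f x * g x) = (%x. f x * g x)"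
 using g(2) by (intro ext) (auto simp: indicator_def)
 then show ?thesis
 unfolding restr_l2_def by (simp add: inner_abs_l2 square_integrable_restr f g(1) S)
qed

lemma restr_l2_lincomb:
 assumes "sqint lborel f" "sqint lborel g" "open S"
 shows "restr S (%x. a * f x + b * g x) = a *\<^sub>R restr S f + b *\<^sub>R restr S g"
proof -
 let ?f = "%x. ind S x * f x" and ?g = "%x. ind S x * g x"
 note sq = square_integrable_restr[OF assms(1,3)] square_integrable_restr[OF assms(2,3)]
 have "a *\<^sub>R abs_l2 ?f + b *\<^sub>R abs_l2 ?g = abs_l2 (%x. a * ?f x + b * ?g x)"
 using sq by (simp add: abs_l2_scale abs_l2_add square_integrable_cmult)
 also have "(%x. a * ?f x + b * ?g x) = (%x. ind S x * (a * f x + b * g x))"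
 by (auto simp: algebra_simps)
 finally show ?thesis by (simp add: restr_l2_def)
qed

lemma restr_l2_weak_deriv:
 assumes ph: "ph \<in> C1c UNIV" and S: "open S"
 shows "is_weak_deriv S e (restr S ph) (restr S (pd ph e))"
 unfolding is_weak_deriv_iff
proof (intro conjI ballI)
 show "restr S (pd ph e) \<in> L2_on S" by (rule restr_l2_in_L2_on[OF C1c_square_integrable(2)[OF ph] S])
 fix ps assume ps: "ps \<in> C1c S"
 note sq = C1c_square_integrable[OF ph] C1c_square_integrable[OF ps]
 have "inner (restr S ph) (abs_l2 (pd ps e)) = (\<integral>x. ph x * pd ps e x \<partial>lborel)"
 by (rule inner_restr_l2_test) (use sq C1c_vanish[OF ps] S in auto)
 also have "... = - (\<integral>x. pd ph e x * ps x \<partial>lborel)" by (rule integral_by_parts[OF ph ps])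
 also have "(\<integral>x. pd ph e x * ps x \<partial>lborel) = inner (restr S (pd ph e)) (abs_l2 ps)"
 by (rule inner_restr_l2_test[symmetric]) (use sq C1c_vanish[OF ps] S in auto)
 finally show "inner (restr S ph) (abs_l2 (pd ps e)) = - inner (restr S (pd ph e)) (abs_l2 ps)" .
qed

text \<open>Serves for spatial cutoffs that open up, and for these multiplied by the factor
  \<open>1 - l\<close> that differentiation of a mollification produces.\<close>

lemma multiplier_converges:
 assumes M: "!!n. sqint \<mu> (M n)" and h: "sqint \<mu> h"
 and lim: "(%n. \<integral>x. (M n x - h x)^2 \<partial>\<mu>) ----> 0"
 and c: "!!n. c n \<in> borel_measurable \<mu>" "!!n x. \<bar>c n x\<bar> <= 1" "!!x. (%n. c n x) ----> 1"
 shows "(%n. \<integral>x. (c n x * M n x - h x)^2 \<partial>\<mu>) ----> 0"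
proof (rule tendsto_sandwich[of "%_. 0", OF _ _ tendsto_const])
 note [measurable] = square_integrableD(1)[OF M] square_integrableD(1)[OF h] c(1)
 have cM: "sqint \<mu> (%x. c n x * M n x)" "sqint \<mu> (%x. c n x * h x)" for n
 using M h c by (auto intro!: square_integrable_bounded_mult[where B = 1])
 have "(%n. \<integral>x. (c n x * h x - h x)^2 \<partial>\<mu>) ----> (\<integral>x. 0 \<partial>\<mu>)"
 proof (rule integral_dominated_convergence[where w = "%x. 4 * (h x)^2"])
 show "AE x in \<mu>. (%n. (c n x * h x - h x)^2) ----> 0"
 proof (rule AE_I2)
  fix x
  have "(%n. (c n x * h x - h x)^2) ----> (1 * h x - h x)^2" by (intro tendsto_intros c(3))
  then show "(%n. (c n x * h x - h x)^2) ----> 0" by simp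
 qed
 show "AE x in \<mu>. norm ((c n x * h x - h x)^2) <= 4 * (h x)^2" for n
 proof (rule AE_I2)
  fix x
  have "\<bar>c n x * h x\<bar> <= 1 * \<bar>h x\<bar>" unfolding abs_mult using c(2) by (intro mult_right_mono) auto
  then have "\<bar>c n x * h x - h x\<bar> <= 2 * \<bar>h x\<bar>" by linarith
  then have "\<bar>c n x * h x - h x\<bar>\<^sup>2 <= (2 * \<bar>h x\<bar>)^2" by (intro power_mono) auto
  then show "norm ((c n x * h x - h x)^2) <= 4 * (h x)^2" by (simp add: power_mult_distrib)
 qed
 qed (use square_integrableD(2)[OF h] in auto)
 then show "(%n. 2 * (\<integral>x. (M n x - h x)^2 \<partial>\<mu>) + 2 * (\<integral>x. (c n x * h x - h x)^2 \<partial>\<mu>)) ----> 0"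
 using tendsto_add[OF tendsto_mult_right_zero[OF lim, of 2] tendsto_mult_right_zero[of _ sequentially 2]] by simp
 show "\<forall>\<^sub>F n in sequentially. (\<integral>x. (c n x * M n x - h x)^2 \<partial>\<mu>)
  <= 2 * (\<integral>x. (M n x - h x)^2 \<partial>\<mu>) + 2 * (\<integral>x. (c n x * h x - h x)^2 \<partial>\<mu>)"
 proof (rule always_eventually, rule allI)
 fix n
 have "(\<integral>x. (c n x * M n x - h x)^2 \<partial>\<mu>)
  <= 2 * (\<integral>x. (c n x * M n x - c n x * h x)^2 \<partial>\<mu>) + 2 * (\<integral>x. (c n x * h x - h x)^2 \<partial>\<mu>)"
  by (rule square_integral_triangle[OF cM h])
 also have "(\<integral>x. (c n x * M n x - c n x * h x)^2 \<partial>\<mu>) <= (\<integral>x. (M n x - h x)^2 \<partial>\<mu>)"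
 proof (intro integral_mono square_integrableD square_integrable_diff cM M h)
  fix x
  have "\<bar>c n x\<bar>\<^sup>2 <= 1^2" using c(2) by (intro power_mono) auto
  then have "(c n x)^2 * (M n x - h x)^2 <= 1 * (M n x - h x)^2" by (intro mult_right_mono) auto
  then show "(c n x * M n x - c n x * h x)^2 <= (M n x - h x)^2"
  by (simp add: power_mult_distrib[symmetric] right_diff_distrib)
 qed
 finally show "(\<integral>x. (c n x * M n x - h x)^2 \<partial>\<mu>)
  <= 2 * (\<integral>x. (M n x - h x)^2 \<partial>\<mu>) + 2 * (\<integral>x. (c n x * h x - h x)^2 \<partial>\<mu>)" by simp
 qed
qed auto

locale convex_domain =
 fixes S :: "plane set"
 assumes convex: "convex S" and op: "open S" and nonempty: "S ~= {}"
begin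

lemma weak_deriv_unique:
 assumes "is_weak_deriv S e u g" "is_weak_deriv S e u h"
 shows "g = h"
proof -
 have "g - h = 0"
 proof (rule L2_test_zero[OF convex op nonempty])
 show "g - h \<in> L2_on S"
  using assms subspace_diff[OF subspace_L2_on] by (simp add: is_weak_deriv_iff)
 fix ps assume ps: "ps \<in> C1c S"
 then have "inner (g - h) (abs_l2 ps) = 0"
  using assms by (simp add: is_weak_deriv_iff inner_diff_left)
 then show "(\<integral>x. rep_l2 (g - h) x * ps x \<partial>lborel) = 0"
  by (simp add: inner_abs_l2_right C1c_square_integrable[OF ps])
 qed
 then show ?thesis by simp
qed

lemma weak_deriv_eqI: "is_weak_deriv S e u g ==> weak_deriv S e u = g"
 unfolding weak_deriv_def using weak_deriv_unique by blast

lemma H1_weak_deriv: "u \<in> H1 S ==> e \<in> Basis ==> is_weak_deriv S e u (weak_deriv S e u)"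
 using weak_deriv_eqI unfolding H1_def by blast

lemma is_weak_deriv_add:
 "is_weak_deriv S e u g ==> is_weak_deriv S e v h ==> is_weak_deriv S e (u + v) (g + h)"
 by (auto simp: is_weak_deriv_iff inner_add_left subspace_add[OF subspace_L2_on])

lemma is_weak_deriv_scale: "is_weak_deriv S e u g ==> is_weak_deriv S e (c *\<^sub>R u) (c *\<^sub>R g)"
 by (auto simp: is_weak_deriv_iff subspace_scale[OF subspace_L2_on])

lemma weak_deriv_add: "u \<in> H1 S ==> v \<in> H1 S ==> e \<in> Basis ==> weak_deriv S e (u + v) = weak_deriv S e u + weak_deriv S e v"
 and weak_deriv_scale: "u \<in> H1 S ==> e \<in> Basis ==> weak_deriv S e (c *\<^sub>R u) = c *\<^sub>R weak_deriv S e u"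
 by (intro weak_deriv_eqI is_weak_deriv_add is_weak_deriv_scale H1_weak_deriv; assumption)+

lemma subspace_H1: "subspace (H1 S)"
 unfolding subspace_def
proof (intro conjI ballI allI)
 have "is_weak_deriv S e 0 0" for e
 by (simp add: is_weak_deriv_iff subspace_0[OF subspace_L2_on])
 then show "0 \<in> H1 S" unfolding H1_def using subspace_0[OF subspace_L2_on] by blast
next
 fix u v assume "u \<in> H1 S" "v \<in> H1 S"
 then show "u + v \<in> H1 S"
 unfolding H1_def using is_weak_deriv_add subspace_add[OF subspace_L2_on] by blast
next
 fix u c assume "u \<in> H1 S"
 then show "c *\<^sub>R u \<in> H1 S"
 unfolding H1_def using is_weak_deriv_scale subspace_scale[OF subspace_L2_on] by blast
qed

lemma restr_l2_H1:
 assumes "ph \<in> C1c UNIV"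
 shows "restr S ph \<in> H1 S" "weak_deriv S e (restr S ph) = restr S (pd ph e)"
 using restr_l2_weak_deriv[OF assms op] weak_deriv_eqI
 restr_l2_in_L2_on[OF C1c_square_integrable(1)[OF assms] op] unfolding H1_def by blast+

text \<open>Closedness of the weak gradient: the defining identities are inner products with fixed
  test functions and pass to the limit. Completeness of the form domain rests on this.\<close>

lemma H1_closed:
 assumes X: "!!n. X n \<in> H1 S" "X ----> u"
 and g: "!!e. e \<in> Basis ==> (%n. weak_deriv S e (X n)) ----> g e"
 shows "u \<in> H1 S" "e \<in> Basis ==> weak_deriv S e u = g e"
proof -
 have L: "Y ----> v ==> (!!n. Y n \<in> L2_on S) ==> v \<in> L2_on S" for Y v
 using L2_on_closed[of S Y v] op by auto
 have *: "is_weak_deriv S e u (g e)" if e: "e \<in> Basis" for e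
 unfolding is_weak_deriv_iff
 proof (intro conjI ballI)
 show "g e \<in> L2_on S"
  by (rule L[OF g[OF e]]) (use H1_weak_deriv[OF X(1) e] in \<open>simp add: is_weak_deriv_iff\<close>)
 fix ps assume ps: "ps \<in> C1c S"
 have "(%n. inner (X n) (abs_l2 (pd ps e))) ----> inner u (abs_l2 (pd ps e))"
  by (intro tendsto_intros X)
 moreover have "inner (X n) (abs_l2 (pd ps e)) = - inner (weak_deriv S e (X n)) (abs_l2 ps)" for n
  using H1_weak_deriv[OF X(1) e, of n] ps unfolding is_weak_deriv_iff by blast
 moreover have "(%n. - inner (weak_deriv S e (X n)) (abs_l2 ps)) ----> - inner (g e) (abs_l2 ps)"
  by (intro tendsto_intros g e)
 ultimately show "inner u (abs_l2 (pd ps e)) = - inner (g e) (abs_l2 ps)"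
  using LIMSEQ_unique by simp
 qed
 then show "e \<in> Basis ==> weak_deriv S e u = g e" by (simp add: weak_deriv_eqI)
 have "u \<in> L2_on S" by (rule L[OF X(2)]) (use X(1) in \<open>auto simp: H1_def\<close>)
 with * show "u \<in> H1 S" unfolding H1_def by blast
qed

text \<open>The sequences that occur in \<open>is_trace\<close>, without the condition on boundary
  values.\<close>

definition approximates :: "(nat => plane => real) => l2 => bool" where
 "approximates ph u \<longleftrightarrow> (\<forall>n. ph n \<in> C1c UNIV) & (%n. restr S (ph n)) ----> u &
  (\<forall>e\<in>Basis. (%n. restr S (pd (ph n) e)) ----> weak_deriv S e u)"

text \<open>Mollification with contraction commutes with weak derivatives on \<open>S\<close> up to
  the factor \<open>1 - l\<close>, without extending \<open>u\<close> across the boundary; a wide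
  cutoff then gives compact support.\<close>

theorem smooth_dense_H1:
 assumes u: "u \<in> H1 S"
 shows "\<exists>ph. approximates ph u"
proof -
 obtain p where "p \<in> S" using nonempty by blast
 then obtain rh where rh: "rh > 0" "cball p rh \<subseteq> S" using op open_contains_cball by blast
 let ?f = "rep_l2 u"
 define l where "l n = 1 / (real n + 2)" for n
 have l: "0 < l n" "l n <= 1/2" "l n < 1" for n by (auto simp: l_def field_simps)
 have l0: "l ----> 0" unfolding l_def by real_asymp
 \<comment> \<open>The inverse scale of the cutoff; its gradient is of order \<open>c n\<close> and
   disappears in the limit.\<close>
 define c where "c n = 1 / (real n + 1)" for n
 have c: "c n ~= 0" "0 < c n" for n by (auto simp: c_def)
 have c0: "c ----> 0" unfolding c_def by real_asymp
 define b where "b n x = bump (c n *\<^sub>R (x - 0))" for n x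
 have b: "b n \<in> C1c UNIV" "\<bar>pd (b n) e x\<bar> <= 4 * c n * norm e" for n e x
 using bump_affine_C1c(1)[OF c(1), of n 0] bump_pd_bound[OF c(1)[of n], where p = 0 and e = e and x = x] c(2)[of n]
 by (simp_all add: b_def[abs_def])
 have b1: "\<bar>b n x\<bar> <= 1" for n x using bump_bounds(1,2) by (simp add: b_def)
 have b_lim: "(%n. b n x) ----> 1" for x
 proof -
 have "(%n. c n *\<^sub>R x) ----> 0 *\<^sub>R x" by (intro tendsto_intros c0)
 moreover have "isCont bump (0 *\<^sub>R x)"
  using C1c_continuous[OF bump_C1c] continuous_on_eq_continuous_at open_UNIV by blast
 ultimately have "(%n. bump (c n *\<^sub>R x)) ----> bump (0 *\<^sub>R x)" by (rule isCont_tendsto_compose[rotated])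
 then show ?thesis by (simp add: b_def bump_def)
 qed
 define W where "W n = mollify p rh (l n) ?f" for n
 define D where "D n x h = - (1 - l n) * (\<integral>y. ?f y * pd (mollify_kernel p rh (l n)) h (y - (1 - l n) *\<^sub>R x) \<partial>lborel)" for n x h
 have W_eq: "W n = (%x. \<integral>y. ?f y * mollify_kernel p rh (l n) (y - (1 - l n) *\<^sub>R x) \<partial>lborel)" for n
 unfolding W_def by (intro ext mollify_kernel(2)[OF l(1) rh(1)]) measurable
 note kern = mollify_kernel(1)[OF l(1) rh(1), of p]
 have W_deriv: "(W n has_derivative D n x) (at x)" "continuous_on UNIV (%x. D n x e)" for n x e
 using convolution_has_derivative(1)[OF square_integrable_rep_l2[of u] kern[of n], of "1 - l n" x]
  convolution_has_derivative(2)[OF square_integrable_rep_l2[of u] kern[of n], of "1 - l n" e]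
 unfolding W_eq D_def by simp_all
 \<comment> \<open>The derivative falls on the kernel, a test function in \<open>S\<close>, and the
   definition of the weak derivative moves it to \<open>u\<close>; \<open>1 - l n\<close> is the
   contraction factor.\<close>
 have D_eq: "D n x e = (1 - l n) * mollify p rh (l n) (rep_l2 (weak_deriv S e u)) x" if e: "e \<in> Basis" and x: "x \<in> S" for n x e
 proof -
 let ?ps = "%y. mollify_kernel p rh (l n) (y - (1 - l n) *\<^sub>R x)"
 have ps: "?ps \<in> C1c S" by (rule mollify_kernel_test(1)[OF convex x rh(2) l(1,3) rh(1)])
 have "(\<integral>y. ?f y * pd ?ps e y \<partial>lborel) = - (\<integral>y. rep_l2 (weak_deriv S e u) y * ?ps y \<partial>lborel)"
  using H1_weak_deriv[OF u e] ps unfolding is_weak_deriv_def by blast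
 moreover have "mollify p rh (l n) (rep_l2 (weak_deriv S e u)) x = (\<integral>y. rep_l2 (weak_deriv S e u) y * ?ps y \<partial>lborel)"
  by (rule mollify_kernel(2)[OF l(1) rh(1)]) measurable
 ultimately show ?thesis
  unfolding D_def mollify_kernel_test(2)[OF convex x rh(2) l(1,3) rh(1)] by (simp add: algebra_simps)
 qed
 note M2 = mollify_bound[OF square_integrable_rep_l2 l(1,2) rh(1), where p = p]
 define ph where "ph n x = W n x * b n x" for n x
 have ph: "ph n \<in> C1c UNIV" "pd (ph n) e x = D n x e * b n x + W n x * pd (b n) e x" for n x e
 unfolding ph_def[abs_def] using C1c_mult[OF W_deriv b(1)] by auto
 note [measurable] = C1c_measurable[OF b(1)]
 have lim1: "(%n. \<integral>x. (b n x * W n x - ?f x)^2 \<partial>lborel) ----> 0"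
 unfolding W_def
 proof (rule multiplier_converges)
 show "(%n. \<integral>x. (mollify p rh (l n) ?f x - ?f x)^2 \<partial>lborel) ----> 0"
  using mollify_converges[OF square_integrable_rep_l2[of u] rh(1), of p] by (simp add: l_def)
 qed (use M2 b1 b_lim square_integrable_rep_l2 in auto)
 have bW: "sqint lborel (%x. b n x * W n x)" for n
 unfolding W_def by (rule square_integrable_bounded_mult[OF M2(1), where B = 1]) (use b1 in auto)
 have ind_le: "(\<integral>x. (ind S x * F x - rep_l2 v x)^2 \<partial>lborel) <= (\<integral>x. (F x - rep_l2 v x)^2 \<partial>lborel)"
 if F: "sqint lborel F" and v: "v \<in> L2_on S" for F v
 proof (rule integral_mono_AE)
 show "integrable lborel (%x. (ind S x * F x - rep_l2 v x)^2)" "integrable lborel (%x. (F x - rep_l2 v x)^2)"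
  using F op by (auto intro!: square_integrableD square_integrable_diff square_integrable_rep_l2 square_integrable_restr)
 show "AE x in lborel. (ind S x * F x - rep_l2 v x)^2 <= (F x - rep_l2 v x)^2"
  using v unfolding L2_on_def mem_Collect_eq
 proof eventually_elim
  fix x assume "x \<notin> S \<longrightarrow> rep_l2 v x = 0"
  then show "(ind S x * F x - rep_l2 v x)^2 <= (F x - rep_l2 v x)^2" by (cases "x \<in> S") auto
 qed
 qed
 have conv: "(%n. restr S (F n)) ----> v"
 if F: "!!n. sqint lborel (F n)" and v: "v \<in> L2_on S"
  and lim: "(%n. \<integral>x. (F n x - rep_l2 v x)^2 \<partial>lborel) ----> 0" for F v
 unfolding restr_l2_def
 proof (rule abs_l2_tendstoI)
 show "sqint lborel (%x. ind S x * F n x)" for n by (rule square_integrable_restr[OF F op])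
 show "(%n. \<integral>x. (ind S x * F n x - rep_l2 v x)^2 \<partial>lborel) ----> 0"
  by (rule tendsto_sandwich[of "%_. 0", OF _ _ tendsto_const lim]) (use ind_le[OF F v] in auto)
 qed
 have "u \<in> L2_on S" using u by (simp add: H1_def)
 then have A: "(%n. restr S (ph n)) ----> u"
 using conv[OF bW _ lim1] by (simp add: ph_def[abs_def] mult.commute)
 have B: "(%n. restr S (pd (ph n) e)) ----> weak_deriv S e u" if e: "e \<in> Basis" for e
 proof -
 let ?g = "rep_l2 (weak_deriv S e u)"
 let ?M = "%n. mollify p rh (l n) ?g"
 let ?c = "%n x. b n x * (1 - l n)"
 define G where "G n x = ?c n x * ?M n x + pd (b n) e x * W n x" for n x
 have lim2: "(%n. \<integral>x. (?c n x * ?M n x - ?g x)^2 \<partial>lborel) ----> 0"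
 proof (rule multiplier_converges)
  show "(%n. \<integral>x. (?M n x - ?g x)^2 \<partial>lborel) ----> 0"
  using mollify_converges[OF square_integrable_rep_l2[of "weak_deriv S e u"] rh(1), of p] by (simp add: l_def)
  show "\<bar>b n x * (1 - l n)\<bar> <= 1" for n x
  proof -
  have "\<bar>b n x\<bar> * \<bar>1 - l n\<bar> <= 1 * 1" using b1 l[of n] by (intro mult_mono) auto
  then show ?thesis by (simp add: abs_mult)
  qed
  show "(%n. b n x * (1 - l n)) ----> 1" for x
  using tendsto_mult[OF b_lim[of x] tendsto_diff[OF tendsto_const[of 1] l0]] by simp
 qed (use M2 square_integrable_rep_l2 in auto)
 have cM: "sqint lborel (%x. ?c n x * ?M n x)" for n
 proof (rule square_integrable_bounded_mult[OF M2(1), where B = 1])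
  show "\<bar>b n x * (1 - l n)\<bar> <= 1" for x
  proof -
  have "\<bar>b n x\<bar> * \<bar>1 - l n\<bar> <= 1 * 1" using b1 l[of n] by (intro mult_mono) auto
  then show ?thesis by (simp add: abs_mult)
  qed
 qed measurable
 have pW: "sqint lborel (%x. pd (b n) e x * W n x)" for n
  unfolding W_def by (rule square_integrable_bounded_mult[OF M2(1) _ b(2)]) measurable
 \<comment> \<open>The term in which the cutoff is differentiated is at most \<open>4 * c n\<close>
   times a bounded norm.\<close>
 have lim3: "(%n. \<integral>x. (pd (b n) e x * W n x)^2 \<partial>lborel) ----> 0"
 proof (rule tendsto_sandwich[of "%_. 0", OF _ _ tendsto_const])
  have "(%n. (4 * c n * norm e)^2 * (4 * (\<integral>x. (?f x)^2 \<partial>lborel))) ----> (4 * 0 * norm e)^2 * (4 * (\<integral>x. (?f x)^2 \<partial>lborel))"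
  by (intro tendsto_intros c0)
  then show "(%n. (4 * c n * norm e)^2 * (4 * (\<integral>x. (?f x)^2 \<partial>lborel))) ----> 0" by simp
  have "(\<integral>x. (pd (b n) e x * W n x)^2 \<partial>lborel) <= (4 * c n * norm e)^2 * (4 * (\<integral>x. (?f x)^2 \<partial>lborel))" for n
  proof -
  have "(\<integral>x. (pd (b n) e x * W n x)^2 \<partial>lborel) <= (\<integral>x. (4 * c n * norm e)^2 * (W n x)^2 \<partial>lborel)"
  proof (rule integral_mono)
   show "integrable lborel (%x. (pd (b n) e x * W n x)^2)" by (rule square_integrableD(2)[OF pW])
   show "integrable lborel (%x. (4 * c n * norm e)^2 * (W n x)^2)"
   unfolding W_def by (intro integrable_mult_right square_integrableD(2) M2(1))
   fix x
   have "\<bar>pd (b n) e x\<bar>\<^sup>2 <= (4 * c n * norm e)^2" using b(2) by (intro power_mono) auto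
   then show "(pd (b n) e x * W n x)^2 <= (4 * c n * norm e)^2 * (W n x)^2"
   unfolding power_mult_distrib[of "pd (b n) e x"] by (intro mult_right_mono) auto
  qed
  also have "... = (4 * c n * norm e)^2 * (\<integral>x. (W n x)^2 \<partial>lborel)" by simp
  also have "... <= (4 * c n * norm e)^2 * (4 * (\<integral>x. (?f x)^2 \<partial>lborel))"
   unfolding W_def by (intro mult_left_mono M2(2)) auto
  finally show ?thesis .
  qed
  then show "\<forall>\<^sub>F n in sequentially. (\<integral>x. (pd (b n) e x * W n x)^2 \<partial>lborel)
   <= (4 * c n * norm e)^2 * (4 * (\<integral>x. (?f x)^2 \<partial>lborel))" by simp
 qed auto
 have Gs: "sqint lborel (G n)" for n
  unfolding G_def[abs_def] by (rule square_integrable_add[OF cM pW])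
 have "(%n. restr S (G n)) ----> weak_deriv S e u"
 proof (rule conv[OF Gs])
  show "weak_deriv S e u \<in> L2_on S" using H1_weak_deriv[OF u e] by (simp add: is_weak_deriv_iff)
  show "(%n. \<integral>x. (G n x - ?g x)^2 \<partial>lborel) ----> 0"
  proof (rule tendsto_sandwich[of "%_. 0", OF _ _ tendsto_const])
  show "(%n. 2 * (\<integral>x. (pd (b n) e x * W n x)^2 \<partial>lborel) + 2 * (\<integral>x. (?c n x * ?M n x - ?g x)^2 \<partial>lborel)) ----> 0"
   using tendsto_add[OF tendsto_mult_right_zero[OF lim3, of 2] tendsto_mult_right_zero[OF lim2, of 2]] by simp
  have "(\<integral>x. (G n x - ?g x)^2 \<partial>lborel)
   <= 2 * (\<integral>x. (G n x - ?c n x * ?M n x)^2 \<partial>lborel) + 2 * (\<integral>x. (?c n x * ?M n x - ?g x)^2 \<partial>lborel)" for n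
   by (rule square_integral_triangle[OF Gs cM square_integrable_rep_l2])
  then show "\<forall>\<^sub>F n in sequentially. (\<integral>x. (G n x - ?g x)^2 \<partial>lborel)
   <= 2 * (\<integral>x. (pd (b n) e x * W n x)^2 \<partial>lborel) + 2 * (\<integral>x. (?c n x * ?M n x - ?g x)^2 \<partial>lborel)"
   by (simp add: G_def)
  qed auto
 qed
 moreover have "restr S (G n) = restr S (pd (ph n) e)" for n
 proof -
  have "(%x. ind S x * G n x) = (%x. ind S x * pd (ph n) e x)"
  by (intro ext) (auto simp: indicator_def ph(2) D_eq[OF e] G_def)
  then show ?thesis by (simp add: restr_l2_def)
 qed
 ultimately show ?thesis by simp
 qed
 have "approximates ph u" unfolding approximates_def using ph(1) A B by blast
 then show ?thesis by blast
qed

end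

section \<open>Traces and the Robin form\<close>

lemma square_integrable_product_converges:
 assumes F: "!!n. sqint M (F n)" "sqint M f" "(%n. \<integral>x. (F n x - f x)^2 \<partial>M) ----> 0"
 and G: "!!n. sqint M (G n)" "sqint M g" "(%n. \<integral>x. (G n x - g x)^2 \<partial>M) ----> 0"
 shows "(%n. \<integral>x. F n x * G n x \<partial>M) ----> (\<integral>x. f x * g x \<partial>M)"
proof -
 have *: "(%n. \<integral>x. A n x * B n x \<partial>M) ----> 0"
 if sq: "!!n. sqint M (A n)" "!!n. sqint M (B n)"
  and lim: "(%n. (\<integral>x. (A n x)^2 \<partial>M) * (\<integral>x. (B n x)^2 \<partial>M)) ----> 0" for A B
 proof (rule tendsto_zero_square)
 show "(%n. (\<integral>x. A n x * B n x \<partial>M)^2) ----> 0"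
  by (rule tendsto_sandwich[of "%_. 0", OF _ _ tendsto_const lim])
  (use square_integrable_Cauchy_Schwarz[OF sq] in auto)
 qed
 note dF = square_integrable_diff[OF F(1,2)] and dG = square_integrable_diff[OF G(1,2)]
 have 1: "(%n. \<integral>x. (F n x - f x) * (G n x - g x) \<partial>M) ----> 0"
 by (rule *[OF dF dG]) (use tendsto_mult[OF F(3) G(3)] in simp)
 have 2: "(%n. \<integral>x. (F n x - f x) * g x \<partial>M) ----> 0"
 by (rule *[OF dF G(2)]) (use tendsto_mult_left_zero[OF F(3)] in simp)
 have 3: "(%n. \<integral>x. f x * (G n x - g x) \<partial>M) ----> 0"
 by (rule *[OF F(2) dG]) (use tendsto_mult_right_zero[OF G(3)] in simp)
 note I = square_integrable_mult_integrable
 have "(\<integral>x. F n x * G n x \<partial>M) - (\<integral>x. f x * g x \<partial>M)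
  = (\<integral>x. (F n x - f x) * (G n x - g x) \<partial>M) + (\<integral>x. (F n x - f x) * g x \<partial>M) + (\<integral>x. f x * (G n x - g x) \<partial>M)" for n
 proof -
 have "(\<integral>x. (F n x - f x) * (G n x - g x) \<partial>M) + (\<integral>x. (F n x - f x) * g x \<partial>M) + (\<integral>x. f x * (G n x - g x) \<partial>M)
  = (\<integral>x. (F n x - f x) * (G n x - g x) + (F n x - f x) * g x + f x * (G n x - g x) \<partial>M)"
  using I[OF dF dG] I[OF dF G(2)] I[OF F(2) dG] by simp
 also have "(%x. (F n x - f x) * (G n x - g x) + (F n x - f x) * g x + f x * (G n x - g x)) = (%x. F n x * G n x - f x * g x)"
  by (auto simp: algebra_simps)
 finally show ?thesis using I[OF F(1) G(1), of n n] I[OF F(2) G(2)] by simp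
 qed
 then have "(%n. (\<integral>x. F n x * G n x \<partial>M) - (\<integral>x. f x * g x \<partial>M)) ----> 0"
 using tendsto_add[OF tendsto_add[OF 1 2] 3] by simp
 then show ?thesis by (rule LIM_zero_cancel)
qed

text \<open>The trace inequality is demanded with every factor \<open>\<epsilon>\<close> in front of
  the Dirichlet integral, so that the boundary term is a small perturbation of it for every
  \<open>al\<close>. It is assumed for test functions only; traces on \<open>H1\<close> are derived
  from it.\<close>

locale robin_domain = convex_domain S for S +
 fixes sg :: "plane measure"
 assumes sets_sg: "sets sg = sets borel"
 and test_trace: "!!ph. ph \<in> C1c UNIV ==> integrable sg (%x. (ph x)^2)"
 and trace_bound: "!!\<epsilon>. \<epsilon> > 0 ==> \<exists>C\<ge>0. \<forall>ph\<in>C1c UNIV. (\<integral>x. (ph x)^2 \<partial>sg)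
  <= \<epsilon> * (dirichlet S ph) + C * (norm (restr S ph))^2"
begin

lemma test_square_integrable: "ph \<in> C1c UNIV ==> sqint sg ph"
 unfolding square_integrable_def using test_trace C1c_measurable(1) measurable_cong_sets[OF sets_sg refl] by blast

lemma restr_diff:
 assumes "ph \<in> C1c UNIV" "ps \<in> C1c UNIV"
 shows "(%x. ph x - ps x) \<in> C1c UNIV"
 "restr S (%x. ph x - ps x) = restr S ph - restr S ps"
 "restr S (pd (%x. ph x - ps x) e) = restr S (pd ph e) - restr S (pd ps e)"
proof -
 have eq: "(%x. ph x - ps x) = (%x. 1 * ph x + (-1) * ps x)" by auto
 show "(%x. ph x - ps x) \<in> C1c UNIV" unfolding eq by (rule C1c_lincomb(1)[OF assms])
 show "restr S (%x. ph x - ps x) = restr S ph - restr S ps"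
 unfolding eq using restr_l2_lincomb[OF C1c_square_integrable(1)[OF assms(1)] C1c_square_integrable(1)[OF assms(2)] op, of 1 "-1"] by simp
 have "pd (%x. ph x - ps x) e = (%x. 1 * pd ph e x + (-1) * pd ps e x)"
 unfolding eq by (rule ext, rule C1c_lincomb(2)[OF assms])
 then show "restr S (pd (%x. ph x - ps x) e) = restr S (pd ph e) - restr S (pd ps e)"
 using restr_l2_lincomb[OF C1c_square_integrable(2)[OF assms(1)] C1c_square_integrable(2)[OF assms(2)] op, of 1 e "-1" e] by simp
qed

lemma trace_diff_bound:
 "\<exists>C\<ge>0. \<forall>ph\<in>C1c UNIV. \<forall>ps\<in>C1c UNIV. (\<integral>x. (ph x - ps x)^2 \<partial>sg)
 <= (\<Sum>e\<in>Basis. (norm (restr S (pd ph e) - restr S (pd ps e)))^2) + C * (norm (restr S ph - restr S ps))^2"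
proof -
 obtain C where C: "C >= 0" "!!ph. ph \<in> C1c UNIV ==> (\<integral>x. (ph x)^2 \<partial>sg)
  <= 1 * (dirichlet S ph) + C * (norm (restr S ph))^2"
 using trace_bound[of 1] by auto
 show ?thesis
 proof (intro exI[of _ C] conjI ballI)
 fix ph ps assume f: "ph \<in> C1c UNIV" and g: "ps \<in> C1c UNIV"
 show "(\<integral>x. (ph x - ps x)^2 \<partial>sg) <= (\<Sum>e\<in>Basis. (norm (restr S (pd ph e) - restr S (pd ps e)))^2) + C * (norm (restr S ph - restr S ps))^2"
  using C(2)[OF restr_diff(1)[OF f g]] by (simp add: restr_diff[OF f g])
 qed (rule C(1))
qed

text \<open>This makes the choice in \<open>boundary_trace\<close> harmless: different approximating
  sequences have the same boundary limit in the square mean.\<close>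

lemma approximates_traces_agree:
 assumes ph: "approximates ph u" and ps: "approximates ps u"
 shows "(%n. \<integral>x. (ph n x - ps n x)^2 \<partial>sg) ----> 0"
proof -
 obtain C where C: "!!ph ps. ph \<in> C1c UNIV ==> ps \<in> C1c UNIV ==> (\<integral>x. (ph x - ps x)^2 \<partial>sg)
 <= (\<Sum>e\<in>Basis. (norm (restr S (pd ph e) - restr S (pd ps e)))^2) + C * (norm (restr S ph - restr S ps))^2"
 using trace_diff_bound by blast
 show ?thesis
 proof (rule tendsto_sandwich[of "%_. 0", OF _ _ tendsto_const])
 have "(%n. (\<Sum>e\<in>Basis. (norm (restr S (pd (ph n) e) - restr S (pd (ps n) e)))^2) + C * (norm (restr S (ph n) - restr S (ps n)))^2)
  ----> (\<Sum>e\<in>Basis. (norm (weak_deriv S e u - weak_deriv S e u))^2) + C * (norm (u - u))^2"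
  by (intro tendsto_intros) (use ph ps in \<open>auto simp: approximates_def\<close>)
 then show "(%n. (\<Sum>e\<in>Basis. (norm (restr S (pd (ph n) e) - restr S (pd (ps n) e)))^2) + C * (norm (restr S (ph n) - restr S (ps n)))^2) ----> 0"
  by simp
 show "\<forall>\<^sub>F n in sequentially. (\<integral>x. (ph n x - ps n x)^2 \<partial>sg)
  <= (\<Sum>e\<in>Basis. (norm (restr S (pd (ph n) e) - restr S (pd (ps n) e)))^2) + C * (norm (restr S (ph n) - restr S (ps n)))^2"
  using ph ps C by (intro always_eventually allI) (auto simp: approximates_def)
 qed auto
qed

text \<open>The trace inequality applied to differences makes boundary values Cauchy, so a trace
  exists; the chosen one, which comes with some sequence of its own, is then the limit along every
  approximating sequence.\<close>

lemma boundary_trace_limit: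
 assumes u: "u \<in> H1 S" and ph: "approximates ph u"
 shows "sqint sg (boundary_trace S sg u)"
 "(%n. \<integral>x. (ph n x - boundary_trace S sg u x)^2 \<partial>sg) ----> 0"
proof -
 have C1: "ph n \<in> C1c UNIV" for n using ph by (simp add: approximates_def)
 obtain C where C: "C >= 0" "!!ph ps. ph \<in> C1c UNIV ==> ps \<in> C1c UNIV ==> (\<integral>x. (ph x - ps x)^2 \<partial>sg)
 <= (\<Sum>e\<in>Basis. (norm (restr S (pd ph e) - restr S (pd ps e)))^2) + C * (norm (restr S ph - restr S ps))^2"
 using trace_diff_bound by blast
 have "\<exists>g. sqint sg g & (%n. \<integral>x. (ph n x - g x)^2 \<partial>sg) ----> 0"
 proof (rule Riesz_Fischer[OF test_square_integrable[OF C1]])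
 fix e :: real assume e: "e > 0"
 \<comment> \<open>There are two partial derivatives and a weight \<open>C\<close> on the function
   itself, so the bound is \<open>(2 + C) * d^2\<close>, strictly below
   \<open>(4 + C) * d^2 = e\<close>.\<close>
 define d where "d = sqrt (e / (C + 4))"
 have d: "d > 0" "d^2 = e / (C + 4)" using e C(1) by (auto simp: d_def)
 have N1: "\<exists>N. \<forall>m\<ge>N. \<forall>n\<ge>N. norm (Y m - Y n) < d" if "Y ----> v" for Y and v :: l2
  using LIMSEQ_imp_Cauchy[OF that] d(1) unfolding Cauchy_iff by blast
 have "\<forall>e\<in>Basis. \<exists>N. \<forall>m\<ge>N. \<forall>n\<ge>N. norm (restr S (pd (ph m) e) - restr S (pd (ph n) e)) < d"
  using ph N1 unfolding approximates_def by blast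
 then obtain N where N: "!!e m n. e \<in> Basis ==> m >= N e ==> n >= N e ==> norm (restr S (pd (ph m) e) - restr S (pd (ph n) e)) < d"
  by metis
 obtain N0 where N0: "!!m n. m >= N0 ==> n >= N0 ==> norm (restr S (ph m) - restr S (ph n)) < d"
  using ph N1 unfolding approximates_def by blast
 define K where "K = Max (insert N0 (N ` Basis))"
 have fin: "finite (insert N0 (N ` Basis))" by simp
 have K: "N0 <= K" "!!e. e \<in> Basis ==> N e <= K"
  unfolding K_def by (rule Max_ge[OF fin insertI1], rule Max_ge[OF fin insertI2[OF imageI]])
 have "(\<integral>x. (ph m x - ph n x)^2 \<partial>sg) < e" if mn: "m >= K" "n >= K" for m n
 proof -
  have "(\<integral>x. (ph m x - ph n x)^2 \<partial>sg) <= (\<Sum>e\<in>Basis. (norm (restr S (pd (ph m) e) - restr S (pd (ph n) e)))^2) + C * (norm (restr S (ph m) - restr S (ph n)))^2"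
  by (rule C(2)[OF C1 C1])
  also have "... <= (\<Sum>e\<in>(Basis :: plane set). d^2) + C * d^2"
  proof (intro add_mono sum_mono mult_left_mono power_mono C(1))
  fix e :: plane assume e: "e \<in> Basis"
  have "m >= N e" "n >= N e" using mn K(2)[OF e] by auto
  then show "norm (restr S (pd (ph m) e) - restr S (pd (ph n) e)) <= d"
   using N[OF e] by (intro less_imp_le)
  next
  show "norm (restr S (ph m) - restr S (ph n)) <= d"
   using N0[of m n] mn K(1) by auto
  qed auto
  also have "... = (2 + C) * d^2" by (simp add: distrib_right)
  also have "... < (4 + C) * d^2" using d(1) by (intro mult_strict_right_mono) auto
  also have "... = e" using d(2) C(1) by (simp add: add.commute)
  finally show ?thesis .
 qed
 then show "\<exists>N. \<forall>m\<ge>N. \<forall>n\<ge>N. (\<integral>x. (ph m x - ph n x)^2 \<partial>sg) < e" by blast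
 qed
 then obtain g where "is_trace S sg u g"
 using ph unfolding is_trace_def approximates_def by blast
 then have "is_trace S sg u (boundary_trace S sg u)" unfolding boundary_trace_def by (rule someI[where P = "is_trace S sg u"])
 then obtain ps where sq: "sqint sg (boundary_trace S sg u)" and ps: "approximates ps u"
 "(%n. \<integral>x. (ps n x - boundary_trace S sg u x)^2 \<partial>sg) ----> 0"
 unfolding is_trace_def approximates_def by blast
 show "sqint sg (boundary_trace S sg u)" by (rule sq)
 have C1': "ps n \<in> C1c UNIV" for n using ps(1) by (simp add: approximates_def)
 show "(%n. \<integral>x. (ph n x - boundary_trace S sg u x)^2 \<partial>sg) ----> 0"
 proof (rule tendsto_sandwich[of "%_. 0", OF _ _ tendsto_const])
 show "(%n. 2 * (\<integral>x. (ph n x - ps n x)^2 \<partial>sg) + 2 * (\<integral>x. (ps n x - boundary_trace S sg u x)^2 \<partial>sg)) ----> 0"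
  using tendsto_add[OF tendsto_mult_right_zero[OF approximates_traces_agree[OF ph ps(1)], of 2] tendsto_mult_right_zero[OF ps(2), of 2]] by simp
 show "\<forall>\<^sub>F n in sequentially. (\<integral>x. (ph n x - boundary_trace S sg u x)^2 \<partial>sg)
  <= 2 * (\<integral>x. (ph n x - ps n x)^2 \<partial>sg) + 2 * (\<integral>x. (ps n x - boundary_trace S sg u x)^2 \<partial>sg)"
  by (intro always_eventually allI square_integral_triangle test_square_integrable C1 C1' sq)
 qed auto
qed

definition test_form :: "real => (plane => real) => (plane => real) => real" where
 "test_form al ph ps = (\<Sum>e\<in>Basis. inner (restr S (pd ph e)) (restr S (pd ps e))) - al * (\<integral>x. ph x * ps x \<partial>sg)"

text \<open>The bridge between the form on \<open>H1 S\<close>, whose traces and weak derivatives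
  are given by choice operators, and integrals of test functions; bilinearity and coercivity are
  transported along it.\<close>

lemma robin_form_limit:
 assumes u: "u \<in> H1 S" "approximates ph u" and v: "v \<in> H1 S" "approximates ps v"
 shows "(%n. test_form al (ph n) (ps n)) ----> robin_form S sg al u v"
 unfolding test_form_def robin_form_def
proof (intro tendsto_intros)
 show "(%n. \<integral>x. ph n x * ps n x \<partial>sg) ----> (\<integral>x. boundary_trace S sg u x * boundary_trace S sg v x \<partial>sg)"
 proof (rule square_integrable_product_converges)
 show "sqint sg (ph n)" "sqint sg (ps n)" for n
  using u v by (auto simp: approximates_def intro: test_square_integrable)
 qed (rule boundary_trace_limit[OF u] boundary_trace_limit[OF v])+
qed (use u v in \<open>auto simp: approximates_def\<close>)

lemma approximates_lincomb:
 assumes u: "u \<in> H1 S" "approximates ph u" and v: "v \<in> H1 S" "approximates ps v"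
 shows "approximates (%n x. a * ph n x + b * ps n x) (a *\<^sub>R u + b *\<^sub>R v)"
 unfolding approximates_def
proof (intro conjI allI ballI)
 have C1: "ph n \<in> C1c UNIV" "ps n \<in> C1c UNIV" for n using u v by (auto simp: approximates_def)
 note sq = C1c_square_integrable[OF C1(1)] C1c_square_integrable[OF C1(2)]
 show "(%x. a * ph n x + b * ps n x) \<in> C1c UNIV" for n by (rule C1c_lincomb(1)[OF C1])
 have "restr S (%x. a * ph n x + b * ps n x) = a *\<^sub>R restr S (ph n) + b *\<^sub>R restr S (ps n)" for n
 by (rule restr_l2_lincomb[OF sq(1) sq(3) op])
 moreover have "(%n. a *\<^sub>R restr S (ph n) + b *\<^sub>R restr S (ps n)) ----> a *\<^sub>R u + b *\<^sub>R v"
 by (intro tendsto_intros) (use u v in \<open>auto simp: approximates_def\<close>)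
 ultimately show "(%n. restr S (%x. a * ph n x + b * ps n x)) ----> a *\<^sub>R u + b *\<^sub>R v" by simp
 fix e :: plane assume e: "e \<in> Basis"
 have pd: "pd (%x. a * ph n x + b * ps n x) e = (%x. a * pd (ph n) e x + b * pd (ps n) e x)" for n
 by (rule ext, rule C1c_lincomb(2)[OF C1])
 have "restr S (pd (%x. a * ph n x + b * ps n x) e) = a *\<^sub>R restr S (pd (ph n) e) + b *\<^sub>R restr S (pd (ps n) e)" for n
 unfolding pd by (rule restr_l2_lincomb[OF sq(2) sq(4) op])
 moreover have "(%n. a *\<^sub>R restr S (pd (ph n) e) + b *\<^sub>R restr S (pd (ps n) e)) ----> a *\<^sub>R weak_deriv S e u + b *\<^sub>R weak_deriv S e v"
 by (intro tendsto_intros) (use u v e in \<open>auto simp: approximates_def\<close>)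
 moreover have "weak_deriv S e (a *\<^sub>R u + b *\<^sub>R v) = a *\<^sub>R weak_deriv S e u + b *\<^sub>R weak_deriv S e v"
 using u(1) v(1) e subspace_scale[OF subspace_H1] by (simp add: weak_deriv_add weak_deriv_scale)
 ultimately show "(%n. restr S (pd (%x. a * ph n x + b * ps n x) e)) ----> weak_deriv S e (a *\<^sub>R u + b *\<^sub>R v)" by simp
qed

lemma robin_form_sym: "robin_form S sg al u v = robin_form S sg al v u"
 by (simp add: robin_form_def inner_commute mult.commute)

lemma test_form_lincomb:
 assumes C1: "ph \<in> C1c UNIV" "ps \<in> C1c UNIV" "\<eta> \<in> C1c UNIV"
 shows "test_form al (%x. a * ph x + b * ps x) \<eta> = a * test_form al ph \<eta> + b * test_form al ps \<eta>"
proof -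
 note sq = C1c_square_integrable[OF C1(1)] C1c_square_integrable[OF C1(2)]
 have pd: "pd (%x. a * ph x + b * ps x) e = (%x. a * pd ph e x + b * pd ps e x)" for e
 by (rule ext, rule C1c_lincomb(2)[OF C1(1,2)])
 have r: "restr S (pd (%x. a * ph x + b * ps x) e) = a *\<^sub>R restr S (pd ph e) + b *\<^sub>R restr S (pd ps e)" for e
 unfolding pd by (rule restr_l2_lincomb[OF sq(2) sq(4) op])
 have I: "integrable sg (%x. ph x * \<eta> x)" "integrable sg (%x. ps x * \<eta> x)"
 by (intro square_integrable_mult_integrable test_square_integrable C1)+
 have "(\<integral>x. (a * ph x + b * ps x) * \<eta> x \<partial>sg) = (\<integral>x. a * (ph x * \<eta> x) + b * (ps x * \<eta> x) \<partial>sg)"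
 by (simp add: algebra_simps)
 also have "... = a * (\<integral>x. ph x * \<eta> x \<partial>sg) + b * (\<integral>x. ps x * \<eta> x \<partial>sg)"
 using I by simp
 finally show ?thesis
 by (simp add: test_form_def r inner_add_left sum.distrib sum_distrib_left algebra_simps)
qed

lemma robin_form_lincomb:
 assumes "u \<in> H1 S" "v \<in> H1 S" "w \<in> H1 S"
 shows "robin_form S sg al (a *\<^sub>R u + b *\<^sub>R v) w = a * robin_form S sg al u w + b * robin_form S sg al v w"
proof -
 obtain ph ps \<eta> where ap: "approximates ph u" "approximates ps v" "approximates \<eta> w"
 using smooth_dense_H1 assms by metis
 have uv: "a *\<^sub>R u + b *\<^sub>R v \<in> H1 S"
 using assms subspace_H1 by (simp add: subspace_add subspace_scale)
 have "(%n. test_form al (%x. a * ph n x + b * ps n x) (\<eta> n)) ----> robin_form S sg al (a *\<^sub>R u + b *\<^sub>R v) w"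
 by (intro robin_form_limit uv approximates_lincomb assms ap)
 moreover have "test_form al (%x. a * ph n x + b * ps n x) (\<eta> n) = a * test_form al (ph n) (\<eta> n) + b * test_form al (ps n) (\<eta> n)" for n
 using ap by (intro test_form_lincomb) (auto simp: approximates_def)
 moreover have "(%n. a * test_form al (ph n) (\<eta> n) + b * test_form al (ps n) (\<eta> n))
  ----> a * robin_form S sg al u w + b * robin_form S sg al v w"
 by (intro tendsto_intros robin_form_limit assms ap)
 ultimately show ?thesis using LIMSEQ_unique by simp
qed

abbreviation grad_norm2 :: "l2 => real" where
 "grad_norm2 u \<equiv> \<Sum>e\<in>Basis. (norm (weak_deriv S e u))^2"

lemma approximates_grad_norm2:
 "approximates ph u ==> (%n. \<Sum>e\<in>Basis. (norm (restr S (pd (ph n) e)))^2) ----> grad_norm2 u"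
 by (intro tendsto_intros) (auto simp: approximates_def)

text \<open>The trace inequality with \<open>\<epsilon> = 1 / (2 * al)\<close> spends one half of
  the Dirichlet integral on the boundary term.\<close>

lemma robin_form_coercive:
 assumes "al > 0"
 shows "\<exists>c. (\<forall>u\<in>H1 S. grad_norm2 u / 2 + (norm u)^2 <= robin_form S sg al u u + c * inner u u)"
proof -
 obtain C where C: "C >= 0" "!!ph. ph \<in> C1c UNIV ==> (\<integral>x. (ph x)^2 \<partial>sg)
  <= 1 / (2 * al) * (dirichlet S ph) + C * (norm (restr S ph))^2"
 using trace_bound[of "1 / (2 * al)"] assms by auto
 define c where "c = al * C + 1"
 have *: "(dirichlet S ph) / 2 + (norm (restr S ph))^2
  <= test_form al ph ph + c * (norm (restr S ph))^2" if ph: "ph \<in> C1c UNIV" for ph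
 proof -
 have "al * (\<integral>x. (ph x)^2 \<partial>sg) <= al * (1 / (2 * al) * (dirichlet S ph) + C * (norm (restr S ph))^2)"
  using assms by (intro mult_left_mono C(2) ph) auto
 also have "... = (dirichlet S ph) / 2 + al * C * (norm (restr S ph))^2"
  using assms by (simp add: distrib_left)
 finally show ?thesis
  by (simp add: test_form_def c_def power2_norm_eq_inner[symmetric] power2_eq_square[symmetric] distrib_right)
 qed
 show ?thesis
 proof (intro exI[of _ c] ballI)
 fix u assume u: "u \<in> H1 S"
 obtain ph where ap: "approximates ph u" using smooth_dense_H1[OF u] by blast
 have 1: "(%n. restr S (ph n)) ----> u" using ap by (simp add: approximates_def)
 have "(%n. (dirichlet S (ph n)) / 2 + (norm (restr S (ph n)))^2) ----> grad_norm2 u / 2 + (norm u)^2"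
  by (intro tendsto_add tendsto_divide approximates_grad_norm2[OF ap] tendsto_const tendsto_power tendsto_norm 1) simp
 moreover have "(%n. test_form al (ph n) (ph n) + c * (norm (restr S (ph n)))^2) ----> robin_form S sg al u u + c * (norm u)^2"
  by (intro tendsto_intros robin_form_limit u ap 1)
 ultimately have "grad_norm2 u / 2 + (norm u)^2 <= robin_form S sg al u u + c * (norm u)^2"
  by (rule LIMSEQ_le) (use * ap in \<open>auto simp: approximates_def\<close>)
 then show "grad_norm2 u / 2 + (norm u)^2 <= robin_form S sg al u u + c * inner u u"
  by (simp add: power2_norm_eq_inner)
 qed
qed

lemma robin_form_le: "al > 0 ==> robin_form S sg al u u <= grad_norm2 u"
 by (simp add: robin_form_def power2_norm_eq_inner)

text \<open>Coercivity makes a form-Cauchy sequence and its weak derivatives Cauchy in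
  \<open>l2\<close>, and closedness identifies the limits. Convergence back in the form norm follows
  from \<open>robin_form_le\<close>, where the boundary term is dropped since it has a favourable
  sign.\<close>

lemma semibounded_robin_form:
 assumes al: "al > 0" and c: "!!u. u \<in> H1 S ==> grad_norm2 u / 2 + (norm u)^2 <= robin_form S sg al u u + c * inner u u"
 shows "semibounded_form (L2_on S) (H1 S) (robin_form S sg al) c"
proof
 show "subspace (L2_on S)" "subspace (H1 S)" by (rule subspace_L2_on, rule subspace_H1)
 show "H1 S \<subseteq> L2_on S" by (auto simp: H1_def)
 fix u v w :: l2 and s :: real
 show "u \<in> H1 S ==> v \<in> H1 S ==> w \<in> H1 S ==> robin_form S sg al (u + v) w = robin_form S sg al u w + robin_form S sg al v w"
 using robin_form_lincomb[of u v w al 1 1] by simp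
 show "u \<in> H1 S ==> w \<in> H1 S ==> robin_form S sg al (s *\<^sub>R u) w = s * robin_form S sg al u w"
 using robin_form_lincomb[of u u w al s 0] by simp
 show "robin_form S sg al u v = robin_form S sg al v u" by (rule robin_form_sym)
 show "u \<in> H1 S ==> inner u u <= robin_form S sg al u u + c * inner u u"
 proof -
 assume "u \<in> H1 S"
 moreover have "0 <= grad_norm2 u" by (intro sum_nonneg) auto
 ultimately show ?thesis using c[of u] by (simp add: power2_norm_eq_inner)
 qed
next
 fix X :: "nat => l2"
 assume X: "!!n. X n \<in> H1 S" and Cau: "!!e. e > 0 ==> \<exists>N. \<forall>m\<ge>N. \<forall>n\<ge>N.
 robin_form S sg al (X m - X n) (X m - X n) + c * inner (X m - X n) (X m - X n) < e"
 have d: "X m - X n \<in> H1 S" for m n using X subspace_H1 by (simp add: subspace_diff)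
 have wd: "weak_deriv S e (X m - v) = weak_deriv S e (X m) - weak_deriv S e v" if "e \<in> Basis" "v \<in> H1 S" for m e v
 using weak_deriv_add[OF X[of m] subspace_scale[OF subspace_H1 that(2), of "-1"] that(1)] weak_deriv_scale[OF that(2,1), of "-1"] by simp
 have lim: "\<exists>v. (%n. f (X n)) ----> v"
 if f: "!!m n. (norm (f (X m) - f (X n)))^2 <= 2 * (grad_norm2 (X m - X n) / 2 + (norm (X m - X n))^2)" for f :: "l2 => l2"
 proof -
 have "Cauchy (%n. f (X n))"
  unfolding Cauchy_iff
 proof (intro allI impI)
  fix e :: real assume e: "e > 0"
  then obtain N where N: "!!m n. m >= N ==> n >= N ==> robin_form S sg al (X m - X n) (X m - X n) + c * inner (X m - X n) (X m - X n) < e^2 / 2"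
  using Cau[of "e^2 / 2"] by (metis half_gt_zero zero_less_power)
  have "norm (f (X m) - f (X n)) < e" if "m >= N" "n >= N" for m n
  proof -
  have "(norm (f (X m) - f (X n)))^2 < e^2" using f[of m n] c[OF d, of m n] N[OF that] by argo
  then show ?thesis by (rule power_less_imp_less_base) (use e in simp)
  qed
  then show "\<exists>M. \<forall>m\<ge>M. \<forall>n\<ge>M. norm (f (X m) - f (X n)) < e" by blast
 qed
 then show ?thesis using complete_l2 by (simp add: convergent_def)
 qed
 have gpos: "0 <= grad_norm2 u" for u by (intro sum_nonneg) auto
 have "\<exists>v. X ----> v"
 proof (rule lim)
 show "(norm (X m - X n))^2 <= 2 * (grad_norm2 (X m - X n) / 2 + (norm (X m - X n))^2)" for m n
  using gpos[of "X m - X n"] zero_le_power2[of "norm (X m - X n)"] by argo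
 qed
 then obtain u where u: "X ----> u" by blast
 have "\<forall>e\<in>Basis. \<exists>v. (%n. weak_deriv S e (X n)) ----> v"
 proof
 fix e :: plane assume e: "e \<in> Basis"
 show "\<exists>v. (%n. weak_deriv S e (X n)) ----> v"
 proof (rule lim)
  fix m n
  have "(norm (weak_deriv S e (X m) - weak_deriv S e (X n)))^2 <= grad_norm2 (X m - X n)"
  unfolding wd[OF e X, symmetric]
  by (rule member_le_sum[OF e, of "%e. (norm (weak_deriv S e (X m - X n)))^2"]) auto
  then show "(norm (weak_deriv S e (X m) - weak_deriv S e (X n)))^2 <= 2 * (grad_norm2 (X m - X n) / 2 + (norm (X m - X n))^2)"
  using zero_le_power2[of "norm (X m - X n)"] by argo
 qed
 qed
 then obtain g where g: "!!e. e \<in> Basis ==> (%n. weak_deriv S e (X n)) ----> g e" by metis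
 note uH = H1_closed(1)[OF X u g] and ug = H1_closed(2)[OF X u g]
 show "\<exists>u\<in>H1 S. (%n. robin_form S sg al (X n - u) (X n - u) + c * inner (X n - u) (X n - u)) ----> 0"
 proof (intro bexI[of _ u] uH)
 have dH: "X n - u \<in> H1 S" for n using X uH subspace_H1 by (simp add: subspace_diff)
 have "(%n. (\<Sum>e\<in>Basis. (norm (weak_deriv S e (X n) - weak_deriv S e u))^2) + c * inner (X n - u) (X n - u))
  ----> (\<Sum>e\<in>Basis. (norm (weak_deriv S e u - weak_deriv S e u))^2) + c * inner (u - u) (u - u)"
  by (intro tendsto_intros u) (use g ug in auto)
 then have up: "(%n. (\<Sum>e\<in>Basis. (norm (weak_deriv S e (X n) - weak_deriv S e u))^2) + c * inner (X n - u) (X n - u)) ----> 0"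
  by simp
 show "(%n. robin_form S sg al (X n - u) (X n - u) + c * inner (X n - u) (X n - u)) ----> 0"
 proof (rule tendsto_sandwich[of "%_. 0", OF _ _ tendsto_const up])
  show "\<forall>\<^sub>F n in sequentially. 0 <= robin_form S sg al (X n - u) (X n - u) + c * inner (X n - u) (X n - u)"
  proof (intro always_eventually allI)
  fix n
  show "0 <= robin_form S sg al (X n - u) (X n - u) + c * inner (X n - u) (X n - u)"
   using c[OF dH, of n] gpos[of "X n - u"] zero_le_power2[of "norm (X n - u)"] by linarith
  qed
  show "\<forall>\<^sub>F n in sequentially. robin_form S sg al (X n - u) (X n - u) + c * inner (X n - u) (X n - u)
   <= (\<Sum>e\<in>Basis. (norm (weak_deriv S e (X n) - weak_deriv S e u))^2) + c * inner (X n - u) (X n - u)"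
  proof (intro always_eventually allI)
  fix n
  have "grad_norm2 (X n - u) = (\<Sum>e\<in>Basis. (norm (weak_deriv S e (X n) - weak_deriv S e u))^2)"
   by (intro sum.cong refl) (simp only: wd[OF _ uH])
  then show "robin_form S sg al (X n - u) (X n - u) + c * inner (X n - u) (X n - u)
   <= (\<Sum>e\<in>Basis. (norm (weak_deriv S e (X n) - weak_deriv S e u))^2) + c * inner (X n - u) (X n - u)"
   using robin_form_le[OF al, of "X n - u"] by linarith
  qed
 qed
 qed
qed

end

section \<open>Reduction of spectral statements to test functions\<close>

locale robin = robin_domain +
 fixes al c :: real
 assumes al: "al > 0"
 and coercive: "!!u. u \<in> H1 S ==> grad_norm2 u / 2 + (norm u)^2 <= robin_form S sg al u u + c * inner u u"
begin

sublocale semibounded_form "L2_on S" "H1 S" "robin_form S sg al" c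
 by (rule semibounded_robin_form[OF al coercive])

lemma robin_operator_eq: "robin_operator S sg al = graph"
 by (simp add: robin_operator_def graph_def)

lemma approximates_const: "ph \<in> C1c UNIV ==> approximates (%_. ph) (restr S ph)"
 by (simp add: approximates_def restr_l2_H1)

lemma robin_form_restr:
 assumes "ph \<in> C1c UNIV" "ps \<in> C1c UNIV"
 shows "robin_form S sg al (restr S ph) (restr S ps) = test_form al ph ps"
 using robin_form_limit[OF restr_l2_H1(1) approximates_const restr_l2_H1(1) approximates_const, OF assms(1,1,2,2), of al]
 by (simp add: LIMSEQ_const_iff)

lemma essentially_geI:
 assumes "finite F"
 and "!!ph. ph \<in> C1c UNIV ==> test_form al ph ph >= M * (norm (restr S ph))^2 - C * (\<Sum>f\<in>F. (inner (restr S ph) f)^2)"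
 shows "essentially_ge M F"
 unfolding essentially_ge_def
proof (intro conjI exI[of _ C] ballI assms(1))
 fix u assume u: "u \<in> H1 S"
 obtain ph where ap: "approximates ph u" using smooth_dense_H1[OF u] by blast
 have 1: "(%n. restr S (ph n)) ----> u" using ap by (simp add: approximates_def)
 have "(%n. M * (norm (restr S (ph n)))^2 - C * (\<Sum>f\<in>F. (inner (restr S (ph n)) f)^2)) ----> M * (norm u)^2 - C * (\<Sum>f\<in>F. (inner u f)^2)"
 by (intro tendsto_intros 1)
 moreover have "(%n. test_form al (ph n) (ph n)) ----> robin_form S sg al u u"
 by (intro robin_form_limit u ap)
 ultimately have "M * (norm u)^2 - C * (\<Sum>f\<in>F. (inner u f)^2) <= robin_form S sg al u u"
 by (rule LIMSEQ_le) (use assms(2) ap in \<open>auto simp: approximates_def\<close>)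
 then show "M * inner u u - C * (\<Sum>f\<in>F. (inner u f)^2) <= robin_form S sg al u u"
 by (simp add: power2_norm_eq_inner)
qed

text \<open>The weak Weyl criterion with both the approximate eigenvector and the test vectors
  smooth, and with the plain Sobolev norm in place of the form norm.\<close>

lemma resolvent_test_bound:
 assumes "z \<in> resolvent_set (L2_on S) graph"
 shows "\<exists>K. \<forall>ph\<in>C1c UNIV. \<forall>\<epsilon>\<ge>0.
 (\<forall>ps\<in>C1c UNIV. \<bar>test_form al ph ps - z * inner (restr S ph) (restr S ps)\<bar>
  <= \<epsilon> * sqrt ((dirichlet S ps) + (norm (restr S ps))^2))
 \<longrightarrow> norm (restr S ph) <= K * \<epsilon>"
proof -
 obtain K where K: "\<forall>u\<in>H1 S. \<forall>e\<ge>0. (\<forall>v\<in>H1 S. \<bar>qs z u v\<bar> <= e * sqrt (qs (- c) v v)) \<longrightarrow> norm u <= K * e"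
 using resolvent_set_lower_bound[OF assms] by (elim exE)
 show ?thesis
 proof (intro exI[of _ "K * sqrt 2"] ballI allI impI)
 fix ph \<epsilon> assume ph: "ph \<in> C1c UNIV" and e: "0 <= (\<epsilon> :: real)"
  and test: "\<forall>ps\<in>C1c UNIV. \<bar>test_form al ph ps - z * inner (restr S ph) (restr S ps)\<bar>
  <= \<epsilon> * sqrt ((dirichlet S ps) + (norm (restr S ps))^2)"
 let ?u = "restr S ph"
 have "\<bar>qs z ?u v\<bar> <= (sqrt 2 * \<epsilon>) * sqrt (qs (- c) v v)" if v: "v \<in> H1 S" for v
 proof -
  obtain ps where ap: "approximates ps v" using smooth_dense_H1[OF v] by blast
  have 1: "(%n. restr S (ps n)) ----> v" using ap by (simp add: approximates_def)
  have "(%n. \<bar>test_form al ph (ps n) - z * inner ?u (restr S (ps n))\<bar>) ----> \<bar>robin_form S sg al ?u v - z * inner ?u v\<bar>"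
  by (intro tendsto_intros 1 robin_form_limit[OF restr_l2_H1(1)[OF ph] approximates_const[OF ph] v ap])
  moreover have "(%n. \<epsilon> * sqrt ((dirichlet S (ps n)) + (norm (restr S (ps n)))^2)) ----> \<epsilon> * sqrt (grad_norm2 v + (norm v)^2)"
  by (intro tendsto_intros 1 approximates_grad_norm2[OF ap])
  ultimately have "\<bar>qs z ?u v\<bar> <= \<epsilon> * sqrt (grad_norm2 v + (norm v)^2)"
  unfolding qs_def by (rule LIMSEQ_le) (use test ap in \<open>auto simp: approximates_def\<close>)
  \<comment> \<open>The 2 compensates the half of the Dirichlet integral that coercivity
    retains.\<close>
  also have "... <= \<epsilon> * sqrt (2 * qs (- c) v v)"
  proof (intro mult_left_mono real_sqrt_le_mono e)
  show "grad_norm2 v + (norm v)^2 <= 2 * qs (- c) v v"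
  proof -
   have "grad_norm2 v + (norm v)^2 <= 2 * (grad_norm2 v / 2 + (norm v)^2)" by simp
   also have "... <= 2 * (robin_form S sg al v v + c * inner v v)"
   by (intro mult_left_mono coercive[OF v]) simp
   finally show ?thesis by (simp add: qs_def)
  qed
  qed
  finally show ?thesis by (simp add: real_sqrt_mult mult_ac)
 qed
 then show "norm ?u <= K * sqrt 2 * \<epsilon>"
  using K[rule_format, OF restr_l2_H1(1)[OF ph], of "sqrt 2 * \<epsilon>"] e by (simp add: mult.assoc)
 qed
qed

end

section \<open>One-dimensional inequalities\<close>

definition seg :: "real => real => real measure" where
 "seg a b = restrict_space lborel {a..b}"

lemma finite_measure_seg: "finite_measure (seg a b)"
 unfolding seg_def by (intro finite_measureI) (auto simp: emeasure_restrict_space space_restrict_space emeasure_lborel_Icc_eq)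

lemma seg_measurable [measurable (raw)]: "f \<in> bmeas ==> f \<in> borel_measurable (seg a b)"
 unfolding seg_def by (intro measurable_restrict_space1) simp

lemma space_seg [simp]: "space (seg a b) = {a..b}"
 by (simp add: seg_def space_restrict_space)

lemma seg_integral: "(\<integral>x. f x \<partial>seg a b) = (\<integral>x. ind {a..b} x * f x \<partial>lborel)" for f :: "real => real"
 by (simp add: seg_def integral_restrict_space)

lemma seg_integrable:
 fixes f :: "real => real"
 assumes "f \<in> bmeas" "!!x. x \<in> {a..b} ==> \<bar>f x\<bar> <= B"
 shows "integrable (seg a b) f"
proof -
 interpret finite_measure "seg a b" by (rule finite_measure_seg)
 show ?thesis
 by (rule integrable_const_bound[of _ B]) (use assms in \<open>auto intro!: AE_I2\<close>)
qed

lemma measure_seg [simp]: "a <= b ==> measure (seg a b) {a..b} = b - a"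
 unfolding seg_def by (subst measure_restrict_space) auto

lemma seg_integral_const: "a <= b ==> (\<integral>x. (c :: real) \<partial>seg a b) = (b - a) * c"
 by simp

lemma seg_square_integrable:
 fixes f :: "real => real"
 assumes "f \<in> bmeas" "!!x. x \<in> {a..b} ==> \<bar>f x\<bar> <= B"
 shows "sqint (seg a b) f"
 unfolding square_integrable_def
proof
 show "f \<in> borel_measurable (seg a b)" using assms(1) by measurable
 have "\<bar>(f x)^2\<bar> <= B^2" if "x \<in> {a..b}" for x
 proof -
 have "\<bar>f x\<bar>\<^sup>2 <= B^2" using assms(2)[OF that] by (intro power_mono) auto
 then show ?thesis by simp
 qed
 then show "integrable (seg a b) (%x. (f x)^2)"
 using assms(1) by (intro seg_integrable) measurable
qed

text \<open>Absolutely continuous functions suffice here in the form: continuous, with bounded derivative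
 off a finite set. Restrictions of test functions to lines become of this kind after the piecewise
 linear change of variables below.\<close>

definition pw_diff :: "real => real => (real => real) => (real => real) => bool" where
 "pw_diff a b f f' \<longleftrightarrow> continuous_on {a..b} f &
  (\<exists>D. finite D & (\<forall>x\<in>{a<..<b} - D. (f has_real_derivative f' x) (at x))) &
  f \<in> bmeas & f' \<in> bmeas & (\<exists>B. \<forall>x\<in>{a..b}. \<bar>f x\<bar> <= B & \<bar>f' x\<bar> <= B)"

lemma pw_diff_facts:
 assumes "pw_diff a b f f'"
 shows "f \<in> bmeas" "f' \<in> bmeas"
 "sqint (seg a b) f" "sqint (seg a b) f'" "integrable (seg a b) f" "integrable (seg a b) f'"
proof -
 obtain B where B: "!!x. x \<in> {a..b} ==> \<bar>f x\<bar> <= B" "!!x. x \<in> {a..b} ==> \<bar>f' x\<bar> <= B"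
 and m: "f \<in> bmeas" "f' \<in> bmeas"
 using assms unfolding pw_diff_def by blast
 show "f \<in> bmeas" "f' \<in> bmeas" by (fact m)+
 show "sqint (seg a b) f" "sqint (seg a b) f'" "integrable (seg a b) f" "integrable (seg a b) f'"
 using seg_square_integrable[OF m(1) B(1)] seg_square_integrable[OF m(2) B(2)] seg_integrable[OF m(1) B(1)]
  seg_integrable[OF m(2) B(2)] by auto
qed

lemma pw_diff_FTC:
 assumes f: "pw_diff a b f f'" and xy: "a <= x" "x <= y" "y <= b"
 shows "(\<integral>t. ind {x..y} t * f' t \<partial>seg a b) = f y - f x"
proof -
 obtain D B where D: "finite D" "!!x. x \<in> {a<..<b} - D ==> (f has_real_derivative f' x) (at x)"
 and c: "continuous_on {a..b} f" and m: "f' \<in> bmeas" and B: "!!x. x \<in> {a..b} ==> \<bar>f' x\<bar> <= B"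
 using f unfolding pw_diff_def by blast
 have "(f' has_integral (f y - f x)) {x..y}"
 by (rule fundamental_theorem_of_calculus_interior_strong[OF D(1) xy(2)])
  (use D(2) xy continuous_on_subset[OF c] in \<open>auto simp: has_real_derivative_iff_has_vector_derivative\<close>)
 then have 1: "integral {x..y} f' = f y - f x" by (rule integral_unique)
 have i: "integrable (seg x y) f'" by (rule seg_integrable[OF m B]) (use xy in auto)
 then have si: "set_integrable lborel {x..y} f'"
 unfolding seg_def set_integrable_def by (subst (asm) integrable_restrict_space) auto
 have "(\<integral>t. ind {x..y} t * f' t \<partial>seg a b) = (\<integral>t. ind {a..b} t * (ind {x..y} t * f' t) \<partial>lborel)"
 by (rule seg_integral)
 also have "(%t. ind {a..b} t * (ind {x..y} t * f' t)) = (%t. ind {x..y} t *\<^sub>R f' t)"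
 using xy by (auto simp: indicator_def)
 also have "(\<integral>t. ind {x..y} t *\<^sub>R f' t \<partial>lborel) = integral {x..y} f'"
 using set_borel_integral_eq_integral(2)[OF si] by (simp add: set_lebesgue_integral_def)
 finally show ?thesis using 1 by simp
qed

lemma pw_diff_FTC_full:
 assumes "pw_diff a b f f'" "a <= b"
 shows "(\<integral>t. f' t \<partial>seg a b) = f b - f a"
proof -
 have "(\<integral>t. f' t \<partial>seg a b) = (\<integral>t. ind {a..b} t * f' t \<partial>seg a b)"
 by (intro Bochner_Integration.integral_cong) auto
 then show ?thesis using pw_diff_FTC[OF assms(1), of a b] assms(2) by simp
qed

lemma pw_diff_mult:
 assumes f: "pw_diff a b f f'" and g: "pw_diff a b g g'"
 shows "pw_diff a b (%x. f x * g x) (%x. f' x * g x + f x * g' x)"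
proof -
 obtain D B where D: "finite D" "!!x. x \<in> {a<..<b} - D ==> (f has_real_derivative f' x) (at x)"
 and B: "!!x. x \<in> {a..b} ==> \<bar>f x\<bar> <= B & \<bar>f' x\<bar> <= B" and c: "continuous_on {a..b} f"
 using f unfolding pw_diff_def by blast
 obtain E C where E: "finite E" "!!x. x \<in> {a<..<b} - E ==> (g has_real_derivative g' x) (at x)"
 and C: "!!x. x \<in> {a..b} ==> \<bar>g x\<bar> <= C & \<bar>g' x\<bar> <= C" and d: "continuous_on {a..b} g"
 using g unfolding pw_diff_def by blast
 note [measurable] = pw_diff_facts(1,2)[OF f] pw_diff_facts(1,2)[OF g]
 show ?thesis
 unfolding pw_diff_def
 proof (intro conjI exI[of _ "D \<union> E"] exI[of _ "2 * \<bar>B * C\<bar>"] ballI)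
 fix x assume x: "x \<in> {a..b}"
 have *: "\<bar>u * v\<bar> <= \<bar>B * C\<bar>" if "\<bar>u\<bar> <= B" "\<bar>v\<bar> <= C" for u v :: real
  unfolding abs_mult using that by (intro mult_mono) auto
 show "\<bar>f x * g x\<bar> <= 2 * \<bar>B * C\<bar>" using *[of "f x" "g x"] B[OF x] C[OF x] by linarith
 have "\<bar>f' x * g x\<bar> <= \<bar>B * C\<bar>" "\<bar>f x * g' x\<bar> <= \<bar>B * C\<bar>" using * B[OF x] C[OF x] by blast+
 then show "\<bar>f' x * g x + f x * g' x\<bar> <= 2 * \<bar>B * C\<bar>" by linarith
 next
 fix x assume "x \<in> {a<..<b} - (D \<union> E)"
 then show "((%x. f x * g x) has_real_derivative f' x * g x + f x * g' x) (at x)"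
  using DERIV_mult[OF D(2)[of x] E(2)[of x]] by (simp add: add.commute mult.commute)
 qed (use D(1) E(1) c d in \<open>auto intro: continuous_on_mult\<close>)
qed

lemma pw_diff_lincomb:
 assumes f: "pw_diff a b f f'" and g: "pw_diff a b g g'"
 shows "pw_diff a b (%x. f x + s * g x) (%x. f' x + s * g' x)"
proof -
 obtain D B where D: "finite D" "!!x. x \<in> {a<..<b} - D ==> (f has_real_derivative f' x) (at x)"
 and B: "!!x. x \<in> {a..b} ==> \<bar>f x\<bar> <= B & \<bar>f' x\<bar> <= B" and c: "continuous_on {a..b} f"
 using f unfolding pw_diff_def by blast
 obtain E C where E: "finite E" "!!x. x \<in> {a<..<b} - E ==> (g has_real_derivative g' x) (at x)"
 and C: "!!x. x \<in> {a..b} ==> \<bar>g x\<bar> <= C & \<bar>g' x\<bar> <= C" and d: "continuous_on {a..b} g"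
 using g unfolding pw_diff_def by blast
 note [measurable] = pw_diff_facts(1,2)[OF f] pw_diff_facts(1,2)[OF g]
 show ?thesis
 unfolding pw_diff_def
 proof (intro conjI exI[of _ "D \<union> E"] exI[of _ "B + \<bar>s\<bar> * C"] ballI)
 fix x assume x: "x \<in> {a..b}"
 have *: "\<bar>u + s * v\<bar> <= B + \<bar>s\<bar> * C" if "\<bar>u\<bar> <= B" "\<bar>v\<bar> <= C" for u v :: real
 proof -
  have "\<bar>s\<bar> * \<bar>v\<bar> <= \<bar>s\<bar> * C" using that by (intro mult_left_mono) auto
  moreover have "\<bar>u + s * v\<bar> <= \<bar>u\<bar> + \<bar>s\<bar> * \<bar>v\<bar>" by (metis abs_mult abs_triangle_ineq)
  ultimately show ?thesis using that(1) by linarith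
 qed
 show "\<bar>f x + s * g x\<bar> <= B + \<bar>s\<bar> * C" "\<bar>f' x + s * g' x\<bar> <= B + \<bar>s\<bar> * C"
  using * B[OF x] C[OF x] by blast+
 next
 fix x assume "x \<in> {a<..<b} - (D \<union> E)"
 then show "((%x. f x + s * g x) has_real_derivative f' x + s * g' x) (at x)"
  using D(2)[of x] E(2)[of x] by (auto intro!: derivative_eq_intros)
 qed (use D(1) E(1) c d in \<open>auto intro!: continuous_intros\<close>)
qed

lemma pw_diff_parts:
 assumes f: "pw_diff a b f f'" and g: "pw_diff a b g g'" and ab: "a <= b"
 shows "(\<integral>x. f' x * g x \<partial>seg a b) = f b * g b - f a * g a - (\<integral>x. f x * g' x \<partial>seg a b)"
proof -
 note I = square_integrable_mult_integrable[OF pw_diff_facts(4)[OF f] pw_diff_facts(3)[OF g]]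
 square_integrable_mult_integrable[OF pw_diff_facts(3)[OF f] pw_diff_facts(4)[OF g]]
 have "(\<integral>x. f' x * g x + f x * g' x \<partial>seg a b) = f b * g b - f a * g a"
 by (rule pw_diff_FTC_full[OF pw_diff_mult[OF f g] ab])
 then show ?thesis using I by simp
qed

section \<open>Poincare, trace and Robin inequalities on an interval\<close>

lemma pw_diff_increment:
 assumes f: "pw_diff a b f f'" and xy: "x \<in> {a..b}" "y \<in> {a..b}"
 shows "(f y - f x)^2 <= (b - a) * (\<integral>t. (f' t)^2 \<partial>seg a b)"
proof -
 have *: "(f y - f x)^2 <= (b - a) * (\<integral>t. (f' t)^2 \<partial>seg a b)" if "a <= x" "x <= y" "y <= b" for x y
 proof -
 have i: "sqint (seg a b) (%t. ind {x..y} t :: real)"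
  by (rule seg_square_integrable[where B = 1]) (auto simp: indicator_def)
 have "(f y - f x)^2 = (\<integral>t. ind {x..y} t * f' t \<partial>seg a b)^2"
  using pw_diff_FTC[OF f that] by simp
 also have "... <= (\<integral>t. (ind {x..y} t)^2 \<partial>seg a b) * (\<integral>t. (f' t)^2 \<partial>seg a b)"
  by (rule square_integrable_Cauchy_Schwarz[OF i pw_diff_facts(4)[OF f]])
 also have "... <= (b - a) * (\<integral>t. (f' t)^2 \<partial>seg a b)"
 proof (rule mult_right_mono)
  have "(\<integral>t. (ind {x..y} t)^2 \<partial>seg a b) <= (\<integral>t. (1 :: real) \<partial>seg a b)"
  by (rule integral_mono[OF square_integrableD(2)[OF i] seg_integrable[of _ _ _ 1]]) (auto simp: indicator_def)
  also have "... = b - a" using seg_integral_const[of a b 1] that by simp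
  finally show "(\<integral>t. (ind {x..y} t)^2 \<partial>seg a b) <= b - a" .
 qed simp
 finally show ?thesis .
 qed
 show ?thesis
 proof (cases "x <= y")
 case True
 then show ?thesis using *[of x y] xy by simp
 next
 case False
 then show ?thesis using *[of y x] xy by (simp add: power2_commute)
 qed
qed

text \<open>The crude constant \<open>1 / L^2\<close> has the right order in \<open>L\<close>; it
  becomes the gain of order \<open>1 / r^2\<close> in the quadrangle.\<close>

lemma Poincare_zero:
 assumes f: "pw_diff 0 L f f'" and L: "L > 0" and f0: "f 0 = 0"
 shows "1 / L^2 * (\<integral>x. (f x)^2 \<partial>seg 0 L) <= (\<integral>x. (f' x)^2 \<partial>seg 0 L)"
proof -
 let ?J = "\<integral>x. (f' x)^2 \<partial>seg 0 L"
 have "(\<integral>x. (f x)^2 \<partial>seg 0 L) <= (\<integral>x. L * ?J \<partial>seg 0 L)"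
 proof (rule integral_mono)
 show "integrable (seg 0 L) (%x. (f x)^2)" by (intro square_integrableD pw_diff_facts(3)[OF f])
 show "integrable (seg 0 L) (%x. L * ?J)" by (rule seg_integrable[where B = "\<bar>L * ?J\<bar>"]) auto
 fix x assume "x \<in> space (seg 0 L)"
 then show "(f x)^2 <= L * ?J" using pw_diff_increment[OF f, of 0 x] L f0 by simp
 qed
 also have "... = L^2 * ?J" using seg_integral_const[of 0 L "L * ?J"] L by (simp add: power2_eq_square)
 finally show ?thesis using L by (simp add: field_simps)
qed

text \<open>Integrating the increment bound over both points turns the left-hand side into twice
  \<open>h\<close> times the variance integral.\<close>

lemma Poincare_mean:
 assumes f: "pw_diff a b f f'" and ab: "a < b"
 shows "(\<integral>x. (f x)^2 \<partial>seg a b) <= (b - a)^2 * (\<integral>x. (f' x)^2 \<partial>seg a b) + (\<integral>x. f x \<partial>seg a b)^2 / (b - a)"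
proof -
 define h where "h = b - a"
 have h: "h > 0" using ab by (simp add: h_def)
 define J where "J = (\<integral>x. (f' x)^2 \<partial>seg a b)"
 define F where "F = (\<integral>x. f x \<partial>seg a b)"
 define G where "G = (\<integral>x. (f x)^2 \<partial>seg a b)"
 have [simp]: "integrable (seg a b) f" "integrable (seg a b) (%x. (f x)^2)"
 using pw_diff_facts[OF f] square_integrableD by auto
 have c[simp]: "integrable (seg a b) (%x. c)" for c :: real
 by (rule seg_integrable[where B = "\<bar>c\<bar>"]) auto
 have m [simp]: "measure (seg a b) {a..b} = h" using ab by (simp add: h_def)
 have const: "(\<integral>x. c \<partial>seg a b) = h * c" for c :: real
 using seg_integral_const[of a b c] ab by (simp add: h_def)
 have 1: "h * (f y)^2 - 2 * f y * F + G <= h * (h * J)" if y: "y \<in> {a..b}" for y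
 proof -
 have "(\<integral>x. ((f y)^2 - 2 * f y * f x) + (f x)^2 \<partial>seg a b) <= (\<integral>x. h * J \<partial>seg a b)"
 proof (rule integral_mono)
  fix x assume "x \<in> space (seg a b)"
  then show "((f y)^2 - 2 * f y * f x) + (f x)^2 <= h * J"
  using pw_diff_increment[OF f, of x y] y by (simp add: h_def J_def power2_diff algebra_simps)
 qed (auto intro!: Bochner_Integration.integrable_add Bochner_Integration.integrable_diff)
 also have "(\<integral>x. ((f y)^2 - 2 * f y * f x) + (f x)^2 \<partial>seg a b) = h * (f y)^2 - 2 * f y * F + G"
  by (subst Bochner_Integration.integral_add) (auto simp: const F_def G_def)
 finally show ?thesis by (simp add: const)
 qed
 have "(\<integral>y. (h * (f y)^2 - 2 * F * f y) + G \<partial>seg a b) <= (\<integral>y. h * (h * J) \<partial>seg a b)"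
 by (rule integral_mono) (use 1 in \<open>auto simp: mult_ac\<close>)
 also have "(\<integral>y. (h * (f y)^2 - 2 * F * f y) + G \<partial>seg a b) = h * G - 2 * F * F + h * G"
 by (subst Bochner_Integration.integral_add) (auto simp: const F_def[symmetric] G_def[symmetric])
 finally have 2: "2 * (h * G) <= h * (h * (h * J)) + 2 * F^2" by (simp add: const power2_eq_square algebra_simps)
 have "J >= 0" by (simp add: J_def)
 then have "0 <= h * (h * (h * J))" using h by simp
 with 2 have "2 * (h * G) <= 2 * (h * (h * (h * J)) + F^2)" by argo
 then have "G <= h^2 * J + F^2 / h" using h by (simp add: field_simps power2_eq_square)
 then show ?thesis by (simp add: G_def J_def F_def h_def)
qed

text \<open>The fundamental theorem for \<open>f^2\<close> and Young's inequality with weight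
  \<open>e\<close> compare \<open>(f a)^2\<close> with \<open>(f x)^2\<close>; averaging over
  \<open>x\<close> gives the term \<open>1 / (b - a)\<close>.\<close>

lemma trace_inequality_1d:
 assumes f: "pw_diff a b f f'" and ab: "a < b" and e: "e > 0"
 shows "(f a)^2 <= e * (\<integral>x. (f' x)^2 \<partial>seg a b) + (1 / (b - a) + 1 / e) * (\<integral>x. (f x)^2 \<partial>seg a b)"
proof -
 define h where "h = b - a"
 have h: "h > 0" using ab by (simp add: h_def)
 define J where "J = (\<integral>x. (f' x)^2 \<partial>seg a b)"
 define G where "G = (\<integral>x. (f x)^2 \<partial>seg a b)"
 note I = square_integrableD(2)[OF pw_diff_facts(3)[OF f]] square_integrableD(2)[OF pw_diff_facts(4)[OF f]]
 have c[simp]: "integrable (seg a b) (%x. c)" for c :: real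
 by (rule seg_integrable[where B = "\<bar>c\<bar>"]) auto
 have m [simp]: "measure (seg a b) {a..b} = h" using ab by (simp add: h_def)
 have const: "(\<integral>x. c \<partial>seg a b) = h * c" for c :: real
 using seg_integral_const[of a b c] ab by (simp add: h_def)
 have ff: "pw_diff a b (%x. f x * f x) (%x. f' x * f x + f x * f' x)" by (rule pw_diff_mult[OF f f])
 have 1: "(f a)^2 <= (f x)^2 + (e * J + G / e)" if x: "x \<in> {a..b}" for x
 proof -
 have "f a * f a - f x * f x = - (\<integral>t. ind {a..x} t * (f' t * f t + f t * f' t) \<partial>seg a b)"
  using pw_diff_FTC[OF ff, of a x] x by simp
 also have "... <= (\<integral>t. e * (f' t)^2 + (1 / e) * (f t)^2 \<partial>seg a b)"
 proof (subst Bochner_Integration.integral_minus[symmetric], rule integral_mono)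
  show "integrable (seg a b) (%t. - (ind {a..x} t * (f' t * f t + f t * f' t)))"
  using x pw_diff_facts(6)[OF ff]
  by (intro Bochner_Integration.integrable_minus integrable_mult_indicator[where 'b = real, unfolded real_scaleR_def])
   (auto simp: seg_def sets_restrict_space_iff)
  show "integrable (seg a b) (%t. e * (f' t)^2 + (1 / e) * (f t)^2)" using I by simp
  fix t
  have "0 <= (sqrt e * f' t + f t / sqrt e)^2" by simp
  then have "0 <= e * (f' t)^2 + (1 / e) * (f t)^2 + (f' t * f t + f t * f' t)"
  using e by (simp add: power2_sum power_mult_distrib power_divide mult.commute[of "f t"])
  moreover have "0 <= e * (f' t)^2 + (1 / e) * (f t)^2" using e by simp
  ultimately show "- (ind {a..x} t * (f' t * f t + f t * f' t)) <= e * (f' t)^2 + (1 / e) * (f t)^2"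
  by (cases "t \<in> {a..x}") auto
 qed
 also have "... = e * J + G / e" using I by (simp add: J_def G_def)
 finally show ?thesis by (simp add: power2_eq_square)
 qed
 have "(\<integral>x. (f a)^2 \<partial>seg a b) <= (\<integral>x. (f x)^2 + (e * J + G / e) \<partial>seg a b)"
 by (rule integral_mono) (use 1 I in auto)
 then have "h * (f a)^2 <= G + h * (e * J + G / e)" using I by (simp add: const G_def)
 then have "(f a)^2 <= e * J + (1 / h + 1 / e) * G" using h by (simp add: field_simps)
 then show ?thesis by (simp add: J_def G_def h_def)
qed

text \<open>The \<open>w\<close>-component is removed by subtracting the multiple of \<open>w\<close> that makes \<open>f\<close> vanish at
 the Robin end, where a Poincare inequality is available.\<close>

lemma robin_inequality_1d:
 assumes f: "pw_diff 0 L f f'" and w: "pw_diff 0 L w w'" and w': "pw_diff 0 L w' (%x. k^2 * w x)"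
 and L: "L > 0" and w0: "w 0 = 1" "w' 0 = - al" and wL: "f L * w' L = 0" "w L * w' L <= 0"
 and m: "0 <= m" "m <= 1 / L^2" and N: "(\<integral>x. (w x)^2 \<partial>seg 0 L) > 0"
 shows "(\<integral>x. (f' x)^2 \<partial>seg 0 L) - al * (f 0)^2
 >= m * (\<integral>x. (f x)^2 \<partial>seg 0 L) - (k^2 + m) * (\<integral>x. f x * w x \<partial>seg 0 L)^2 / (\<integral>x. (w x)^2 \<partial>seg 0 L)"
proof -
 define c where "c = f 0"
 define N where "N = (\<integral>x. (w x)^2 \<partial>seg 0 L)"
 define F where "F = (\<integral>x. f x * w x \<partial>seg 0 L)"
 define G where "G = (\<integral>x. (f x)^2 \<partial>seg 0 L)"
 define J where "J = (\<integral>x. (f' x)^2 \<partial>seg 0 L)"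
 have N0: "N > 0" using N by (simp add: N_def)
 note sf = pw_diff_facts(3,4)[OF f] and sw = pw_diff_facts(3,4)[OF w]
 note I = square_integrableD(2)[OF sf(1)] square_integrableD(2)[OF sf(2)] square_integrableD(2)[OF sw(1)] square_integrableD(2)[OF sw(2)]
 square_integrable_mult_integrable[OF sf(1) sw(1)] square_integrable_mult_integrable[OF sf(2) sw(2)]
 \<comment> \<open>The boundary term at \<open>L\<close> vanishes for one of two reasons: a Neumann
   end of the profile, \<open>w' L = 0\<close>, or a function that is zero there,
   \<open>f L = 0\<close>.\<close>
 have "(\<integral>x. f' x * w' x \<partial>seg 0 L) = f L * w' L - f 0 * w' 0 - (\<integral>x. f x * (k^2 * w x) \<partial>seg 0 L)"
 by (rule pw_diff_parts[OF f w']) (use L in simp)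
 moreover have "(%x. f x * (k^2 * w x)) = (%x. k^2 * (f x * w x))" by (auto simp: mult_ac)
 ultimately have 1: "(\<integral>x. f' x * w' x \<partial>seg 0 L) = al * c - k^2 * F"
 using wL w0 by (simp add: c_def F_def)
 have "(\<integral>x. w' x * w' x \<partial>seg 0 L) = w L * w' L - w 0 * w' 0 - (\<integral>x. w x * (k^2 * w x) \<partial>seg 0 L)"
 by (rule pw_diff_parts[OF w w']) (use L in simp)
 moreover have "(%x. w x * (k^2 * w x)) = (%x. k^2 * (w x)^2)" by (auto simp: power2_eq_square mult_ac)
 ultimately have 2: "(\<integral>x. (w' x)^2 \<partial>seg 0 L) <= al - k^2 * N"
 using wL w0 by (simp add: N_def power2_eq_square)
 have g: "pw_diff 0 L (%x. f x + (- c) * w x) (%x. f' x + (- c) * w' x)" by (rule pw_diff_lincomb[OF f w])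
 have sq: "(\<integral>x. (p x + (- c) * r x)^2 \<partial>seg 0 L) = (\<integral>x. (p x)^2 \<partial>seg 0 L) - 2 * c * (\<integral>x. p x * r x \<partial>seg 0 L) + c^2 * (\<integral>x. (r x)^2 \<partial>seg 0 L)"
 if "integrable (seg 0 L) (%x. (p x)^2)" "integrable (seg 0 L) (%x. p x * r x)" "integrable (seg 0 L) (%x. (r x)^2)" for p r
 proof -
 have "(%x. (p x + (- c) * r x)^2) = (%x. (p x)^2 - 2 * c * (p x * r x) + c^2 * (r x)^2)"
  by (auto simp: power2_eq_square algebra_simps)
 then show ?thesis using that by simp
 qed
 have "1 / L^2 * (\<integral>x. (f x + (- c) * w x)^2 \<partial>seg 0 L) <= (\<integral>x. (f' x + (- c) * w' x)^2 \<partial>seg 0 L)"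
 by (rule Poincare_zero[OF g L]) (simp add: c_def w0)
 moreover have "m * (\<integral>x. (f x + (- c) * w x)^2 \<partial>seg 0 L) <= 1 / L^2 * (\<integral>x. (f x + (- c) * w x)^2 \<partial>seg 0 L)"
 using m by (intro mult_right_mono) auto
 ultimately have "m * (G - 2 * c * F + c^2 * N) <= J - 2 * c * (al * c - k^2 * F) + c^2 * (\<integral>x. (w' x)^2 \<partial>seg 0 L)"
 using sq[OF I(1) I(5) I(3)] sq[OF I(2) I(6) I(4)] 1 by (simp add: G_def F_def N_def J_def)
 also have "... <= J - 2 * c * (al * c - k^2 * F) + c^2 * (al - k^2 * N)"
 using 2 by (intro add_left_mono mult_left_mono) auto
 finally have 3: "J - al * c^2 >= m * G + (k^2 + m) * (c^2 * N - 2 * c * F)"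
 by (simp add: power2_eq_square algebra_simps)
 \<comment> \<open>Completing the square removes the unknown boundary value \<open>c\<close> in
   favour of the projection of \<open>f\<close> onto \<open>w\<close>.\<close>
 have "0 <= (c * N - F)^2 / N" using N0 by simp
 also have "(c * N - F)^2 / N = (c^2 * N - 2 * c * F) + F^2 / N"
 using N0 by (simp add: power2_eq_square field_simps)
 finally have "(k^2 + m) * (- (F^2 / N)) <= (k^2 + m) * (c^2 * N - 2 * c * F)"
 using m by (intro mult_left_mono) auto
 with 3 show ?thesis by (simp add: J_def G_def F_def N_def c_def)
qed

section \<open>Tensor products\<close>

text \<open>With the projections \<open>P\<close> onto \<open>w1\<close> and \<open>Q\<close> onto \<open>w2\<close> in the two variables this is
 \<open>(1 - P) (1 - Q) >= 0\<close>.\<close>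

lemma tensor_Bessel:
 fixes v :: "'a => 'b => real"
 assumes M1: "finite_measure M1" and M2: "finite_measure M2"
 and v: "(%(x, y). v x y) \<in> borel_measurable (M1 \<Otimes>\<^sub>M M2)" "!!x y. x \<in> space M1 ==> y \<in> space M2 ==> \<bar>v x y\<bar> <= B"
 and w1: "w1 \<in> borel_measurable M1" "!!x. x \<in> space M1 ==> \<bar>w1 x\<bar> <= B1"
 and w2: "w2 \<in> borel_measurable M2" "!!y. y \<in> space M2 ==> \<bar>w2 y\<bar> <= B2"
 and N1: "N1 = (\<integral>x. (w1 x)^2 \<partial>M1)" "N1 > 0" and N2: "N2 = (\<integral>y. (w2 y)^2 \<partial>M2)" "N2 > 0"
 shows "(\<integral>y. (\<integral>x. v x y * w1 x \<partial>M1)^2 \<partial>M2) / N1 + (\<integral>x. (\<integral>y. v x y * w2 y \<partial>M2)^2 \<partial>M1) / N2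
 <= (\<integral>y. \<integral>x. (v x y)^2 \<partial>M1 \<partial>M2) + (\<integral>y. \<integral>x. v x y * (w1 x * w2 y) \<partial>M1 \<partial>M2)^2 / (N1 * N2)"
proof -
 interpret M1: finite_measure M1 by (rule M1)
 interpret M2: finite_measure M2 by (rule M2)
 interpret P: pair_sigma_finite M1 M2 ..
 interpret P: finite_measure "M1 \<Otimes>\<^sub>M M2" by (rule finite_measure_pair_measure[OF M2 M1])
 note [measurable] = v(1) w1(1) w2(1)
 have bI1: "integrable M1 f" if "f \<in> borel_measurable M1" "!!x. x \<in> space M1 ==> \<bar>f x\<bar> <= C" for f :: "'a => real" and C
 by (rule M1.integrable_const_bound[of _ C]) (use that in auto)
 have bI2: "integrable M2 f" if "f \<in> borel_measurable M2" "!!x. x \<in> space M2 ==> \<bar>f x\<bar> <= C" for f :: "'b => real" and C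
 by (rule M2.integrable_const_bound[of _ C]) (use that in auto)
 have bP: "integrable (M1 \<Otimes>\<^sub>M M2) f" if "f \<in> borel_measurable (M1 \<Otimes>\<^sub>M M2)" "!!x y. x \<in> space M1 ==> y \<in> space M2 ==> \<bar>f (x, y)\<bar> <= C" for f :: "'a \<times> 'b => real" and C
 by (rule P.integrable_const_bound[of _ C]) (use that in \<open>auto simp: space_pair_measure\<close>)
 have prod_le: "\<bar>s * t\<bar> <= \<bar>C\<bar> * \<bar>D\<bar>" if "\<bar>s\<bar> <= C" "\<bar>t\<bar> <= D" for s t C D :: real
 unfolding abs_mult using that by (intro mult_mono) auto
 have sq_le: "\<bar>s^2\<bar> <= C^2" if "\<bar>s\<bar> <= C" for s C :: real
 using power_mono[OF that, of 2] by simp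
 have vm1: "(%x. v x y) \<in> borel_measurable M1" if "y \<in> space M2" for y
 using that by measurable
 have vm2: "(%y. v x y) \<in> borel_measurable M2" if "x \<in> space M1" for x
 using that by measurable
 define a where "a y = (\<integral>x. v x y * w1 x \<partial>M1)" for y
 define b where "b x = (\<integral>y. v x y * w2 y \<partial>M2)" for x
 define c where "c = (\<integral>y. \<integral>x. v x y * (w1 x * w2 y) \<partial>M1 \<partial>M2)"
 have am[measurable]: "a \<in> borel_measurable M2"
 unfolding a_def by (rule M1.borel_measurable_lebesgue_integral) measurable
 have bm[measurable]: "b \<in> borel_measurable M1"
 unfolding b_def by (rule M2.borel_measurable_lebesgue_integral) measurable
 have iv1: "integrable M1 (%x. v x y * w1 x)" "integrable M1 (%x. (v x y)^2)" "integrable M1 (%x. (w1 x)^2)" if "y \<in> space M2" for y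
 proof -
 note [measurable] = vm1[OF that]
 show "integrable M1 (%x. v x y * w1 x)"
  by (rule bI1[of _ "\<bar>B\<bar> * \<bar>B1\<bar>"]) (measurable, intro prod_le v(2) w1(2) that)
 show "integrable M1 (%x. (v x y)^2)" by (rule bI1[of _ "B^2"]) (measurable, intro sq_le v(2) that)
 show "integrable M1 (%x. (w1 x)^2)" by (rule bI1[of _ "B1^2"]) (measurable, intro sq_le w1(2))
 qed
 have w1I: "integrable M1 (%x. (w1 x)^2)" "integrable M1 w1"
 by (rule bI1[of _ "B1^2"], measurable, intro sq_le w1(2), assumption) (rule bI1[of _ B1], measurable, intro w1(2))
 have w2I: "integrable M2 (%x. (w2 x)^2)"
 by (rule bI2[of _ "B2^2"], measurable, intro sq_le w2(2))
 have iv2: "integrable M2 (%y. v x y * w2 y)" if "x \<in> space M1" for x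
 proof -
 note [measurable] = vm2[OF that]
 show ?thesis by (rule bI2[of _ "\<bar>B\<bar> * \<bar>B2\<bar>"]) (measurable, intro prod_le v(2) w2(2) that)
 qed
 define A where "A = \<bar>B\<bar> * \<bar>B1\<bar> * measure M1 (space M1)"
 have aB: "\<bar>a y\<bar> <= A" if "y \<in> space M2" for y
 proof -
 have "\<bar>a y\<bar> <= (\<integral>x. \<bar>v x y * w1 x\<bar> \<partial>M1)" unfolding a_def by (rule integral_abs_bound)
 also have "... <= (\<integral>x. \<bar>B\<bar> * \<bar>B1\<bar> \<partial>M1)"
  by (rule integral_mono[OF integrable_abs[OF iv1(1)[OF that]]]) (simp, intro prod_le v(2) w1(2) that)
 also have "... = A" by (simp add: A_def)
 finally show ?thesis .
 qed
 define B' where "B' = \<bar>B\<bar> * \<bar>B2\<bar> * measure M2 (space M2)"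
 have bB: "\<bar>b x\<bar> <= B'" if "x \<in> space M1" for x
 proof -
 have "\<bar>b x\<bar> <= (\<integral>y. \<bar>v x y * w2 y\<bar> \<partial>M2)" unfolding b_def by (rule integral_abs_bound)
 also have "... <= (\<integral>x. \<bar>B\<bar> * \<bar>B2\<bar> \<partial>M2)"
  by (rule integral_mono[OF integrable_abs[OF iv2[OF that]]]) (simp, intro prod_le v(2) w2(2) that)
 also have "... = B'" by (simp add: B'_def)
 finally show ?thesis .
 qed
 have a2: "integrable M2 (%y. (a y)^2)" "integrable M2 (%y. a y * w2 y)"
 by (rule bI2[of _ "A^2"], measurable, intro sq_le aB, assumption)
  (rule bI2[of _ "\<bar>A\<bar> * \<bar>B2\<bar>"], measurable, intro prod_le aB w2(2))
 have b2: "integrable M1 (%x. (b x)^2)" "integrable M1 (%x. b x * w1 x)"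
 by (rule bI1[of _ "B'^2"], measurable, intro sq_le bB, assumption)
  (rule bI1[of _ "\<bar>B'\<bar> * \<bar>B1\<bar>"], measurable, intro prod_le bB w1(2))
 have ca: "(\<integral>y. a y * w2 y \<partial>M2) = c"
 unfolding c_def a_def by (simp add: mult.assoc[symmetric])
 have cb: "(\<integral>x. b x * w1 x \<partial>M1) = c"
 proof -
 have "integrable (M1 \<Otimes>\<^sub>M M2) (%(x, y). v x y * (w1 x * w2 y))"
 proof (rule bP[of _ "\<bar>B\<bar> * \<bar>\<bar>B1\<bar> * \<bar>B2\<bar>\<bar>"])
  show "\<bar>case (x, y) of (x, y) => v x y * (w1 x * w2 y)\<bar> <= \<bar>B\<bar> * \<bar>\<bar>B1\<bar> * \<bar>B2\<bar>\<bar>" if "x \<in> space M1" "y \<in> space M2" for x y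
  using v(2)[OF that] w1(2)[OF that(1)] w2(2)[OF that(2)] by (simp only: prod.case) (intro prod_le)
 qed measurable
 from P.Fubini_integral[OF this] have "c = (\<integral>x. \<integral>y. v x y * (w1 x * w2 y) \<partial>M2 \<partial>M1)"
  by (simp add: c_def)
 also have "... = (\<integral>x. b x * w1 x \<partial>M1)"
 proof (rule Bochner_Integration.integral_cong[OF refl])
  fix x
  have "(%y. v x y * (w1 x * w2 y)) = (%y. (v x y * w2 y) * w1 x)" by (auto simp: mult_ac)
  then show "(\<integral>y. v x y * (w1 x * w2 y) \<partial>M2) = b x * w1 x" by (simp add: b_def)
 qed
 finally show ?thesis by simp
 qed
 \<comment> \<open>This is \<open>(1 - P) v\<close>, with \<open>a y / N1\<close> the coefficient of
   \<open>w1\<close> on the line through \<open>y\<close>.\<close>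
 define p where "p x y = v x y - w1 x * a y / N1" for x y
 have pm[measurable]: "(%(x, y). p x y) \<in> borel_measurable (M1 \<Otimes>\<^sub>M M2)"
 unfolding p_def by measurable
 define PB where "PB = \<bar>B\<bar> + \<bar>B1\<bar> * \<bar>A\<bar> / N1"
 have pB: "\<bar>p x y\<bar> <= PB" if "x \<in> space M1" "y \<in> space M2" for x y
 proof -
 have "\<bar>w1 x * a y / N1\<bar> <= \<bar>B1\<bar> * \<bar>A\<bar> / N1"
  using prod_le[OF w1(2)[OF that(1)] aB[OF that(2)]] N1(2) by (simp add: abs_divide divide_right_mono)
 then show ?thesis using v(2)[OF that] unfolding p_def PB_def by linarith
 qed
 have p1: "(\<integral>x. (p x y)^2 \<partial>M1) = (\<integral>x. (v x y)^2 \<partial>M1) - (a y)^2 / N1" if y: "y \<in> space M2" for y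
 proof -
 have "(%x. (p x y)^2) = (%x. (v x y)^2 - (2 * a y / N1) * (v x y * w1 x) + (a y / N1)^2 * (w1 x)^2)"
  using N1(2) by (auto simp: p_def power2_eq_square field_simps)
 then have "(\<integral>x. (p x y)^2 \<partial>M1) = (\<integral>x. (v x y)^2 \<partial>M1) - (2 * a y / N1) * a y + (a y / N1)^2 * N1"
  using iv1[OF y] by (simp add: a_def N1(1))
 also have "... = (\<integral>x. (v x y)^2 \<partial>M1) - (a y)^2 / N1"
  using N1(2) by (simp add: power2_eq_square field_simps)
 finally show ?thesis .
 qed
 \<comment> \<open>Bessel's inequality for \<open>w2\<close> applied to \<open>(1 - P) v\<close>,
   that is, \<open>1 - Q >= 0\<close> on the range of \<open>1 - P\<close>.\<close>
 have p2: "(\<integral>y. (p x y)^2 \<partial>M2) >= (b x - w1 x * c / N1)^2 / N2" if x: "x \<in> space M1" for x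
 proof -
 have pm2: "(%y. p x y) \<in> borel_measurable M2" using x by measurable
 have sp: "sqint M2 (p x)"
  unfolding square_integrable_def
  by (intro conjI pm2 bI2[of _ "PB^2"] borel_measurable_power sq_le pB[OF x])
 have sw: "sqint M2 w2" using w2(1) w2I by (simp add: square_integrable_def)
 have "(\<integral>y. p x y * w2 y \<partial>M2) = (\<integral>y. v x y * w2 y - (w1 x / N1) * (a y * w2 y) \<partial>M2)"
  using N1(2) by (intro Bochner_Integration.integral_cong refl) (simp add: p_def field_simps)
 also have "... = b x - w1 x * c / N1" using iv2[OF x] a2(2) by (simp add: ca b_def)
 finally have "(b x - w1 x * c / N1)^2 <= (\<integral>y. (p x y)^2 \<partial>M2) * N2"
  using square_integrable_Cauchy_Schwarz[OF sp sw] by (simp add: N2(1))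
 then show ?thesis using N2(2) by (simp add: field_simps)
 qed
 have ip: "integrable (M1 \<Otimes>\<^sub>M M2) (%(x, y). (p x y)^2)"
 by (rule bP[of _ "PB^2"]) (use pB sq_le in \<open>auto simp del: abs_power2\<close>)
 have iv: "integrable (M1 \<Otimes>\<^sub>M M2) (%(x, y). (v x y)^2)"
 by (rule bP[of _ "B^2"]) (use v(2) sq_le in \<open>auto simp del: abs_power2\<close>)
 have expand: "(b x - w1 x * c / N1)^2 / N2 = ((b x)^2 - (2 * c / N1) * (b x * w1 x) + (c / N1)^2 * (w1 x)^2) / N2" for x
 proof -
 have "(s - t * d)^2 = s^2 - (2 * d) * (s * t) + d^2 * t^2" for s t d :: real
  by (simp add: power2_eq_square algebra_simps)
 from this[of "b x" "w1 x" "c / N1"] show ?thesis by simp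
 qed
 have "(\<integral>x. (b x - w1 x * c / N1)^2 / N2 \<partial>M1) <= (\<integral>x. \<integral>y. (p x y)^2 \<partial>M2 \<partial>M1)"
 proof (rule integral_mono)
 have "integrable M1 (%x. ((b x)^2 - (2 * c / N1) * (b x * w1 x) + (c / N1)^2 * (w1 x)^2) / N2)"
  using b2 w1I by simp
 moreover have "(%x. ((b x)^2 - (2 * c / N1) * (b x * w1 x) + (c / N1)^2 * (w1 x)^2) / N2) = (%x. (b x - w1 x * c / N1)^2 / N2)"
  by (simp only: expand)
 ultimately show "integrable M1 (%x. (b x - w1 x * c / N1)^2 / N2)" by simp
 show "integrable M1 (%x. \<integral>y. (p x y)^2 \<partial>M2)" using P.integrable_fst'[OF ip] by simp
 qed (rule p2)
 also have "(\<integral>x. (b x - w1 x * c / N1)^2 / N2 \<partial>M1) = ((\<integral>x. (b x)^2 \<partial>M1) - c^2 / N1) / N2"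
 proof -
 have "(%x. (b x - w1 x * c / N1)^2 / N2) = (%x. ((b x)^2 - (2 * c / N1) * (b x * w1 x) + (c / N1)^2 * (w1 x)^2) / N2)"
  by (simp only: expand)
 then have "(\<integral>x. (b x - w1 x * c / N1)^2 / N2 \<partial>M1) = ((\<integral>x. (b x)^2 \<partial>M1) - (2 * c / N1) * c + (c / N1)^2 * N1) / N2"
  using b2 w1I cb by (simp add: N1(1)[symmetric])
 also have "... = ((\<integral>x. (b x)^2 \<partial>M1) - c^2 / N1) / N2"
  using N1(2) by (simp add: power2_eq_square field_simps)
 finally show ?thesis .
 qed
 also have "(\<integral>x. \<integral>y. (p x y)^2 \<partial>M2 \<partial>M1) = (\<integral>y. \<integral>x. (p x y)^2 \<partial>M1 \<partial>M2)"
 using P.Fubini_integral[OF ip] by simp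
 also have "... = (\<integral>y. (\<integral>x. (v x y)^2 \<partial>M1) - (a y)^2 / N1 \<partial>M2)"
 by (intro Bochner_Integration.integral_cong refl p1)
 also have "... = (\<integral>y. \<integral>x. (v x y)^2 \<partial>M1 \<partial>M2) - (\<integral>y. (a y)^2 \<partial>M2) / N1"
 using P.integrable_snd[OF iv] a2(1) by simp
 finally show ?thesis
 using N1(2) N2(2) by (simp add: a_def[symmetric] b_def[symmetric] c_def[symmetric] diff_divide_distrib)
qed

section \<open>Unfolding the sector\<close>

text \<open>The map is factored into two one-dimensional affine substitutions, first
  \<open>u = a x + b y\<close> in \<open>x\<close>, then one in \<open>y\<close> with factor
  \<open>det / a\<close>; hence the condition on \<open>a\<close> besides the determinant.\<close>

lemma nn_integral_plane_linear:
 fixes F :: "plane => ennreal"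
 assumes F[measurable]: "F \<in> bmeas" and a: "a ~= 0" and det: "a * d - b * c ~= 0"
 shows "(\<integral>\<^sup>+z. F z \<partial>lborel) = ennreal \<bar>a * d - b * c\<bar> * (\<integral>\<^sup>+z. F (a * fst z + b * snd z, c * fst z + d * snd z) \<partial>lborel)"
proof -
 let ?D = "a * d - b * c"
 have m2: "F \<in> borel_measurable (borel \<Otimes>\<^sub>M borel)" using F by (simp add: borel_prod)
 have "(\<integral>\<^sup>+z. F (a * fst z + b * snd z, c * fst z + d * snd z) \<partial>lborel)
  = (\<integral>\<^sup>+z. F (a * fst z + b * snd z, c * fst z + d * snd z) \<partial>(lborel \<Otimes>\<^sub>M lborel))"
 by (simp add: lborel_prod)
 also have "... = (\<integral>\<^sup>+y. \<integral>\<^sup>+x. F (a * x + b * y, c * x + d * y) \<partial>lborel \<partial>lborel)"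
 by (subst lborel_pair.nn_integral_snd[symmetric]) (use m2 in \<open>auto simp: split_beta\<close>)
 also have "ennreal \<bar>a\<bar> * ... = (\<integral>\<^sup>+y. ennreal \<bar>a\<bar> * (\<integral>\<^sup>+x. F (a * x + b * y, c * x + d * y) \<partial>lborel) \<partial>lborel)"
 by (rule nn_integral_cmult[symmetric]) (use m2 in measurable)
 also have "... = (\<integral>\<^sup>+y. \<integral>\<^sup>+u. F (u, (c / a) * u + (?D / a) * y) \<partial>lborel \<partial>lborel)"
 proof (rule nn_integral_cong)
 fix y
 have "(\<integral>\<^sup>+u. F (u, (c / a) * u + (?D / a) * y) \<partial>lborel)
  = ennreal \<bar>a\<bar> * (\<integral>\<^sup>+x. F (b * y + a * x, (c / a) * (b * y + a * x) + (?D / a) * y) \<partial>lborel)"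
  by (rule nn_integral_real_affine[OF _ a]) (use m2 in measurable)
 also have "(%x. F (b * y + a * x, (c / a) * (b * y + a * x) + (?D / a) * y)) = (%x. F (a * x + b * y, c * x + d * y))"
  using a by (intro ext arg_cong[of _ _ F]) (auto simp: field_simps)
 finally show "ennreal \<bar>a\<bar> * (\<integral>\<^sup>+x. F (a * x + b * y, c * x + d * y) \<partial>lborel) = (\<integral>\<^sup>+u. F (u, (c / a) * u + (?D / a) * y) \<partial>lborel)" by simp
 qed
 also have "... = (\<integral>\<^sup>+u. \<integral>\<^sup>+y. F (u, (c / a) * u + (?D / a) * y) \<partial>lborel \<partial>lborel)"
 by (rule lborel_pair.Fubini') (use m2 in measurable)
 finally have 1: "ennreal \<bar>a\<bar> * (\<integral>\<^sup>+z. F (a * fst z + b * snd z, c * fst z + d * snd z) \<partial>lborel)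
  = (\<integral>\<^sup>+u. \<integral>\<^sup>+y. F (u, (c / a) * u + (?D / a) * y) \<partial>lborel \<partial>lborel)" .
 have "(\<integral>\<^sup>+z. F z \<partial>lborel) = (\<integral>\<^sup>+z. F z \<partial>(lborel \<Otimes>\<^sub>M lborel))" by (simp add: lborel_prod)
 also have "... = (\<integral>\<^sup>+u. \<integral>\<^sup>+w. F (u, w) \<partial>lborel \<partial>lborel)"
 by (subst lborel.nn_integral_fst[symmetric]) (use m2 in auto)
 also have "... = (\<integral>\<^sup>+u. ennreal \<bar>?D / a\<bar> * (\<integral>\<^sup>+y. F (u, (c / a) * u + (?D / a) * y) \<partial>lborel) \<partial>lborel)"
 proof (rule nn_integral_cong)
 fix u
 show "(\<integral>\<^sup>+w. F (u, w) \<partial>lborel) = ennreal \<bar>?D / a\<bar> * (\<integral>\<^sup>+y. F (u, (c / a) * u + (?D / a) * y) \<partial>lborel)"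
  by (rule nn_integral_real_affine) (use m2 a det in \<open>measurable, auto\<close>)
 qed
 also have "... = ennreal \<bar>?D / a\<bar> * (\<integral>\<^sup>+u. \<integral>\<^sup>+y. F (u, (c / a) * u + (?D / a) * y) \<partial>lborel \<partial>lborel)"
 by (rule nn_integral_cmult) (use m2 in measurable)
 also have "... = ennreal \<bar>?D\<bar> * (\<integral>\<^sup>+z. F (a * fst z + b * snd z, c * fst z + d * snd z) \<partial>lborel)"
 unfolding 1[symmetric] mult.assoc[symmetric] using a by (simp add: ennreal_mult[symmetric] abs_divide)
 finally show ?thesis .
qed

lemma seg_seg_integral:
 fixes G :: "plane => real"
 assumes G: "G \<in> bmeas" "!!x y. x \<in> {0..L} ==> y \<in> {0..L} ==> \<bar>G (x, y)\<bar> <= B"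
 shows "integrable lborel (%z :: plane. ind ({0..L} \<times> {0..L}) z * G z)"
 and "(\<integral>z. ind ({0..L} \<times> {0..L}) z * G z \<partial>(lborel :: plane measure)) = (\<integral>y. \<integral>x. G (x, y) \<partial>seg 0 L \<partial>seg 0 L)"
proof -
 have c: "compact ({0..L} \<times> {0..L} :: plane set)" by (intro compact_Times) auto
 have [measurable]: "{0..L} \<times> {0..L} \<in> sets (borel :: plane measure)" using c by (simp add: borel_compact)
 note [measurable] = G(1)
 have "integrable lborel (%z :: plane. ind ({0..L} \<times> {0..L}) z *\<^sub>R \<bar>B\<bar>)"
 using borel_integrable_compact[OF c, of "%_. \<bar>B\<bar>"] by simp
 then show i: "integrable lborel (%z :: plane. ind ({0..L} \<times> {0..L}) z * G z)"
 proof (rule Bochner_Integration.integrable_bound)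
 show "AE z in lborel. norm (ind ({0..L} \<times> {0..L}) z * G z) <= norm (ind ({0..L} \<times> {0..L}) z *\<^sub>R \<bar>B\<bar>)"
 proof (rule AE_I2)
  fix z
  have "\<bar>G z\<bar> <= \<bar>B\<bar>" if "z \<in> {0..L} \<times> {0..L}"
  using G(2)[of "fst z" "snd z"] that abs_ge_self[of B] by (auto simp: mem_Times_iff)
  then show "norm (ind ({0..L} \<times> {0..L}) z * G z) <= norm (ind ({0..L} \<times> {0..L}) z *\<^sub>R \<bar>B\<bar>)"
  by (cases "z \<in> {0..L} \<times> {0..L}") auto
 qed
 qed measurable
 then have i': "integrable (lborel \<Otimes>\<^sub>M lborel) (%(x, y). ind ({0..L} \<times> {0..L}) (x, y) * G (x, y))"
 by (simp add: lborel_prod split_beta')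
 have "(\<integral>z. ind ({0..L} \<times> {0..L}) z * G z \<partial>(lborel :: plane measure)) = (\<integral>z. ind ({0..L} \<times> {0..L}) z * G z \<partial>(lborel \<Otimes>\<^sub>M lborel))"
 by (simp add: lborel_prod)
 also have "... = (\<integral>y. \<integral>x. ind ({0..L} \<times> {0..L}) (x, y) * G (x, y) \<partial>lborel \<partial>lborel)"
 using lborel_pair.integral_snd[OF i'] by (simp add: split_beta')
 also have "... = (\<integral>y. ind {0..L} y * (\<integral>x. G (x, y) \<partial>seg 0 L) \<partial>lborel)"
 proof (rule Bochner_Integration.integral_cong[OF refl])
 fix y
 have "(%x. ind ({0..L} \<times> {0..L}) (x, y) * G (x, y)) = (%x. ind {0..L} y * (ind {0..L} x * G (x, y)))"
  by (auto simp: indicator_def)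
 then show "(\<integral>x. ind ({0..L} \<times> {0..L}) (x, y) * G (x, y) \<partial>lborel) = ind {0..L} y * (\<integral>x. G (x, y) \<partial>seg 0 L)"
  by (simp add: seg_integral)
 qed
 also have "... = (\<integral>y. \<integral>x. G (x, y) \<partial>seg 0 L \<partial>seg 0 L)" by (subst (2) seg_integral) simp
 finally show "(\<integral>z. ind ({0..L} \<times> {0..L}) z * G z \<partial>(lborel :: plane measure)) = (\<integral>y. \<integral>x. G (x, y) \<partial>seg 0 L \<partial>seg 0 L)" .
qed

lemma integral_side_measure:
 fixes F :: "plane => real"
 assumes F[measurable]: "F \<in> bmeas" and J[measurable]: "J \<in> sets borel"
 and I: "integrable lborel (%t. ind J t * F (t * cos th, t * sin th))" "integrable lborel (%t. ind J t * F (t * cos th, - t * sin th))"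
 shows "integrable (side_measure th J) F"
 and "(\<integral>x. F x \<partial>side_measure th J) = (\<integral>t. ind J t * F (t * cos th, t * sin th) \<partial>lborel) + (\<integral>t. ind J t * F (t * cos th, - t * sin th) \<partial>lborel)"
proof -
 let ?p = "%t. (t * cos th, t * sin th)" and ?m = "%t. (t * cos th, - t * sin th)"
 have [measurable]: "?p \<in> bmeas" "?m \<in> bmeas"
 by (intro borel_measurable_continuous_onI continuous_intros)+
 have sets: "sets (side_measure th J) = sets borel" by (simp add: side_measure_def)
 have Fm: "F \<in> borel_measurable (side_measure th J)" using F measurable_cong_sets[OF sets refl] by blast
 have ind: "ennreal y * ind J t = ennreal (ind J t * y)" for y t :: real
 by (auto simp: indicator_def)
 have nn: "(\<integral>\<^sup>+x. ennreal (G x) \<partial>side_measure th J) = (\<integral>\<^sup>+t. ennreal (ind J t * G (?p t)) \<partial>lborel) + (\<integral>\<^sup>+t. ennreal (ind J t * G (?m t)) \<partial>lborel)"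
 if [measurable]: "G \<in> bmeas" for G :: "plane => real"
 by (subst nn_integral_side_measure) (auto simp: ind)
 have fin: "(\<integral>\<^sup>+t. ennreal (f t) \<partial>lborel) < \<infinity>" if "integrable lborel f" for f :: "real => real"
 proof -
 have "(\<integral>\<^sup>+t. ennreal (f t) \<partial>lborel) <= (\<integral>\<^sup>+t. ennreal (norm (f t)) \<partial>lborel)"
  by (intro nn_integral_mono ennreal_leI) auto
 also have "... < \<infinity>" using that by (simp add: integrable_iff_bounded)
 finally show ?thesis .
 qed
 have n: "ind J t * \<bar>G\<bar> = \<bar>ind J t * G\<bar>" "ind J t * (- G) = - (ind J t * G)" for t G :: real
 by (auto simp: indicator_def)
 have "(\<integral>\<^sup>+x. ennreal (norm (F x)) \<partial>side_measure th J) < \<infinity>"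
 using fin[OF integrable_abs[OF I(1)]] fin[OF integrable_abs[OF I(2)]]
 by (simp add: nn n)
 with Fm show i: "integrable (side_measure th J) F" by (simp add: integrable_iff_bounded)
 note f = fin[OF I(1)] fin[OF I(2)] fin[OF Bochner_Integration.integrable_minus[OF I(1)]] fin[OF Bochner_Integration.integrable_minus[OF I(2)]]
 show "(\<integral>x. F x \<partial>side_measure th J) = (\<integral>t. ind J t * F (?p t) \<partial>lborel) + (\<integral>t. ind J t * F (?m t) \<partial>lborel)"
 unfolding real_lebesgue_integral_def[OF i] real_lebesgue_integral_def[OF I(1)] real_lebesgue_integral_def[OF I(2)]
 using f by (subst nn, measurable, subst nn, measurable) (simp add: n enn2real_plus)
qed

lemma rotation_identities:
 fixes s c t u :: real
 shows "(u * c + t * s)^2 + (u * s - t * c)^2 = (u^2 + t^2) * (s * s + c * c)"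
 "(u * c + t * s) * c + (u * s - t * c) * s = u * (s * s + c * c)"
 "(t * c)^2 + (t * s)^2 = t^2 * (s * s + c * c)"
 by (simp_all add: power2_eq_square algebra_simps)

section \<open>The unfolding map\<close>

locale half_angle =
 fixes th :: real
 assumes theta: "pi / 4 <= th" "th < pi / 2"
begin

abbreviation co where "co \<equiv> cos th"
abbreviation si where "si \<equiv> sin th"

text \<open>The ratio of the legs \<open>A B\<close> and \<open>O A\<close> of half the quadrangle,
  a right triangle with its right angle at \<open>A\<close>; stretching \<open>O A\<close> by it
  makes the triangle isosceles.\<close>

definition slope :: real where "slope = tan th"

lemma cos_pos: "co > 0" and sin_pos: "si > 0"
 using theta pi_gt_zero by (intro cos_gt_zero_pi sin_gt_zero; linarith)+

lemma slope: "slope = si / co" "slope >= 1" "slope > 0" "slope * co = si" "si / slope = co"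
proof -
 show 1: "slope = si / co" by (simp add: slope_def tan_def)
 have "tan (pi / 4) <= tan th" using theta by (intro tan_mono_le) auto
 then show 2: "slope >= 1" by (simp add: slope_def tan_45)
 show "slope > 0" using 2 by simp
 show "slope * co = si" "si / slope = co" using cos_pos sin_pos by (auto simp: 1)
qed

lemma sq1: "si * si + co * co = 1"
 using sin_cos_squared_add[of th] by (simp add: power2_eq_square)

text \<open>The isometric images of the two halves of the sector, rescaled along the Robin sides so that
 they fit together to a quadrant; \<open>unf (x, 0)\<close> and \<open>unf (0, y)\<close> parametrize the two sides.\<close>

definition unf :: "plane => plane" where
 "unf z = (max (fst z) (snd z) * (co / slope) + min (fst z) (snd z) * si, (fst z - snd z) * co)"

text \<open>The left inverse of \<open>unf\<close>: \<open>t\<close> recovers the smaller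
  coordinate, the distance to the nearer side for points of the sector, and the larger coordinate
  exceeds it by \<open>\<bar>snd p\<bar> / co\<close>.\<close>

definition refold :: "plane => plane" where
 "refold p = (let t = fst p * si - \<bar>snd p\<bar> * co in (t + max 0 (snd p) / co, t + max 0 (- snd p) / co))"

lemma continuous_unf: "continuous_on UNIV unf"
 unfolding unf_def[abs_def] by (intro continuous_intros)

lemma unf_measurable [measurable]: "unf \<in> bmeas"
 by (rule borel_measurable_continuous_onI[OF continuous_unf])

lemma refold_measurable [measurable]: "refold \<in> bmeas"
 unfolding refold_def[abs_def] Let_def
 by (intro borel_measurable_continuous_onI continuous_intros) (use cos_pos in auto)

text \<open>On each half this displays an isometry after rescaling: the larger coordinate divided by
  \<open>slope\<close> is arc length along a side, the smaller one the distance from that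
  side.\<close>

lemma unf_cases:
 "y <= x ==> unf (x, y) = (x / slope * co + y * si, x / slope * si - y * co)"
 "x <= y ==> unf (x, y) = (y / slope * co + x * si, - (y / slope) * si + x * co)"
proof -
 have "x / slope * si = x * co" for x using slope by (metis times_divide_eq_left times_divide_eq_right)
 then show "y <= x ==> unf (x, y) = (x / slope * co + y * si, x / slope * si - y * co)"
 "x <= y ==> unf (x, y) = (y / slope * co + x * si, - (y / slope) * si + x * co)"
 by (auto simp: unf_def algebra_simps)
qed

lemma fst_unf_sin: "fst (unf (x, y)) * si = max x y * (co * co) + min x y * (si * si)"
proof -
 have K: "co / slope * si = co * co" using slope(5) by (metis times_divide_eq_left times_divide_eq_right)
 show ?thesis by (simp only: unf_def fst_conv snd_conv distrib_right mult.assoc K)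
qed

lemma refold_unf: "refold (unf (x, y)) = (x, y)"
proof -
 have s: "\<bar>snd (unf (x, y))\<bar> * co = (max x y - min x y) * (co * co)"
 using cos_pos by (auto simp: unf_def abs_mult max_def min_def)
 have t: "fst (unf (x, y)) * si - \<bar>snd (unf (x, y))\<bar> * co = min x y"
 proof -
 have "fst (unf (x, y)) * si - \<bar>snd (unf (x, y))\<bar> * co = min x y * (si * si + co * co)"
 proof -
  have "a * p + b * r - (a - b) * p = b * (r + p)" for a b p r :: real by (simp add: algebra_simps)
  then show ?thesis unfolding fst_unf_sin s by blast
 qed
 then show ?thesis by (simp only: sq1 mult_1_right)
 qed
 have "max 0 (snd (unf (x, y))) / co = max 0 (x - y)" "max 0 (- snd (unf (x, y))) / co = max 0 (y - x)"
 using cos_pos by (auto simp: unf_def max_def zero_le_mult_iff mult_le_0_iff field_simps)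
 then show ?thesis unfolding refold_def Let_def t by (auto simp: max_def min_def)
qed

text \<open>The axis of the sector corresponds to the diagonal. On either side of it
  \<open>unf\<close> is linear with determinant of modulus \<open>1 / slope\<close>, and the two
  images are complementary half-planes.\<close>

lemma nn_integral_unf:
 fixes F :: "plane => ennreal"
 assumes [measurable]: "F \<in> bmeas"
 shows "(\<integral>\<^sup>+z. F z \<partial>lborel) = ennreal (1 / slope) * (\<integral>\<^sup>+z. F (unf z) \<partial>lborel)"
proof -
 let ?P = "%z :: plane. (co / slope * fst z + si * snd z, co * fst z + (- co) * snd z)"
 let ?M = "%z :: plane. (si * fst z + co / slope * snd z, co * fst z + (- co) * snd z)"
 have cs: "co / slope * co + si * co = 1 / slope"
 proof -
 have "co / slope * co + si * co = (co * co + si * (slope * co)) / slope"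
  using slope(3) by (simp add: add_divide_distrib)
 also have "... = 1 / slope" unfolding slope(4) using sq1 by (simp add: add.commute)
 finally show ?thesis .
 qed
 have dP: "\<bar>co / slope * (- co) - si * co\<bar> = 1 / slope"
 proof -
 have "co / slope * (- co) - si * co = - (1 / slope)" using cs by simp
 then show ?thesis using slope(3) by simp
 qed
 have dM: "\<bar>si * (- co) - co / slope * co\<bar> = 1 / slope"
 proof -
 have "si * (- co) - co / slope * co = - (1 / slope)" using cs by simp
 then show ?thesis using slope(3) by simp
 qed
 have nP: "co / slope * (- co) - si * co ~= 0" and nM: "si * (- co) - co / slope * co ~= 0"
 using dP dM slope(3) by (metis abs_zero zero_less_divide_1_iff less_irrefl)+
 have up: "0 <= snd (?P z) \<longleftrightarrow> snd z <= fst z" "snd (?M z) < 0 \<longleftrightarrow> fst z < snd z" for z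
 using cos_pos by (auto simp: algebra_simps)
 have [measurable]: "{z :: plane. 0 <= snd z} \<in> sets borel" "{z :: plane. snd z < 0} \<in> sets borel"
 by (rule borel_closed, intro closed_Collect_le continuous_intros) (rule borel_open, intro open_Collect_less continuous_intros)
 have [measurable]: "{z :: plane. snd z <= fst z} \<in> sets borel" "{z :: plane. fst z < snd z} \<in> sets borel"
 by (rule borel_closed, intro closed_Collect_le continuous_intros) (rule borel_open, intro open_Collect_less continuous_intros)
 have "(\<integral>\<^sup>+z. F z \<partial>lborel) = (\<integral>\<^sup>+z. F z * ind {z. 0 <= snd z} z + F z * ind {z. snd z < 0} z \<partial>lborel)"
 by (intro nn_integral_cong) (auto simp: indicator_def)
 also have "... = (\<integral>\<^sup>+z. F z * ind {z. 0 <= snd z} z \<partial>lborel) + (\<integral>\<^sup>+z. F z * ind {z. snd z < 0} z \<partial>lborel)"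
 by (rule nn_integral_add) measurable
 also have "(\<integral>\<^sup>+z. F z * ind {z. 0 <= snd z} z \<partial>lborel)
  = ennreal (1 / slope) * (\<integral>\<^sup>+z. F (?P z) * ind {z. 0 <= snd z} (?P z) \<partial>lborel)"
 by (subst nn_integral_plane_linear[of _ "co / slope" "- co" "si" "co"])
  (use cos_pos slope(3) nP dP in \<open>simp_all\<close>)
 also have "(\<integral>\<^sup>+z. F z * ind {z. snd z < 0} z \<partial>lborel)
  = ennreal (1 / slope) * (\<integral>\<^sup>+z. F (?M z) * ind {z. snd z < 0} (?M z) \<partial>lborel)"
 by (subst nn_integral_plane_linear[of _ "si" "- co" "co / slope" "co"])
  (use sin_pos slope(3) nM dM in \<open>simp_all\<close>)
 also have "(\<integral>\<^sup>+z. F (?P z) * ind {z. 0 <= snd z} (?P z) \<partial>lborel) = (\<integral>\<^sup>+z. F (unf z) * ind {z. snd z <= fst z} z \<partial>lborel)"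
 proof (rule nn_integral_cong)
 fix z
 show "F (?P z) * ind {z. 0 <= snd z} (?P z) = F (unf z) * ind {z. snd z <= fst z} z"
 proof (cases "snd z <= fst z")
  case True
  then have "?P z = unf z" by (auto simp: unf_def max_def min_def algebra_simps)
  then show ?thesis using True up(1)[of z] by (simp add: indicator_def)
 next
  case False
  then show ?thesis using up(1)[of z] by (simp add: indicator_def)
 qed
 qed
 also have "(\<integral>\<^sup>+z. F (?M z) * ind {z. snd z < 0} (?M z) \<partial>lborel) = (\<integral>\<^sup>+z. F (unf z) * ind {z. fst z < snd z} z \<partial>lborel)"
 proof (rule nn_integral_cong)
 fix z
 show "F (?M z) * ind {z. snd z < 0} (?M z) = F (unf z) * ind {z. fst z < snd z} z"
 proof (cases "fst z < snd z")
  case True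
  then have "?M z = unf z" by (auto simp: unf_def max_def min_def algebra_simps)
  then show ?thesis using True up(2)[of z] by (simp add: indicator_def)
 next
  case False
  then show ?thesis using up(2)[of z] by (simp add: indicator_def)
 qed
 qed
 also have "ennreal (1 / slope) * (\<integral>\<^sup>+z. F (unf z) * ind {z. snd z <= fst z} z \<partial>lborel) +
  ennreal (1 / slope) * (\<integral>\<^sup>+z. F (unf z) * ind {z. fst z < snd z} z \<partial>lborel)
  = ennreal (1 / slope) * (\<integral>\<^sup>+z. F (unf z) * ind {z. snd z <= fst z} z + F (unf z) * ind {z. fst z < snd z} z \<partial>lborel)"
 by (subst nn_integral_add) (measurable, simp add: distrib_left)
 also have "(\<integral>\<^sup>+z. F (unf z) * ind {z. snd z <= fst z} z + F (unf z) * ind {z. fst z < snd z} z \<partial>lborel) = (\<integral>\<^sup>+z. F (unf z) \<partial>lborel)"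
 by (intro nn_integral_cong) (auto simp: indicator_def)
 finally show ?thesis .
qed

lemma lborel_unf: "(lborel :: plane measure) = density (distr lborel borel unf) (%_. ennreal (1 / slope))"
proof (rule measure_eqI)
 fix X :: "plane set" assume "X \<in> sets lborel"
 then have [measurable]: "X \<in> sets borel" by simp
 have "emeasure lborel X = (\<integral>\<^sup>+z. ind X z \<partial>lborel)" by simp
 also have "... = ennreal (1 / slope) * (\<integral>\<^sup>+z. ind X (unf z) \<partial>lborel)" by (rule nn_integral_unf) measurable
 also have "(\<integral>\<^sup>+z. ind X (unf z) \<partial>lborel) = emeasure (distr lborel borel unf) X"
 by (subst indicator_vimage[symmetric]) (simp add: emeasure_distr measurable_sets_borel[OF unf_measurable])
 also have "ennreal (1 / slope) * emeasure (distr lborel borel unf) X = emeasure (density (distr lborel borel unf) (%_. ennreal (1 / slope))) X"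
 by (simp add: emeasure_density nn_integral_cmult)
 finally show "emeasure lborel X = emeasure (density (distr lborel borel unf) (%_. ennreal (1 / slope))) X" .
qed simp

lemma integral_unf:
 fixes F :: "plane => real"
 assumes [measurable]: "F \<in> bmeas"
 shows "(\<integral>z. F z \<partial>lborel) = (1 / slope) * (\<integral>z. F (unf z) \<partial>lborel)"
proof -
 have "(\<integral>z. F z \<partial>lborel) = (\<integral>z. F z \<partial>density (distr lborel borel unf) (%_. ennreal (1 / slope)))"
 by (subst lborel_unf) simp
 also have "... = (1 / slope) * (\<integral>z. F (unf z) \<partial>lborel)"
 using slope(3) by (subst integral_density) (auto simp: integral_distr)
 finally show ?thesis .
qed

text \<open>The left-hand sides are the signed distances to the lines that carry the upper and the
  lower side.\<close>

lemma normals: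
 "fst (unf (x, y)) * si - snd (unf (x, y)) * co = y + (if x < y then 2 * (co * co) * (y - x) else 0) - (if x < y then y - x else 0)"
 "fst (unf (x, y)) * si + snd (unf (x, y)) * co = x + (if y < x then 2 * (co * co) * (x - y) else 0) - (if y < x then x - y else 0)"
proof -
 have ss: "si * si = 1 - co * co" using sq1 by linarith
 have f: "fst (unf (x, y)) * si = max x y * (co * co) + min x y * (1 - co * co)"
 by (simp only: fst_unf_sin ss)
 show "fst (unf (x, y)) * si - snd (unf (x, y)) * co = y + (if x < y then 2 * (co * co) * (y - x) else 0) - (if x < y then y - x else 0)"
 "fst (unf (x, y)) * si + snd (unf (x, y)) * co = x + (if y < x then 2 * (co * co) * (x - y) else 0) - (if y < x then x - y else 0)"
 unfolding f by (auto simp: unf_def algebra_simps max_def min_def)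
qed

section \<open>Sector and quadrangle in unfolded coordinates\<close>

lemma sector_eq: "sector th = {p. 0 < fst p * si - snd p * co & 0 < fst p * si + snd p * co}"
proof (intro set_eqI)
 fix p :: plane
 obtain x y where p: "p = (x, y)" by force
 show "p \<in> sector th \<longleftrightarrow> p \<in> {p. 0 < fst p * si - snd p * co & 0 < fst p * si + snd p * co}"
 proof (cases "p = 0")
 case True
 then show ?thesis by (simp add: sector_def)
 next
 case False
 then have z: "Complex x y ~= 0" by (auto simp: p complex_eq_iff zero_prod_def)
 define r where "r = cmod (Complex x y)"
 define t where "t = Arg (Complex x y)"
 have r: "r > 0" using z by (simp add: r_def)
 have "Complex x y = of_real r * exp (\<i> * of_real t)"
  unfolding r_def t_def using z by (metis Arg_eq)
 then have xy: "x = r * cos t" "y = r * sin t"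
  by (auto simp: complex_eq_iff Re_exp Im_exp)
 have t: "- pi < t" "t <= pi" using Arg_bounded[of "Complex x y"] by (auto simp: t_def)
 have e: "fst p * si - snd p * co = r * sin (th - t)" "fst p * si + snd p * co = r * sin (th + t)"
  by (auto simp: p xy sin_diff sin_add algebra_simps)
 have "\<bar>t\<bar> < th \<longleftrightarrow> 0 < sin (th - t) & 0 < sin (th + t)"
 proof
  assume "\<bar>t\<bar> < th"
  then show "0 < sin (th - t) & 0 < sin (th + t)"
  using theta by (intro conjI sin_gt_zero) linarith+
 next
  assume s: "0 < sin (th - t) & 0 < sin (th + t)"
  show "\<bar>t\<bar> < th"
  proof (rule ccontr)
  assume "\<not> \<bar>t\<bar> < th"
  then consider "t >= th" | "- t >= th" by linarith
  then show False
  proof cases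
   case 1
   have "0 <= sin (t - th)" using 1 t theta pi_gt_zero by (intro sin_ge_zero) linarith+
   moreover have "sin (t - th) = - sin (th - t)" by (metis minus_diff_eq sin_minus)
   ultimately show False using s by simp
  next
   case 2
   have "0 <= sin (- t - th)" using 2 t theta pi_gt_zero by (intro sin_ge_zero) linarith+
   moreover have "sin (- t - th) = - sin (th + t)" by (metis minus_add_distrib add.commute uminus_add_conv_diff sin_minus diff_conv_add_uminus)
   ultimately show False using s by simp
  qed
  qed
 qed
 then show ?thesis
  using False r unfolding mem_Collect_eq e
  by (simp add: sector_def p t_def zero_less_mult_iff)
 qed
qed

lemma unf_sector: "unf (x, y) \<in> sector th \<longleftrightarrow> 0 < x & 0 < y"
proof -
 have c: "0 < co * co" using cos_pos by simp
 have c2: "2 * (co * co) <= 1"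
 proof -
 have "co <= si" using slope(2,4) cos_pos by (metis mult_1 mult_right_mono less_imp_le)
 then have "co * co <= si * si" using cos_pos by (intro mult_mono) auto
 then show ?thesis using sq1 by linarith
 qed
 show ?thesis
 proof (cases "x < y")
 case True
 have "0 < 2 * (co * co) * (y - x)" using True c by simp
 then show ?thesis using True unfolding sector_eq mem_Collect_eq normals by auto
 next
 case False
 have "y < x ==> 0 < 2 * (co * co) * (x - y)" using c by simp
 then show ?thesis using False unfolding sector_eq mem_Collect_eq normals by auto
 qed
qed

lemma convex_domain_sector: "convex_domain (sector th)"
proof
 show "convex (sector th)"
 proof -
 have "sector th = {p. inner (si, - co) p > 0} \<inter> {p. inner (si, co) p > 0}"
  unfolding sector_eq by (auto simp: mult.commute)
 then show ?thesis by (simp add: convex_Int convex_halfspace_gt)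
 qed
 show "open (sector th)"
 unfolding sector_eq by (intro open_Collect_conj open_Collect_less continuous_intros)
 show "sector th ~= {}" using unf_sector[of 1 1] by auto
qed

lemma unf_norm: "max x y / slope <= norm (unf (x, y))"
proof -
 have *: "u <= norm (u * co + t * si, u * si - t * co)" for u t
 proof -
 have "(u * co + t * si)^2 + (u * si - t * co)^2 = (u^2 + t^2) * (si * si + co * co)"
  by (rule rotation_identities)
 also have "... = u^2 + t^2" by (simp only: sq1 mult_1_right)
 finally have "u^2 <= (u * co + t * si)^2 + (u * si - t * co)^2" by simp
 then show ?thesis by (simp add: norm_prod_def real_le_rsqrt)
 qed
 show ?thesis
 proof (cases "y <= x")
 case True
 then show ?thesis using *[of "x / slope" y] unf_cases(1)[OF True] by (simp add: max_def)
 next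
 case False
 then have xy: "x <= y" by simp
 have "norm (unf (x, y)) = norm (y / slope * co + x * si, y / slope * si - x * co)"
  unfolding unf_cases(2)[OF xy] by (simp add: norm_prod_def power2_eq_square algebra_simps)
 then show ?thesis using *[of "y / slope" x] xy by (simp add: max_def)
 qed
qed

lemma unf_sides: "0 <= x ==> unf (x, 0) = (x / slope * co, x / slope * si)"
 "0 <= y ==> unf (0, y) = (y / slope * co, - (y / slope) * si)"
 using unf_cases(1)[of 0 x] unf_cases(2)[of 0 y] by simp_all

text \<open>Together with the outer inclusion this locates the quadrangle up to the boundary of the
  square, a null set, without an exact description of the interior of the hull. The open set
  \<open>P\<close> of four half-plane conditions lies in the hull because each of its halves lies in
  a triangle.\<close>

lemma quadrangle_unf_inner:
 assumes r: "r > 0" and x: "0 < x" "x < slope * r" and y: "0 < y" "y < slope * r"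
 shows "unf (x, y) \<in> quadrangle th r"
proof -
 let ?O = "(0, 0) :: plane" and ?A = "(r * co, r * si)" and ?B = "(r / co, 0) :: plane" and ?A' = "(r * co, - r * si)"
 let ?H = "convex hull {?O, ?A, ?B, ?A'}"
 define P where "P = {p :: plane. 0 < fst p * si - snd p * co & 0 < fst p * si + snd p * co
 & fst p * co + snd p * si < r & fst p * co - snd p * si < r}"
 \<comment> \<open>Barycentric coordinates in the triangle \<open>O A B\<close>: \<open>a\<close> is
   read off the height \<open>w\<close>, and \<open>b\<close> off the distance to the line
   \<open>O A\<close>.\<close>
 have coeff: "\<exists>a b. 0 <= a & 0 <= b & a + b <= 1 & u = a * (r * co) + b * (r / co) & w = a * (r * si)"
 if w: "0 <= w" and p: "0 < u * si - w * co" "u * co + w * si < r" for u w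
 proof -
 define b where "b = (u * si - w * co) / (r * slope)"
 define a where "a = w / (r * si)"
 have b: "b >= 0" using p r slope(3) by (simp add: b_def)
 have a: "a >= 0" using w r sin_pos by (simp add: a_def)
 have bs: "b * r * si = (u * si - w * co) * co"
  using r cos_pos sin_pos by (simp add: b_def slope(1))
 have as: "a * r * si = w" using r sin_pos by (simp add: a_def)
 have "(a + b) * r * si = w + (u * si - w * co) * co"
  by (simp only: distrib_right as bs)
 also have "... = w * (1 - co * co) + u * co * si" by (simp add: algebra_simps)
 also have "1 - co * co = si * si" using sq1 by linarith
 also have "w * (si * si) + u * co * si = (u * co + w * si) * si" by (simp add: algebra_simps)
 finally have "(a + b) * r = u * co + w * si" using sin_pos by simp
 then have "(a + b) * r <= 1 * r" using p by simp
 then have ab: "a + b <= 1" using r by simp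
 have "(a * (r * co) + b * (r / co)) * (co * si) = (a * r * si) * co * co + b * r * si"
  using cos_pos by (simp add: field_simps)
 also have "... = w * co * co + (u * si - w * co) * co" by (simp only: as bs)
 also have "... = u * (co * si)" by (simp add: algebra_simps)
 finally have "u = a * (r * co) + b * (r / co)" using cos_pos sin_pos by simp
 then show ?thesis using a b ab as by (intro exI[of _ a] exI[of _ b]) (simp add: mult.assoc)
 qed
 have PH: "P \<subseteq> ?H"
 proof
 fix p assume p: "p \<in> P"
 show "p \<in> ?H"
 proof (cases "0 <= snd p")
  case True
  obtain a b where ab: "0 <= a" "0 <= b" "a + b <= 1" "fst p = a * (r * co) + b * (r / co)" "snd p = a * (r * si)"
  using coeff[OF True, of "fst p"] p by (auto simp: P_def)
  have "p = (1 - a - b) *\<^sub>R ?O + a *\<^sub>R ?A + b *\<^sub>R ?B" using ab(4,5) by (intro prod_eqI) auto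
  then have "p \<in> convex hull {?O, ?A, ?B}"
  unfolding convex_hull_3 using ab(1-3) by (intro CollectI exI[of _ "1 - a - b"] exI[of _ a] exI[of _ b]) auto
  moreover have "convex hull {?O, ?A, ?B} \<subseteq> ?H" by (rule hull_mono) auto
  ultimately show ?thesis by blast
 next
  case False
  then have "0 <= - snd p" by simp
  then obtain a b where ab: "0 <= a" "0 <= b" "a + b <= 1" "fst p = a * (r * co) + b * (r / co)" "- snd p = a * (r * si)"
  using coeff[of "- snd p" "fst p"] p by (auto simp: P_def)
  have "p = (1 - a - b) *\<^sub>R ?O + a *\<^sub>R ?A' + b *\<^sub>R ?B" using ab(4,5) by (intro prod_eqI) auto
  then have "p \<in> convex hull {?O, ?A', ?B}"
  unfolding convex_hull_3 using ab(1-3) by (intro CollectI exI[of _ "1 - a - b"] exI[of _ a] exI[of _ b]) auto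
  moreover have "convex hull {?O, ?A', ?B} \<subseteq> ?H" by (rule hull_mono) auto
  ultimately show ?thesis by blast
 qed
 qed
 have "open P" unfolding P_def by (intro open_Collect_conj open_Collect_less continuous_intros)
 with PH have "P \<subseteq> interior ?H" by (rule interior_maximal)
 moreover have "unf (x, y) \<in> P"
 proof -
 have "unf (x, y) \<in> sector th" using unf_sector x y by simp
 moreover have "fst (unf (x, y)) * co + snd (unf (x, y)) * si < r & fst (unf (x, y)) * co - snd (unf (x, y)) * si < r"
 proof -
  have X: "(u * co + t * si) * co + (u * si - t * co) * si = u" for u t
  proof -
  have "(u * co + t * si) * co + (u * si - t * co) * si = u * (si * si + co * co)"
   by (rule rotation_identities)
  then show ?thesis by (simp only: sq1 mult_1_right)
  qed
  have lt: "z / slope < r" if "z < slope * r" for z using that slope(3) by (simp add: field_simps)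
  have sn: "snd (unf (x, y)) = (x - y) * co" by (simp add: unf_def)
  show ?thesis
  proof (cases "y <= x")
  case True
  then have "0 <= snd (unf (x, y)) * si" using cos_pos sin_pos by (simp add: sn)
  moreover have "fst (unf (x, y)) * co + snd (unf (x, y)) * si = x / slope"
   unfolding unf_cases(1)[OF True] fst_conv snd_conv by (rule X)
  ultimately show ?thesis using lt[OF x(2)] by linarith
  next
  case False
  then have xy: "x <= y" by simp
  then have "snd (unf (x, y)) * si <= 0" using cos_pos sin_pos by (simp add: sn mult_nonpos_nonneg)
  moreover have "fst (unf (x, y)) * co - snd (unf (x, y)) * si = y / slope"
   using X[of "y / slope" x] unfolding unf_cases(2)[OF xy] fst_conv snd_conv by (simp add: algebra_simps)
  ultimately show ?thesis using lt[OF y(2)] by linarith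
  qed
 qed
 ultimately show ?thesis by (simp add: P_def sector_eq)
 qed
 ultimately show ?thesis by (auto simp: quadrangle_def)
qed

lemma quadrangle_unf_outer:
 assumes r: "r > 0" and z: "unf (x, y) \<in> quadrangle th r"
 shows "0 <= x & x <= slope * r & 0 <= y & y <= slope * r"
proof -
 let ?V = "{(0, 0), (r * co, r * si), (r / co, 0), (r * co, - r * si)} :: plane set"
 define P where "P = {p :: plane. inner (- si, co) p <= 0} \<inter> {p. inner (- si, - co) p <= 0}
 \<inter> {p. inner (co, si) p <= r} \<inter> {p. inner (co, - si) p <= r}"
 have "convex P" unfolding P_def by (intro convex_Int convex_halfspace_le)
 moreover have "?V \<subseteq> P"
 proof -
 have 1: "r * (si * si) + r * (co * co) = r" using sq1 by (metis distrib_left mult_1_right)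
 have 2: "0 <= r * (si * si)" using r by simp
 have 4: "r * (co * co) <= r + r * (si * si)" using 1 2 by linarith
 have 3: "0 <= r * (si * co)" "0 <= si * r / co" using r sin_pos cos_pos by auto
 show ?thesis
  unfolding P_def using r 1 2 3 4 cos_pos by (auto simp: algebra_simps)
 qed
 ultimately have "convex hull ?V \<subseteq> P" by (rule hull_minimal[rotated])
 then have zP: "unf (x, y) \<in> P" using z interior_subset unfolding quadrangle_def by blast
 have X: "(u * co + t * si) * co + (u * si - t * co) * si = u" for u t
 proof -
 have "(u * co + t * si) * co + (u * si - t * co) * si = u * (si * si + co * co)"
  by (rule rotation_identities)
 then show ?thesis by (simp only: sq1 mult_1_right)
 qed
 have f: "0 <= fst (unf (x, y)) * si - snd (unf (x, y)) * co" "0 <= fst (unf (x, y)) * si + snd (unf (x, y)) * co"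
 "fst (unf (x, y)) * co + snd (unf (x, y)) * si <= r" "fst (unf (x, y)) * co - snd (unf (x, y)) * si <= r"
 using zP by (auto simp: P_def inner_prod_def mult.commute)
 show ?thesis
 proof (cases "y <= x")
 case True
 have "fst (unf (x, y)) * co + snd (unf (x, y)) * si = x / slope"
  unfolding unf_cases(1)[OF True] fst_conv snd_conv by (rule X)
 with f(3) have "x / slope <= r" by linarith
 then have "x <= slope * r" using slope(3) by (simp add: pos_divide_le_eq mult.commute)
 moreover have "0 <= y" using f(1) True by (simp add: normals)
 ultimately show ?thesis using True by linarith
 next
 case False
 then have xy: "x <= y" by simp
 have "fst (unf (x, y)) * co - snd (unf (x, y)) * si = y / slope"
  using X[of "y / slope" x] unfolding unf_cases(2)[OF xy] fst_conv snd_conv by (simp add: algebra_simps)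
 with f(4) have "y / slope <= r" by linarith
 then have "y <= slope * r" using slope(3) by (simp add: pos_divide_le_eq mult.commute)
 moreover have "0 <= x" using f(2) xy by (simp add: normals)
 ultimately show ?thesis using xy by linarith
 qed
qed

lemma convex_domain_quadrangle:
 assumes "r > 0"
 shows "convex_domain (quadrangle th r)"
proof
 show "convex (quadrangle th r)" unfolding quadrangle_def by (intro convex_interior convex_convex_hull)
 show "open (quadrangle th r)" unfolding quadrangle_def by (rule open_interior)
 have "unf (slope * r / 2, slope * r / 2) \<in> quadrangle th r"
 by (rule quadrangle_unf_inner) (use assms slope(3) in auto)
 then show "quadrangle th r ~= {}" by blast
qed

end

section \<open>Area and arc length under the unfolding\<close>

context half_angle
begin

text \<open>Area and arc length both become \<open>1 / slope\<close> times Lebesgue measure, on a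
  square and on its two sides through the origin. The set \<open>K\<close> restricts the integrands,
  so that the unbounded sector can be replaced by a square large enough for a given support.\<close>

definition unfolds :: "plane set => plane measure => plane set => real => bool" where
 "unfolds S sg K L \<longleftrightarrow> (\<forall>G\<in>bmeas. (\<exists>B. \<forall>x. \<bar>G x\<bar> <= B) \<longrightarrow> (\<forall>x. x \<notin> K \<longrightarrow> G x = 0) \<longrightarrow>
  integrable lborel (%x. ind S x * G x) & integrable sg G &
  (\<integral>x. ind S x * G x \<partial>lborel) = (1 / slope) * (\<integral>y. \<integral>x. G (unf (x, y)) \<partial>seg 0 L \<partial>seg 0 L) &
  (\<integral>x. G x \<partial>sg) = (1 / slope) * ((\<integral>x. G (unf (x, 0)) \<partial>seg 0 L) + (\<integral>y. G (unf (0, y)) \<partial>seg 0 L)))"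

lemma AE_lines: "AE z :: plane in lborel. fst z ~= a & snd z ~= b"
proof -
 have n: "negligible {z :: plane. z \<bullet> (1, 0) = a}" "negligible {z :: plane. z \<bullet> (0, 1) = b}"
 by (rule negligible_standard_hyperplane, simp add: Basis_prod_def)+
 have "AE z in lborel. z \<notin> {z :: plane. z \<bullet> (1, 0) = a}" "AE z in lborel. z \<notin> {z :: plane. z \<bullet> (0, 1) = b}"
 using n by (metis AE_not_in negligible_iff_null_sets AE_completion_iff)+
 then show ?thesis by eventually_elim (auto simp: inner_prod_def)
qed

text \<open>The geometric conditions are compared only off the lines where a coordinate is 0 or
  \<open>L\<close>; these are null sets, so open and closed descriptions can be mixed
  freely.\<close>

lemma unfoldsI:
 assumes S: "open S" and J: "J \<in> sets borel" and L: "L >= 0"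
 and vol: "!!x y. x ~= 0 ==> x ~= L ==> y ~= 0 ==> y ~= L ==> unf (x, y) \<in> K ==>
  unf (x, y) \<in> S \<longleftrightarrow> x \<in> {0..L} & y \<in> {0..L}"
 and out: "!!x y. unf (x, y) \<in> K ==> unf (x, y) \<in> S ==> x \<in> {0..L} & y \<in> {0..L}"
 and side: "!!t. t ~= 0 ==> slope * t ~= L ==> (t * co, t * si) \<in> K \<or> (t * co, - t * si) \<in> K ==> t \<in> J \<longleftrightarrow> slope * t \<in> {0..L}"
 shows "unfolds S (side_measure th J) K L"
 unfolding unfolds_def
proof (intro ballI impI)
 fix G :: "plane => real"
 assume G[measurable]: "G \<in> bmeas" and "\<exists>B. \<forall>x. \<bar>G x\<bar> <= B" and K: "\<forall>x. x \<notin> K \<longrightarrow> G x = 0"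
 then obtain B where B: "!!x. \<bar>G x\<bar> <= B" by blast
 have S'[measurable]: "S \<in> sets borel" using S by auto
 let ?Q = "{0..L} \<times> {0..L} :: plane set"
 have [measurable]: "?Q \<in> sets borel" by (intro borel_compact compact_Times) auto
 have ae: "AE z in lborel. ind S (unf z) * G (unf z) = ind ?Q z * G (unf z)"
 using AE_lines[of 0 0] AE_lines[of L L]
 proof eventually_elim
 fix z :: plane assume "fst z ~= 0 & snd z ~= 0" "fst z ~= L & snd z ~= L"
 then have "unf z \<in> K ==> unf z \<in> S \<longleftrightarrow> z \<in> ?Q" using vol[of "fst z" "snd z"] by (simp add: mem_Times_iff)
 then show "ind S (unf z) * G (unf z) = ind ?Q z * G (unf z)"
 proof (cases "unf z \<in> K")
  case False
  then have "G (unf z) = 0" using K by blast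
  then show ?thesis by simp
 qed (simp add: indicator_def)
 qed
 have Gu[measurable]: "(%z. G (unf z)) \<in> bmeas" by measurable
 note ss = seg_seg_integral[of "%z. G (unf z)" L B, OF Gu B]
 have "(\<integral>x. ind S x * G x \<partial>lborel) = (1 / slope) * (\<integral>z. ind S (unf z) * G (unf z) \<partial>lborel)"
 by (rule integral_unf) measurable
 also have "(\<integral>z. ind S (unf z) * G (unf z) \<partial>lborel) = (\<integral>z. ind ?Q z * G (unf z) \<partial>lborel)"
 by (rule integral_cong_AE[OF _ _ ae]) measurable
 finally have vol_eq: "(\<integral>x. ind S x * G x \<partial>lborel) = (1 / slope) * (\<integral>y. \<integral>x. G (unf (x, y)) \<partial>seg 0 L \<partial>seg 0 L)"
 by (simp only: ss(2))
 have int: "integrable lborel (%x. ind S x * G x)"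
 proof -
 have "(\<integral>\<^sup>+x. ennreal (norm (ind S x * G x)) \<partial>lborel) = ennreal (1 / slope) * (\<integral>\<^sup>+z. ennreal (norm (ind S (unf z) * G (unf z))) \<partial>lborel)"
  by (rule nn_integral_unf) measurable
 also have "(\<integral>\<^sup>+z. ennreal (norm (ind S (unf z) * G (unf z))) \<partial>lborel) = (\<integral>\<^sup>+z. ennreal (norm (ind ?Q z * G (unf z))) \<partial>lborel)"
  by (rule nn_integral_cong_AE, rule AE_mp[OF ae], rule AE_I2, rule impI, drule arg_cong[of _ _ "%u. ennreal (norm u)"], assumption)
 finally have "(\<integral>\<^sup>+x. ennreal (norm (ind S x * G x)) \<partial>lborel) = ennreal (1 / slope) * (\<integral>\<^sup>+z. ennreal (norm (ind ?Q z * G (unf z))) \<partial>lborel)" .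
 moreover have "(\<integral>\<^sup>+z. ennreal (norm (ind ?Q z * G (unf z))) \<partial>lborel) < \<infinity>" using ss(1) unfolding integrable_iff_bounded by blast
 ultimately have "(\<integral>\<^sup>+x. ennreal (norm (ind S x * G x)) \<partial>lborel) < \<infinity>" by (simp add: ennreal_mult_less_top)
 moreover have "(%x. ind S x * G x) \<in> borel_measurable lborel" by measurable
 ultimately show ?thesis unfolding integrable_iff_bounded by blast
 qed
 have ray: "integrable lborel (%t. ind J t * F t) & (\<integral>t. ind J t * F t \<partial>lborel) = (1 / slope) * (\<integral>x. F (x / slope) \<partial>seg 0 L)"
 if F[measurable]: "F \<in> bmeas" and FB: "!!t. \<bar>F t\<bar> <= B"
  and F0: "!!t. t ~= 0 ==> slope * t ~= L ==> F t ~= 0 ==> t \<in> J \<longleftrightarrow> slope * t \<in> {0..L}" for F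
 proof -
 note [measurable] = J
 have "AE t in lborel. t ~= 0 & t ~= L / slope"
  by (intro AE_conjI AE_lborel_singleton)
 then have ae: "AE t in lborel. ind J t * F t = ind {0..L} (0 + slope * t) * F ((0 + slope * t) / slope)"
 proof eventually_elim
  fix t assume t: "t ~= 0 & t ~= L / slope"
  then have "slope * t ~= L" using slope(3) by (auto simp: field_simps)
  then show "ind J t * F t = ind {0..L} (0 + slope * t) * F ((0 + slope * t) / slope)"
  using F0[of t] t slope(3) by (cases "F t = 0") (auto simp: indicator_def)
 qed
 have i0: "integrable (seg 0 L) (%x. F (x / slope))"
  by (rule seg_integrable[where B = B]) (use FB in auto)
 then have i1: "integrable lborel (%x. ind {0..L} x * F (x / slope))"
  unfolding seg_def by (subst (asm) integrable_restrict_space) auto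
 have i2: "integrable lborel (%t. ind {0..L} (0 + slope * t) * F ((0 + slope * t) / slope))"
  by (rule lborel_integrable_real_affine[OF i1]) (use slope(3) in simp)
 have "(\<integral>x. ind {0..L} x * F (x / slope) \<partial>lborel) = \<bar>slope\<bar> * (\<integral>t. ind {0..L} (0 + slope * t) * F ((0 + slope * t) / slope) \<partial>lborel)"
  using lborel_integral_real_affine[of slope "%x. ind {0..L} x * F (x / slope)" 0] slope(3) by simp
 also have "(\<integral>t. ind {0..L} (0 + slope * t) * F ((0 + slope * t) / slope) \<partial>lborel) = (\<integral>t. ind J t * F t \<partial>lborel)"
  by (rule sym, rule integral_cong_AE[OF _ _ ae]) measurable
 finally have "(\<integral>t. ind J t * F t \<partial>lborel) = (1 / slope) * (\<integral>x. F (x / slope) \<partial>seg 0 L)"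
  using slope(3) by (simp add: seg_integral)
 moreover have "integrable lborel (%t. ind J t * F t)"
 proof (rule integrable_cong_AE_imp[OF i2])
  show "(%t. ind J t * F t) \<in> borel_measurable lborel" by measurable
  show "AE t in lborel. ind {0..L} (0 + slope * t) * F ((0 + slope * t) / slope) = ind J t * F t"
  using ae by eventually_elim (rule sym)
 qed
 ultimately show ?thesis by blast
 qed
 have [measurable]: "(%t. (t * co, t * si)) \<in> bmeas" "(%t. (t * co, - t * si)) \<in> bmeas"
 by (intro borel_measurable_continuous_onI continuous_intros)+
 have K': "G x ~= 0 ==> x \<in> K" for x using K by blast
 have r1: "integrable lborel (%t. ind J t * G (t * co, t * si)) &
  (\<integral>t. ind J t * G (t * co, t * si) \<partial>lborel) = (1 / slope) * (\<integral>x. G (x / slope * co, x / slope * si) \<partial>seg 0 L)"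
 by (rule ray) (measurable, rule B, rule side, assumption, assumption, rule disjI1, erule K')
 have r2: "integrable lborel (%t. ind J t * G (t * co, - t * si)) &
  (\<integral>t. ind J t * G (t * co, - t * si) \<partial>lborel) = (1 / slope) * (\<integral>x. G (x / slope * co, - (x / slope) * si) \<partial>seg 0 L)"
 by (rule ray) (measurable, rule B, rule side, assumption, assumption, rule disjI2, erule K')
 note sm = integral_side_measure[OF G J, of th]
 have s1: "(\<integral>x. G (x / slope * co, x / slope * si) \<partial>seg 0 L) = (\<integral>x. G (unf (x, 0)) \<partial>seg 0 L)"
 "(\<integral>x. G (x / slope * co, - (x / slope) * si) \<partial>seg 0 L) = (\<integral>y. G (unf (0, y)) \<partial>seg 0 L)"
 by (intro Bochner_Integration.integral_cong refl, simp add: unf_sides)+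
 have "(\<integral>x. G x \<partial>side_measure th J) = (1 / slope) * ((\<integral>x. G (unf (x, 0)) \<partial>seg 0 L) + (\<integral>y. G (unf (0, y)) \<partial>seg 0 L))"
 using sm(2) r1 r2 s1 by (simp only: distrib_left)
 moreover have "integrable (side_measure th J) G" using sm(1) r1 r2 by blast
 ultimately show "integrable lborel (%x. ind S x * G x) & integrable (side_measure th J) G &
  (\<integral>x. ind S x * G x \<partial>lborel) = (1 / slope) * (\<integral>y. \<integral>x. G (unf (x, y)) \<partial>seg 0 L \<partial>seg 0 L) &
  (\<integral>x. G x \<partial>side_measure th J) = (1 / slope) * ((\<integral>x. G (unf (x, 0)) \<partial>seg 0 L) + (\<integral>y. G (unf (0, y)) \<partial>seg 0 L))"
 using int vol_eq by blast
qed

lemma unfolds_quadrangle: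
 assumes r: "r > 0"
 shows "unfolds (quadrangle th r) (side_measure th {0<..<r}) UNIV (slope * r)"
proof (rule unfoldsI)
 interpret convex_domain "quadrangle th r" by (rule convex_domain_quadrangle[OF r])
 show "open (quadrangle th r)" by (rule op)
 show "unf (x, y) \<in> quadrangle th r \<longleftrightarrow> x \<in> {0..slope * r} & y \<in> {0..slope * r}"
 if "x ~= 0" "x ~= slope * r" "y ~= 0" "y ~= slope * r" for x y
 using quadrangle_unf_outer[OF r, of x y] quadrangle_unf_inner[OF r, of x y] that by force
 show "x \<in> {0..slope * r} & y \<in> {0..slope * r}" if "unf (x, y) \<in> quadrangle th r" for x y
 using quadrangle_unf_outer[OF r that] by simp
 show "t \<in> {0<..<r} \<longleftrightarrow> slope * t \<in> {0..slope * r}" if "t ~= 0" "slope * t ~= slope * r" for t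
 using that slope(3) by (auto simp: zero_le_mult_iff)
qed (use r slope(3) in auto)

text \<open>Unfolded coordinates of points in the ball are at most \<open>slope * rh\<close>, so the
  square covers every part of the sector where the integrand lives.\<close>

lemma unfolds_sector:
 assumes rh: "rh > 0" and L: "L >= slope * rh"
 shows "unfolds (sector th) (side_measure th {0<..}) (cball 0 rh) L"
proof (rule unfoldsI)
 interpret convex_domain "sector th" by (rule convex_domain_sector)
 show "open (sector th)" by (rule op)
 have le: "x <= L & y <= L" if "unf (x, y) \<in> cball 0 rh" for x y
 proof -
 have "max x y / slope <= rh" using unf_norm[of x y] that by simp
 then have "max x y <= slope * rh" using slope(3) by (simp add: field_simps)
 then show ?thesis using L by simp
 qed
 show "unf (x, y) \<in> sector th \<longleftrightarrow> x \<in> {0..L} & y \<in> {0..L}"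
 if "x ~= 0" "y ~= 0" "unf (x, y) \<in> cball 0 rh" for x y
 using le[OF that(3)] that unf_sector[of x y] by auto
 show "x \<in> {0..L} & y \<in> {0..L}" if "unf (x, y) \<in> cball 0 rh" "unf (x, y) \<in> sector th" for x y
 using le[OF that(1)] that(2) unf_sector[of x y] by auto
 show "t \<in> {0<..} \<longleftrightarrow> slope * t \<in> {0..L}"
 if "t ~= 0" "(t * co, t * si) \<in> cball 0 rh \<or> (t * co, - t * si) \<in> cball 0 rh" for t
 proof -
 have n: "norm (t * co, t * si) = \<bar>t\<bar>" "norm (t * co, - t * si) = \<bar>t\<bar>"
 proof -
  have "(t * co)^2 + (t * si)^2 = t^2 * (si * si + co * co)" by (rule rotation_identities)
  then have "(t * co)^2 + (t * si)^2 = t^2" by (simp only: sq1 mult_1_right)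
  then show "norm (t * co, t * si) = \<bar>t\<bar>" "norm (t * co, - t * si) = \<bar>t\<bar>" by (simp_all add: norm_prod_def)
 qed
 have "\<bar>t\<bar> <= rh" using that(2) n by (metis mem_cball_0)
 then have "slope * t <= slope * rh" using slope(3) by (intro mult_left_mono) auto
 then have "slope * t <= L" using L by linarith
 then show ?thesis using that(1) slope(3) by (auto simp: zero_le_mult_iff)
 qed
qed (use rh L slope(3) in \<open>auto intro: order_trans[of _ "slope * rh"]\<close>)

end

section \<open>Test functions in unfolded coordinates\<close>

lemma C1c_bounded:
 assumes "ph \<in> C1c S"
 shows "\<exists>B. \<forall>x. \<bar>ph x\<bar> <= B" "\<exists>B. \<forall>x. \<bar>pd ph e x\<bar> <= B"
proof -
 obtain K where K: "compact K" "K \<subseteq> S" "!!x. x \<notin> K ==> ph x = 0" "!!x e. x \<notin> K ==> pd ph e x = 0"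
 using C1c_support[OF assms] by blast
 show "\<exists>B. \<forall>x. \<bar>ph x\<bar> <= B" by (rule square_integrable_compact_support(3)[OF C1c_continuous[OF assms] K(1,3)])
 show "\<exists>B. \<forall>x. \<bar>pd ph e x\<bar> <= B" by (rule square_integrable_compact_support(3)[OF C1c_pd_continuous[OF assms] K(1,4)])
qed

lemma C1c_line_derivative:
 assumes "ph \<in> C1c S"
 shows "((%t. ph (a + t *\<^sub>R d)) has_real_derivative pd ph d (a + t *\<^sub>R d)) (at t)"
proof -
 have l: "linear (%e. pd ph e x)" for x
 using C1c_has_derivative[OF assms] has_derivative_linear by blast
 have "((%t. ph (a + t *\<^sub>R d)) has_derivative (%h. pd ph (h *\<^sub>R d) (a + t *\<^sub>R d))) (at t)"
 by (rule has_derivative_compose[OF _ C1c_has_derivative[OF assms], of "%t. a + t *\<^sub>R d" "%h. h *\<^sub>R d" t UNIV])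
  (auto intro!: derivative_eq_intros)
 then show ?thesis
 by (rule has_derivative_imp_has_field_derivative) (simp add: linear_scale[OF l] mult.commute)
qed

lemma seg_seg_Fubini:
 fixes G :: "plane => real"
 assumes G: "G \<in> bmeas" "!!z. \<bar>G z\<bar> <= B"
 shows "integrable (seg a b \<Otimes>\<^sub>M seg c d) G"
 "(\<integral>y. \<integral>x. G (x, y) \<partial>seg a b \<partial>seg c d) = (\<integral>z. G z \<partial>(seg a b \<Otimes>\<^sub>M seg c d))"
 "(\<integral>x. \<integral>y. G (x, y) \<partial>seg c d \<partial>seg a b) = (\<integral>z. G z \<partial>(seg a b \<Otimes>\<^sub>M seg c d))"
 "integrable (seg c d) (%y. \<integral>x. G (x, y) \<partial>seg a b)" "integrable (seg a b) (%x. \<integral>y. G (x, y) \<partial>seg c d)"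
 "G \<in> borel_measurable (seg a b \<Otimes>\<^sub>M seg c d)"
proof -
 let ?P = "seg a b \<Otimes>\<^sub>M seg c d"
 interpret M1: finite_measure "seg a b" by (rule finite_measure_seg)
 interpret M2: finite_measure "seg c d" by (rule finite_measure_seg)
 interpret P: pair_sigma_finite "seg a b" "seg c d" ..
 interpret F: finite_measure ?P by (rule finite_measure_pair_measure) unfold_locales
 have "fst \<in> borel_measurable ?P" "snd \<in> borel_measurable ?P"
 by (rule measurable_compose[OF measurable_fst seg_measurable[of "%x. x"]], simp)
  (rule measurable_compose[OF measurable_snd seg_measurable[of "%x. x"]], simp)
 then have "(%z. (fst z, snd z)) \<in> ?P \<rightarrow>\<^sub>M borel" by (rule borel_measurable_Pair)
 then show m: "G \<in> borel_measurable ?P" using measurable_compose[OF _ G(1)] by simp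
 show i: "integrable ?P G"
 by (rule F.integrable_const_bound[of _ B]) (use G(2) m in auto)
 then have i': "integrable ?P (%(x, y). G (x, y))" by simp
 show "(\<integral>y. \<integral>x. G (x, y) \<partial>seg a b \<partial>seg c d) = (\<integral>z. G z \<partial>?P)"
 using P.integral_snd[OF i'] by simp
 show "(\<integral>x. \<integral>y. G (x, y) \<partial>seg c d \<partial>seg a b) = (\<integral>z. G z \<partial>?P)"
 using P.integral_fst'[OF i] by simp
 show "integrable (seg c d) (%y. \<integral>x. G (x, y) \<partial>seg a b)"
 using P.integrable_snd[OF i'] by simp
 show "integrable (seg a b) (%x. \<integral>y. G (x, y) \<partial>seg c d)"
 using P.integrable_fst'[OF i] by simp
qed

section \<open>Energy, norm and trace of a test function on the square\<close>

locale unfolded_test = half_angle th + convex_domain S for th S +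
 fixes sg :: "plane measure" and K L and ph :: "plane => real"
 assumes U: "unfolds S sg K L" and L: "L > 0" and C1: "ph \<in> C1c UNIV"
 and K: "!!x. x \<notin> K ==> ph x = 0" "!!x e. x \<notin> K ==> pd ph e x = 0"
begin

text \<open>The partial derivatives of \<open>ph\<close> composed with \<open>unf\<close> off the
  diagonal. The factor \<open>1 / slope\<close> accompanies the derivative along the nearer side,
  which is the \<open>x\<close> direction on one half and the \<open>y\<close> direction on the
  other.\<close>

definition "vx z = (if snd z <= fst z then pd ph (co, si) (unf z) / slope else pd ph (si, co) (unf z))"
definition "vy z = (if snd z <= fst z then pd ph (si, - co) (unf z) else pd ph (co, - si) (unf z) / slope)"

lemma measurable_v [measurable]:
 "(%z. ph (unf z)) \<in> bmeas" "vx \<in> bmeas" "vy \<in> bmeas"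
proof -
 have 1 [measurable]: "(%z. pd ph e (unf z)) \<in> bmeas" for e
 by (rule borel_measurable_continuous_onI, rule continuous_on_compose2[OF C1c_pd_continuous[OF C1] continuous_unf]) simp
 show "(%z. ph (unf z)) \<in> bmeas"
 by (rule borel_measurable_continuous_onI, rule continuous_on_compose2[OF C1c_continuous[OF C1] continuous_unf]) simp
 have s: "{z :: plane. snd z <= fst z} \<in> sets borel"
 by (rule borel_closed, intro closed_Collect_le continuous_intros)
 show "vx \<in> bmeas" "vy \<in> bmeas"
 unfolding vx_def[abs_def] vy_def[abs_def]
 by (intro measurable_If borel_measurable_divide 1 borel_measurable_const; simp add: s)+
qed

lemma bound_v: "\<exists>B\<ge>0. \<forall>z. \<bar>ph (unf z)\<bar> <= B & \<bar>vx z\<bar> <= B & \<bar>vy z\<bar> <= B"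
proof -
 obtain B0 where B0: "!!x. \<bar>ph x\<bar> <= B0" using C1c_bounded(1)[OF C1] by blast
 obtain B where B: "!!e x. \<bar>pd ph e x\<bar> <= B e" using C1c_bounded(2)[OF C1] by metis
 have B0': "B0 >= 0" using B0[of 0] by linarith
 have B': "B e >= 0" for e using B[where e = e and x = 0] by linarith
 have d: "\<bar>t / slope\<bar> <= \<bar>t\<bar>" for t using slope(2) by (simp add: divide_le_eq mult_le_cancel_left1)
 let ?B = "B0 + B (co, si) + B (si, co) + B (si, - co) + B (co, - si)"
 note p = B0' B'[of "(co, si)"] B'[of "(si, co)"] B'[of "(si, - co)"] B'[of "(co, - si)"]
 have "\<bar>ph (unf z)\<bar> <= ?B & \<bar>vx z\<bar> <= ?B & \<bar>vy z\<bar> <= ?B" for z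
 proof (intro conjI)
 show "\<bar>ph (unf z)\<bar> <= ?B" using B0[of "unf z"] p by linarith
 show "\<bar>vx z\<bar> <= ?B" unfolding vx_def
  using B[of "unf z" "(co, si)"] B[of "unf z" "(si, co)"] d[of "pd ph (co, si) (unf z)"] p by (simp split: if_split; linarith)
 show "\<bar>vy z\<bar> <= ?B" unfolding vy_def
  using B[of "unf z" "(si, - co)"] B[of "unf z" "(co, - si)"] d[of "pd ph (co, - si) (unf z)"] p by (simp split: if_split; linarith)
 qed
 then show ?thesis using p by (intro exI[of _ ?B]) simp
qed

lemma pd_scaled: "pd ph (a / slope, b / slope) x = pd ph (a, b) x / slope"
 using pd_plane[OF C1, where a = "a / slope" and b = "b / slope"] pd_plane[OF C1, where a = a and b = b]
 by (simp add: add_divide_distrib)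

text \<open>The kink of \<open>unf\<close> on the diagonal is met by each line parallel to an axis
  in a single point, the exceptional point allowed by \<open>pw_diff\<close>.\<close>

lemma slices:
 "pw_diff a b (%x. ph (unf (x, y))) (%x. vx (x, y))" "pw_diff a b (%y. ph (unf (x, y))) (%y. vy (x, y))"
proof -
 have unf: "unf (x, y) = (if y <= x then (y * si, - y * co) + x *\<^sub>R (co / slope, si / slope)
  else (y * (co / slope), - y * (si / slope)) + x *\<^sub>R (si, co))"
 "unf (x, y) = (if y <= x then (x * (co / slope), x * (si / slope)) + y *\<^sub>R (si, - co)
  else (x * si, x * co) + y *\<^sub>R (co / slope, - si / slope))" for x y
 using unf_cases[of x y] unf_cases[of y x] by (auto simp: field_simps)
 have dx: "((%x. ph (unf (x, y))) has_real_derivative vx (x, y)) (at x)" if "x ~= y" for x y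
 proof (cases "y < x")
 case True
 have "((%x. ph ((y * si, - y * co) + x *\<^sub>R (co / slope, si / slope))) has_real_derivative vx (x, y)) (at x)"
  using C1c_line_derivative[OF C1, of "(y * si, - y * co)" "(co / slope, si / slope)" x] True
  by (simp add: vx_def unf(1) pd_scaled)
 then show ?thesis
  by (rule has_field_derivative_transform_within_open[of _ _ _ "{y<..}"]) (use True unf(1) in auto)
 next
 case False
 then have lt: "x < y" using that by simp
 have "((%x. ph ((y * (co / slope), - y * (si / slope)) + x *\<^sub>R (si, co))) has_real_derivative vx (x, y)) (at x)"
  using C1c_line_derivative[OF C1, of "(y * (co / slope), - y * (si / slope))" "(si, co)" x] lt
  by (simp add: vx_def unf(1))
 then show ?thesis
  by (rule has_field_derivative_transform_within_open[of _ _ _ "{..<y}"]) (use lt unf(1) in auto)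
 qed
 have dy: "((%y. ph (unf (x, y))) has_real_derivative vy (x, y)) (at y)" if "x ~= y" for x y
 proof (cases "y < x")
 case True
 have "((%y. ph ((x * (co / slope), x * (si / slope)) + y *\<^sub>R (si, - co))) has_real_derivative vy (x, y)) (at y)"
  using C1c_line_derivative[OF C1, of "(x * (co / slope), x * (si / slope))" "(si, - co)" y] True
  by (simp add: vy_def unf(2))
 then show ?thesis
  by (rule has_field_derivative_transform_within_open[of _ _ _ "{..<x}"]) (use True unf(2) in auto)
 next
 case False
 then have lt: "x < y" using that by simp
 have "((%y. ph ((x * si, x * co) + y *\<^sub>R (co / slope, - si / slope))) has_real_derivative vy (x, y)) (at y)"
  using C1c_line_derivative[OF C1, of "(x * si, x * co)" "(co / slope, - si / slope)" y] lt
  by (simp add: vy_def unf(2) pd_scaled[where a = "co" and b = "- si", simplified])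
 then show ?thesis
  by (rule has_field_derivative_transform_within_open[of _ _ _ "{x<..}"]) (use lt unf(2) in auto)
 qed
 have c: "continuous_on A (%x. ph (unf (x, y)))" "continuous_on A (%y. ph (unf (x, y)))" for A x y
 by (rule continuous_on_compose2[OF continuous_on_compose2[OF C1c_continuous[OF C1] continuous_unf]];
  auto intro!: continuous_intros)+
 have [measurable]: "(%x. (x, y :: real)) \<in> bmeas" "(%y. (x :: real, y)) \<in> bmeas" for x y :: real
 by (intro borel_measurable_continuous_onI continuous_intros)+
 have m: "(%x. f (x, y)) \<in> bmeas" "(%y. f (x, y)) \<in> bmeas"
 if [measurable]: "f \<in> bmeas" for f :: "plane => real" and x y by measurable
 obtain B where B: "\<forall>z. \<bar>ph (unf z)\<bar> <= B & \<bar>vx z\<bar> <= B & \<bar>vy z\<bar> <= B" using bound_v by blast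
 show "pw_diff a b (%x. ph (unf (x, y))) (%x. vx (x, y))" unfolding pw_diff_def
 by (intro conjI c exI[of _ "{y}"] m measurable_v ballI exI[of _ B]) (use dx B in auto)
 show "pw_diff a b (%y. ph (unf (x, y))) (%y. vy (x, y))" unfolding pw_diff_def
 by (intro conjI c exI[of _ "{x}"] m measurable_v ballI exI[of _ B]) (use dy B in auto)
qed

lemma inner_unf:
 assumes f: "f \<in> bmeas" "!!x. \<bar>f x\<bar> <= B" "!!x. x \<notin> K ==> f x = 0" "sqint lborel f"
 and g: "g \<in> bmeas" "!!x. \<bar>g x\<bar> <= B'" "sqint lborel (%x. ind S x * g x)"
 shows "inner (restr S f) (restr S g) = (1 / slope) * (\<integral>y. \<integral>x. f (unf (x, y)) * g (unf (x, y)) \<partial>seg 0 L \<partial>seg 0 L)"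
proof -
 have "\<bar>f x * g x\<bar> <= B * B'" for x
 unfolding abs_mult using f(2)[of x] g(2)[of x] by (intro mult_mono) auto
 then have "\<exists>B. \<forall>x. \<bar>f x * g x\<bar> <= B" by blast
 moreover have "(%x. f x * g x) \<in> bmeas" using f(1) g(1) by measurable
 ultimately have *: "(\<integral>x. ind S x * (f x * g x) \<partial>lborel) = (1 / slope) * (\<integral>y. \<integral>x. f (unf (x, y)) * g (unf (x, y)) \<partial>seg 0 L \<partial>seg 0 L)"
 using U f(3) unfolding unfolds_def by fastforce
 have "(%x. ind S x * f x * (ind S x * g x)) = (%x. ind S x * (f x * g x))"
 by (intro ext) (auto simp: indicator_def)
 then show ?thesis unfolding restr_l2_def using * op
 by (simp add: inner_abs_l2 square_integrable_restr f g)
qed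

text \<open>Up to the factor \<open>1 / slope\<close>, \<open>V\<close> is the squared norm. In
  \<open>X\<close> and \<open>Y\<close> the inner integral runs along the direction of
  differentiation, ready for the one-dimensional inequalities.\<close>

abbreviation "V \<equiv> \<integral>y. \<integral>x. (ph (unf (x, y)))^2 \<partial>seg 0 L \<partial>seg 0 L"
abbreviation "X \<equiv> \<integral>y. \<integral>x. (vx (x, y))^2 \<partial>seg 0 L \<partial>seg 0 L"
abbreviation "Y \<equiv> \<integral>x. \<integral>y. (vy (x, y))^2 \<partial>seg 0 L \<partial>seg 0 L"

lemma norm_unf: "(norm (restr S ph))^2 = V / slope"
proof -
 obtain B where B: "!!x. \<bar>ph x\<bar> <= B" using C1c_bounded(1)[OF C1] by blast
 note sq = C1c_square_integrable(1)[OF C1]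
 show ?thesis
 unfolding power2_norm_eq_inner
 using inner_unf[OF C1c_measurable(1)[OF C1] B K(1) sq C1c_measurable(1)[OF C1] B square_integrable_restr[OF sq op]]
 by (simp add: power2_eq_square)
qed

lemma sum_Basis_plane: "(\<Sum>e\<in>Basis. f e) = f (1, 0) + f (0, 1)" for f :: "plane => real"
 by (simp add: Basis_prod_def)

lemma square_bounded: "\<bar>t\<bar> <= B ==> \<bar>t\<^sup>2\<bar> <= B^2" for t B :: real
 using power_mono[of "\<bar>t\<bar>" B 2] by simp

text \<open>In the rotated frame the gradient keeps its length, and dividing its tangential
  component by \<open>slope >= 1\<close> only shortens it. The assumption
  \<open>pi / 4 <= th\<close> decides the direction of this inequality.\<close>

lemma grad_unf: "(X + Y) / slope <= (dirichlet S ph)"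
proof -
 let ?P = "seg 0 L \<Otimes>\<^sub>M seg 0 L"
 obtain B where B: "!!e x. \<bar>pd ph e x\<bar> <= B e" using C1c_bounded(2)[OF C1] by metis
 have m [measurable]: "(%z. pd ph e (unf z)) \<in> bmeas" for e
 by (rule borel_measurable_continuous_onI, rule continuous_on_compose2[OF C1c_pd_continuous[OF C1] continuous_unf]) simp
 have n: "(norm (restr S (pd ph e)))^2 = (\<integral>z. (pd ph e (unf z))^2 \<partial>?P) / slope" and i: "integrable ?P (%z. (pd ph e (unf z))^2)" for e
 proof -
 note sq = C1c_square_integrable(2)[OF C1, of e] and me = C1c_measurable(2)[OF C1, of e]
 have b: "\<bar>(pd ph e (unf z))^2\<bar> <= (B e)^2" for z by (rule square_bounded) (rule B)
 have mm: "(%z. (pd ph e (unf z))^2) \<in> bmeas" by measurable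
 show "integrable ?P (%z. (pd ph e (unf z))^2)" by (rule seg_seg_Fubini(1)[OF mm b])
 show "(norm (restr S (pd ph e)))^2 = (\<integral>z. (pd ph e (unf z))^2 \<partial>?P) / slope"
  unfolding power2_norm_eq_inner seg_seg_Fubini(2)[OF mm b, symmetric]
  using inner_unf[OF me B[where e = e] K(2) sq me B[where e = e] square_integrable_restr[OF sq op]] by (simp add: power2_eq_square)
 qed
 obtain C where C: "\<forall>z. \<bar>ph (unf z)\<bar> <= C & \<bar>vx z\<bar> <= C & \<bar>vy z\<bar> <= C" using bound_v by blast
 have bx: "\<bar>(vx z)^2\<bar> <= C^2" and bz: "\<bar>(vy z)^2\<bar> <= C^2" for z using C square_bounded by blast+
 have mx: "(%z. (vx z)^2) \<in> bmeas" and my: "(%z. (vy z)^2) \<in> bmeas" by measurable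
 note ix = seg_seg_Fubini(1)[OF mx bx, of 0 L 0 L] and iy = seg_seg_Fubini(1)[OF my bz, of 0 L 0 L]
 have "X + Y = (\<integral>z. (vx z)^2 + (vy z)^2 \<partial>?P)"
 unfolding seg_seg_Fubini(2)[OF mx bx] seg_seg_Fubini(3)[OF my bz] using ix iy by simp
 also have "... <= (\<integral>z. (pd ph (1, 0) (unf z))^2 + (pd ph (0, 1) (unf z))^2 \<partial>?P)"
 proof (rule integral_mono)
 fix z
 define a where "a = pd ph (1, 0) (unf z)"
 define b where "b = pd ph (0, 1) (unf z)"
 have pl: "pd ph (c, d) (unf z) = c * a + d * b" for c d
  unfolding a_def b_def by (rule pd_plane[OF C1])
 have d: "(t / slope)^2 <= t^2" for t
 proof -
  have "t^2 / slope^2 <= t^2 / 1" using slope(2) by (intro divide_left_mono) auto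
  then show ?thesis by (simp add: power_divide)
 qed
 have rot: "(co * a + si * b)^2 + (si * a - co * b)^2 = a^2 + b^2"
  "(co * a - si * b)^2 + (si * a + co * b)^2 = a^2 + b^2"
 proof -
  have "(co * a + si * b)^2 + (si * a - co * b)^2 = (a^2 + b^2) * (si * si + co * co)"
  "(co * a - si * b)^2 + (si * a + co * b)^2 = (a^2 + b^2) * (si * si + co * co)"
  unfolding power2_eq_square by (rule trans[OF _ refl], simp only: algebra_simps)+
  then show "(co * a + si * b)^2 + (si * a - co * b)^2 = a^2 + b^2"
  "(co * a - si * b)^2 + (si * a + co * b)^2 = a^2 + b^2"
  by (simp_all only: sq1 mult_1_right)
 qed
 show "(vx z)^2 + (vy z)^2 <= (pd ph (1, 0) (unf z))^2 + (pd ph (0, 1) (unf z))^2"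
 proof (cases "snd z <= fst z")
  case True
  then have e: "vx z = (co * a + si * b) / slope" "vy z = si * a - co * b" by (simp_all add: vx_def vy_def pl)
  show ?thesis using d[of "co * a + si * b"] rot(1) unfolding e a_def[symmetric] b_def[symmetric] by linarith
 next
  case False
  then have e: "vx z = si * a + co * b" "vy z = (co * a - si * b) / slope" by (simp_all add: vx_def vy_def pl)
  show ?thesis using d[of "co * a - si * b"] rot(2) unfolding e a_def[symmetric] b_def[symmetric] by linarith
 qed
 qed (use ix iy i in auto)
 also have "... = (\<integral>z. (pd ph (1, 0) (unf z))^2 \<partial>?P) + (\<integral>z. (pd ph (0, 1) (unf z))^2 \<partial>?P)"
 using i by simp
 finally show ?thesis unfolding sum_Basis_plane n using slope(3) by (simp add: divide_right_mono add_divide_distrib[symmetric])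
qed

lemma trace_unf: "integrable sg (%x. (ph x)^2)"
 "(\<integral>x. (ph x)^2 \<partial>sg) = ((\<integral>x. (ph (unf (x, 0)))^2 \<partial>seg 0 L) + (\<integral>y. (ph (unf (0, y)))^2 \<partial>seg 0 L)) / slope"
proof -
 obtain B where B: "!!x. \<bar>ph x\<bar> <= B" using C1c_bounded(1)[OF C1] by blast
 have b: "\<exists>B. \<forall>x. \<bar>(ph x)^2\<bar> <= B" using square_bounded[OF B] by blast
 have m: "(%x. (ph x)^2) \<in> bmeas" using C1c_measurable(1)[OF C1] by measurable
 have "\<forall>x. x \<notin> K \<longrightarrow> (ph x)\<^sup>2 = 0" using K(1) by simp
 note * = U[unfolded unfolds_def, rule_format, OF m b this[rule_format]]
 show "integrable sg (%x. (ph x)^2)" using * by blast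
 show "(\<integral>x. (ph x)^2 \<partial>sg) = ((\<integral>x. (ph (unf (x, 0)))^2 \<partial>seg 0 L) + (\<integral>y. (ph (unf (0, y)))^2 \<partial>seg 0 L)) / slope" using * by simp
qed

lemma integrable_sides:
 "integrable (seg 0 L) (%y. (ph (unf (0, y)))^2)" "integrable (seg 0 L) (%x. (ph (unf (x, 0)))^2)"
 using square_integrableD(2)[OF pw_diff_facts(3)[OF slices(1)]] square_integrableD(2)[OF pw_diff_facts(3)[OF slices(2)]] by blast+

text \<open>A one-dimensional inequality that holds on all lines parallel to the axes is integrated over
 the square.\<close>

lemma integrate_slices:
 assumes x: "!!y. y \<in> {0..L} ==> h1 y <= (\<integral>x. (vx (x, y))^2 \<partial>seg 0 L) - al * (ph (unf (0, y)))^2"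
 and y: "!!x. x \<in> {0..L} ==> h2 x <= (\<integral>y. (vy (x, y))^2 \<partial>seg 0 L) - al * (ph (unf (x, 0)))^2"
 and i: "integrable (seg 0 L) h1" "integrable (seg 0 L) h2"
 shows "((\<integral>y. h1 y \<partial>seg 0 L) + (\<integral>x. h2 x \<partial>seg 0 L)) / slope
 <= (dirichlet S ph) - al * (\<integral>x. (ph x)^2 \<partial>sg)"
proof -
 obtain C where C: "\<forall>z. \<bar>ph (unf z)\<bar> <= C & \<bar>vx z\<bar> <= C & \<bar>vy z\<bar> <= C" using bound_v by blast
 have bx: "\<bar>(vx z)^2\<bar> <= C^2" and bz: "\<bar>(vy z)^2\<bar> <= C^2" for z using C square_bounded by blast+
 have mx: "(%z. (vx z)^2) \<in> bmeas" and my: "(%z. (vy z)^2) \<in> bmeas" by measurable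
 note ix = seg_seg_Fubini(4)[OF mx bx, of 0 L 0 L] and iy = seg_seg_Fubini(5)[OF my bz, of 0 L 0 L]
 have "(\<integral>y. h1 y \<partial>seg 0 L) <= (\<integral>y. (\<integral>x. (vx (x, y))^2 \<partial>seg 0 L) - al * (ph (unf (0, y)))^2 \<partial>seg 0 L)"
 by (rule integral_mono) (use x i ix integrable_sides in auto)
 moreover have "(\<integral>x. h2 x \<partial>seg 0 L) <= (\<integral>x. (\<integral>y. (vy (x, y))^2 \<partial>seg 0 L) - al * (ph (unf (x, 0)))^2 \<partial>seg 0 L)"
 by (rule integral_mono) (use y i iy integrable_sides in auto)
 ultimately have "(\<integral>y. h1 y \<partial>seg 0 L) + (\<integral>x. h2 x \<partial>seg 0 L)
  <= (X + Y) - al * ((\<integral>x. (ph (unf (x, 0)))^2 \<partial>seg 0 L) + (\<integral>y. (ph (unf (0, y)))^2 \<partial>seg 0 L))"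
 using ix iy integrable_sides by (simp add: algebra_simps)
 then have "((\<integral>y. h1 y \<partial>seg 0 L) + (\<integral>x. h2 x \<partial>seg 0 L)) / slope
  <= ((X + Y) - al * ((\<integral>x. (ph (unf (x, 0)))^2 \<partial>seg 0 L) + (\<integral>y. (ph (unf (0, y)))^2 \<partial>seg 0 L))) / slope"
 using slope(3) by (intro divide_right_mono) auto
 then show ?thesis using grad_unf unfolding trace_unf(2) by (simp add: diff_divide_distrib)
qed

lemma V_Fubini:
 "integrable (seg 0 L) (%y. \<integral>x. (ph (unf (x, y)))^2 \<partial>seg 0 L)" "integrable (seg 0 L) (%x. \<integral>y. (ph (unf (x, y)))^2 \<partial>seg 0 L)"
 "(\<integral>x. \<integral>y. (ph (unf (x, y)))^2 \<partial>seg 0 L \<partial>seg 0 L) = V"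
proof -
 obtain C where C: "\<forall>z. \<bar>ph (unf z)\<bar> <= C & \<bar>vx z\<bar> <= C & \<bar>vy z\<bar> <= C" using bound_v by blast
 have b: "\<bar>(ph (unf z))^2\<bar> <= C^2" for z using C square_bounded by blast
 have m: "(%z. (ph (unf z))^2) \<in> bmeas" by measurable
 show "integrable (seg 0 L) (%y. \<integral>x. (ph (unf (x, y)))^2 \<partial>seg 0 L)" "integrable (seg 0 L) (%x. \<integral>y. (ph (unf (x, y)))^2 \<partial>seg 0 L)"
 by (rule seg_seg_Fubini(4)[OF m b] seg_seg_Fubini(5)[OF m b])+
 show "(\<integral>x. \<integral>y. (ph (unf (x, y)))^2 \<partial>seg 0 L \<partial>seg 0 L) = V"
 unfolding seg_seg_Fubini(2)[OF m b] seg_seg_Fubini(3)[OF m b] ..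
qed

text \<open>Divided by \<open>\<epsilon>\<close>, the one-dimensional trace inequality is a Robin
  inequality with parameter \<open>1 / \<epsilon>\<close>, so it can be integrated over slices like
  the others; the factor 2 counts the two directions.\<close>

lemma trace_bound_unf:
 assumes e: "\<epsilon> > 0"
 shows "(\<integral>x. (ph x)^2 \<partial>sg) <= \<epsilon> * (dirichlet S ph) + 2 * (1 / L + 1 / \<epsilon>) * (norm (restr S ph))^2"
proof -
 let ?c = "(1 / L + 1 / \<epsilon>) / \<epsilon>"
 have a: "- ?c * J <= I - (1 / \<epsilon>) * t" if "t <= \<epsilon> * I + (1 / (L - 0) + 1 / \<epsilon>) * J" for t I J :: real
 proof -
 have "t / \<epsilon> <= (\<epsilon> * I + (1 / L + 1 / \<epsilon>) * J) / \<epsilon>" using that e by (intro divide_right_mono) auto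
 also have "... = I + ?c * J" using e by (simp only: add_divide_distrib[of "\<epsilon> * I"]) simp
 finally show ?thesis by simp
 qed
 have "((\<integral>y. - ?c * (\<integral>x. (ph (unf (x, y)))^2 \<partial>seg 0 L) \<partial>seg 0 L) + (\<integral>x. - ?c * (\<integral>y. (ph (unf (x, y)))^2 \<partial>seg 0 L) \<partial>seg 0 L)) / slope
 <= (dirichlet S ph) - (1 / \<epsilon>) * (\<integral>x. (ph x)^2 \<partial>sg)"
 by (rule integrate_slices; (rule a, rule trace_inequality_1d[OF slices(1) L e] trace_inequality_1d[OF slices(2) L e])?)
  (intro integrable_mult_right V_Fubini)+
 also have "(\<integral>y. - ?c * (\<integral>x. (ph (unf (x, y)))^2 \<partial>seg 0 L) \<partial>seg 0 L) = - ?c * V" by (simp add: V_Fubini(3))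
 also have "(\<integral>x. - ?c * (\<integral>y. (ph (unf (x, y)))^2 \<partial>seg 0 L) \<partial>seg 0 L) = - ?c * V" by (simp add: V_Fubini(3))
 finally have "\<epsilon> * ((- ?c * V + - ?c * V) / slope) <= \<epsilon> * ((dirichlet S ph) - (1 / \<epsilon>) * (\<integral>x. (ph x)^2 \<partial>sg))"
 using e by (intro mult_left_mono) auto
 moreover have "\<epsilon> * ((- ?c * V + - ?c * V) / slope) = - (2 * (1 / L + 1 / \<epsilon>) * (norm (restr S ph))^2)"
 proof -
 have "\<epsilon> * ((- (q / \<epsilon>) * v + - (q / \<epsilon>) * v) / slope) = - (2 * q * (v / slope))" for q v :: real
  using e slope(3) by (simp add: field_simps)
 then show ?thesis unfolding norm_unf .
 qed
 moreover have "\<epsilon> * ((dirichlet S ph) - (1 / \<epsilon>) * (\<integral>x. (ph x)^2 \<partial>sg)) = \<epsilon> * (dirichlet S ph) - (\<integral>x. (ph x)^2 \<partial>sg)"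
 using e by (simp add: right_diff_distrib)
 ultimately show ?thesis by linarith
qed

end

section \<open>Division of a square into cells, and product functions\<close>

lemma seg_split:
 fixes f :: "real => real"
 assumes "a <= b" "b <= c" and f: "integrable (seg a c) f"
 shows "integrable (seg a b) f" "integrable (seg b c) f" "(\<integral>x. f x \<partial>seg a c) = (\<integral>x. f x \<partial>seg a b) + (\<integral>x. f x \<partial>seg b c)"
proof -
 have eq: "integrable (seg a b) f \<longleftrightarrow> set_integrable lborel {a..b} f" "(\<integral>x. f x \<partial>seg a b) = (LINT x:{a..b}|lborel. f x)" for a b
 unfolding seg_def set_integrable_def set_lebesgue_integral_def
 by (simp_all add: integrable_restrict_space integral_restrict_space)
 have f': "set_integrable lborel {a..c} f" using f by (simp add: eq)
 have s: "set_integrable lborel {a..b} f" "set_integrable lborel {b..c} f"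
 by (rule set_integrable_subset[OF f']; use assms(1,2) in auto)+
 then show "integrable (seg a b) f" "integrable (seg b c) f" by (simp_all add: eq)
 have "AE x in lborel. \<not> (x \<in> {a..b} & x \<in> {b..c})" using AE_lborel_singleton[of b] by eventually_elim auto
 from set_integral_Un_AE[OF this _ _ s] have "(LINT x:{a..b} \<union> {b..c}|lborel. f x) = (LINT x:{a..b}|lborel. f x) + (LINT x:{b..c}|lborel. f x)" by simp
 moreover have "{a..b} \<union> {b..c} = {a..c}" using assms(1,2) by auto
 ultimately show "(\<integral>x. f x \<partial>seg a c) = (\<integral>x. f x \<partial>seg a b) + (\<integral>x. f x \<partial>seg b c)" by (simp add: eq)
qed

abbreviation cell :: "real => nat => real measure" where "cell h i \<equiv> seg (h * real i) (h * real i + h)"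

lemma seg_grid:
 fixes f :: "real => real"
 assumes h: "h >= 0" and f: "integrable (seg 0 (h * real n)) f"
 shows "(\<forall>i<n. integrable (cell h i) f) & (\<integral>x. f x \<partial>seg 0 (h * real n)) = (\<Sum>i<n. \<integral>x. f x \<partial>cell h i)"
 using f
proof (induction n)
 case 0
 have "AE x in lborel. ind {0..0} x * f x = 0" using AE_lborel_singleton[of "0 :: real"] by eventually_elim auto
 then have "(\<integral>x. ind {0..0} x * f x \<partial>lborel) = 0" by (rule integral_eq_zero_AE)
 then show ?case by (simp add: seg_integral)
next
 case (Suc n)
 have e: "h * real (Suc n) = h * real n + h" by (simp add: algebra_simps)
 have "0 <= h * real n" "h * real n <= h * real n + h" using h by auto
 from seg_split[OF this] Suc.prems Suc.IH show ?case unfolding e by (auto simp: less_Suc_eq)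
qed

lemma seg_grid2:
 fixes G :: "plane => real"
 assumes h: "h >= 0" and G: "G \<in> bmeas" "!!z. \<bar>G z\<bar> <= B"
 shows "(\<integral>y. \<integral>x. G (x, y) \<partial>seg 0 (h * real n) \<partial>seg 0 (h * real n)) = (\<Sum>j<n. \<Sum>i<n. \<integral>y. \<integral>x. G (x, y) \<partial>cell h i \<partial>cell h j)"
proof -
 have m: "(%x. G (x, y)) \<in> bmeas" for y
 using measurable_compose[OF _ G(1), of "%x. (x, y)" borel] by (simp add: borel_measurable_continuous_onI continuous_intros)
 have "(\<integral>x. G (x, y) \<partial>seg 0 (h * real n)) = (\<Sum>i<n. \<integral>x. G (x, y) \<partial>cell h i)" for y
 using seg_grid[OF h seg_integrable[OF m G(2)]] by blast
 then have "(\<integral>y. \<integral>x. G (x, y) \<partial>seg 0 (h * real n) \<partial>seg 0 (h * real n)) = (\<integral>y. (\<Sum>i<n. \<integral>x. G (x, y) \<partial>cell h i) \<partial>seg 0 (h * real n))" by simp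
 also have "... = (\<Sum>j<n. \<integral>y. (\<Sum>i<n. \<integral>x. G (x, y) \<partial>cell h i) \<partial>cell h j)"
 by (rule conjunct2[OF seg_grid[OF h]]) (intro Bochner_Integration.integrable_sum seg_seg_Fubini(4)[OF G])
 also have "... = (\<Sum>j<n. \<Sum>i<n. \<integral>y. \<integral>x. G (x, y) \<partial>cell h i \<partial>cell h j)"
 by (intro sum.cong refl Bochner_Integration.integral_sum seg_seg_Fubini(4)[OF G])
 finally show ?thesis .
qed

lemma seg_indicator:
 assumes "0 <= a" "b <= L"
 shows "(\<integral>x. f x * ind {a..b} x \<partial>seg 0 L) = (\<integral>x. (f x :: real) \<partial>seg a b)"
proof -
 have "(%x. ind {0..L} x * (f x * ind {a..b} x)) = (%x. ind {a..b} x * f x)"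
 using assms by (auto simp: indicator_def)
 then show ?thesis by (simp only: seg_integral)
qed

lemma seg_partial_square:
 fixes G :: "plane => real"
 assumes G: "G \<in> bmeas" "!!z. \<bar>G z\<bar> <= B"
 shows "integrable (seg c d) (%y. (\<integral>x. G (x, y) \<partial>seg a b)^2)" "integrable (seg a b) (%x. (\<integral>y. G (x, y) \<partial>seg c d)^2)"
proof -
 have bd: "\<bar>\<integral>x. f x \<partial>seg a b\<bar> <= measure (seg a b) {a..b} * B" if "!!x. \<bar>f x\<bar> <= B" for f :: "real => real" and a b
 proof (cases "integrable (seg a b) f")
 case True
 have "\<bar>\<integral>x. f x \<partial>seg a b\<bar> <= (\<integral>x. \<bar>f x\<bar> \<partial>seg a b)" using integral_norm_bound[of "seg a b" f] by simp
 also have "... <= (\<integral>x. B \<partial>seg a b)"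
  by (rule integral_mono) (use True that finite_measure.integrable_const[OF finite_measure_seg] in auto)
 finally show ?thesis by simp
 next
 case False
 have "0 <= B" using that[of 0] by linarith
 with False show ?thesis by (simp add: not_integrable_integral_eq)
 qed
 have sq: "integrable (seg a b) (%x. (f x)^2)" if i: "integrable (seg a b) f" and b: "!!x. \<bar>f x\<bar> <= D" for f :: "real => real" and a b D
 proof (rule finite_measure.integrable_const_bound[OF finite_measure_seg])
 show "AE x in seg a b. norm ((f x)^2) <= D^2" using power_mono[OF b, where n = 2] by (intro AE_I2) auto
 qed (use i in measurable)
 show "integrable (seg c d) (%y. (\<integral>x. G (x, y) \<partial>seg a b)^2)" by (rule sq[OF seg_seg_Fubini(4)[OF G] bd[OF G(2)]])
 show "integrable (seg a b) (%x. (\<integral>y. G (x, y) \<partial>seg c d)^2)" by (rule sq[OF seg_seg_Fubini(5)[OF G] bd[OF G(2)]])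
qed

text \<open>The product of \<open>f\<close> and \<open>g\<close> in unfolded coordinates,
  transported to the plane so that it represents a functional on the original domain.\<close>

definition (in half_angle) tensor :: "(real => real) => (real => real) => plane => real" where
 "tensor f g p = f (fst (refold p)) * g (snd (refold p))"

lemma (in half_angle) tensor_bounds:
 assumes "f \<in> bmeas" "!!x. \<bar>f x\<bar> <= B" "g \<in> bmeas" "!!x. \<bar>g x\<bar> <= C"
 shows "tensor f g \<in> bmeas" "\<bar>tensor f g p\<bar> <= B * C"
proof -
 note [measurable] = assms(1,3)
 have "fst \<in> borel_measurable (borel :: plane measure)" "snd \<in> borel_measurable (borel :: plane measure)"
 by (intro borel_measurable_continuous_onI continuous_intros)+
 note [measurable] = measurable_compose[OF refold_measurable this(1)] measurable_compose[OF refold_measurable this(2)]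
 show "tensor f g \<in> bmeas" unfolding tensor_def[abs_def] by measurable
 have "0 <= B" using assms(2)[of 0] by linarith
 then show "\<bar>tensor f g p\<bar> <= B * C" unfolding tensor_def abs_mult using assms(2,4) by (intro mult_mono) auto
qed

context unfolded_test
begin

lemma inner_tensor:
 assumes f: "f \<in> bmeas" "!!x. \<bar>f x\<bar> <= B" and g: "g \<in> bmeas" "!!x. \<bar>g x\<bar> <= C"
 and sq: "sqint lborel (%x. ind S x * tensor f g x)"
 shows "inner (restr S ph) (restr S (tensor f g)) = (\<integral>y. \<integral>x. ph (unf (x, y)) * (f x * g y) \<partial>seg 0 L \<partial>seg 0 L) / slope"
proof -
 obtain D where D: "!!x. \<bar>ph x\<bar> <= D" using C1c_bounded(1)[OF C1] by blast
 have t: "tensor f g (unf (x, y)) = f x * g y" for x y by (simp add: tensor_def refold_unf)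
 show ?thesis
 using inner_unf[OF C1c_measurable(1)[OF C1] D K(1) C1c_square_integrable(1)[OF C1] tensor_bounds[OF f g] sq]
 by (simp add: t)
qed

text \<open>With P and Q the projections onto \<open>w\<close> in the two variables, the slices
  contribute \<open>2 m - (k^2 + m) (P + Q)\<close>. \<open>tensor_Bessel\<close> says P + Q <= 1 +
  PQ, which leaves \<open>m - k^2\<close> and a multiple of the single functional PQ. The condition
  at \<open>L\<close> covers both a Neumann profile and a test function vanishing on the far
  sides.\<close>

lemma robin_product_bound:
 assumes w: "pw_diff 0 L w w'" and w': "pw_diff 0 L w' (%x. k^2 * w x)"
 and w0: "w 0 = 1" "w' 0 = - al" and wL: "w L * w' L <= 0"
  "!!x. x \<in> {0..L} ==> ph (unf (L, x)) * w' L = 0 & ph (unf (x, L)) * w' L = 0"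
 and m: "0 <= m" "m <= 1 / L^2" and N: "N = (\<integral>x. (w x)^2 \<partial>seg 0 L)" "N > 0"
 and B: "!!x. \<bar>w x\<bar> <= B" and sq: "sqint lborel (%x. ind S x * tensor w w x)"
 shows "(m - k^2) * (norm (restr S ph))^2 - (k^2 + m) * slope / N^2 * (inner (restr S ph) (restr S (tensor w w)))^2
 <= (dirichlet S ph) - al * (\<integral>x. (ph x)^2 \<partial>sg)"
proof -
 have wm [measurable]: "w \<in> bmeas" by (rule pw_diff_facts(1)[OF w])
 obtain C where C: "\<forall>z. \<bar>ph (unf z)\<bar> <= C & \<bar>vx z\<bar> <= C & \<bar>vy z\<bar> <= C" using bound_v by blast
 have [measurable]: "fst \<in> borel_measurable (borel :: plane measure)" "snd \<in> borel_measurable (borel :: plane measure)"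
 by (intro borel_measurable_continuous_onI continuous_intros)+
 have m1: "(%z. ph (unf z) * w (fst z)) \<in> bmeas" "(%z. ph (unf z) * w (snd z)) \<in> bmeas"
 using measurable_compose[OF _ wm] by measurable
 have b1: "\<bar>ph (unf z) * w t\<bar> <= C * B" for z t
 proof -
 have "\<bar>ph (unf z)\<bar> <= C" using C by blast
 then show ?thesis unfolding abs_mult by (intro mult_mono B order_trans[OF abs_ge_zero]) auto
 qed
 let ?F1 = "%y. \<integral>x. ph (unf (x, y)) * w x \<partial>seg 0 L" and ?F2 = "%x. \<integral>y. ph (unf (x, y)) * w y \<partial>seg 0 L"
 have i1: "integrable (seg 0 L) (%y. (?F1 y)^2)" and i2: "integrable (seg 0 L) (%x. (?F2 x)^2)"
 using seg_partial_square(1)[OF m1(1) b1] seg_partial_square(2)[OF m1(2) b1] by simp_all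
 let ?h1 = "%y. m * (\<integral>x. (ph (unf (x, y)))^2 \<partial>seg 0 L) - (k^2 + m) * (?F1 y)^2 / N"
 let ?h2 = "%x. m * (\<integral>y. (ph (unf (x, y)))^2 \<partial>seg 0 L) - (k^2 + m) * (?F2 x)^2 / N"
 let ?I = "\<integral>y. \<integral>x. ph (unf (x, y)) * (w x * w y) \<partial>seg 0 L \<partial>seg 0 L"
 have main: "((\<integral>y. ?h1 y \<partial>seg 0 L) + (\<integral>x. ?h2 x \<partial>seg 0 L)) / slope
 <= (dirichlet S ph) - al * (\<integral>x. (ph x)^2 \<partial>sg)"
 proof (rule integrate_slices)
 show "?h1 y <= (\<integral>x. (vx (x, y))^2 \<partial>seg 0 L) - al * (ph (unf (0, y)))^2" if "y \<in> {0..L}" for y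
  using robin_inequality_1d[OF slices(1) w w' L w0 _ wL(1) m] wL(2)[OF that] N by simp
 show "?h2 x <= (\<integral>y. (vy (x, y))^2 \<partial>seg 0 L) - al * (ph (unf (x, 0)))^2" if "x \<in> {0..L}" for x
  using robin_inequality_1d[OF slices(2) w w' L w0 _ wL(1) m] wL(2)[OF that] N by simp
 show "integrable (seg 0 L) ?h1" "integrable (seg 0 L) ?h2" using V_Fubini i1 i2 by auto
 qed
 have A: "(\<integral>y. (?F1 y)^2 \<partial>seg 0 L) / N + (\<integral>x. (?F2 x)^2 \<partial>seg 0 L) / N <= V + ?I^2 / (N * N)"
 proof (rule tensor_Bessel[OF finite_measure_seg finite_measure_seg _ _ _ B _ B N N])
 show "(%(x, y). ph (unf (x, y))) \<in> borel_measurable (seg 0 L \<Otimes>\<^sub>M seg 0 L)"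
  using seg_seg_Fubini(6)[OF measurable_v(1), of C] C by simp
 show "\<bar>ph (unf (x, y))\<bar> <= C" for x y using C by blast
 qed measurable
 have "(m - k^2) * V - (k^2 + m) * (?I^2 / (N * N)) = 2 * m * V - (k^2 + m) * (V + ?I^2 / (N * N))"
 by (simp add: algebra_simps)
 also have "... <= 2 * m * V - (k^2 + m) * ((\<integral>y. (?F1 y)^2 \<partial>seg 0 L) / N + (\<integral>x. (?F2 x)^2 \<partial>seg 0 L) / N)"
 using A m(1) by (intro diff_left_mono mult_left_mono) auto
 also have "... = (\<integral>y. ?h1 y \<partial>seg 0 L) + (\<integral>x. ?h2 x \<partial>seg 0 L)"
 using V_Fubini i1 i2 by (simp add: algebra_simps)
 finally have "((m - k^2) * V - (k^2 + m) * (?I^2 / (N * N))) / slope <= ((\<integral>y. ?h1 y \<partial>seg 0 L) + (\<integral>x. ?h2 x \<partial>seg 0 L)) / slope"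
 using slope(3) by (intro divide_right_mono) auto
 with main have 1: "((m - k^2) * V - (k^2 + m) * (?I^2 / (N * N))) / slope <= (dirichlet S ph) - al * (\<integral>x. (ph x)^2 \<partial>sg)"
 by (rule order_trans[rotated])
 have "(m - k^2) * (V / slope) - (k^2 + m) * slope / N^2 * (?I / slope)^2 = ((m - k^2) * V - (k^2 + m) * (?I^2 / (N * N))) / slope"
 using slope(3) by (simp add: power2_eq_square diff_divide_distrib)
 with 1 show ?thesis unfolding inner_tensor[OF wm B wm B sq] norm_unf by simp
qed

text \<open>The mean-value inequalities in the two directions add up to twice the squared norm.
  Their squared line means are bounded, by \<open>tensor_Bessel\<close> with constant profiles, by
  one squared norm plus the squared cell mean, so one squared norm remains.\<close>

lemma Poincare_cell:
 assumes h: "h > 0" and b: "b = a + h" and d: "d = c + h"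
 shows "(\<integral>y. \<integral>x. (ph (unf (x, y)))^2 \<partial>seg a b \<partial>seg c d)
 <= h^2 * ((\<integral>y. \<integral>x. (vx (x, y))^2 \<partial>seg a b \<partial>seg c d) + (\<integral>y. \<integral>x. (vy (x, y))^2 \<partial>seg a b \<partial>seg c d))
  + (\<integral>y. \<integral>x. ph (unf (x, y)) \<partial>seg a b \<partial>seg c d)^2 / h^2"
proof -
 obtain C where C: "\<forall>z. \<bar>ph (unf z)\<bar> <= C & \<bar>vx z\<bar> <= C & \<bar>vy z\<bar> <= C" using bound_v by blast
 have bv: "\<bar>ph (unf z)\<bar> <= C" "\<bar>(ph (unf z))^2\<bar> <= C^2" "\<bar>(vx z)^2\<bar> <= C^2" "\<bar>(vy z)^2\<bar> <= C^2" for z using C square_bounded by blast+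
 have mv: "(%z. (ph (unf z))^2) \<in> bmeas" "(%z. (vx z)^2) \<in> bmeas" "(%z. (vy z)^2) \<in> bmeas" by measurable
 note F = seg_seg_Fubini[OF mv(1) bv(2)] seg_seg_Fubini[OF mv(2) bv(3)] seg_seg_Fubini[OF mv(3) bv(4)]
 note P = seg_partial_square[OF measurable_v(1) bv(1)]
 have ab: "a < b" "b - a = h" "c < d" "d - c = h" using h b d by auto
 let ?V = "\<integral>y. \<integral>x. (ph (unf (x, y)))^2 \<partial>seg a b \<partial>seg c d"
 let ?A = "\<integral>y. (\<integral>x. ph (unf (x, y)) \<partial>seg a b)^2 \<partial>seg c d" and ?B = "\<integral>x. (\<integral>y. ph (unf (x, y)) \<partial>seg c d)^2 \<partial>seg a b"
 have "?V <= (\<integral>y. h^2 * (\<integral>x. (vx (x, y))^2 \<partial>seg a b) + (\<integral>x. ph (unf (x, y)) \<partial>seg a b)^2 / h \<partial>seg c d)"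
 by (rule integral_mono) (use F P Poincare_mean[OF slices(1) ab(1)] ab(2) in auto)
 also have "... = h^2 * (\<integral>y. \<integral>x. (vx (x, y))^2 \<partial>seg a b \<partial>seg c d) + ?A / h"
 using F P by simp
 finally have 1: "?V <= h^2 * (\<integral>y. \<integral>x. (vx (x, y))^2 \<partial>seg a b \<partial>seg c d) + ?A / h" .
 have "(\<integral>x. \<integral>y. (ph (unf (x, y)))^2 \<partial>seg c d \<partial>seg a b) <= (\<integral>x. h^2 * (\<integral>y. (vy (x, y))^2 \<partial>seg c d) + (\<integral>y. ph (unf (x, y)) \<partial>seg c d)^2 / h \<partial>seg a b)"
 by (rule integral_mono) (use F P Poincare_mean[OF slices(2) ab(3)] ab(4) in auto)
 also have "... = h^2 * (\<integral>x. \<integral>y. (vy (x, y))^2 \<partial>seg c d \<partial>seg a b) + ?B / h"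
 using F P by simp
 finally have 2: "?V <= h^2 * (\<integral>y. \<integral>x. (vy (x, y))^2 \<partial>seg a b \<partial>seg c d) + ?B / h" using F by simp
 have "?A / h + ?B / h = (\<integral>y. (\<integral>x. ph (unf (x, y)) * 1 \<partial>seg a b)^2 \<partial>seg c d) / h + (\<integral>x. (\<integral>y. ph (unf (x, y)) * 1 \<partial>seg c d)^2 \<partial>seg a b) / h" by simp
 also have "... <= ?V + (\<integral>y. \<integral>x. ph (unf (x, y)) * (1 * 1) \<partial>seg a b \<partial>seg c d)^2 / (h * h)"
 proof (rule tensor_Bessel[OF finite_measure_seg finite_measure_seg, where B = C and ?B1.0 = 1 and ?B2.0 = 1])
 show "(%(x, y). ph (unf (x, y))) \<in> borel_measurable (seg a b \<Otimes>\<^sub>M seg c d)"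
  using seg_seg_Fubini(6)[OF measurable_v(1) bv(1)] by simp
 qed (use bv h ab in auto)
 finally have "?A / h + ?B / h <= ?V + (\<integral>y. \<integral>x. ph (unf (x, y)) \<partial>seg a b \<partial>seg c d)^2 / h^2" by (simp add: power2_eq_square)
 then show ?thesis using 1 2 by (simp add: distrib_left)
qed

text \<open>A quantitative substitute for a compact embedding: when the finitely many cell averages
  vanish, the Dirichlet integral is at least \<open>1 / h^2\<close> times the squared norm.\<close>

lemma Poincare_grid:
 assumes n: "n > 0" and h: "h = L / real n" and I: "I = (%i :: nat. ind {h * real i..h * real i + h})"
 and sq: "!!i j. i < n ==> j < n ==> sqint lborel (%x. ind S x * tensor (I i) (I j) x)"
 shows "(norm (restr S ph))^2 <= h^2 * (dirichlet S ph)
 + slope / h^2 * (\<Sum>j<n. \<Sum>i<n. (inner (restr S ph) (restr S (tensor (I i) (I j))))^2)"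
proof -
 have h0: "h > 0" using n L by (simp add: h)
 have Lh: "L = h * real n" using n by (simp add: h)
 obtain C where C: "\<forall>z. \<bar>ph (unf z)\<bar> <= C & \<bar>vx z\<bar> <= C & \<bar>vy z\<bar> <= C" using bound_v by blast
 have bv: "\<bar>(ph (unf z))^2\<bar> <= C^2" "\<bar>(vx z)^2\<bar> <= C^2" "\<bar>(vy z)^2\<bar> <= C^2" for z using C square_bounded by blast+
 have mv: "(%z. (ph (unf z))^2) \<in> bmeas" "(%z. (vx z)^2) \<in> bmeas" "(%z. (vy z)^2) \<in> bmeas" by measurable
 have i: "(\<integral>y. \<integral>x. ph (unf (x, y)) \<partial>cell h i \<partial>cell h j) = slope * inner (restr S ph) (restr S (tensor (I i) (I j)))" if "i < n" "j < n" for i j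
 proof -
 have c: "0 <= h * real i" "h * real i + h <= L" if "i < n" for i
 proof -
  have "h * (real i + 1) <= h * real n" using that h0 by (intro mult_left_mono) auto
  then show "0 <= h * real i" "h * real i + h <= L" using h0 by (auto simp: Lh algebra_simps)
 qed
 have Ib: "I i \<in> bmeas" "\<bar>I i x\<bar> <= 1" for i x by (auto simp: I indicator_def)
 have e: "ph (unf (x, y)) * (I i x * I j y) = (ph (unf (x, y)) * I i x) * I j y" for x y by simp
 have "(\<integral>y. \<integral>x. ph (unf (x, y)) * (I i x * I j y) \<partial>seg 0 L \<partial>seg 0 L) = (\<integral>y. \<integral>x. ph (unf (x, y)) \<partial>cell h i \<partial>cell h j)"
  by (simp only: e integral_mult_left_zero) (simp only: I seg_indicator[OF c[OF that(1)]] seg_indicator[OF c[OF that(2)]])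
 then show ?thesis unfolding inner_tensor[OF Ib Ib sq[OF that]] using slope(3) by simp
 qed
 have Yeq: "Y = (\<integral>y. \<integral>x. (vy (x, y))^2 \<partial>seg 0 L \<partial>seg 0 L)"
 using seg_seg_Fubini(2,3)[OF mv(3) bv(3)] by simp
 have "V <= h^2 * (X + Y) + (\<Sum>j<n. \<Sum>i<n. (slope * inner (restr S ph) (restr S (tensor (I i) (I j))))^2 / h^2)"
 unfolding Yeq
 unfolding Lh
 unfolding seg_grid2[OF less_imp_le[OF h0] mv(1) bv(1)] seg_grid2[OF less_imp_le[OF h0] mv(2) bv(2)] seg_grid2[OF less_imp_le[OF h0] mv(3) bv(3)]
  sum.distrib[symmetric] sum_distrib_left
 proof (intro sum_mono)
 fix j i assume "j \<in> {..<n}" "i \<in> {..<n}"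
 then have ij: "i < n" "j < n" by auto
 show "(\<integral>y. \<integral>x. (ph (unf (x, y)))^2 \<partial>cell h i \<partial>cell h j)
  <= h^2 * ((\<integral>y. \<integral>x. (vx (x, y))^2 \<partial>cell h i \<partial>cell h j) + (\<integral>y. \<integral>x. (vy (x, y))^2 \<partial>cell h i \<partial>cell h j))
   + (slope * inner (restr S ph) (restr S (tensor (I i) (I j))))^2 / h^2"
  unfolding i[OF ij, symmetric] by (rule Poincare_cell[OF h0 refl refl])
 qed
 then have "V / slope <= (h^2 * (X + Y) + (\<Sum>j<n. \<Sum>i<n. (slope * inner (restr S ph) (restr S (tensor (I i) (I j))))^2 / h^2)) / slope"
 using slope(3) by (intro divide_right_mono) auto
 also have "... = h^2 * ((X + Y) / slope) + slope / h^2 * (\<Sum>j<n. \<Sum>i<n. (inner (restr S ph) (restr S (tensor (I i) (I j))))^2)"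
 using slope(3) by (simp only: add_divide_distrib[of "h^2 * (X + Y)"] times_divide_eq_right)
  (simp add: sum_divide_distrib sum_distrib_left power_mult_distrib power2_eq_square mult_ac)
 also have "h^2 * ((X + Y) / slope) <= h^2 * (dirichlet S ph)"
 by (intro mult_left_mono grad_unf) simp
 finally show ?thesis unfolding norm_unf by simp
qed

end

section \<open>The operator in the quadrangle\<close>

lemma pw_diff_cong:
 assumes f: "pw_diff a b f f'" and g: "!!x. x \<in> {a..b} ==> g x = f x" "!!x. x \<in> {a..b} ==> g' x = f' x"
 "g \<in> bmeas" "g' \<in> bmeas"
 shows "pw_diff a b g g'"
proof -
 obtain D B where D: "finite D" "!!x. x \<in> {a<..<b} - D ==> (f has_real_derivative f' x) (at x)"
 and B: "!!x. x \<in> {a..b} ==> \<bar>f x\<bar> <= B & \<bar>f' x\<bar> <= B" and c: "continuous_on {a..b} f"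
 using f unfolding pw_diff_def by blast
 have "(g has_real_derivative g' x) (at x)" if x: "x \<in> {a<..<b} - D" for x
 proof (rule has_field_derivative_transform_within_open[of f])
 show "(f has_real_derivative g' x) (at x)" using D(2)[OF x] g(2)[of x] x by simp
 show "open {a<..<b}" "x \<in> {a<..<b}" using x by auto
 show "f y = g y" if "y \<in> {a<..<b}" for y using that g(1)[of y] by simp
 qed
 then show ?thesis unfolding pw_diff_def
 using D(1) B g c continuous_on_cong[OF refl g(1), of "{a..b}"] by (intro conjI exI[of _ D] exI[of _ B]) auto
qed

lemma pw_diff_smooth:
 assumes "!!x. (f has_real_derivative f' x) (at x)" "continuous_on UNIV f'"
 shows "pw_diff a b f f'"
proof -
 have c: "continuous_on UNIV f" using assms(1) by (meson DERIV_isCont continuous_at_imp_continuous_on)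
 have bd: "\<exists>B. \<forall>x\<in>{a..b}. \<bar>g x\<bar> <= B" if "continuous_on UNIV g" for g :: "real => real"
 proof -
 have "bounded (g ` {a..b})"
  by (intro compact_imp_bounded compact_continuous_image continuous_on_subset[OF that]) auto
 then show ?thesis unfolding bounded_iff by auto
 qed
 obtain B where B: "\<forall>x\<in>{a..b}. \<bar>f x\<bar> <= B" using bd[OF c] by blast
 obtain C where C: "\<forall>x\<in>{a..b}. \<bar>f' x\<bar> <= C" using bd[OF assms(2)] by blast
 have "\<forall>x\<in>{a..b}. \<bar>f x\<bar> <= max B C & \<bar>f' x\<bar> <= max B C" using B C by (auto simp: le_max_iff_disj)
 moreover have "f \<in> bmeas" "f' \<in> bmeas" "continuous_on {a..b} f"
 using c assms(2) continuous_on_subset by (blast intro: borel_measurable_continuous_onI)+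
 ultimately show ?thesis unfolding pw_diff_def using assms(1) by blast
qed

text \<open>The equation says that \<open>cosh (k * (x - R))\<close> has Neumann condition at
  \<open>R\<close> and Robin condition with parameter \<open>al\<close> at 0. It implies that
  \<open>k^2 - al^2\<close> equals \<open>k^2 / cosh (k * R) ^ 2\<close>, which is exponentially
  small; only a fraction of \<open>1 / R^2\<close> is claimed.\<close>

lemma exists_cosh_profile:
 fixes al R :: real
 assumes al: "al > 0" and R: "al * R >= 6"
 shows "\<exists>k>0. k * sinh (k * R) = al * cosh (k * R) & k^2 - al^2 <= 1 / (2 * R^2)"
proof -
 have R0: "R > 0"
 proof (rule ccontr)
 assume "\<not> R > 0"
 then have "al * R <= 0" using al by (intro mult_nonneg_nonpos) auto
 with R show False by simp
 qed
 let ?g = "%k. k * sinh (k * R) - al * cosh (k * R)"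
 \<comment> \<open>At \<open>k = al\<close> the sign comes from \<open>sinh <= cosh\<close>; at
   \<open>k = 2 * al\<close> it comes from \<open>tanh (2 * al * R) >= 1/2\<close>, guaranteed by
   the size of \<open>al * R\<close>.\<close>
 have "\<exists>k\<ge>al. k <= 2 * al & ?g k = 0"
 proof (rule IVT')
 have "sinh (al * R) <= cosh (al * R)" by (simp add: sinh_def cosh_def)
 then show "?g al <= 0" using al by (simp add: mult_left_mono)
 have "1 + 2 * (al * R) <= exp (2 * (al * R))" by (rule exp_ge_add_one_self)
 moreover have "exp (- (2 * (al * R))) <= 1" using al R0 by simp
 ultimately have "3 * exp (- (2 * (al * R))) <= exp (2 * (al * R))" using R by linarith
 then have "0 <= 2 * sinh (2 * (al * R)) - cosh (2 * (al * R))" by (simp add: sinh_def cosh_def)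
 then have "0 <= al * (2 * sinh (2 * (al * R)) - cosh (2 * (al * R)))" using al by simp
 then show "0 <= ?g (2 * al)" by (simp add: right_diff_distrib mult.assoc)
 show "continuous_on {al..2 * al} ?g" by (intro continuous_intros)
 qed (use al in simp)
 then obtain k where k: "k >= al" "k * sinh (k * R) = al * cosh (k * R)" by auto
 let ?c = "cosh (k * R)"
 have c0: "?c > 0" by simp
 have "(k * sinh (k * R))^2 = (al * ?c)^2" using k(2) by simp
 then have e: "(k^2 - al^2) * ?c^2 = k^2" by (simp add: power_mult_distrib sinh_square_eq algebra_simps)
 define t where "t = k * R"
 have "al * R <= t" unfolding t_def using k(1) R0 by (intro mult_right_mono) auto
 \<comment> \<open>The threshold 6 ensures \<open>t^2 >= 32\<close>, which is what turns
   \<open>cosh t >= t^2 / 4\<close> into \<open>(cosh t)^2 >= 2 * t^2\<close>.\<close>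
 then have t: "6 <= t" using R by linarith
 have "1 + t + t^2 / 2 <= exp t" using t by (intro exp_lower_Taylor_quadratic) simp
 moreover have "0 <= exp (- t)" by simp
 ultimately have "t^2 / 4 <= exp t / 2 + exp (- t) / 2" using t by linarith
 then have ct: "t^2 / 4 <= cosh t" by (simp only: cosh_field_def add_divide_distrib)
 have "6 * 6 <= t * t" using t by (intro mult_mono) auto
 then have t36: "36 <= t^2" by (simp add: power2_eq_square)
 have "36 * t^2 <= t^2 * t^2" by (rule mult_right_mono[OF t36]) simp
 moreover have "0 <= t^2" by simp
 moreover have "(t^2 / 4) * (t^2 / 4) = t^2 * t^2 / 16" by simp
 ultimately have "2 * t^2 <= (t^2 / 4) * (t^2 / 4)" by linarith
 also have "... <= cosh t * cosh t" by (intro mult_mono ct) auto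
 finally have "2 * t^2 <= (cosh t)^2" by (simp add: power2_eq_square)
 then have b: "2 * (k^2 * R^2) <= ?c^2" by (simp add: t_def power_mult_distrib)
 have "k^2 - al^2 = k^2 / ?c^2" using e c0 by (simp add: nonzero_eq_divide_eq)
 also have "... <= k^2 / (2 * (k^2 * R^2))" using b k(1) al R0 by (intro divide_left_mono) auto
 also have "... = 1 / (2 * R^2)" using k(1) al by simp
 finally show ?thesis using k al by (intro exI[of _ k]) auto
qed

section \<open>Trial vectors in a convex domain\<close>

context convex_domain
begin

text \<open>Two normalised bumps with disjoint supports: the open balls of radius
  \<open>e / 2\<close> around \<open>p + h\<close> and \<open>p - h\<close> touch but do not meet.
  They guarantee that a second eigenvalue exists.\<close>

lemma exists_orthonormal_pair:
 "\<exists>U. finite U & card U = 2 & U \<subseteq> H1 S & (\<forall>u\<in>U. \<forall>v\<in>U. inner u v = (if u = v then 1 else 0))"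
proof -
 obtain p e where e: "e > 0" "ball p e \<subseteq> S" using op nonempty open_contains_ball by blast
 define h :: plane where "h = (e / 2, 0)"
 define f where "f q = (%x. bump ((2 / e) *\<^sub>R (x - q)))" for q :: plane
 have nh: "norm h = e / 2" using e by (simp add: h_def norm_prod_def)
 have C: "f q \<in> C1c UNIV" for q unfolding f_def by (rule bump_affine_C1c) (use e in auto)
 note sq = C1c_square_integrable(1)[OF C]
 have near: "dist x q < e / 2" if "f q x ~= 0" for q x
 proof -
 have "norm ((2 / e) *\<^sub>R (x - q)) < 1" using that unfolding f_def bump_bounds(3) by linarith
 then show ?thesis unfolding norm_scaleR using e by (simp add: dist_norm field_simps)
 qed
 have pos: "inner (restr S (f q)) (restr S (f q)) > 0" if "ball q (e / 2) \<subseteq> S" for q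
 proof -
 have i: "ind S x * (f q x * f q x) = f q x * f q x" for x
 proof (cases "f q x = 0")
  case False
  then have "x \<in> ball q (e / 2)" using near[of q x] by (simp add: dist_commute)
  then have "x \<in> S" using that by blast
  then show ?thesis by simp
 qed simp
 have "inner (restr S (f q)) (restr S (f q)) = (\<integral>x. f q x * f q x \<partial>lborel)" by (simp only: inner_restr_l2[OF sq sq op] i)
 moreover have "f q q = 1" by (simp add: f_def bump_def)
 ultimately show ?thesis using integral_C1c_pos[OF C1c_mult'(1)[OF C C], of q q q] by simp
 qed
 have "ball (p + h) (e / 2) \<subseteq> ball p e" "ball (p - h) (e / 2) \<subseteq> ball p e"
 by (rule ball_subset_ball_iff[THEN iffD2], simp add: dist_norm nh)+
 with pos e(2) have pos': "inner (restr S (f (p + h))) (restr S (f (p + h))) > 0" "inner (restr S (f (p - h))) (restr S (f (p - h))) > 0" by blast+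
 have z: "f (p + h) x * f (p - h) x = 0" for x
 proof (rule ccontr)
 assume "f (p + h) x * f (p - h) x ~= 0"
 then have "dist x (p + h) < e / 2" "dist x (p - h) < e / 2" using near by auto
 then have "dist (p + h) (p - h) < e" using dist_triangle2[of "p + h" "p - h" x] by (simp add: dist_commute)
 moreover have "dist (p + h) (p - h) = norm (2 *\<^sub>R h)" by (simp add: dist_norm scaleR_2)
 ultimately show False using e nh by simp
 qed
 have orth: "inner (restr S (f (p + h))) (restr S (f (p - h))) = 0"
 by (simp only: inner_restr_l2[OF sq sq op] z mult_zero_right) simp
 define g where "g q = restr S (f q) /\<^sub>R norm (restr S (f q))" for q
 have n: "inner (g (p + h)) (g (p + h)) = 1" "inner (g (p - h)) (g (p - h)) = 1"
 proof -
 have "inner (g q) (g q) = 1" if "inner (restr S (f q)) (restr S (f q)) > 0" for q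
 proof -
  have "norm (g q) = 1" using that by (auto simp: g_def)
  then show ?thesis by (simp add: power2_norm_eq_inner[symmetric])
 qed
 then show "inner (g (p + h)) (g (p + h)) = 1" "inner (g (p - h)) (g (p - h)) = 1" using pos' by blast+
 qed
 have o: "inner (g (p + h)) (g (p - h)) = 0" "inner (g (p - h)) (g (p + h)) = 0" using orth by (simp_all add: g_def inner_commute)
 have "g (p + h) ~= g (p - h)" using n(1) o(1) by auto
 moreover have "g q \<in> H1 S" for q unfolding g_def by (intro subspace_scale[OF subspace_H1] restr_l2_H1 C)
 ultimately show ?thesis using n o by (intro exI[of _ "{g (p + h), g (p - h)}"]) auto
qed

end

lemma (in robin) essentially_geI':
 assumes "finite F" "!!ph. ph \<in> C1c UNIV ==> (dirichlet S ph) - al * (\<integral>x. (ph x)^2 \<partial>sg)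
 >= M * (norm (restr S ph))^2 - C * (\<Sum>f\<in>F. (inner (restr S ph) f)^2)"
 shows "essentially_ge M F"
proof -
 have t: "test_form al ph ph = (dirichlet S ph) - al * (\<integral>x. (ph x)^2 \<partial>sg)" for ph
 by (simp only: test_form_def power2_norm_eq_inner) (simp only: power2_eq_square)
 show ?thesis by (rule essentially_geI[OF assms(1)]) (unfold t, rule assms(2))
qed

section \<open>Eigenvalues in the quadrangle\<close>

context half_angle
begin

lemma unfolded_test_quadrangle:
 assumes "r > 0" "ph \<in> C1c UNIV"
 shows "unfolded_test th (quadrangle th r) (side_measure th {0<..<r}) UNIV (slope * r) ph"
proof -
 interpret convex_domain "quadrangle th r" by (rule convex_domain_quadrangle[OF assms(1)])
 show ?thesis by unfold_locales (use assms slope(3) unfolds_quadrangle[OF assms(1)] in auto)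
qed

lemma robin_domain_quadrangle:
 assumes "r > 0"
 shows "robin_domain (quadrangle th r) (side_measure th {0<..<r})"
proof -
 interpret convex_domain "quadrangle th r" by (rule convex_domain_quadrangle[OF assms])
 note U = unfolded_test_quadrangle[OF assms]
 show ?thesis
 proof
 show "sets (side_measure th {0<..<r}) = sets borel" by (simp add: side_measure_def)
 show "integrable (side_measure th {0<..<r}) (%x. (ph x)^2)" if "ph \<in> C1c UNIV" for ph
  by (rule unfolded_test.trace_unf(1)[OF U[OF that]])
 show "\<exists>C\<ge>0. \<forall>ph\<in>C1c UNIV. (\<integral>x. (ph x)^2 \<partial>side_measure th {0<..<r})
  <= \<epsilon> * (dirichlet (quadrangle th r) ph) + C * (norm (restr (quadrangle th r) ph))^2" if "\<epsilon> > 0" for \<epsilon>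
  using unfolded_test.trace_bound_unf[OF U that] that assms slope(3)
  by (intro exI[of _ "2 * (1 / (slope * r) + 1 / \<epsilon>)"]) auto
 qed
qed

lemma quadrangle_tensor:
 assumes r: "r > 0" and f: "f \<in> bmeas" "!!x. \<bar>f x\<bar> <= B" and g: "g \<in> bmeas" "!!x. \<bar>g x\<bar> <= C"
 shows "sqint lborel (%x. ind (quadrangle th r) x * tensor f g x)"
proof -
 interpret convex_domain "quadrangle th r" by (rule convex_domain_quadrangle[OF r])
 note [measurable] = tensor_bounds(1)[OF f g]
 have [measurable]: "quadrangle th r \<in> sets borel" using op by simp
 have b: "\<exists>D. \<forall>x. \<bar>(tensor f g x)^2\<bar> <= D"
 using power_mono[OF tensor_bounds(2)[OF f g] abs_ge_zero, where n = 2] by (intro exI[of _ "(B * C)^2"]) simp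
 have m: "(%x. (tensor f g x)^2) \<in> bmeas" by measurable
 have "integrable lborel (%x. ind (quadrangle th r) x * (tensor f g x)^2)"
 by (rule conjunct1[OF unfolds_quadrangle[OF r, unfolded unfolds_def, rule_format, OF m b]]) simp
 moreover have "(%x. ind (quadrangle th r) x * (tensor f g x)^2) = (%x. (ind (quadrangle th r) x * tensor f g x)^2)"
 by (auto simp: indicator_def)
 moreover have "(%x. ind (quadrangle th r) x * tensor f g x) \<in> borel_measurable lborel"
 using tensor_bounds(1)[OF f g] op by (intro borel_measurable_times borel_measurable_indicator) auto
 ultimately show ?thesis unfolding square_integrable_def by simp
qed

text \<open>One half of the Dirichlet integral pays for the boundary term; the other half exceeds
  any multiple of the squared norm off the cell averages once the grid is fine enough.\<close>

lemma quadrangle_essentially_ge: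
 assumes r: "r > 0" and al: "al > 0"
 shows "\<exists>F C. finite F & (\<forall>ph\<in>C1c UNIV. (dirichlet (quadrangle th r) ph) - al * (\<integral>x. (ph x)^2 \<partial>side_measure th {0<..<r})
 >= M * (norm (restr (quadrangle th r) ph))^2 - C * (\<Sum>f\<in>F. (inner (restr (quadrangle th r) ph) f)^2))"
proof -
 let ?S = "quadrangle th r" and ?sg = "side_measure th {0<..<r}"
 interpret robin_domain ?S ?sg by (rule robin_domain_quadrangle[OF r])
 let ?G = "%ph. \<Sum>e\<in>Basis. (norm (restr ?S (pd ph e)))^2" and ?N = "%ph. (norm (restr ?S ph))^2"
 obtain D where D: "D >= 0" "!!ph. ph \<in> C1c UNIV ==> (\<integral>x. (ph x)^2 \<partial>?sg) <= 1 / (2 * al) * ?G ph + D * ?N ph"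
 using trace_bound[of "1 / (2 * al)"] al by auto
 define L where "L = slope * r"
 have L: "L > 0" using r slope(3) by (simp add: L_def)
 \<comment> \<open>Taking \<open>E >= 1\<close> gives \<open>1 / h >= 1\<close>, so that
   \<open>1 / h >= E\<close> already implies \<open>1 / h^2 >= E\<close>.\<close>
 define E where "E = max 1 (2 * (M + al * D))"
 obtain n :: nat where n: "L * E < real n" using reals_Archimedean2 by blast
 have n0: "n > 0" using n L by (metis E_def gr0I max.strict_coboundedI1 mult_pos_pos of_nat_0 order_less_asym zero_less_one)
 define h where "h = L / real n"
 have h: "h > 0" using L n0 by (simp add: h_def)
 have hE: "2 * (M + al * D) <= 1 / h^2"
 proof -
 have "E <= 1 / h" using n L n0 by (simp add: h_def field_simps)
 moreover from this have "1 <= 1 / h" by (simp add: E_def)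
 ultimately have "E * 1 <= (1 / h) * (1 / h)" using h by (intro mult_mono) auto
 then show ?thesis by (simp add: E_def power2_eq_square)
 qed
 define I :: "nat => real => real" where "I = (%i. ind {h * real i..h * real i + h})"
 have Ib: "I i \<in> bmeas" "\<bar>I i x\<bar> <= 1" for i x by (auto simp: I_def indicator_def)
 define F where "F = (%(i, j). restr ?S (tensor (I i) (I j))) ` ({..<n} \<times> {..<n})"
 have fin: "finite F" by (simp add: F_def)
 have "\<forall>ph\<in>C1c UNIV. ?G ph - al * (\<integral>x. (ph x)^2 \<partial>?sg) >= M * ?N ph - slope / h^2 * (real n)^2 / h^2 / 2 * (\<Sum>f\<in>F. (inner (restr ?S ph) f)^2)"
 proof
 fix ph :: "plane => real" assume ph: "ph \<in> C1c UNIV"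
 interpret unfolded_test th ?S ?sg UNIV L ph unfolding L_def by (rule unfolded_test_quadrangle[OF r ph])
 let ?s = "\<Sum>f\<in>F. (inner (restr ?S ph) f)^2"
 \<comment> \<open>\<open>F\<close> is a set, in which elements of different cells might coincide;
   each term is therefore bounded by the whole sum over \<open>F\<close>, at the price of
   \<open>n^2\<close>.\<close>
 have "(\<Sum>j<n. \<Sum>i<n. (inner (restr ?S ph) (restr ?S (tensor (I i) (I j))))^2) <= (\<Sum>j<n. \<Sum>i<n. ?s)"
 proof (intro sum_mono)
  fix i j assume "j \<in> {..<n}" "i \<in> {..<n}"
  then have "restr ?S (tensor (I i) (I j)) \<in> F" unfolding F_def by (intro image_eqI[of _ _ "(i, j)"]) auto
  then show "(inner (restr ?S ph) (restr ?S (tensor (I i) (I j))))^2 <= ?s"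
  using member_le_sum[of _ F "%f. (inner (restr ?S ph) f)^2"] fin by simp
 qed
 also have "... = (real n)^2 * ?s" by (simp add: power2_eq_square)
 finally have s: "(\<Sum>j<n. \<Sum>i<n. (inner (restr ?S ph) (restr ?S (tensor (I i) (I j))))^2) <= (real n)^2 * ?s" .
 have "?N ph <= h^2 * ?G ph + slope / h^2 * (\<Sum>j<n. \<Sum>i<n. (inner (restr ?S ph) (restr ?S (tensor (I i) (I j))))^2)"
  by (rule Poincare_grid[OF n0 h_def I_def quadrangle_tensor[OF r Ib Ib]])
 also have "... <= h^2 * ?G ph + slope / h^2 * ((real n)^2 * ?s)"
  using slope(3) by (intro add_left_mono mult_left_mono s) auto
 finally have "?N ph / h^2 <= (h^2 * ?G ph + slope / h^2 * ((real n)^2 * ?s)) / h^2" by (intro divide_right_mono) auto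
 also have "... = ?G ph + slope / h^2 * ((real n)^2 * ?s) / h^2" using h by (simp only: add_divide_distrib) simp
 finally have 1: "?N ph / h^2 - slope / h^2 * (real n)^2 / h^2 * ?s <= ?G ph" by simp
 have 2: "2 * (M + al * D) * ?N ph <= ?N ph / h^2" using mult_right_mono[OF hE, of "?N ph"] by simp
 have "al * (\<integral>x. (ph x)^2 \<partial>?sg) <= al * (1 / (2 * al) * ?G ph + D * ?N ph)"
  using al by (intro mult_left_mono D(2)[OF ph]) auto
 also have "... = ?G ph / 2 + al * D * ?N ph" using al by (simp add: distrib_left)
 finally have 3: "?G ph / 2 - al * D * ?N ph <= ?G ph - al * (\<integral>x. (ph x)^2 \<partial>?sg)" by simp
 show "?G ph - al * (\<integral>x. (ph x)^2 \<partial>?sg) >= M * ?N ph - slope / h^2 * (real n)^2 / h^2 / 2 * ?s"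
  using 1 2 3 by (simp add: algebra_simps)
 qed
 with fin show ?thesis by blast
qed

text \<open>The product bound with \<open>m = 1 / R^2\<close> for the square of side
  \<open>R = slope * r\<close> leaves one functional, hence speaks about the second eigenvalue. Half
  of \<open>1 / R^2\<close> is consumed by \<open>k^2 - al^2\<close>; the other half is the constant
  \<open>1 / (2 * slope^2)\<close>.\<close>

lemma quadrangle_second_eigenvalue:
 assumes al: "al > 0" and r: "r > 0" "al * (slope * r) >= 6"
 shows "\<exists>E \<ge> - al\<^sup>2 + 1 / (2 * slope^2) / r^2. nth_discrete_eigenvalue (L2_on (quadrangle th r)) (N_op th r al) 2 E"
proof -
 let ?S = "quadrangle th r" and ?sg = "side_measure th {0<..<r}"
 interpret robin_domain ?S ?sg by (rule robin_domain_quadrangle[OF r(1)])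
 obtain c where "robin ?S ?sg al c"
 using robin_form_coercive[OF al] al robin_domain_axioms unfolding robin_def robin_axioms_def by blast
 then interpret robin ?S ?sg al c .
 define R where "R = slope * r"
 have R: "R > 0" "al * R >= 6" using r slope(3) by (auto simp: R_def)
 obtain k where k: "k > 0" "k * sinh (k * R) = al * cosh (k * R)" "k^2 - al^2 <= 1 / (2 * R^2)"
 using exists_cosh_profile[OF al R(2)] by blast
 \<comment> \<open>The profile matters on \<open>[0, R]\<close> only; extended by constants it is
   bounded on the whole line, as product functions on the plane require.\<close>
 define clip where "clip = (%x. max 0 (min R x))"
 define u where "u = (%x. cosh (k * (x - R)) / cosh (k * R))"
 define u' where "u' = (%x. k * sinh (k * (x - R)) / cosh (k * R))"
 define w where "w = (%x. u (clip x))"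
 define w' where "w' = (%x. u' (clip x))"
 have clip: "clip x = x" if "x \<in> {0..R}" for x using that by (simp add: clip_def)
 have cu: "continuous_on UNIV u" "continuous_on UNIV u'" unfolding u_def u'_def by (intro continuous_intros; simp)+
 have d: "((%x. cosh (k * (x - R))) has_real_derivative k * sinh (k * (x - R))) (at x)"
 "((%x. k * sinh (k * (x - R))) has_real_derivative k\<^sup>2 * cosh (k * (x - R))) (at x)" for x
 by (auto intro!: derivative_eq_intros simp: power2_eq_square)
 have pu: "pw_diff 0 R u u'"
 by (rule pw_diff_smooth[OF _ cu(2)]) (unfold u_def u'_def, rule DERIV_cdivide[OF d(1)])
 have pu': "pw_diff 0 R u' (%x. k^2 * u x)"
 proof (rule pw_diff_smooth)
 show "(u' has_real_derivative k\<^sup>2 * u x) (at x)" for x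
  using DERIV_cdivide[OF d(2), of "cosh (k * R)" x] by (simp add: u_def u'_def)
 qed (intro continuous_intros cu)
 have cclip: "continuous_on UNIV clip" unfolding clip_def by (intro continuous_intros)
 have mw: "w \<in> bmeas" "w' \<in> bmeas"
 unfolding w_def w'_def by (rule borel_measurable_continuous_onI, rule continuous_on_compose2[OF cu(1) cclip], simp)
  (rule borel_measurable_continuous_onI, rule continuous_on_compose2[OF cu(2) cclip], simp)
 have pw: "pw_diff 0 R w w'"
 by (rule pw_diff_cong[OF pu _ _ mw]) (simp_all add: w_def w'_def clip)
 have pw': "pw_diff 0 R w' (%x. k^2 * w x)"
 by (rule pw_diff_cong[OF pu' _ _ mw(2)]) (use mw in \<open>simp_all add: w_def w'_def clip\<close>)
 obtain B where "\<forall>x\<in>{0..R}. \<bar>w x\<bar> <= B" using pw unfolding pw_diff_def by blast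
 moreover have "w (clip x) = w x" "clip x \<in> {0..R}" for x using R by (auto simp: w_def clip_def)
 ultimately have B: "\<bar>w x\<bar> <= B" for x by metis
 have w0: "w 0 = 1" "w' 0 = - al" "w' R = 0"
 using R k(2) cosh_real_pos[of "k * R"] by (simp_all add: w_def w'_def u_def u'_def clip_def field_simps del: cosh_real_pos)
 define N where "N = (\<integral>x. (w x)^2 \<partial>seg 0 R)"
 have N: "N > 0"
 proof -
 have "(\<integral>x. (1 / cosh (k * R))^2 \<partial>seg 0 R) <= N" unfolding N_def
 proof (rule integral_mono)
  show "integrable (seg 0 R) (%x. (1 / cosh (k * R))^2)" by (rule finite_measure.integrable_const[OF finite_measure_seg])
  show "integrable (seg 0 R) (%x. (w x)^2)" by (rule square_integrableD(2)[OF pw_diff_facts(3)[OF pw]])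
  show "(1 / cosh (k * R))^2 <= (w x)^2" for x
  unfolding w_def u_def by (intro power_mono divide_right_mono) (auto simp: cosh_real_ge_1)
 qed
 moreover have "(\<integral>x. (1 / cosh (k * R))^2 \<partial>seg 0 R) > 0" using R(1) by (simp add: zero_less_power)
 ultimately show ?thesis by simp
 qed
 note sq = quadrangle_tensor[OF r(1) mw(1) B mw(1) B]
 let ?\<Psi> = "restr ?S (tensor w w)"
 have ess: "essentially_ge (1 / R^2 - k^2) {?\<Psi>}"
 proof (rule essentially_geI')
 fix ph assume ph: "ph \<in> C1c UNIV"
 interpret unfolded_test th ?S ?sg UNIV R ph unfolding R_def by (rule unfolded_test_quadrangle[OF r(1) ph])
 have "(1 / R^2 - k^2) * (norm (restr ?S ph))^2 - (k^2 + 1 / R^2) * slope / N^2 * (inner (restr ?S ph) ?\<Psi>)^2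
  <= (dirichlet ?S ph) - al * (\<integral>x. (ph x)^2 \<partial>?sg)"
  by (rule robin_product_bound[OF pw pw' w0(1,2) _ _ _ _ N_def N B sq]) (use w0 in auto)
 then show "(dirichlet ?S ph) - al * (\<integral>x. (ph x)^2 \<partial>?sg) >= (1 / R^2 - k^2) * (norm (restr ?S ph))^2
  - (k^2 + 1 / R^2) * slope / N^2 * (\<Sum>f\<in>{?\<Psi>}. (inner (restr ?S ph) f)^2)" by simp
 qed simp
 obtain U where U: "finite U" "card U = 2" "U \<subseteq> H1 ?S" "\<forall>u\<in>U. \<forall>v\<in>U. inner u v = (if u = v then 1 else 0)"
 using exists_orthonormal_pair by blast
 have "\<exists>E \<ge> 1 / R^2 - k^2. nth_discrete_eigenvalue (L2_on ?S) graph 2 E"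
 proof (rule exists_nth_eigenvalue_ge[OF ess _ _ U])
 show "\<exists>F. essentially_ge M F" for M
  using quadrangle_essentially_ge[OF r(1) al, of M] by (elim exE conjE) (blast intro: essentially_geI')
 qed simp
 moreover have "- al\<^sup>2 + 1 / (2 * slope^2) / r^2 <= 1 / R^2 - k^2"
 proof -
 have "1 / (2 * slope^2) / r^2 = 1 / (2 * R^2)" by (simp add: R_def power_mult_distrib)
 moreover have "1 / R^2 = 1 / (2 * R^2) + 1 / (2 * R^2)" by simp
 ultimately show ?thesis using k(3) by linarith
 qed
 ultimately show ?thesis unfolding N_op_def robin_operator_eq by (meson order_trans)
qed

end

section \<open>The operator in the sector\<close>

lemma nn_integral_plane_product:
 fixes f g :: "real => ennreal"
 assumes [measurable]: "f \<in> bmeas" "g \<in> bmeas"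
 shows "(\<integral>\<^sup>+z. f (fst z) * g (snd z) \<partial>(lborel :: plane measure)) = (\<integral>\<^sup>+x. f x \<partial>lborel) * (\<integral>\<^sup>+y. g y \<partial>lborel)"
proof -
 have "(\<integral>\<^sup>+z. f (fst z) * g (snd z) \<partial>(lborel :: plane measure)) = (\<integral>\<^sup>+z. f (fst z) * g (snd z) \<partial>(lborel \<Otimes>\<^sub>M lborel))"
 by (simp add: lborel_prod)
 also have "... = (\<integral>\<^sup>+x. \<integral>\<^sup>+y. f x * g y \<partial>lborel \<partial>lborel)"
 by (subst lborel.nn_integral_fst[symmetric]) auto
 also have "... = (\<integral>\<^sup>+x. f x * (\<integral>\<^sup>+y. g y \<partial>lborel) \<partial>lborel)" by (intro nn_integral_cong nn_integral_cmult) simp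
 also have "... = (\<integral>\<^sup>+x. f x \<partial>lborel) * (\<integral>\<^sup>+y. g y \<partial>lborel)" by (rule nn_integral_multc) simp
 finally show ?thesis .
qed

lemma nn_integral_exp_half_line:
 assumes "\<beta> > 0"
 shows "(\<integral>\<^sup>+x. ennreal (exp (- \<beta> * x)) * ind {0..} x \<partial>lborel) = ennreal (1 / \<beta>)"
proof -
 have "(\<integral>\<^sup>+x. ennreal (exp (- \<beta> * x)) * ind {0..} x \<partial>lborel) = ennreal (0 - (- exp (- \<beta> * 0) / \<beta>))"
 proof (rule nn_integral_FTC_atLeast)
 show "((%x. - exp (- \<beta> * x) / \<beta>) has_real_derivative exp (- \<beta> * x)) (at x)" for x
  using assms by (auto intro!: derivative_eq_intros)
 have "((%x. exp (- (\<beta> * x))) \<longlongrightarrow> 0) at_top"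
  by (rule filterlim_compose[OF exp_at_bot], unfold filterlim_uminus_at_bot minus_minus)
  (rule filterlim_tendsto_pos_mult_at_top[OF tendsto_const assms filterlim_ident])
 then show "((%x. - exp (- \<beta> * x) / \<beta>) \<longlongrightarrow> 0) at_top" using tendsto_divide[OF tendsto_minus tendsto_const, of "%x. exp (- (\<beta> * x))" 0 at_top \<beta>] assms by simp
 qed auto
 then show ?thesis by simp
qed

context half_angle
begin

lemma sector_integrable:
 fixes G :: "plane => real"
 assumes G: "G \<in> bmeas" and \<beta>: "\<beta> > 0"
 and le: "!!x y. 0 < x ==> 0 < y ==> \<bar>G (unf (x, y))\<bar> <= exp (- \<beta> * x) * exp (- \<beta> * y)"
 shows "integrable lborel (%x. ind (sector th) x * G x)"
proof -
 interpret convex_domain "sector th" by (rule convex_domain_sector)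
 have m [measurable]: "(%x. ind (sector th) x * G x) \<in> bmeas"
 using op G by (intro borel_measurable_times borel_measurable_indicator) auto
 let ?e = "%x. ennreal (exp (- \<beta> * x)) * ind {0..} x"
 have "(\<integral>\<^sup>+x. ennreal (norm (ind (sector th) x * G x)) \<partial>lborel)
  = ennreal (1 / slope) * (\<integral>\<^sup>+z. ennreal (norm (ind (sector th) (unf z) * G (unf z))) \<partial>lborel)"
 by (rule nn_integral_unf) measurable
 also have "(\<integral>\<^sup>+z. ennreal (norm (ind (sector th) (unf z) * G (unf z))) \<partial>lborel) <= (\<integral>\<^sup>+z. ?e (fst z) * ?e (snd z) \<partial>lborel)"
 proof (rule nn_integral_mono)
 fix z :: plane
 obtain x y where z: "z = (x, y)" by force
 show "ennreal (norm (ind (sector th) (unf z) * G (unf z))) <= ?e (fst z) * ?e (snd z)"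
 proof (cases "0 < x & 0 < y")
  case True
  then show ?thesis using le[of x y] by (simp add: z unf_sector indicator_def ennreal_mult[symmetric] ennreal_leI)
 next
  case False
  then have "unf z \<notin> sector th" unfolding z unf_sector .
  then show ?thesis by simp
 qed
 qed
 also have "(\<integral>\<^sup>+z. ?e (fst z) * ?e (snd z) \<partial>(lborel :: plane measure)) = ennreal (1 / \<beta>) * ennreal (1 / \<beta>)"
 by (subst nn_integral_plane_product) (simp_all add: nn_integral_exp_half_line[OF \<beta>, simplified])
 finally have "(\<integral>\<^sup>+x. ennreal (norm (ind (sector th) x * G x)) \<partial>lborel) <= ennreal (1 / slope) * (ennreal (1 / \<beta>) * ennreal (1 / \<beta>))"
 by (simp add: mult_left_mono)
 also have "... < \<infinity>" by (simp add: ennreal_mult_less_top)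
 finally show ?thesis unfolding integrable_iff_bounded using m by simp
qed

text \<open>Tonelli in orthonormal coordinates along the upper side and across it.\<close>

lemma strip_integral:
 fixes f g :: "real => real"
 assumes f: "f \<in> bmeas" "!!x. 0 <= f x" and g: "g \<in> bmeas" "!!x. 0 <= g x"
 shows "(\<integral>\<^sup>+p. ennreal (f (fst p * co + snd p * si) * g (fst p * si - snd p * co)) \<partial>lborel)
 = (\<integral>\<^sup>+x. ennreal (f x) \<partial>lborel) * (\<integral>\<^sup>+x. ennreal (g x) \<partial>lborel)"
proof -
 have [measurable]: "(%p :: plane. fst p * co + snd p * si) \<in> bmeas" "(%p :: plane. fst p * si - snd p * co) \<in> bmeas"
 by (intro borel_measurable_continuous_onI continuous_intros)+
 note [measurable] = f(1) g(1)
 let ?F = "%p :: plane. ennreal (f (fst p * co + snd p * si) * g (fst p * si - snd p * co))"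
 have d: "co * (- co) - si * si = - 1" using sq1 by linarith
 have m: "?F \<in> bmeas" by measurable
 have r: "(co * s + si * t) * co + (si * s + - co * t) * si = s"
 "(co * s + si * t) * si - (si * s + - co * t) * co = t" for s t
 proof -
 have "(co * s + si * t) * co + (si * s + - co * t) * si = s * (si * si + co * co)"
  "(co * s + si * t) * si - (si * s + - co * t) * co = t * (si * si + co * co)"
  by (algebra, algebra)
 then show "(co * s + si * t) * co + (si * s + - co * t) * si = s"
  "(co * s + si * t) * si - (si * s + - co * t) * co = t" by (simp_all only: sq1 mult_1_right)
 qed
 have "(\<integral>\<^sup>+p. ?F p \<partial>lborel) = (\<integral>\<^sup>+z. ?F (co * fst z + si * snd z, si * fst z + (- co) * snd z) \<partial>lborel)"
 by (subst nn_integral_plane_linear[OF m, of "co" "- co" "si" "si"]) (use cos_pos d in simp_all)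
 also have "... = (\<integral>\<^sup>+z. ennreal (f (fst z)) * ennreal (g (snd z)) \<partial>lborel)"
 by (simp only: fst_conv snd_conv r ennreal_mult[OF f(2) g(2)])
 also have "... = (\<integral>\<^sup>+x. ennreal (f x) \<partial>lborel) * (\<integral>\<^sup>+x. ennreal (g x) \<partial>lborel)"
 by (rule nn_integral_plane_product) measurable
 finally show ?thesis .
qed

text \<open>The square is taken beyond the support, so the function vanishes on the two far sides
  and no boundary terms arise there. The condition \<open>L >= 1\<close> keeps constants that
  involve \<open>1 / L\<close> uniform over all test functions.\<close>

lemma unfolded_test_sector:
 assumes ph: "ph \<in> C1c UNIV"
 shows "\<exists>K L. L >= 1 & unfolded_test th (sector th) (side_measure th {0<..}) K L ph & (\<forall>x. ph (unf (L, x)) = 0 & ph (unf (x, L)) = 0)"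
proof -
 interpret convex_domain "sector th" by (rule convex_domain_sector)
 obtain K where K: "compact K" "K \<subseteq> UNIV" "!!x. x \<notin> K ==> ph x = 0" "!!x e. x \<notin> K ==> pd ph e x = 0"
 using C1c_support[OF ph] by blast
 obtain rh where rh: "rh > 0" "K \<subseteq> cball 0 rh"
 using compact_imp_bounded[OF K(1)] unfolding bounded_pos by (auto simp: subset_iff)
 define L where "L = slope * rh + 1"
 have L: "L >= 1" "L >= slope * rh" using slope(3) rh(1) by (auto simp: L_def)
 have n: "L / slope > rh" using slope(3) by (simp add: L_def field_simps)
 have off: "unf (L, x) \<notin> K" "unf (x, L) \<notin> K" for x
 proof -
 have "L / slope <= max L x / slope" "L / slope <= max x L / slope" using slope(3) by (intro divide_right_mono; simp)+
 then have "rh < norm (unf (L, x))" "rh < norm (unf (x, L))" using unf_norm[of L x] unf_norm[of x L] n by linarith+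
 then show "unf (L, x) \<notin> K" "unf (x, L) \<notin> K" using rh(2) by force+
 qed
 have "unfolded_test th (sector th) (side_measure th {0<..}) (cball 0 rh) L ph"
 proof unfold_locales
 show "unfolds (sector th) (side_measure th {0<..}) (cball 0 rh) L" by (rule unfolds_sector[OF rh(1) L(2)])
 show "ph x = 0" if "x \<notin> cball 0 rh" for x using K(3) that rh(2) by blast
 show "pd ph e x = 0" if "x \<notin> cball 0 rh" for x e using K(4) that rh(2) by blast
 qed (use L ph in auto)
 then show ?thesis using L(1) off K(3) by blast
qed

lemma robin_domain_sector: "robin_domain (sector th) (side_measure th {0<..})"
proof -
 interpret convex_domain "sector th" by (rule convex_domain_sector)
 show ?thesis
 proof
 show "sets (side_measure th {0<..}) = sets borel" by (simp add: side_measure_def)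
 show "integrable (side_measure th {0<..}) (%x. (ph x)^2)" if "ph \<in> C1c UNIV" for ph
  using unfolded_test_sector[OF that] unfolded_test.trace_unf(1) by blast
 show "\<exists>C\<ge>0. \<forall>ph\<in>C1c UNIV. (\<integral>x. (ph x)^2 \<partial>side_measure th {0<..})
  <= \<epsilon> * (dirichlet (sector th) ph) + C * (norm (restr (sector th) ph))^2" if e: "\<epsilon> > 0" for \<epsilon>
 \<comment> \<open>The side \<open>L\<close> depends on the test function, but the constant may not;
   \<open>1 / L <= 1\<close> removes it.\<close>
 proof (intro exI[of _ "2 * (1 + 1 / \<epsilon>)"] conjI ballI)
  fix ph :: "plane => real" assume "ph \<in> C1c UNIV"
  then obtain K L where L: "L >= 1" and U: "unfolded_test th (sector th) (side_measure th {0<..}) K L ph"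
  using unfolded_test_sector by blast
  have "2 * (1 / L + 1 / \<epsilon>) * (norm (restr (sector th) ph))^2 <= 2 * (1 + 1 / \<epsilon>) * (norm (restr (sector th) ph))^2"
  using L by (intro mult_right_mono mult_left_mono add_right_mono) auto
  then show "(\<integral>x. (ph x)^2 \<partial>side_measure th {0<..})
  <= \<epsilon> * (dirichlet (sector th) ph) + 2 * (1 + 1 / \<epsilon>) * (norm (restr (sector th) ph))^2"
  using unfolded_test.trace_bound_unf[OF U e] by linarith
 qed (use e in auto)
 qed
qed

end

section \<open>Divergence identities in the sector\<close>

context unfolded_test
begin

lemma slice_integrals:
 assumes "!!x. ph (unf (L, x)) = 0 & ph (unf (x, L)) = 0"
 shows "(\<integral>y. \<integral>x. vx (x, y) \<partial>seg 0 L \<partial>seg 0 L) = - (\<integral>y. ph (unf (0, y)) \<partial>seg 0 L)"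
 "(\<integral>y. \<integral>x. vy (x, y) \<partial>seg 0 L \<partial>seg 0 L) = - (\<integral>x. ph (unf (x, 0)) \<partial>seg 0 L)"
 "(\<integral>y. \<integral>x. a * vx (x, y) + b * vy (x, y) \<partial>seg 0 L \<partial>seg 0 L) = - a * (\<integral>y. ph (unf (0, y)) \<partial>seg 0 L) - b * (\<integral>x. ph (unf (x, 0)) \<partial>seg 0 L)"
proof -
 obtain C where C: "\<forall>z. \<bar>ph (unf z)\<bar> <= C & \<bar>vx z\<bar> <= C & \<bar>vy z\<bar> <= C" using bound_v by blast
 have bx: "\<bar>vx z\<bar> <= C" and bz: "\<bar>vy z\<bar> <= C" for z using C by blast+
 have bab: "\<bar>a * vx z + b * vy z\<bar> <= \<bar>a\<bar> * C + \<bar>b\<bar> * C" for z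
 by (rule order_trans[OF abs_triangle_ineq]) (unfold abs_mult, intro add_mono mult_left_mono bx bz abs_ge_zero)
 have mab: "(%z. a * vx z + b * vy z) \<in> bmeas" by measurable
 have L0: "0 <= L" using L by simp
 show 1: "(\<integral>y. \<integral>x. vx (x, y) \<partial>seg 0 L \<partial>seg 0 L) = - (\<integral>y. ph (unf (0, y)) \<partial>seg 0 L)"
 using pw_diff_FTC_full[OF slices(1) L0] assms by simp
 have "(\<integral>x. \<integral>y. vy (x, y) \<partial>seg 0 L \<partial>seg 0 L) = - (\<integral>x. ph (unf (x, 0)) \<partial>seg 0 L)"
 using pw_diff_FTC_full[OF slices(2) L0] assms by simp
 then show 2: "(\<integral>y. \<integral>x. vy (x, y) \<partial>seg 0 L \<partial>seg 0 L) = - (\<integral>x. ph (unf (x, 0)) \<partial>seg 0 L)"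
 using seg_seg_Fubini(2,3)[OF measurable_v(3) bz] by simp
 have "(\<integral>y. \<integral>x. a * vx (x, y) + b * vy (x, y) \<partial>seg 0 L \<partial>seg 0 L)
  = a * (\<integral>y. \<integral>x. vx (x, y) \<partial>seg 0 L \<partial>seg 0 L) + b * (\<integral>y. \<integral>x. vy (x, y) \<partial>seg 0 L \<partial>seg 0 L)"
 unfolding seg_seg_Fubini(2)[OF mab bab] seg_seg_Fubini(2)[OF measurable_v(2) bx] seg_seg_Fubini(2)[OF measurable_v(3) bz]
 using seg_seg_Fubini(1)[OF measurable_v(2) bx] seg_seg_Fubini(1)[OF measurable_v(3) bz] by simp
 then show "(\<integral>y. \<integral>x. a * vx (x, y) + b * vy (x, y) \<partial>seg 0 L \<partial>seg 0 L) = - a * (\<integral>y. ph (unf (0, y)) \<partial>seg 0 L) - b * (\<integral>x. ph (unf (x, 0)) \<partial>seg 0 L)"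
 unfolding 1 2 by simp
qed

lemma integral_pd_unf:
 assumes "!!x. ph (unf (L, x)) = 0 & ph (unf (x, L)) = 0" and e: "!!z. pd ph e (unf z) = a * vx z + b * vy z"
 shows "(\<integral>x. ind S x * pd ph e x \<partial>lborel) = (- a * (\<integral>y. ph (unf (0, y)) \<partial>seg 0 L) - b * (\<integral>x. ph (unf (x, 0)) \<partial>seg 0 L)) / slope"
proof -
 have "(\<integral>x. ind S x * pd ph e x \<partial>lborel) = 1 / slope * (\<integral>y. \<integral>x. pd ph e (unf (x, y)) \<partial>seg 0 L \<partial>seg 0 L)"
 by (rule conjunct1[OF conjunct2[OF conjunct2[OF U[unfolded unfolds_def, rule_format, OF C1c_measurable(2)[OF C1] C1c_bounded(2)[OF C1] K(2)]]]])
 then show ?thesis unfolding e slice_integrals(3)[OF assms(1)] by simp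
qed

lemma integral_sides:
 "(\<integral>x. ph x \<partial>sg) = ((\<integral>x. ph (unf (x, 0)) \<partial>seg 0 L) + (\<integral>y. ph (unf (0, y)) \<partial>seg 0 L)) / slope"
 using conjunct2[OF conjunct2[OF conjunct2[OF U[unfolded unfolds_def, rule_format, OF C1c_measurable(1)[OF C1] C1c_bounded(1)[OF C1] K(1)]]]] by simp

text \<open>The divergence theorem along the axis: the outer unit normals of both sides have the
  same horizontal component \<open>- si\<close>. In unfolded coordinates it is the fundamental
  theorem on slices.\<close>

lemma divergence_axis:
 assumes "!!x. ph (unf (L, x)) = 0 & ph (unf (x, L)) = 0"
 shows "(\<integral>x. ind S x * pd ph (1, 0) x \<partial>lborel) = - si * (\<integral>x. ph x \<partial>sg)"
proof -
 have "pd ph (1, 0) (unf z) = si * vx z + si * vy z" for z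
 proof -
 define a where "a = pd ph (1, 0) (unf z)"
 define b where "b = pd ph (0, 1) (unf z)"
 have pl: "pd ph (c, d) (unf z) = c * a + d * b" for c d
  unfolding a_def b_def by (rule pd_plane[OF C1])
 have s: "si * (t / slope) = co * t" for t using slope(5) by (metis times_divide_eq_left times_divide_eq_right)
 have r: "co * (co * a + si * b) + si * (si * a - co * b) = a * (si * si + co * co)"
  "si * (si * a + co * b) + co * (co * a - si * b) = a * (si * si + co * co)"
  by (simp_all only: algebra_simps)
 have "vx z = (co * a + si * b) / slope & vy z = si * a - co * b \<or>
  vx z = si * a + co * b & vy z = (co * a - si * b) / slope"
  by (simp add: vx_def vy_def pl)
 then show ?thesis unfolding a_def[symmetric] using r unfolding sq1 by (elim disjE conjE) (simp_all only: s mult_1_right)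
 qed
 from integral_pd_unf[OF assms this] show ?thesis unfolding integral_sides by (simp add: algebra_simps add_divide_distrib diff_divide_distrib)
qed

text \<open>For functions living in the upper half-plane only the upper side counts; the first
  direction is tangential to it, the second is its inner normal.\<close>

lemma divergence_side:
 assumes z: "!!x. ph (unf (L, x)) = 0 & ph (unf (x, L)) = 0"
 and up: "!!p e. snd p <= 0 ==> ph p = 0 & pd ph e p = 0"
 shows "(\<integral>x. ind S x * pd ph (co, si) x \<partial>lborel) = 0"
 "(\<integral>x. ind S x * pd ph (si, - co) x \<partial>lborel) = - (\<integral>x. ph x \<partial>sg)"
proof -
 have sn: "snd (unf z) <= 0" if "fst z <= snd z" for z using that cos_pos by (simp add: unf_def mult_nonpos_nonneg)
 have e: "pd ph (co, si) (unf z) = slope * vx z + 0 * vy z" "pd ph (si, - co) (unf z) = 0 * vx z + 1 * vy z" for z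
 using up[OF sn, of z] slope(3) by (auto simp: vx_def vy_def)
 have "(\<integral>y. ph (unf (0, y)) \<partial>seg 0 L) = (\<integral>y. 0 \<partial>seg 0 L)"
 by (rule Bochner_Integration.integral_cong[OF refl]) (use up[OF sn] in auto)
 then have 0: "(\<integral>y. ph (unf (0, y)) \<partial>seg 0 L) = 0" by simp
 show "(\<integral>x. ind S x * pd ph (co, si) x \<partial>lborel) = 0"
 unfolding integral_pd_unf[OF z e(1)] 0 by simp
 show "(\<integral>x. ind S x * pd ph (si, - co) x \<partial>lborel) = - (\<integral>x. ph x \<partial>sg)"
 unfolding integral_pd_unf[OF z e(2)] integral_sides 0 by simp
qed

end

lemma (in convex_domain) norm_restr_eq:
 "sqint lborel f ==> (norm (restr S f))^2 = (\<integral>x. ind S x * (f x)^2 \<partial>lborel)"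
 unfolding power2_norm_eq_inner by (subst inner_restr_l2[OF _ _ op]) (simp_all add: power2_eq_square)

lemma (in convex_domain) integrable_restr:
 "sqint lborel f ==> sqint lborel g ==> integrable lborel (%x. ind S x * (f x * g x))"
 using square_integrable_mult_integrable[OF square_integrable_restr[OF _ op], of f g]
 by (simp only: mult.assoc)

context half_angle
begin

text \<open>The case \<open>m = 0\<close>, \<open>k = al\<close> of the product bound with profile
  \<open>exp (- al * x)\<close>. This profile decays, so one square integrable product serves all
  test functions; the condition at \<open>L\<close> holds because the test function vanishes
  there.\<close>

lemma sector_essentially_ge:
 assumes al: "al > 0"
 shows "\<exists>\<Psi> C. \<forall>ph\<in>C1c UNIV. (dirichlet (sector th) ph) - al * (\<integral>x. (ph x)^2 \<partial>side_measure th {0<..})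
 >= - al\<^sup>2 * (norm (restr (sector th) ph))^2 - C * (inner (restr (sector th) ph) \<Psi>)^2"
proof -
 let ?S = "sector th" and ?sg = "side_measure th {0<..}"
 interpret convex_domain ?S by (rule convex_domain_sector)
 define w :: "real => real" where "w x = exp (- al * max 0 x)" for x
 define w' where "w' x = - al * w x" for x
 have cw: "continuous_on UNIV w" unfolding w_def[abs_def] by (intro continuous_intros)
 have cw': "continuous_on UNIV w'" unfolding w'_def[abs_def] by (intro continuous_intros cw)
 note mw = borel_measurable_continuous_onI[OF cw] and mw' = borel_measurable_continuous_onI[OF cw']
 have pe: "pw_diff 0 L (%x. exp (- al * x)) (%x. - al * exp (- al * x))" for L
 by (rule pw_diff_smooth) (auto intro!: derivative_eq_intros continuous_intros)
 have pe': "pw_diff 0 L (%x. - al * exp (- al * x)) (%x. al^2 * exp (- al * x))" for L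
 by (rule pw_diff_smooth) (auto intro!: derivative_eq_intros continuous_intros simp: power2_eq_square)
 have pw: "pw_diff 0 L w w'" for L
 by (rule pw_diff_cong[OF pe _ _ mw mw']) (auto simp: w_def w'_def max_def)
 have pw': "pw_diff 0 L w' (%x. al^2 * w x)" for L
 by (rule pw_diff_cong[OF pe' _ _ mw']) (use mw in \<open>auto simp: w_def w'_def max_def\<close>)
 have B: "\<bar>w x\<bar> <= 1" for x using al by (simp add: w_def)
 have sq: "sqint lborel (%x. ind ?S x * tensor w w x)"
 proof -
 note tb = tensor_bounds[OF mw B mw B]
 have "integrable lborel (%x. ind ?S x * (tensor w w x)^2)"
 proof (rule sector_integrable)
  show "(%x. (tensor w w x)^2) \<in> bmeas" using tb(1) by measurable
  show "\<bar>(tensor w w (unf (x, y)))^2\<bar> <= exp (- (2 * al) * x) * exp (- (2 * al) * y)" if "0 < x" "0 < y" for x y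
  using that by (simp add: tensor_def refold_unf w_def power_mult_distrib exp_double[symmetric] mult.assoc[symmetric])
 qed (use al in simp)
 moreover have "(%x. ind ?S x * (tensor w w x)^2) = (%x. (ind ?S x * tensor w w x)^2)"
  by (auto simp: indicator_def)
 moreover have "(%x. ind ?S x * tensor w w x) \<in> borel_measurable lborel"
  using tb(1) op by (intro borel_measurable_times borel_measurable_indicator) auto
 ultimately show ?thesis unfolding square_integrable_def by simp
 qed
 \<comment> \<open>A lower bound for the squared norm of \<open>w\<close> on \<open>[0, 1]\<close>,
   hence on every \<open>[0, L]\<close> with \<open>L >= 1\<close>, so that the constant
   \<open>C\<close> does not depend on the test function.\<close>
 define n0 where "n0 = (exp (- al))^2"
 have n0: "n0 > 0" by (simp add: n0_def)
 have N: "n0 <= (\<integral>x. (w x)^2 \<partial>seg 0 L)" if "L >= 1" for L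
 proof -
 have i: "integrable (seg 0 L) (%x. (w x)^2)" by (rule square_integrableD(2)[OF pw_diff_facts(3)[OF pw]])
 have s: "integrable (seg 0 1) (%x. (w x)^2)" "(\<integral>x. (w x)^2 \<partial>seg 0 L) = (\<integral>x. (w x)^2 \<partial>seg 0 1) + (\<integral>x. (w x)^2 \<partial>seg 1 L)"
  by (rule seg_split[OF _ that i], simp)+
 have "(\<integral>x. n0 \<partial>seg 0 1) <= (\<integral>x. (w x)^2 \<partial>seg 0 1)"
 proof (rule integral_mono[OF finite_measure.integrable_const[OF finite_measure_seg] s(1)])
  fix x :: real assume "x \<in> space (seg 0 1)"
  then show "n0 <= (w x)^2" using al unfolding n0_def w_def by (intro power_mono) (auto simp: max_def)
 qed
 then have "n0 <= (\<integral>x. (w x)^2 \<partial>seg 0 1)" by simp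
 moreover have "0 <= (\<integral>x. (w x)^2 \<partial>seg 1 L)" by simp
 ultimately have "n0 <= (\<integral>x. (w x)^2 \<partial>seg 0 1) + (\<integral>x. (w x)^2 \<partial>seg 1 L)" by linarith
 then show ?thesis unfolding s(2) .
 qed
 let ?\<Psi> = "restr ?S (tensor w w)"
 have "- al\<^sup>2 * (norm (restr ?S ph))^2 - al^2 * slope / n0^2 * (inner (restr ?S ph) ?\<Psi>)^2
 <= (dirichlet ?S ph) - al * (\<integral>x. (ph x)^2 \<partial>?sg)" if ph: "ph \<in> C1c UNIV" for ph
 proof -
 obtain K L where L: "L >= 1" and U: "unfolded_test th ?S ?sg K L ph" and z: "!!x. ph (unf (L, x)) = 0 & ph (unf (x, L)) = 0"
  using unfolded_test_sector[OF ph] by blast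
 let ?N = "\<integral>x. (w x)^2 \<partial>seg 0 L"
 have N0: "0 < ?N" using N[OF L] n0 by linarith
 have "(0 - al^2) * (norm (restr ?S ph))^2 - (al^2 + 0) * slope / ?N^2 * (inner (restr ?S ph) ?\<Psi>)^2
  <= (dirichlet ?S ph) - al * (\<integral>x. (ph x)^2 \<partial>?sg)"
  by (rule unfolded_test.robin_product_bound[OF U pw pw' _ _ _ _ _ _ refl N0 B sq])
  (use al z in \<open>auto simp: w_def w'_def mult_nonneg_nonpos\<close>)
 moreover have "al^2 * slope / ?N^2 * (inner (restr ?S ph) ?\<Psi>)^2 <= al^2 * slope / n0^2 * (inner (restr ?S ph) ?\<Psi>)^2"
  using N[OF L] n0 N0 slope(3) by (intro mult_right_mono divide_left_mono power_mono mult_pos_pos) auto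
 ultimately show ?thesis by simp
 qed
 then show ?thesis by blast
qed

text \<open>With \<open>c = al / si\<close> the function \<open>exp (- c * x1)\<close> satisfies the
  Robin condition and has energy level \<open>- c^2\<close>, strictly below \<open>- al^2\<close>
  because \<open>si < 1\<close>. Truncation at scale \<open>R\<close> costs only
  \<open>O(1 / R^2)\<close>.\<close>

lemma sector_trial:
 assumes al: "al > 0"
 shows "\<exists>ph\<in>C1c UNIV. (dirichlet (sector th) ph) - al * (\<integral>x. (ph x)^2 \<partial>side_measure th {0<..})
 < - al\<^sup>2 * (norm (restr (sector th) ph))^2"
proof -
 let ?S = "sector th" and ?sg = "side_measure th {0<..}"
 interpret convex_domain ?S by (rule convex_domain_sector)
 define c where "c = al / si"
 have c: "c > 0" "c * si = al" using al sin_pos by (auto simp: c_def)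
 define ps :: "plane => real" where "ps p = exp (- c * fst p)" for p
 have dps: "(ps has_derivative (%e. - c * fst e * ps p)) (at p)" for p
 unfolding ps_def[abs_def] by (auto intro!: derivative_eq_intros)
 have cps: "continuous_on UNIV (%p. - c * fst e * ps p)" "continuous_on UNIV ps" for e :: plane
 unfolding ps_def[abs_def] by (intro continuous_intros)+
 have mps: "ps \<in> bmeas" by (rule borel_measurable_continuous_onI[OF cps(2)])
 have ips: "integrable lborel (%x. ind ?S x * (ps x)^2)"
 proof (rule sector_integrable)
 show "(%x. (ps x)^2) \<in> bmeas" using mps by measurable
 \<comment> \<open>The rate comes from \<open>fst (unf (x, y)) >= co^2 * (x + y)\<close>, which uses
   \<open>co <= si <= 1\<close>.\<close>
 show "2 * c * (co * co) > 0" using c cos_pos by simp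
 fix x y :: real assume xy: "0 < x" "0 < y"
 have "co <= si" using slope(2,4) cos_pos mult_right_mono[OF slope(2), of "co"] by simp
 then have ss: "co * co <= si * si" using cos_pos by (intro mult_mono) auto
 have "(co * co) * (max x y + min x y) <= max x y * (co * co) + min x y * (si * si)"
  using mult_left_mono[OF ss, of "min x y"] xy by (simp add: distrib_left mult.commute)
 moreover have "max x y + min x y = x + y" by (simp add: max_def min_def)
 ultimately have 1: "(co * co) * (x + y) <= fst (unf (x, y)) * si" unfolding fst_unf_sin by simp
 moreover have "0 <= (co * co) * (x + y)" using xy by simp
 ultimately have "0 <= fst (unf (x, y)) * si" by linarith
 then have "0 <= fst (unf (x, y))" using sin_pos by (simp add: zero_le_mult_iff)
 then have "fst (unf (x, y)) * si <= fst (unf (x, y)) * 1" by (intro mult_left_mono) auto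
 with 1 have "(co * co) * (x + y) <= fst (unf (x, y))" by linarith
 then have "2 * c * ((co * co) * (x + y)) <= 2 * c * fst (unf (x, y))" using c by (intro mult_left_mono) auto
 then have "- (2 * c * fst (unf (x, y))) <= - (2 * c * (co * co)) * x + - (2 * c * (co * co)) * y" by (simp add: algebra_simps)
 then show "\<bar>(ps (unf (x, y)))^2\<bar> <= exp (- (2 * c * (co * co)) * x) * exp (- (2 * c * (co * co)) * y)"
  by (simp only: exp_add[symmetric] ps_def) (simp add: exp_double[symmetric] mult.assoc)
 qed
 define b where "b R = (%x. bump ((1 / R) *\<^sub>R (x - 0)))" for R :: real
 define ph where "ph R = (%x. ps x * b R x)" for R
 have Cph: "ph R \<in> C1c UNIV" and pdph: "pd (ph R) e x = - c * fst e * ps x * b R x + ps x * pd (b R) e x"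
 and pdb: "\<bar>pd (b R) e x\<bar> <= 4 * (1 / R) * norm e" if R: "R > 0" for R e x
 proof -
 have Cb: "b R \<in> C1c UNIV" unfolding b_def by (rule bump_affine_C1c) (use R in auto)
 show "ph R \<in> C1c UNIV" unfolding ph_def by (rule C1c_mult(1)[OF dps cps(1) Cb])
 show "pd (ph R) e x = - c * fst e * ps x * b R x + ps x * pd (b R) e x" unfolding ph_def by (rule C1c_mult(2)[OF dps cps(1) Cb])
 show "\<bar>pd (b R) e x\<bar> <= 4 * (1 / R) * norm e" using bump_pd_bound[of "1 / R" 0 x e] R unfolding b_def by simp
 qed
 define I where "I = (\<integral>x. ind ?S x * (ps x)^2 \<partial>lborel)"
 have form: "(dirichlet ?S (ph R)) - al * (\<integral>x. (ph R x)^2 \<partial>?sg)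
  <= - c\<^sup>2 * (norm (restr ?S (ph R)))^2 + 32 / R^2 * I" if R: "R > 0" for R
 proof -
 note C = Cph[OF R]
 note sq = C1c_square_integrable[OF C]
 note CF = C1c_mult'[OF C C]
 let ?p = "%e x. pd (ph R) e x"
 have "\<exists>K L. L >= 1 & unfolded_test th ?S ?sg K L (%x. ph R x * ph R x) & (\<forall>x. ph R (unf (L, x)) * ph R (unf (L, x)) = 0 & ph R (unf (x, L)) * ph R (unf (x, L)) = 0)"
  by (rule unfolded_test_sector[OF CF(1)])
 then obtain K L where U: "unfolded_test th ?S ?sg K L (%x. ph R x * ph R x)"
  and z: "!!x. ph R (unf (L, x)) * ph R (unf (L, x)) = 0 & ph R (unf (x, L)) * ph R (unf (x, L)) = 0" by blast
 \<comment> \<open>The divergence identity for the square of the trial function converts its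
   boundary integral into a volume integral.\<close>
 have dv: "(\<integral>x. ind ?S x * (?p (1, 0) x * ph R x + ph R x * ?p (1, 0) x) \<partial>lborel) = - si * (\<integral>x. (ph R x)^2 \<partial>?sg)"
  using unfolded_test.divergence_axis[OF U z] unfolding CF(2) by (simp only: power2_eq_square)
 note i1 = integrable_restr[OF sq(2) sq(2), of "(1, 0)" "(1, 0)"] and i2 = integrable_restr[OF sq(2) sq(2), of "(0, 1)" "(0, 1)"]
  and i3 = integrable_restr[OF sq(2) sq(1), of "(1, 0)"] and i4 = integrable_restr[OF sq(1) sq(1)]
 have T: "al * (\<integral>x. (ph R x)^2 \<partial>?sg) = - (2 * c) * (\<integral>x. ind ?S x * (?p (1, 0) x * ph R x) \<partial>lborel)"
 proof -
  have "(%x. ind ?S x * (?p (1, 0) x * ph R x + ph R x * ?p (1, 0) x)) = (%x. 2 * (ind ?S x * (?p (1, 0) x * ph R x)))"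
  by (auto simp: algebra_simps)
  then have "- si * (\<integral>x. (ph R x)^2 \<partial>?sg) = 2 * (\<integral>x. ind ?S x * (?p (1, 0) x * ph R x) \<partial>lborel)" using dv by simp
  then have "(- c) * (- si * (\<integral>x. (ph R x)^2 \<partial>?sg)) = (- c) * (2 * (\<integral>x. ind ?S x * (?p (1, 0) x * ph R x) \<partial>lborel))" by simp
  then show ?thesis using c(2) by (simp add: mult.assoc[symmetric])
 qed
 have "(dirichlet ?S (ph R)) - al * (\<integral>x. (ph R x)^2 \<partial>?sg) + c^2 * (norm (restr ?S (ph R)))^2
  = (\<integral>x. ind ?S x * (?p (1, 0) x * ?p (1, 0) x) + ind ?S x * (?p (0, 1) x * ?p (0, 1) x)
   + (2 * c) * (ind ?S x * (?p (1, 0) x * ph R x)) + c^2 * (ind ?S x * (ph R x * ph R x)) \<partial>lborel)"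
  unfolding T using i1 i2 i3 i4
  by (simp add: unfolded_test.sum_Basis_plane[OF U] norm_restr_eq[OF sq(1)] norm_restr_eq[OF sq(2)] power2_eq_square[of "pd _ _ _"] power2_eq_square[of "ph R _"])
 also have "... <= (\<integral>x. 32 / R^2 * (ind ?S x * (ps x)^2) \<partial>lborel)"
 proof (rule integral_mono)
  fix x
  have le: "(pd (b R) e x)^2 <= 16 / R^2" if "norm e = 1" for e
  proof -
  have "\<bar>pd (b R) e x\<bar>\<^sup>2 <= (4 * (1 / R) * norm e)^2" by (intro power_mono pdb R) simp
  then show ?thesis using that by (simp add: power_divide)
  qed
  have e12: "?p (1, 0) x = - c * ph R x + ps x * pd (b R) (1, 0) x" "?p (0, 1) x = ps x * pd (b R) (0, 1) x"
  unfolding pdph[OF R] by (simp_all add: ph_def)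
  \<comment> \<open>The integrand is \<open>(d1 ph + c * ph)^2 + (d2 ph)^2\<close>, in which all
    terms without a derivative of the cutoff cancel; its two parts give
    \<open>2 * 16 = 32\<close>.\<close>
  have "?p (1, 0) x * ?p (1, 0) x + ?p (0, 1) x * ?p (0, 1) x + 2 * c * (?p (1, 0) x * ph R x) + c^2 * (ph R x * ph R x)
  = (ps x)^2 * ((pd (b R) (1, 0) x)^2 + (pd (b R) (0, 1) x)^2)" unfolding e12 by algebra
  also have "... <= (ps x)^2 * (16 / R^2 + 16 / R^2)" by (intro mult_left_mono add_mono le) auto
  finally show "ind ?S x * (?p (1, 0) x * ?p (1, 0) x) + ind ?S x * (?p (0, 1) x * ?p (0, 1) x)
   + (2 * c) * (ind ?S x * (?p (1, 0) x * ph R x)) + c^2 * (ind ?S x * (ph R x * ph R x)) <= 32 / R^2 * (ind ?S x * (ps x)^2)"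
  by (simp add: indicator_def mult.commute)
 qed (use i1 i2 i3 i4 ips in auto)
 also have "... = 32 / R^2 * I" by (simp add: I_def)
 finally show ?thesis by simp
 qed
 obtain p e where e: "e > 0" "ball p e \<subseteq> ?S" using op nonempty open_contains_ball by blast
 define R0 where "R0 = norm p + e"
 have R0: "R0 > 0" using e(1) by (simp add: R0_def add_nonneg_pos)
 define f where "f = (%x. bump ((1 / e) *\<^sub>R (x - p)))"
 have Cf: "f \<in> C1c UNIV" unfolding f_def by (rule bump_affine_C1c) (use e in auto)
 \<comment> \<open>A lower bound of the squared norms that is uniform in \<open>R\<close>: on a
   fixed ball inside the sector \<open>ps >= exp (- c * R0)\<close>, and the cutoff is at least 1/2
   there once \<open>R >= 2 * R0\<close>.\<close>
 define \<kappa> where "\<kappa> = (exp (- c * R0) / 2)^2 * (\<integral>x. f x * f x \<partial>lborel)"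
 have "f p = 1" by (simp add: f_def bump_def)
 then have \<kappa>: "\<kappa> > 0" unfolding \<kappa>_def using integral_C1c_pos[OF C1c_mult'(1)[OF Cf Cf], of p] by simp
 have low: "\<kappa> <= (norm (restr ?S (ph R)))^2" if R: "R >= 2 * R0" for R
 proof -
 have Rp: "R > 0" using R R0 by linarith
 note sq = C1c_square_integrable(1)[OF Cph[OF Rp]]
 have "\<kappa> = (\<integral>x. (exp (- c * R0) / 2)^2 * (f x * f x) \<partial>lborel)" by (simp add: \<kappa>_def)
 also have "... <= (\<integral>x. ind ?S x * (ph R x * ph R x) \<partial>lborel)"
 proof (rule integral_mono)
  show "integrable lborel (%x. (exp (- c * R0) / 2)^2 * (f x * f x))"
  using square_integrable_mult_integrable[OF C1c_square_integrable(1)[OF Cf] C1c_square_integrable(1)[OF Cf]] by simp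
  show "integrable lborel (%x. ind ?S x * (ph R x * ph R x))" by (rule integrable_restr[OF sq sq])
  fix x
  show "(exp (- c * R0) / 2)^2 * (f x * f x) <= ind ?S x * (ph R x * ph R x)"
  proof (cases "f x = 0")
  case False
  then have "norm ((1 / e) *\<^sub>R (x - p)) < 1" unfolding f_def bump_bounds(3) by linarith
  then have d: "norm (x - p) < e" unfolding norm_scaleR using e by (simp add: field_simps)
  then have "x \<in> ball p e" by (simp add: dist_norm norm_minus_commute)
  then have xS: "x \<in> ?S" using e(2) by blast
  have nx: "norm x <= R0" using norm_triangle_ineq[of "x - p" p] d by (simp add: R0_def)
  have "\<bar>fst x\<bar> <= norm x" by (metis norm_fst_le prod.collapse real_norm_def)
  then have "c * fst x <= c * R0" using nx c by (intro mult_left_mono) auto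
  then have 1: "exp (- c * R0) <= ps x" by (simp add: ps_def)
  have "norm ((1 / R) *\<^sub>R (x - 0)) <= 1 / 2" unfolding norm_scaleR using nx R Rp by (simp add: field_simps)
  then have "(norm ((1 / R) *\<^sub>R (x - 0)))^2 <= (1 / 2)^2" by (intro power_mono) auto
  then have m: "3 / 4 <= max 0 (1 - inner ((1 / R) *\<^sub>R (x - 0)) ((1 / R) *\<^sub>R (x - 0)))" unfolding power2_norm_eq_inner by (simp only: le_max_iff_disj power2_eq_square) argo
  have "(3 / 4)^2 <= b R x" unfolding b_def bump_def by (rule power_mono[OF m]) simp
  then have 2: "1 / 2 <= b R x" by (simp add: power2_eq_square)
  have "exp (- c * R0) * (1 / 2) <= ps x * b R x" by (intro mult_mono 1 2) (auto simp: ps_def)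
  then have m2: "(exp (- c * R0) / 2)^2 <= (ph R x)^2" unfolding ph_def by (intro power_mono) auto
  have "f x * f x <= 1 * 1" unfolding f_def by (intro mult_mono bump_bounds) auto
  then have "(exp (- c * R0) / 2)^2 * (f x * f x) <= (exp (- c * R0) / 2)^2 * 1" by (intro mult_left_mono) auto
  with m2 have "(exp (- c * R0) / 2)^2 * (f x * f x) <= (ph R x)^2" by linarith
  then show ?thesis using xS by (simp only: indicator_simps mult_1_left power2_eq_square[of "ph R x"])
  qed simp
 qed
 also have "... = (norm (restr ?S (ph R)))^2" by (simp only: norm_restr_eq[OF sq] power2_eq_square[of "ph R _"])
 finally show ?thesis .
 qed
 have ca: "c^2 - al^2 > 0"
 proof -
 have "si * si < 1" using sq1 cos_pos mult_pos_pos[OF cos_pos cos_pos] by linarith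
 then have "c^2 * (si * si) < c^2 * 1" using c by (intro mult_strict_left_mono) auto
 then show ?thesis by (simp add: c(2)[symmetric] power2_eq_square mult_ac)
 qed
 \<comment> \<open>Large enough for the truncation error \<open>32 * I / R^2\<close> to stay below
   \<open>(c^2 - al^2) * \<kappa>\<close>.\<close>
 define R where "R = max (max 1 (2 * R0)) (32 * \<bar>I\<bar> / ((c^2 - al^2) * \<kappa>) + 1)"
 have R: "R >= 1" "R >= 2 * R0" "R > 32 * \<bar>I\<bar> / ((c^2 - al^2) * \<kappa>)" unfolding R_def by auto
 have "R * 1 <= R * R" using R by (intro mult_left_mono) auto
 then have "32 * \<bar>I\<bar> / ((c^2 - al^2) * \<kappa>) < R^2" using R(3) by (simp add: power2_eq_square)
 then have "32 * \<bar>I\<bar> < R^2 * ((c^2 - al^2) * \<kappa>)" using ca \<kappa> by (simp add: pos_divide_less_eq)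
 then have "32 * I < R^2 * ((c^2 - al^2) * \<kappa>)" by linarith
 then have "32 / R^2 * I < (c^2 - al^2) * \<kappa>" using R(1) by (simp add: pos_divide_less_eq mult.commute)
 also have "... <= (c^2 - al^2) * (norm (restr ?S (ph R)))^2" using low[OF R(2)] ca by (intro mult_left_mono) auto
 finally have "32 / R^2 * I < c^2 * (norm (restr ?S (ph R)))^2 - al^2 * (norm (restr ?S (ph R)))^2" by (simp add: left_diff_distrib)
 moreover have "0 < R" using R(1) by linarith
 ultimately show ?thesis using form[of R] Cph[of R] by (intro bexI[of _ "ph R"]) auto
qed

end

lemma integral_le_nn_integral:
 assumes "integrable M f" "!!x. 0 <= f x" "(\<integral>\<^sup>+x. ennreal (f x) \<partial>M) <= ennreal C" "0 <= C"
 shows "(\<integral>x. f x \<partial>M) <= C"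
 using assms by (simp add: nn_integral_eq_integral)

lemma le_integral_nn_integral:
 assumes "integrable M f" "!!x. 0 <= f x" "ennreal C <= (\<integral>\<^sup>+x. ennreal (f x) \<partial>M)"
 shows "C <= (\<integral>x. f x \<partial>M)"
proof -
 have "0 <= (\<integral>x. f x \<partial>M)" using assms(2) by (simp add: integral_nonneg_AE)
 then show ?thesis using assms by (simp add: nn_integral_eq_integral)
qed

context half_angle
begin

text \<open>Singular sequences at \<open>-al^2 + k^2\<close>: plane waves along one side of the sector, decaying like
 \<open>exp (-al t)\<close> with the distance \<open>t\<close> to it, cut off to a ball of radius \<open>R\<close> about the point at
 distance \<open>2 R\<close> from the apex, which misses the other side. The error terms all carry a derivative
 of the cutoff.\<close>

lemma sector_spectrum:
 assumes al: "al > 0" and rb: "robin (sector th) (side_measure th {0<..}) al c0"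
 shows "{- al\<^sup>2..} \<subseteq> spectrum (L2_on (sector th)) (robin_operator (sector th) (side_measure th {0<..}) al)"
proof
 let ?S = "sector th" and ?sg = "side_measure th {0<..}"
 interpret robin ?S ?sg al c0 by (rule rb)
 fix z assume z: "z \<in> {- al\<^sup>2..}"
 define k where "k = sqrt (z + al^2)"
 have k: "k >= 0" "k * k = z + al * al" using z by (auto simp: k_def power2_eq_square)
 define s where "s p = fst p * co + snd p * si" for p :: plane
 define t where "t p = fst p * si - snd p * co" for p :: plane
 have st: "s (co, si) = 1" "t (co, si) = 0" "s (si, - co) = 0" "t (si, - co) = 1"
 using sq1 by (simp_all add: s_def t_def add.commute)
 have st2: "s p * s p + t p * t p = inner p p" for p
 proof -
 have "s p * s p + t p * t p = (fst p * fst p + snd p * snd p) * (si * si + co * co)" unfolding s_def t_def by algebra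
 then show ?thesis by (simp only: sq1 mult_1_right inner_prod_def inner_real_def)
 qed
 \<comment> \<open>The phase \<open>d\<close> is used with the values 0 and \<open>- pi / 2\<close>,
   that is, with cosine and sine; the sum of their squares does not oscillate, which makes the lower
   bound of the norms uniform in \<open>k\<close>.\<close>
 define E where "E d p = exp (- al * t p) * cos (k * s p + d)" for d p
 define E2 where "E2 d p = exp (- al * t p) * sin (k * s p + d)" for d p
 have dst: "(s has_derivative s) (at p)" "(t has_derivative t) (at p)" for p
 unfolding s_def[abs_def] t_def[abs_def] by (auto intro!: derivative_eq_intros)
 have dE: "(E d has_derivative (%e. - al * t e * E d p - k * s e * E2 d p)) (at p)"
 and dE2: "(E2 d has_derivative (%e. - al * t e * E2 d p + k * s e * E d p)) (at p)" for d p
 unfolding E_def[abs_def] E2_def[abs_def] by (auto intro!: derivative_eq_intros dst simp: algebra_simps)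
 have cst: "continuous_on UNIV s" "continuous_on UNIV t" unfolding s_def[abs_def] t_def[abs_def] by (intro continuous_intros)+
 have cE: "continuous_on UNIV (E d)" "continuous_on UNIV (E2 d)" for d unfolding E_def[abs_def] E2_def[abs_def] by (intro continuous_intros cst)+
 have cdE: "continuous_on UNIV (%p. - al * t e * E d p - k * s e * E2 d p)" for e d by (intro continuous_intros cE)
 have E_le: "\<bar>E d p\<bar> <= exp (- al * t p)" "\<bar>E2 d p\<bar> <= exp (- al * t p)" for d p
 by (simp_all add: E_def E2_def abs_mult)
 show "z \<in> spectrum (L2_on ?S) (robin_operator ?S ?sg al)"
 proof (rule ccontr)
 assume "\<not> ?thesis"
 then have "z \<in> resolvent_set (L2_on ?S) graph" by (simp add: spectrum_def robin_operator_eq)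
 from resolvent_test_bound[OF this] obtain K where K: "!!ph \<epsilon>. ph \<in> C1c UNIV ==> \<epsilon> >= 0 ==>
  (!!ps. ps \<in> C1c UNIV ==> \<bar>test_form al ph ps - z * inner (restr ?S ph) (restr ?S ps)\<bar>
  <= \<epsilon> * sqrt ((dirichlet ?S ps) + (norm (restr ?S ps))^2)) ==> norm (restr ?S ph) <= K * \<epsilon>"
  by blast
 define M where "M = 1 + k + al"
 have M: "M >= 1" using k al by (simp add: M_def)
 define g0 where "g0 = exp (- (2 * al)) / 16"
 have g0: "g0 > 0" by (simp add: g0_def)
 \<comment> \<open>\<open>Z / R\<close> is the upper bound \<open>2 * (K * (5 * A))^2\<close> for
   the two squared norms, \<open>g0 * R\<close> their lower bound; \<open>R\<close> is chosen to
   make these incompatible.\<close>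
 define Z where "Z = 800 * K^2 * M^2 / al"
 define R where "R = max 2 (Z / g0 + 1)"
 have R: "R >= 2" "Z / g0 < R" by (auto simp: R_def)
 have R0: "R > 0" using R by simp
 define q where "q = ((2 * R) * co, (2 * R) * si)"
 have sq: "s q = 2 * R" "t q = 0"
 proof -
  have "s q = 2 * R * (si * si + co * co)" unfolding s_def q_def fst_conv snd_conv by algebra
  then show "s q = 2 * R" by (simp only: sq1 mult_1_right)
 qed (simp add: t_def q_def)
 have lin: "s (x - y) = s x - s y" "t (x - y) = t x - t y" for x y by (simp_all add: s_def t_def algebra_simps)
 define b where "b = (%x. bump ((1 / R) *\<^sub>R (x - q)))"
 have R1: "1 / R ~= 0" using R0 by simp
 have Cb: "b \<in> C1c UNIV" unfolding b_def by (rule bump_affine_C1c(1)[OF R1])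
 have off: "b x = 0" "pd b e x = 0" if "R <= norm (x - q)" for e x
 proof -
  have n: "1 <= norm ((1 / R) *\<^sub>R (x - q))" unfolding norm_scaleR using that R0 by (simp add: field_simps)
  then show "b x = 0" unfolding b_def bump_bounds(3) .
  have "1 <= (norm ((1 / R) *\<^sub>R (x - q)))^2" using power_mono[OF n, of 2] by simp
  then have m: "max 0 (1 - inner ((1 / R) *\<^sub>R (x - q)) ((1 / R) *\<^sub>R (x - q))) = 0" unfolding power2_norm_eq_inner by linarith
  show "pd b e x = 0" unfolding b_def bump_affine_C1c(2)[OF R1] m by simp
 qed
 have pdb: "\<bar>pd b e x\<bar> <= 4 / R" if "norm e = 1" for e x
  using bump_pd_bound[OF R1, of q x e] R0 that unfolding b_def by simp
 let ?\<tau> = "(co, si)" and ?n = "(si, - co)"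
 have unit: "norm ?\<tau> = 1" "norm ?n = 1" using sq1 by (simp_all add: norm_prod_def)
 \<comment> \<open>The centre has height \<open>2 * R * si\<close>, and \<open>2 * si >= 1\<close>,
   so the ball lies in the upper half-plane.\<close>
 have up: "R <= norm (x - q)" if "snd x <= 0" for x
 proof -
  have "1 <= 2 * si"
  proof -
  have "co <= si" using slope(2,4) cos_pos mult_right_mono[OF slope(2), of "co"] by simp
  then have "co * co <= si * si" using cos_pos by (intro mult_mono) auto
  then have "1 / 2 <= si * si" using sq1 by linarith
  also have "... <= si * 1" using sin_pos by (intro mult_left_mono) auto
  finally show ?thesis by simp
  qed
  then have "R * 1 <= R * (2 * si)" using R0 by (intro mult_left_mono) auto
  also have "... = snd q" by (simp add: q_def)
  also have "... <= \<bar>snd (x - q)\<bar>" using that by simp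
  also have "... <= norm (x - q)" by (metis norm_snd_le prod.collapse real_norm_def)
  finally show ?thesis by simp
 qed
 \<comment> \<open>Square of the pointwise bound, \<open>(4 * M / R)^2\<close>, times the length
   \<open>2 * R\<close> of the ball along the side, times \<open>1 / (2 * al)\<close> from the decay
   across it.\<close>
 define A where "A = sqrt (16 * M^2 / (al * R))"
 have A0: "A >= 0" using al R0 by (simp add: A_def)
 have bound: "sqint lborel h & norm (restr ?S h) <= A"
  if ch: "continuous_on UNIV h" and h: "!!x. \<bar>h x\<bar> <= M * (4 / R) * exp (- al * t x)" "!!x. R <= norm (x - q) ==> h x = 0" for h
 proof -
  have hsq: "sqint lborel h"
  by (rule square_integrable_compact_support(1)[OF ch, of "cball q R"]) (auto intro!: h(2) simp: dist_norm norm_minus_commute)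
  let ?f = "ind {R..3 * R} :: real => real" and ?g = "%y. exp (- (2 * al) * y) * ind {0..} y :: real"
  have "(\<integral>x. ind ?S x * (h x)^2 \<partial>lborel) <= 16 * M^2 / (al * R)"
  proof (rule integral_le_nn_integral)
  show "integrable lborel (%x. ind ?S x * (h x)^2)" using integrable_restr[OF hsq hsq] by (simp only: power2_eq_square)
  have "(\<integral>\<^sup>+x. ennreal (ind ?S x * (h x)^2) \<partial>lborel) <= (\<integral>\<^sup>+p. ennreal (((M * (4 / R))^2 * ?f (fst p * co + snd p * si)) * ?g (fst p * si - snd p * co)) \<partial>lborel)"
  proof (rule nn_integral_mono, rule ennreal_leI)
   fix x
   have nn: "0 <= ((M * (4 / R))^2 * ?f u) * ?g v" for u v by (intro mult_nonneg_nonneg) auto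
   show "ind ?S x * (h x)^2 <= ((M * (4 / R))^2 * ?f (fst x * co + snd x * si)) * ?g (fst x * si - snd x * co)"
   proof (cases "x \<in> ?S & norm (x - q) < R")
   case True
   then have t0: "0 <= t x" unfolding sector_eq t_def by auto
   have "s (x - q) * s (x - q) <= inner (x - q) (x - q)" using st2[of "x - q"] zero_le_square[of "t (x - q)"] by linarith
   then have "\<bar>s (x - q)\<bar>^2 <= (norm (x - q))^2" unfolding power2_norm_eq_inner by (simp add: power2_eq_square)
   then have "\<bar>s (x - q)\<bar> <= norm (x - q)" by (rule power2_le_imp_le) simp
   then have "\<bar>s x - 2 * R\<bar> < R" using True by (simp add: lin sq)
   then have s0: "s x \<in> {R..3 * R}" by auto
   have "\<bar>h x\<bar>\<^sup>2 <= (M * (4 / R) * exp (- al * t x))^2" by (intro power_mono h(1)) simp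
   moreover have "exp (- (2 * al) * t x) = (exp (- al * t x))^2" by (simp add: exp_double[symmetric] mult.assoc)
   ultimately have "(h x)^2 <= (M * (4 / R))^2 * exp (- (2 * al) * t x)" by (simp only: power_mult_distrib power2_abs)
   then show ?thesis using True t0 s0 unfolding s_def[symmetric] t_def[symmetric] by simp
   next
   case False
   then have z: "ind ?S x * (h x)^2 = 0" using h(2)[of x] by (cases "x \<in> ?S") auto
   show ?thesis unfolding z by (rule nn)
   qed
  qed
  also have "... = (\<integral>\<^sup>+x. ennreal ((M * (4 / R))^2 * ?f x) \<partial>lborel) * (\<integral>\<^sup>+x. ennreal (?g x) \<partial>lborel)"
   by (rule strip_integral) auto
  also have "(\<integral>\<^sup>+x. ennreal (?g x) \<partial>lborel) = ennreal (1 / (2 * al))"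
   using nn_integral_exp_half_line[of "2 * al"] al by (simp add: ennreal_mult' ennreal_indicator)
  also have "(\<integral>\<^sup>+x. ennreal ((M * (4 / R))^2 * ?f x) \<partial>lborel) = ennreal ((M * (4 / R))^2) * ennreal (2 * R)"
   using R0 by (subst ennreal_mult') (auto simp: nn_integral_cmult ennreal_indicator)
  also have "ennreal ((M * (4 / R))^2) * ennreal (2 * R) * ennreal (1 / (2 * al)) = ennreal ((M * (4 / R))^2 * (2 * R) * (1 / (2 * al)))"
   using R0 al by (simp add: ennreal_mult'[symmetric] del: times_divide_eq_right)
  also have "(M * (4 / R))^2 * (2 * R) * (1 / (2 * al)) = 16 * M^2 / (al * R)"
   using R0 al by (simp add: field_simps power2_eq_square)
  finally show "(\<integral>\<^sup>+x. ennreal (ind ?S x * (h x)^2) \<partial>lborel) <= ennreal (16 * M^2 / (al * R))" .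
  qed (use al R0 in auto)
  then have "(norm (restr ?S h))^2 <= 16 * M^2 / (al * R)" unfolding norm_restr_eq[OF hsq] .
  then have "norm (restr ?S h) <= A" unfolding A_def by (rule real_le_rsqrt)
  with hsq show ?thesis by blast
 qed
 define ph where "ph d = (%x. E d x * b x)" for d
 have Cph: "ph d \<in> C1c UNIV" and pdph: "pd (ph d) e x = (- al * t e * E d x - k * s e * E2 d x) * b x + E d x * pd b e x" for d e x
  unfolding ph_def by (rule C1c_mult(1)[OF dE cdE Cb] C1c_mult(2)[OF dE cdE Cb])+
 have small: "norm (restr ?S (ph d)) <= K * (5 * A)" for d
 proof (rule K[OF Cph])
  show "0 <= 5 * A" using A0 by simp
  fix ps :: "plane => real" assume ps: "ps \<in> C1c UNIV"
  note sqps = C1c_square_integrable[OF ps] and sqph = C1c_square_integrable[OF Cph]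
  \<comment> \<open>\<open>h1\<close>, \<open>h2\<close>, \<open>h3\<close> collect the terms of the
    weak equation in which the cutoff is differentiated; the rest is the sum of the total
    derivatives of \<open>F1\<close> along the side and of \<open>F2\<close> across it.\<close>
  define h1 where "h1 x = E d x * pd b ?\<tau> x" for x
  define h2 where "h2 x = E d x * pd b ?n x" for x
  define h3 where "h3 x = k * E2 d x * pd b ?\<tau> x + al * E d x * pd b ?n x" for x
  have le: "\<bar>F * pd b e x\<bar> <= exp (- al * t x) * (4 / R)" if "\<bar>F\<bar> <= exp (- al * t x)" "norm e = 1" for F e x
  unfolding abs_mult by (intro mult_mono that pdb) (use R0 in auto)
  have w: "exp (- al * t x) * (4 / R) <= M * (4 / R) * exp (- al * t x)" for x
  using mult_right_mono[OF M, of "exp (- al * t x) * (4 / R)"] R0 by (simp add: mult_ac)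
  have H: "sqint lborel (%x. E d x * pd b e x) & norm (restr ?S (%x. E d x * pd b e x)) <= A" if e: "norm e = 1" for e
  proof (rule bound)
  show "continuous_on UNIV (%x. E d x * pd b e x)" by (intro continuous_intros cE C1c_pd_continuous[OF Cb])
  show "\<bar>E d x * pd b e x\<bar> <= M * (4 / R) * exp (- al * t x)" for x by (rule order_trans[OF le[OF E_le(1) e] w])
  show "E d x * pd b e x = 0" if "R <= norm (x - q)" for x using off(2)[OF that] by simp
  qed
  have H1: "sqint lborel h1 & norm (restr ?S h1) <= A" unfolding h1_def[abs_def] by (rule H[OF unit(1)])
  have H2: "sqint lborel h2 & norm (restr ?S h2) <= A" unfolding h2_def[abs_def] by (rule H[OF unit(2)])
  have H3: "sqint lborel h3 & norm (restr ?S h3) <= A"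
  proof (rule bound)
  show "continuous_on UNIV h3" unfolding h3_def[abs_def] by (intro continuous_intros cE C1c_pd_continuous[OF Cb])
  show "h3 x = 0" if "R <= norm (x - q)" for x using off[OF that] by (simp add: h3_def)
  fix x
  let ?e = "exp (- al * t x) * (4 / R)"
  have "\<bar>h3 x\<bar> <= k * \<bar>E2 d x * pd b ?\<tau> x\<bar> + al * \<bar>E d x * pd b ?n x\<bar>"
   using abs_triangle_ineq[of "k * (E2 d x * pd b ?\<tau> x)" "al * (E d x * pd b ?n x)"] k al by (simp add: h3_def abs_mult mult.assoc)
  also have "... <= k * ?e + al * ?e" using k al by (intro add_mono mult_left_mono le E_le unit) auto
  also have "... = (k + al) * ?e" by (rule distrib_right[symmetric])
  also have "... <= M * ?e" using R0 by (intro mult_right_mono) (auto simp: M_def)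
  finally show "\<bar>h3 x\<bar> <= M * (4 / R) * exp (- al * t x)" by (simp add: mult_ac)
  qed
  define f1 where "f1 x = - k * E2 d x" for x
  define f2 where "f2 x = - al * E d x" for x
  have bps: "(%x. b x * ps x) \<in> C1c UNIV" "pd (%x. b x * ps x) e x = pd b e x * ps x + b x * pd ps e x" for e x
  by (rule C1c_mult'[OF Cb ps])+
  have df1: "(f1 has_derivative (%e. - k * (- al * t e * E2 d p + k * s e * E d p))) (at p)" for p
  unfolding f1_def[abs_def] by (rule has_derivative_mult_right[OF dE2])
  have df2: "(f2 has_derivative (%e. - al * (- al * t e * E d p - k * s e * E2 d p))) (at p)" for p
  unfolding f2_def[abs_def] by (rule has_derivative_mult_right[OF dE])
  have cf: "continuous_on UNIV (%p. - k * (- al * t e * E2 d p + k * s e * E d p))" "continuous_on UNIV (%p. - al * (- al * t e * E d p - k * s e * E2 d p))" for e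
  by (intro continuous_intros cE)+
  define F1 where "F1 = (%x. f1 x * (b x * ps x))"
  define F2 where "F2 = (%x. f2 x * (b x * ps x))"
  have F1: "F1 \<in> C1c UNIV" "pd F1 e x = - k * (- al * t e * E2 d x + k * s e * E d x) * (b x * ps x) + f1 x * pd (%x. b x * ps x) e x" for e x
  unfolding F1_def by (rule C1c_mult[OF df1 cf(1) bps(1)])+
  have F2: "F2 \<in> C1c UNIV" "pd F2 e x = - al * (- al * t e * E d x - k * s e * E2 d x) * (b x * ps x) + f2 x * pd (%x. b x * ps x) e x" for e x
  unfolding F2_def by (rule C1c_mult[OF df2 cf(2) bps(1)])+
  have D1: "(\<integral>x. ind ?S x * pd F1 ?\<tau> x \<partial>lborel) = 0"
  proof -
  obtain K' L where U: "unfolded_test th ?S ?sg K' L F1" and zz: "!!x. F1 (unf (L, x)) = 0 & F1 (unf (x, L)) = 0"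
   using unfolded_test_sector[OF F1(1)] by blast
  show ?thesis by (rule unfolded_test.divergence_side(1)[OF U zz]) (use off[OF up] in \<open>simp add: F1(2) bps(2), simp add: F1_def\<close>)
  qed
  \<comment> \<open>The boundary term released here equals \<open>al\<close> times the integral of
    \<open>ph d * ps\<close>, so it cancels the Robin term of the form.\<close>
  have D2: "(\<integral>x. ind ?S x * pd F2 ?n x \<partial>lborel) = - (\<integral>x. F2 x \<partial>?sg)"
  proof -
  obtain K' L where U: "unfolded_test th ?S ?sg K' L F2" and zz: "!!x. F2 (unf (L, x)) = 0 & F2 (unf (x, L)) = 0"
   using unfolded_test_sector[OF F2(1)] by blast
  show ?thesis by (rule unfolded_test.divergence_side(2)[OF U zz]) (use off[OF up] in \<open>simp add: F2(2) bps(2), simp add: F2_def\<close>)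
  qed
  have F2sg: "(\<integral>x. F2 x \<partial>?sg) = - al * (\<integral>x. ph d x * ps x \<partial>?sg)"
  proof -
  have "F2 = (%x. - al * (ph d x * ps x))" by (auto simp: F2_def f2_def ph_def)
  then show ?thesis by simp
  qed
  have one: "sqint lborel h1" "sqint lborel h2" "sqint lborel h3" using H1 H2 H3 by auto
  have op': "open ?S" by (rule op)
  note inn = inner_restr_l2[OF _ _ op']
  note ii = integrable_restr
  have iF: "integrable lborel (%x. ind ?S x * pd F1 ?\<tau> x)" "integrable lborel (%x. ind ?S x * pd F2 ?n x)"
  proof -
  obtain K1 where K1: "compact K1" "K1 \<subseteq> UNIV" "!!x. x \<notin> K1 ==> F1 x = 0" "!!x e. x \<notin> K1 ==> pd F1 e x = 0"
   using C1c_support[OF F1(1)] by blast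
  obtain K2 where K2: "compact K2" "K2 \<subseteq> UNIV" "!!x. x \<notin> K2 ==> F2 x = 0" "!!x e. x \<notin> K2 ==> pd F2 e x = 0"
   using C1c_support[OF F2(1)] by blast
  have m: "?S \<in> sets lborel" using op' by simp
  show "integrable lborel (%x. ind ?S x * pd F1 ?\<tau> x)"
   using integrable_mult_indicator[OF m square_integrable_compact_support(2)[OF C1c_pd_continuous[OF F1(1)] K1(1,4)]] by simp
  show "integrable lborel (%x. ind ?S x * pd F2 ?n x)"
   using integrable_mult_indicator[OF m square_integrable_compact_support(2)[OF C1c_pd_continuous[OF F2(1)] K2(1,4)]] by simp
  qed
  have point: "ind ?S x * (pd (ph d) (1, 0) x * pd ps (1, 0) x) + ind ?S x * (pd (ph d) (0, 1) x * pd ps (0, 1) x) - z * (ind ?S x * (ph d x * ps x))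
  = ind ?S x * (h1 x * pd ps ?\<tau> x) + ind ?S x * (h2 x * pd ps ?n x) + ind ?S x * (h3 x * ps x)
   + ind ?S x * pd F1 ?\<tau> x + ind ?S x * pd F2 ?n x" for x
  proof -
  have rot: "pd (ph d) ?\<tau> x * pd ps ?\<tau> x + pd (ph d) ?n x * pd ps ?n x = pd (ph d) (1, 0) x * pd ps (1, 0) x + pd (ph d) (0, 1) x * pd ps (0, 1) x"
  proof -
   have "(co * a + si * b) * (co * a' + si * b') + (si * a + - co * b) * (si * a' + - co * b') = (a * a' + b * b') * (si * si + co * co)" for a b a' b' :: real
   by algebra
   then show ?thesis
   unfolding pd_plane[OF Cph, where a = "co"] pd_plane[OF Cph, where a = "si"] pd_plane[OF ps, where a = "co"] pd_plane[OF ps, where a = "si"]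
   by (simp only: sq1 mult_1_right)
  qed
  have zk: "z = k * k - al * al" using k by simp
  have "pd (ph d) ?\<tau> x * pd ps ?\<tau> x + pd (ph d) ?n x * pd ps ?n x - z * (ph d x * ps x)
   = h1 x * pd ps ?\<tau> x + h2 x * pd ps ?n x + h3 x * ps x + pd F1 ?\<tau> x + pd F2 ?n x"
   unfolding pdph F1(2) F2(2) bps(2) st h1_def h2_def h3_def f1_def f2_def zk unfolding ph_def by algebra
  then have "ind ?S x * (pd (ph d) ?\<tau> x * pd ps ?\<tau> x + pd (ph d) ?n x * pd ps ?n x - z * (ph d x * ps x))
   = ind ?S x * (h1 x * pd ps ?\<tau> x + h2 x * pd ps ?n x + h3 x * ps x + pd F1 ?\<tau> x + pd F2 ?n x)" by simp
  then show ?thesis unfolding rot by (simp only: distrib_left right_diff_distrib mult.left_commute[of z])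
  qed
  have "test_form al (ph d) ps - z * inner (restr ?S (ph d)) (restr ?S ps)
  = (\<integral>x. ind ?S x * (pd (ph d) (1, 0) x * pd ps (1, 0) x) + ind ?S x * (pd (ph d) (0, 1) x * pd ps (0, 1) x) - z * (ind ?S x * (ph d x * ps x)) \<partial>lborel)
   - al * (\<integral>x. ph d x * ps x \<partial>?sg)"
  proof -
  obtain K' L where U: "unfolded_test th ?S ?sg K' L ps" using unfolded_test_sector[OF ps] by blast
  show ?thesis unfolding test_form_def unfolded_test.sum_Basis_plane[OF U] inn[OF sqph(1) sqps(1)] inn[OF sqph(2) sqps(2)]
   using ii[OF sqph(1) sqps(1)] ii[OF sqph(2) sqps(2)] by simp
  qed
  also have "... = inner (restr ?S h1) (restr ?S (pd ps ?\<tau>)) + inner (restr ?S h2) (restr ?S (pd ps ?n)) + inner (restr ?S h3) (restr ?S ps)"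
  unfolding point inn[OF one(1) sqps(2)] inn[OF one(2) sqps(2)] inn[OF one(3) sqps(1)]
  using iF ii[OF one(1) sqps(2), of ?\<tau>] ii[OF one(2) sqps(2), of ?n] ii[OF one(3) sqps(1)] D1 D2 F2sg by simp
  finally have id: "test_form al (ph d) ps - z * inner (restr ?S (ph d)) (restr ?S ps)
  = inner (restr ?S h1) (restr ?S (pd ps ?\<tau>)) + inner (restr ?S h2) (restr ?S (pd ps ?n)) + inner (restr ?S h3) (restr ?S ps)" .
  define Q where "Q = sqrt ((dirichlet ?S ps) + (norm (restr ?S ps))^2)"
  have Q: "norm (restr ?S ps) <= Q" "e \<in> Basis ==> norm (restr ?S (pd ps e)) <= Q" for e
  unfolding Q_def using member_le_sum[of e Basis "%e. (norm (restr ?S (pd ps e)))^2"]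
  by (auto intro!: real_le_rsqrt simp: sum_nonneg add_increasing2)
  have Q0: "0 <= Q" using Q(1) norm_ge_zero order_trans by blast
  have dir: "norm (restr ?S (pd ps (u, v))) <= 2 * Q" if "\<bar>u\<bar> <= 1" "\<bar>v\<bar> <= 1" for u v
  proof -
  have "restr ?S (pd ps (u, v)) = u *\<^sub>R restr ?S (pd ps (1, 0)) + v *\<^sub>R restr ?S (pd ps (0, 1))"
   unfolding restr_l2_lincomb[OF sqps(2) sqps(2) op', symmetric] by (intro arg_cong[of _ _ "restr ?S"] ext pd_plane[OF ps])
  then have "norm (restr ?S (pd ps (u, v))) <= \<bar>u\<bar> * norm (restr ?S (pd ps (1, 0))) + \<bar>v\<bar> * norm (restr ?S (pd ps (0, 1)))"
   using norm_triangle_ineq[of "u *\<^sub>R restr ?S (pd ps (1, 0))" "v *\<^sub>R restr ?S (pd ps (0, 1))"] by simp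
  also have "... <= 1 * Q + 1 * Q" by (intro add_mono mult_mono Q(2) that) (auto simp: Basis_prod_def)
  finally show ?thesis by simp
  qed
  have cs: "\<bar>inner (restr ?S f) (restr ?S g)\<bar> <= A * P" if "norm (restr ?S f) <= A" "norm (restr ?S g) <= P" for f g P
  by (rule order_trans[OF Cauchy_Schwarz_ineq2]) (intro mult_mono that, use A0 in auto)
  have "\<bar>inner (restr ?S h1) (restr ?S (pd ps ?\<tau>))\<bar> <= A * (2 * Q)" "\<bar>inner (restr ?S h2) (restr ?S (pd ps ?n))\<bar> <= A * (2 * Q)"
  "\<bar>inner (restr ?S h3) (restr ?S ps)\<bar> <= A * Q"
  using H1 H2 H3 Q(1) by (auto intro!: cs dir)
  \<comment> \<open>The 2's come from expressing a derivative in an oblique unit direction by the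
    two coordinate derivatives; in total 2 + 2 + 1 = 5.\<close>
  then have "\<bar>test_form al (ph d) ps - z * inner (restr ?S (ph d)) (restr ?S ps)\<bar> <= A * (2 * Q) + A * (2 * Q) + A * Q"
  unfolding id by linarith
  then show "\<bar>test_form al (ph d) ps - z * inner (restr ?S (ph d)) (restr ?S ps)\<bar>
  <= 5 * A * sqrt ((dirichlet ?S ps) + (norm (restr ?S ps))^2)"
  unfolding Q_def[symmetric] by simp
 qed
 \<comment> \<open>The mass is found in a strip of length \<open>R\<close> and width 1 along the
   side. There the point is within \<open>R / 2\<close> of the centre in both directions, so the
   cutoff is at least 1/4, and the decay costs at most \<open>exp (- (2 * al))\<close>; the product
   is \<open>g0\<close>. The width 1 fits since \<open>R >= 2\<close>.\<close>
 have low: "g0 * R <= (norm (restr ?S (ph 0)))^2 + (norm (restr ?S (ph (- (pi / 2)))))^2"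
 proof -
  note sqa = C1c_square_integrable(1)[OF Cph[of 0]] and sqb = C1c_square_integrable(1)[OF Cph[of "- (pi / 2)"]]
  note i = integrable_restr[OF sqa sqa] integrable_restr[OF sqb sqb]
  let ?h = "%x. ind ?S x * (ph 0 x)^2 + ind ?S x * (ph (- (pi / 2)) x)^2"
  let ?f = "ind {3 / 2 * R..5 / 2 * R} :: real => real" and ?g = "ind {0<..1} :: real => real"
  have "g0 * R <= (\<integral>x. ?h x \<partial>lborel)"
  proof (rule le_integral_nn_integral)
  show "integrable lborel ?h" using i by (simp add: power2_eq_square)
  have "ennreal (g0 * R) = ennreal g0 * ennreal R * ennreal 1" using g0 R0 by (simp add: ennreal_mult')
  also have "... = (\<integral>\<^sup>+x. ennreal (g0 * ?f x) \<partial>lborel) * (\<integral>\<^sup>+x. ennreal (?g x) \<partial>lborel)"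
   using R0 g0 by (simp add: ennreal_mult' nn_integral_cmult ennreal_indicator)
  also have "... = (\<integral>\<^sup>+p. ennreal ((g0 * ?f (fst p * co + snd p * si)) * ?g (fst p * si - snd p * co)) \<partial>lborel)"
   by (rule strip_integral[symmetric]) (use g0 in auto)
  also have "... <= (\<integral>\<^sup>+x. ennreal (?h x) \<partial>lborel)"
  proof (rule nn_integral_mono, rule ennreal_leI)
   fix x
   show "(g0 * ?f (fst x * co + snd x * si)) * ?g (fst x * si - snd x * co) <= ?h x"
   proof (cases "s x \<in> {3 / 2 * R..5 / 2 * R} & t x \<in> {0<..1}")
   case True
   have e: "fst x * si + snd x * co = (s x * (2 * si * co) + t x * (si * si - co * co))"
   proof -
    have "s x * (2 * si * co) + t x * (si * si - co * co) = (fst x * si + snd x * co) * (si * si + co * co)"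
    unfolding s_def t_def by algebra
    then show ?thesis by (simp only: sq1 mult_1_right)
   qed
   have B: "0 < s x * (2 * si * co)" using True R0 sin_pos cos_pos by (intro mult_pos_pos) auto
   have C: "0 <= t x * (si * si - co * co)"
   proof -
    have "co <= si" using slope(2,4) cos_pos mult_right_mono[OF slope(2), of "co"] by simp
    then have "co * co <= si * si" using cos_pos by (intro mult_mono) auto
    then show ?thesis using True by (intro mult_nonneg_nonneg) auto
   qed
   have "0 < fst x * si + snd x * co" unfolding e by (rule add_pos_nonneg[OF B C])
   then have xS: "x \<in> ?S" using True unfolding sector_eq t_def by simp
   have "3 / 2 * R <= s x" "s x <= 5 / 2 * R" "0 < t x" "t x <= 1" using True by auto
   then have "\<bar>s (x - q)\<bar> <= R / 2" "\<bar>t (x - q)\<bar> <= R / 2" using R(1) unfolding lin sq by (intro abs_leI; linarith)+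
   then have "\<bar>s (x - q)\<bar>^2 <= (R / 2)^2" "\<bar>t (x - q)\<bar>^2 <= (R / 2)^2" by (intro power_mono; simp)+
   then have "inner (x - q) (x - q) <= R^2 / 2" unfolding st2[symmetric] by (simp add: power2_eq_square)
   then have "(1 / R) * (1 / R) * inner (x - q) (x - q) <= (1 / R) * (1 / R) * (R^2 / 2)" using R0 by (intro mult_left_mono) auto
   also have "... = 1 / 2" using R0 by (simp add: power2_eq_square)
   finally have f: "(1 / R) * (1 / R) * inner (x - q) (x - q) <= 1 / 2" .
   have i: "inner ((1 / R) *\<^sub>R (x - q)) ((1 / R) *\<^sub>R (x - q)) = (1 / R) * (1 / R) * inner (x - q) (x - q)"
    by (simp only: inner_scaleR_left inner_scaleR_right mult.assoc)
   have m: "1 / 2 <= max 0 (1 - inner ((1 / R) *\<^sub>R (x - q)) ((1 / R) *\<^sub>R (x - q)))"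
    unfolding i by (rule max.coboundedI2) (use f in linarith)
   have "(1 / 2)^2 <= b x" unfolding b_def bump_def by (rule power_mono[OF m]) simp
   from power_mono[OF this, of 2] have "((1 / 2)^2)^2 <= (b x)^2" by simp
   then have b16: "1 / 16 <= (b x)^2" by (simp add: power_divide)
   have ex: "exp (- (2 * al)) <= exp (- (2 * al) * t x)" using True al by simp
   have cs: "cos (k * s x + - (pi / 2)) = sin (k * s x)" by (simp add: cos_diff)
   have "(ph 0 x)^2 + (ph (- (pi / 2)) x)^2 = (exp (- al * t x))^2 * (b x)^2 * ((cos (k * s x))^2 + (sin (k * s x))^2)"
    unfolding ph_def E_def cs by (simp add: power_mult_distrib algebra_simps del: sin_cos_squared_add sin_cos_squared_add2)
   also have "... = exp (- (2 * al) * t x) * (b x)^2" by (simp add: exp_double[symmetric] mult.assoc)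
   finally have e: "(ph 0 x)^2 + (ph (- (pi / 2)) x)^2 = exp (- (2 * al) * t x) * (b x)^2" .
   have "g0 <= exp (- (2 * al) * t x) * (b x)^2" using mult_mono[OF ex b16] by (simp add: g0_def)
   then show ?thesis using True xS e unfolding s_def[symmetric] t_def[symmetric] by simp
   next
   case False
   then have z: "(g0 * ?f (s x)) * ?g (t x) = 0" by (auto simp: indicator_def)
   show ?thesis unfolding s_def[symmetric] t_def[symmetric] z by (intro add_nonneg_nonneg mult_nonneg_nonneg) auto
   qed
  qed
  finally show "ennreal (g0 * R) <= (\<integral>\<^sup>+x. ennreal (?h x) \<partial>lborel)" .
  qed simp
  also have "... = (norm (restr ?S (ph 0)))^2 + (norm (restr ?S (ph (- (pi / 2)))))^2"
  unfolding norm_restr_eq[OF sqa] norm_restr_eq[OF sqb] using i by (simp add: power2_eq_square)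
  finally show ?thesis .
 qed
 have "(norm (restr ?S (ph d)))^2 <= (K * (5 * A))^2" for d by (intro power_mono small) simp
 from low add_mono[OF this[of 0] this[of "- (pi / 2)"]] have "g0 * R <= 2 * (K * (5 * A))^2" by linarith
 also have "... = Z / R" using al R0 by (simp add: power_mult_distrib A_def Z_def)
 finally have "g0 * R * R <= Z" using R0 by (simp add: pos_le_divide_eq)
 moreover have "R * 1 <= R * R" using R by (intro mult_left_mono) auto
 then have "g0 * R <= g0 * (R * R)" using g0 by (intro mult_left_mono) auto
 moreover have "Z < g0 * R" using R(2) g0 by (simp add: pos_divide_less_eq mult.commute)
 ultimately show False by (simp add: mult.assoc)
 qed
qed

lemma kappa_eq_1:
 assumes al: "al > 0"
 shows "kappa th al = 1"
proof -
 let ?S = "sector th" and ?sg = "side_measure th {0<..}"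
 interpret robin_domain ?S ?sg by (rule robin_domain_sector)
 obtain c where rb: "robin ?S ?sg al c"
 using robin_form_coercive[OF al] al robin_domain_axioms unfolding robin_def robin_axioms_def by blast
 then interpret robin ?S ?sg al c .
 obtain \<Psi> C where C: "!!ph. ph \<in> C1c UNIV ==> (dirichlet ?S ph) - al * (\<integral>x. (ph x)^2 \<partial>?sg)
 >= - al\<^sup>2 * (norm (restr ?S ph))^2 - C * (inner (restr ?S ph) \<Psi>)^2"
 using sector_essentially_ge[OF al] by blast
 have ess: "essentially_ge (- al\<^sup>2) {\<Psi>}" by (rule essentially_geI'[where C = C]) (use C in auto)
 obtain ph where ph: "ph \<in> C1c UNIV" "(dirichlet ?S ph) - al * (\<integral>x. (ph x)^2 \<partial>?sg)
 < - al\<^sup>2 * (norm (restr ?S ph))^2"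
 using sector_trial[OF al] by blast
 have "robin_form ?S ?sg al (restr ?S ph) (restr ?S ph) < - al\<^sup>2 * inner (restr ?S ph) (restr ?S ph)"
 using ph(2) unfolding robin_form_restr[OF ph(1,1)] test_form_def power2_norm_eq_inner by (simp only: power2_eq_square)
 from multiplicity_sum_eq_1[OF ess restr_l2_H1(1)[OF ph(1)] this] show ?thesis
 using sector_spectrum[OF al rb] unfolding kappa_def T_op_def robin_operator_eq by blast
qed

end

theorem proposition3p10:
  fixes \<theta> :: real
  assumes "pi / 4 \<le> \<theta>" and "\<theta> < pi / 2"
  shows "non_resonant \<theta>"
  unfolding non_resonant_def
proof (intro allI impI)
  interpret half_angle \<theta> using assms by unfold_locales
  fix \<alpha> :: real assume \<alpha>: "0 < \<alpha>"
  \<comment> \<open>The threshold is the condition \<open>al * R >= 6\<close> of the cosh profile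
    for the side \<open>R = slope * r\<close> of the square.\<close>
  have "\<exists>E. nth_discrete_eigenvalue (L2_on (quadrangle \<theta> r)) (N_op \<theta> r \<alpha>) (kappa \<theta> \<alpha> + 1) E \<and> - \<alpha>\<^sup>2 + 1 / (2 * slope\<^sup>2) / r\<^sup>2 \<le> E"
    if r: "r \<ge> 6 / (\<alpha> * slope)" for r
  proof -
    have as: "\<alpha> * slope > 0" using \<alpha> slope(3) by simp
    then have "0 < 6 / (\<alpha> * slope)" by simp
    then have "r > 0" using r by linarith
    moreover have "6 \<le> \<alpha> * (slope * r)" using r as by (simp add: pos_divide_le_eq mult_ac)
    ultimately have "\<exists>E\<ge>- \<alpha>\<^sup>2 + 1 / (2 * slope\<^sup>2) / r\<^sup>2. nth_discrete_eigenvalue (L2_on (quadrangle \<theta> r)) (N_op \<theta> r \<alpha>) 2 E"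
      by (rule quadrangle_second_eigenvalue[OF \<alpha>])
    moreover have k: "kappa \<theta> \<alpha> + 1 = 2" by (simp add: kappa_eq_1[OF \<alpha>])
    ultimately show ?thesis unfolding k by blast
  qed
  then have "\<forall>\<^sub>F r in at_top. \<exists>E. nth_discrete_eigenvalue (L2_on (quadrangle \<theta> r)) (N_op \<theta> r \<alpha>) (kappa \<theta> \<alpha> + 1) E \<and> - \<alpha>\<^sup>2 + 1 / (2 * slope\<^sup>2) / r\<^sup>2 \<le> E"
    unfolding eventually_at_top_linorder by blast
  then show "\<exists>C>0. \<forall>\<^sub>F r in at_top. \<exists>E. nth_discrete_eigenvalue (L2_on (quadrangle \<theta> r)) (N_op \<theta> r \<alpha>) (kappa \<theta> \<alpha> + 1) E \<and> - \<alpha>\<^sup>2 + C / r\<^sup>2 \<le> E"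
    using slope(3) by (intro exI[of _ "1 / (2 * slope\<^sup>2)"]) simp
qed

end
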